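(* Consider the random dynamical system $x_n=S(x_{n-1},\xi_{n-1})$, $x_0=x\in\mathcal X$, described in the context. Suppose that hypotheses $\mathbf{(AC)}$, $\mathbf{(I)}$ and $\mathbf{(C)}$ (see context) are satisfied, and that there exists $\zeta\in\mathcal E$ such that $S(z,\zeta)=z$, where $z$ is the point in $\mathbf{(I)}$. Then the function $\mathcal I\colon\mathcal P(\mathcal X)\to[0,\infty]$ given by $$\mathcal I(\sigma)=\begin{cases}-\inf\limits_{f\in C_+(Y)}\displaystyle\int_Y\log\left(\frac{Pf}{f}\right)d\sigma & \text{for }\sigma\in\mathcal P(Y),\\ \infty&\text{otherwise,}\end{cases}$$ is a good rate function, and for any $x\in\mathcal X$, any closed $F\subset\mathcal P(\mathcal X)$ and any open $G\subset\mathcal P(\mathcal X)$, $$\limsup_{n\to\infty}\frac1n\log\mathbb P(L_{n,x}\in F)\le-\inf\{\mathcal I(\sigma):\sigma\in F\},\qquad(\mathrm U)$$ $$\liminf_{n\to\infty}\frac1n\log\mathbb P(L_{n,x}\in G)\ge-\inf\{\mathcal I(\sigma):\sigma\in G\cap\mathcal W\}.\qquad(\mathrm L)$$ Moreover, for every $R>0$, on the bounded invariant set $X_R$ the following holds: (a) The restriction of $\mathcal I$ to $\mathcal P(X_R)$ equals $I_R$. (b) For $x\in X_R$, $(\mathrm U)$ holds for any closed $F\subset\mathcal P(X_R)$, and $(\mathrm L)$ holds for any open $G\subset\mathcal P(X_R)$ with $\mathcal W$ replaced by $\mathcal W_R$; in addition these convergences are uniform with respect to $x\in X_R$, i.e.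 $(\mathrm U)$ holds with $\frac1n\log\mathbb P(L_{n,x}\in F)$ replaced by its supremum over $x\in X_R$, and $(\mathrm L)$ holds with $\frac1n\log\mathbb P(L_{n,x}\in G)$ replaced by its infimum over $x\in X_R$. (c) For any $L>0$ there exists $\delta=\delta(L)>0$ such that $\mathcal V_{R,L,\delta}\subset\mathcal V_R$, where $\mathcal V_{R,L,\delta}:=\{V\in L_b(X_R):\operatorname{Lip}(V)<L,\ \operatorname{Osc}(V)<\delta\}$. Furthermore, $\mathcal W_R$ is independent of $R$, and thus $\mathcal W=\mathcal W_R$ for any $R>0$.
   Context: Notation. For a Polish space $X$: $C_b(X)$ is the space of bounded continuous real functions with sup norm $\|\cdot\|_\infty$; $L_b(X)$ the bounded Lipschitz functions; $\operatorname{Lip}(f)$ the Lipschitz constant; $\operatorname{Osc}(f)=\sup f-\inf f$; $\mathcal P(X)$ the Borel probability measures with the weak topology; $\langle f,\mu\rangle=\int f\,d\mu$. For a closed $Y\subset X$, $\mathcal P(Y)$ is identified with $\{\sigma\in\mathcal P(X):\sigma(Y)=1\}$. $C_+(Y)$ is the set of positive continuous functions on $Y$. $B_X(x,r)$ is the open ball and $B_X(A,r)$ the open $r$-neighbourhood of $A$. A rate function is a lower semicontinuous $[0,\infty]$-valued function; it is good if all sublevel sets $\{I\le a\}$, $a<\infty$, are compact. System. $(\mathcal X,d)$ is a Polish space, $(\mathcal E,d_{\mathcal E})$ a compact metric space, $(\xi_n)_{n\in\mathbb N_0}$ i.i.d. $\mathcal E$-valued random variables with $\operatorname{supp}$ of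 the law of $\xi_0$ equal to $\mathcal E$, and $S\colon\mathcal X\times\mathcal E\to\mathcal X$ is locally Lipschitz. $x_n=S(x_{n-1},\xi_{n-1})$, $x_0=x$, is a Markov process with transition functions $P_n(x,\cdot)$; $\mathbb P_x,\mathbb E_x$ are the probability and expectation for initial point $x$; $Pf(x)=\int f(y)P_1(x,dy)$. For $\boldsymbol\zeta=(\zeta_n)\in\mathcal E^{\mathbb N_0}$, $S_n(x;\boldsymbol\zeta)=S_n(x;\zeta_0,\dots,\zeta_{n-1})$ is the $n$-th point of the deterministic sequence obtained by replacing $\xi_k$ with $\zeta_k$. A set $Z\subset\mathcal X$ is invariant if $S(y,\zeta)\in Z$ for all $y\in Z$, $\zeta\in\mathcal E$. $\mathbf{(AC)}$ There exist a compact invariant set $Y\subset\mathcal X$, a measurable $V\colon\mathcal X\to[0,\infty)$ bounded on bounded sets, and $\kappa>0$ such that $\operatorname{dist}_{\mathcal X}(S_n(x;\boldsymbol\zeta),Y)\le V(x)e^{-\kappa n}$ for all $x\in\mathcal X$, $\boldsymbol\zeta\in\mathcal E^{\mathbb N_0}$, $n\in\mathbb N_0$. $\mathbf{(I)}$ There exists $z\in Y$ such that for any $\varepsilon>0$ there is $N\in\mathbb N$ with $\inf_{y\in Y}P_N(y,B_Y(z,\varepsilon))>0$. $\mathbf{(C)}$ There exists $q\in[0,1)$ such that for any $x,x'\in Y$ the pair $(P_1(x,\cdot),P_1(x',\cdot))$ admits a coupling $(R(x,x'),R'(x,x'))$ (random variables with these marginal laws) on a common probability space $(\Omega,\mathcal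 F,\mathbb P)$ with $\mathbb P(d(R(x,x'),R'(x,x'))>q\,d(x,x'))\le g(d(x,x'))$, where $g\colon[0,\infty)\to[0,\infty)$ is continuous increasing with $g(0)=0$ and $\limsup_{k\to\infty}\frac1k\log g(q^k)\in[-\infty,0)$, and $R,R'\colon Y\times Y\times\Omega\to Y$ are measurable. Further objects. For $Z\subset\mathcal X$, $\mathcal A_0(Z)=Z$, $\mathcal A_n(Z)=\{S_n(x;\zeta_0,\dots,\zeta_{n-1}):x\in Z,\zeta_i\in\mathcal E\}$, $\mathcal A(Z)=\overline{\bigcup_{n\ge0}\mathcal A_n(Z)}$. For $R>0$, $X_R:=\mathcal A(B_{\mathcal X}(Y,R))$, a bounded invariant set containing $Y$. Empirical distributions: $L_{n,x}=\frac1n\sum_{k=1}^n\delta_{x_k}$ with $x_0=x$. Pressure: for $V\in C_b(X_R)$, $$\Lambda_R(V)=\limsup_{n\to\infty}\sup_{x\in X_R}\frac1n\log\mathbb E_xe^{V(x_1)+\cdots+V(x_n)}.$$ Legendre transform: $I_R(\sigma)=\sup_{V\in C_b(X_R)}(\langle V,\sigma\rangle-\Lambda_R(V))$, $\sigma\in\mathcal P(X_R)$. An equilibrium state for $V\in C_b(X_R)$ is $\sigma\in\mathcal P(X_R)$ with $\Lambda_R(V)=\langle V,\sigma\rangle-I_R(\sigma)$. $\mathcal V_R$ is the set of $V\in L_b(X_R)$ such that (1) $\frac1n\log\mathbb E_xe^{V(x_1)+\cdots+V(x_n)}\to\Lambda_R(V)$ as $n\to\infty$ uniformly in $x\in X_R$,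 and (2) $V$ has a unique equilibrium state $\sigma_V$. $\mathcal W_R:=\{\sigma_V:V\in\mathcal V_R\}\subset\mathcal P(X_R)\subset\mathcal P(\mathcal X)$ and $\mathcal W:=\bigcup_{R>0}\mathcal W_R$. *)

theory Defs
  imports "HOL-Probability.Probability"
begin

class compact_metric_space = metric_space +
  assumes compact_UNIV: "compact (UNIV :: 'a set)"

instance compact_metric_space \<subseteq> polish_space
proof
  fix X :: "nat \<Rightarrow> 'a"
  assume "Cauchy X"
  with compact_imp_complete[OF compact_UNIV] show "convergent X"
    unfolding complete_def convergent_def by auto
next
  have "\<forall>n::nat. \<exists>D. finite D \<and> (UNIV :: 'a set) \<subseteq> (\<Union>x\<in>D. ball x (1 / (Suc n)))"
    using compact_UNIV[where 'a='a] unfolding compact_eq_totally_bounded by auto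
  then obtain D where D: "\<And>n::nat. finite (D n)"
      "\<And>n. (UNIV :: 'a set) \<subseteq> (\<Union>x\<in>D n. ball x (1 / (Suc n)))"
    by metis
  define B where "B = (\<Union>n. (\<lambda>x. ball x (1 / (Suc n))) ` D n)"
  have "countable B"
    unfolding B_def by (intro countable_UN countable_image countable_finite D countableI_type)
  moreover have "topological_basis B"
  proof (rule topological_basisI)
    show "open U" if "U \<in> B" for U
      using that by (auto simp: B_def)
  next
    fix U :: "'a set" and x
    assume "open U" "x \<in> U"
    then obtain e where e: "e > 0" "ball x e \<subseteq> U"
      by (meson open_contains_ball)
    obtain n where n: "1 / (Suc n) < e / 2"
      using e(1) nat_approx_posE[of "e / 2"] by auto
    obtain y where y: "y \<in> D n" "x \<in> ball y (1 / (Suc n))"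
      using D(2)[of n] by blast
    have "ball y (1 / (Suc n)) \<subseteq> ball x e"
    proof
      fix w assume w: "w \<in> ball y (1 / (Suc n))"
      have "dist x w \<le> dist y x + dist y w"
        by (metis dist_commute dist_triangle)
      also have "\<dots> < e"
        using w y(2) n by auto
      finally show "w \<in> ball x e" by simp
    qed
    with e y show "\<exists>B'\<in>B. x \<in> B' \<and> B' \<subseteq> U"
      by (intro bexI[of _ "ball y (1 / (Suc n))"]) (auto simp: B_def)
  qed
  ultimately show "\<exists>B :: 'a set set. countable B \<and> open = generate_topology B"
    using topological_basis_imp_subbasis by blast
qed


section \<open>Functions and measures on a closed set\<close>

text \<open>
  A function on a subset \<open>Z\<close> of the state space is a total function whose values outside \<open>Z\<close> are
  irrelevant (and possibly non-measurable).  Hence it is only ever evaluated on \<open>Z\<close> and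
  only integrated over \<open>Z\<close>.
\<close>

definition Cb :: "'a::metric_space set \<Rightarrow> ('a \<Rightarrow> real) set" where
  "Cb Z = {f. continuous_on Z f \<and> bounded (f ` Z)}"

definition Lb :: "'a::metric_space set \<Rightarrow> ('a \<Rightarrow> real) set" where
  "Lb Z = {f. bounded (f ` Z) \<and> (\<exists>C. C-lipschitz_on Z f)}"

definition Cpos :: "'a::metric_space set \<Rightarrow> ('a \<Rightarrow> real) set" where
  "Cpos Z = {f. continuous_on Z f \<and> (\<forall>x\<in>Z. f x > 0)}"

definition Lip :: "'a::metric_space set \<Rightarrow> ('a \<Rightarrow> real) \<Rightarrow> real" where
  "Lip Z f = Inf {C. C-lipschitz_on Z f}"

definition Osc :: "'a set \<Rightarrow> ('a \<Rightarrow> real) \<Rightarrow> real" where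
  "Osc Z f = (SUP x\<in>Z. f x) - (INF x\<in>Z. f x)"

definition probs :: "'a::topological_space set \<Rightarrow> 'a measure set" where
  "probs Z = {\<sigma>. prob_space \<sigma> \<and> sets \<sigma> = sets borel \<and> measure \<sigma> Z = 1}"

definition weak_topology :: "'a::metric_space set \<Rightarrow> 'a measure topology" where
  "weak_topology Z =
     topology_generated_by
       {{\<sigma> \<in> probs Z. (LINT x:Z|\<sigma>. f x) \<in> U} | f U. f \<in> Cb Z \<and> open U}"

lemma topspace_weak_topology [simp]: "topspace (weak_topology Z) = probs Z"
proof -
  have "(\<lambda>_. 0) \<in> Cb Z" by (auto simp: Cb_def image_constant_conv)
  then show ?thesis
    unfolding weak_topology_def topology_generated_by_topspace by blast
qed

definition support :: "'a::topological_space measure \<Rightarrow> 'a set" where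
  "support \<mu> = {x. \<forall>U. open U \<and> x \<in> U \<longrightarrow> measure \<mu> U > 0}"


section \<open>Rate functions\<close>

text \<open>Logarithm on \<open>[0, \<infinity>)\<close> with the convention \<open>log 0 = -\<infinity>\<close>.\<close>

definition elog :: "real \<Rightarrow> ereal" where
  "elog p = (if p > 0 then ereal (ln p) else -\<infinity>)"

definition rate_function :: "'b topology \<Rightarrow> ('b \<Rightarrow> ereal) \<Rightarrow> bool" where
  "rate_function T I \<longleftrightarrow>
     (\<forall>\<sigma>\<in>topspace T. 0 \<le> I \<sigma>) \<and> (\<forall>a. openin T {\<sigma> \<in> topspace T. a < I \<sigma>})"

definition good_rate_function :: "'b topology \<Rightarrow> ('b \<Rightarrow> ereal) \<Rightarrow> bool" where
  "good_rate_function T I \<longleftrightarrow>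
     rate_function T I \<and> (\<forall>a::real. compactin T {\<sigma> \<in> topspace T. I \<sigma> \<le> ereal a})"


section \<open>The random dynamical system\<close>

definition locally_lipschitz :: "('a::metric_space \<Rightarrow> 'b::metric_space) \<Rightarrow> bool" where
  "locally_lipschitz f \<longleftrightarrow> (\<forall>x. \<exists>u>0. \<exists>C. C-lipschitz_on (ball x u) f)"

text \<open>\<open>orbit S x \<zeta> n\<close> is the point \<open>S\<^sub>n(x; \<zeta>\<^sub>0, \<dots>, \<zeta>\<^sub>n\<^sub>-\<^sub>1)\<close>; the Markov process started
  at \<open>x\<close> is \<open>x\<^sub>n = orbit S x (\<lambda>k. \<xi> k \<omega>) n\<close>.\<close>

primrec orbit :: "('a \<Rightarrow> 'e \<Rightarrow> 'a) \<Rightarrow> 'a \<Rightarrow> (nat \<Rightarrow> 'e) \<Rightarrow> nat \<Rightarrow> 'a" where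
  "orbit S x \<zeta> 0 = x"
| "orbit S x \<zeta> (Suc n) = S (orbit S x \<zeta> n) (\<zeta> n)"

definition invariant :: "('a \<Rightarrow> 'e \<Rightarrow> 'a) \<Rightarrow> 'a set \<Rightarrow> bool" where
  "invariant S Z \<longleftrightarrow> (\<forall>y\<in>Z. \<forall>\<zeta>. S y \<zeta> \<in> Z)"

definition attainable :: "('a::topological_space \<Rightarrow> 'e \<Rightarrow> 'a) \<Rightarrow> 'a set \<Rightarrow> 'a set" where
  "attainable S Z = closure (\<Union>n. {orbit S x \<zeta> n | x \<zeta>. x \<in> Z})"

definition XR :: "('a::metric_space \<Rightarrow> 'e \<Rightarrow> 'a) \<Rightarrow> 'a set \<Rightarrow> real \<Rightarrow> 'a set" where
  "XR S Y R = attainable S (\<Union>y\<in>Y. ball y R)"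

definition transition ::
  "'w measure \<Rightarrow> (nat \<Rightarrow> 'w \<Rightarrow> 'e) \<Rightarrow> ('a::topological_space \<Rightarrow> 'e \<Rightarrow> 'a) \<Rightarrow> nat \<Rightarrow> 'a \<Rightarrow> 'a measure"
where
  "transition M \<xi> S n x = distr M borel (\<lambda>\<omega>. orbit S x (\<lambda>k. \<xi> k \<omega>) n)"

text \<open>\<open>markov_op M \<xi> S Z f\<close> is \<open>Pf\<close> for a function \<open>f\<close> on an invariant set \<open>Z\<close>: for \<open>x \<in> Z\<close> the
  measure \<open>P\<^sub>1(x, \<cdot>)\<close> is carried by \<open>Z\<close>.\<close>

definition markov_op ::
  "'w measure \<Rightarrow> (nat \<Rightarrow> 'w \<Rightarrow> 'e) \<Rightarrow> ('a::topological_space \<Rightarrow> 'e \<Rightarrow> 'a) \<Rightarrow> 'a set \<Rightarrow>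
   ('a \<Rightarrow> real) \<Rightarrow> 'a \<Rightarrow> real"
where
  "markov_op M \<xi> S Z f x = (LINT y:Z|transition M \<xi> S 1 x. f y)"

definition empirical :: "(nat \<Rightarrow> 'a::topological_space) \<Rightarrow> nat \<Rightarrow> 'a measure" where
  "empirical X n =
     measure_of UNIV (sets borel) (\<lambda>A. (\<Sum>k=1..n. emeasure (return borel (X k)) A) / of_nat n)"

lemma sets_empirical [simp]: "sets (empirical X n) = sets borel"
  by (simp add: empirical_def sets.sigma_sets_eq[of borel, simplified])

lemma emeasure_empirical:
  assumes "A \<in> sets borel"
  shows "emeasure (empirical X n) A = (\<Sum>k=1..n. emeasure (return borel (X k)) A) / of_nat n"
proof -
  let ?m = "\<lambda>A. (\<Sum>k=1..n. emeasure (return borel (X k)) A) / of_nat n"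
  have "countably_additive (sets borel) ?m"
  proof (rule countably_additiveI)
    fix B :: "nat \<Rightarrow> 'a set"
    assume B: "range B \<subseteq> sets borel" "disjoint_family B"
    have "(\<Sum>i. ?m (B i)) = (\<Sum>i. \<Sum>k=1..n. emeasure (return borel (X k)) (B i)) / of_nat n"
      by (simp add: divide_ennreal_def)
    also have "\<dots> = (\<Sum>k=1..n. \<Sum>i. emeasure (return borel (X k)) (B i)) / of_nat n"
      by (subst suminf_sum) auto
    also have "\<dots> = ?m (\<Union>i. B i)"
      using B by (subst suminf_emeasure) auto
    finally show "(\<Sum>i. ?m (B i)) = ?m (\<Union>i. B i)" .
  qed
  moreover have "positive (sets borel) ?m"
    by (simp add: positive_def divide_ennreal_def)
  ultimately show ?thesis
    using assms sets.sigma_algebra_axioms[of "borel :: 'a measure"]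
    unfolding empirical_def by (subst emeasure_measure_of_sigma) auto
qed

text \<open>\<open>prob_L M \<xi> S x n F\<close> is the probability that \<open>L\<^sub>n\<^sub>,\<^sub>x\<close> lies in \<open>F\<close>.\<close>

definition prob_L ::
  "'w measure \<Rightarrow> (nat \<Rightarrow> 'w \<Rightarrow> 'e) \<Rightarrow> ('a::topological_space \<Rightarrow> 'e \<Rightarrow> 'a) \<Rightarrow>
   'a \<Rightarrow> nat \<Rightarrow> 'a measure set \<Rightarrow> real"
where
  "prob_L M \<xi> S x n F =
     measure M {\<omega> \<in> space M. empirical (orbit S x (\<lambda>k. \<xi> k \<omega>)) n \<in> F}"


section \<open>Hypotheses\<close>

definition hyp_AC :: "('a::metric_space \<Rightarrow> 'e \<Rightarrow> 'a) \<Rightarrow> 'a set \<Rightarrow> bool" where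
  "hyp_AC S Y \<longleftrightarrow>
     compact Y \<and> invariant S Y \<and>
     (\<exists>V \<kappa>. V \<in> borel_measurable borel \<and> (\<forall>x. 0 \<le> V x) \<and>
        (\<forall>B. bounded B \<longrightarrow> bounded (V ` B)) \<and> (0::real) < \<kappa> \<and>
        (\<forall>x \<zeta> n. infdist (orbit S x \<zeta> n) Y \<le> V x * exp (- \<kappa> * real n)))"

definition hyp_I ::
  "'w measure \<Rightarrow> (nat \<Rightarrow> 'w \<Rightarrow> 'e) \<Rightarrow> ('a::metric_space \<Rightarrow> 'e \<Rightarrow> 'a) \<Rightarrow> 'a set \<Rightarrow> 'a \<Rightarrow> bool"
where
  "hyp_I M \<xi> S Y z \<longleftrightarrow>
     z \<in> Y \<and>
     (\<forall>\<epsilon>>0. \<exists>N\<ge>1. (INF y\<in>Y. measure (transition M \<xi> S N y) (Y \<inter> ball z \<epsilon>)) > 0)"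

text \<open>The probability space carrying the coupling is the argument \<open>\<Omega>\<close>, since HOL cannot quantify
  existentially over its underlying type; a theorem assuming \<open>hyp_C\<close> for an arbitrary \<open>\<Omega>\<close> assumes
  the existence of some such space.  \<open>Increasing\<close> is read as non-decreasing.\<close>

definition hyp_C ::
  "'w measure \<Rightarrow> (nat \<Rightarrow> 'w \<Rightarrow> 'e) \<Rightarrow> ('a::metric_space \<Rightarrow> 'e \<Rightarrow> 'a) \<Rightarrow> 'a set \<Rightarrow> 'c measure \<Rightarrow> bool"
where
  "hyp_C M \<xi> S Y \<Omega> \<longleftrightarrow>
     prob_space \<Omega> \<and>
     (\<exists>(q::real) (g::real \<Rightarrow> real) (R::'a \<Rightarrow> 'a \<Rightarrow> 'c \<Rightarrow> 'a) R'.
        0 \<le> q \<and> q < 1 \<and>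
        continuous_on {0..} g \<and> mono_on {0..} g \<and> (\<forall>r\<ge>0. 0 \<le> g r) \<and> g 0 = 0 \<and>
        limsup (\<lambda>k. ereal (1 / real k) * elog (g (q ^ k))) < 0 \<and>
        (\<lambda>(x, x', \<omega>). R x x' \<omega>) \<in>
          restrict_space borel Y \<Otimes>\<^sub>M (restrict_space borel Y \<Otimes>\<^sub>M \<Omega>) \<rightarrow>\<^sub>M restrict_space borel Y \<and>
        (\<lambda>(x, x', \<omega>). R' x x' \<omega>) \<in>
          restrict_space borel Y \<Otimes>\<^sub>M (restrict_space borel Y \<Otimes>\<^sub>M \<Omega>) \<rightarrow>\<^sub>M restrict_space borel Y \<and>
        (\<forall>x\<in>Y. \<forall>x'\<in>Y.
           distr \<Omega> borel (R x x') = transition M \<xi> S 1 x \<and>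
           distr \<Omega> borel (R' x x') = transition M \<xi> S 1 x' \<and>
           measure \<Omega> {\<omega> \<in> space \<Omega>. dist (R x x' \<omega>) (R' x x' \<omega>) > q * dist x x'} \<le> g (dist x x')))"


section \<open>Pressure, equilibrium states and the rate function\<close>

text \<open>\<open>log_mgf M \<xi> S V n x\<close> is \<open>1/n log E\<^sub>x exp (V(x\<^sub>1) + \<cdots> + V(x\<^sub>n))\<close>.\<close>

definition log_mgf ::
  "'w measure \<Rightarrow> (nat \<Rightarrow> 'w \<Rightarrow> 'e) \<Rightarrow> ('a \<Rightarrow> 'e \<Rightarrow> 'a) \<Rightarrow> ('a \<Rightarrow> real) \<Rightarrow> nat \<Rightarrow> 'a \<Rightarrow> real"
where
  "log_mgf M \<xi> S V n x =
     1 / real n * ln (\<integral>\<omega>. exp (\<Sum>k=1..n. V (orbit S x (\<lambda>k. \<xi> k \<omega>) k)) \<partial>M)"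

definition pressure ::
  "'w measure \<Rightarrow> (nat \<Rightarrow> 'w \<Rightarrow> 'e) \<Rightarrow> ('a::metric_space \<Rightarrow> 'e \<Rightarrow> 'a) \<Rightarrow> 'a set \<Rightarrow> real \<Rightarrow>
   ('a \<Rightarrow> real) \<Rightarrow> ereal"
where
  "pressure M \<xi> S Y R V = limsup (\<lambda>n. SUP x\<in>XR S Y R. ereal (log_mgf M \<xi> S V n x))"

definition legendre ::
  "'w measure \<Rightarrow> (nat \<Rightarrow> 'w \<Rightarrow> 'e) \<Rightarrow> ('a::metric_space \<Rightarrow> 'e \<Rightarrow> 'a) \<Rightarrow> 'a set \<Rightarrow> real \<Rightarrow>
   'a measure \<Rightarrow> ereal"
where
  "legendre M \<xi> S Y R \<sigma> =
     (SUP V\<in>Cb (XR S Y R). ereal (LINT x:XR S Y R|\<sigma>. V x) - pressure M \<xi> S Y R V)"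

definition equilibrium_state ::
  "'w measure \<Rightarrow> (nat \<Rightarrow> 'w \<Rightarrow> 'e) \<Rightarrow> ('a::metric_space \<Rightarrow> 'e \<Rightarrow> 'a) \<Rightarrow> 'a set \<Rightarrow> real \<Rightarrow>
   ('a \<Rightarrow> real) \<Rightarrow> 'a measure \<Rightarrow> bool"
where
  "equilibrium_state M \<xi> S Y R V \<sigma> \<longleftrightarrow>
     \<sigma> \<in> probs (XR S Y R) \<and>
     pressure M \<xi> S Y R V = ereal (LINT x:XR S Y R|\<sigma>. V x) - legendre M \<xi> S Y R \<sigma>"

definition VR ::
  "'w measure \<Rightarrow> (nat \<Rightarrow> 'w \<Rightarrow> 'e) \<Rightarrow> ('a::metric_space \<Rightarrow> 'e \<Rightarrow> 'a) \<Rightarrow> 'a set \<Rightarrow> real \<Rightarrow>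
   ('a \<Rightarrow> real) set"
where
  "VR M \<xi> S Y R =
     {V \<in> Lb (XR S Y R).
        (\<exists>l. pressure M \<xi> S Y R V = ereal l \<and>
             uniform_limit (XR S Y R) (log_mgf M \<xi> S V) (\<lambda>_. l) sequentially) \<and>
        (\<exists>!\<sigma>. equilibrium_state M \<xi> S Y R V \<sigma>)}"

definition VRL ::
  "('a::metric_space \<Rightarrow> 'e \<Rightarrow> 'a) \<Rightarrow> 'a set \<Rightarrow> real \<Rightarrow> real \<Rightarrow> real \<Rightarrow> ('a \<Rightarrow> real) set"
where
  "VRL S Y R L \<delta> = {V \<in> Lb (XR S Y R). Lip (XR S Y R) V < L \<and> Osc (XR S Y R) V < \<delta>}"

definition WR ::
  "'w measure \<Rightarrow> (nat \<Rightarrow> 'w \<Rightarrow> 'e) \<Rightarrow> ('a::metric_space \<Rightarrow> 'e \<Rightarrow> 'a) \<Rightarrow> 'a set \<Rightarrow> real \<Rightarrow>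
   'a measure set"
where
  "WR M \<xi> S Y R = (\<lambda>V. THE \<sigma>. equilibrium_state M \<xi> S Y R V \<sigma>) ` VR M \<xi> S Y R"

definition Wset ::
  "'w measure \<Rightarrow> (nat \<Rightarrow> 'w \<Rightarrow> 'e) \<Rightarrow> ('a::metric_space \<Rightarrow> 'e \<Rightarrow> 'a) \<Rightarrow> 'a set \<Rightarrow> 'a measure set"
where
  "Wset M \<xi> S Y = (\<Union>R\<in>{0<..}. WR M \<xi> S Y R)"

definition rate ::
  "'w measure \<Rightarrow> (nat \<Rightarrow> 'w \<Rightarrow> 'e) \<Rightarrow> ('a::metric_space \<Rightarrow> 'e \<Rightarrow> 'a) \<Rightarrow> 'a set \<Rightarrow> 'a measure \<Rightarrow> ereal"
where
  "rate M \<xi> S Y \<sigma> =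
     (if \<sigma> \<in> probs Y
      then - (INF f\<in>Cpos Y. ereal (LINT x:Y|\<sigma>. ln (markov_op M \<xi> S Y f x / f x)))
      else \<infinity>)"

end

theory Submission
  imports Defs
begin

text \<open>
  Let \<open>T V f x = E (exp (V (x\<^sub>1)) f (x\<^sub>1))\<close> be the Feynman--Kac operator.  Since \<open>(T V)\<^sup>n 1\<close> is continuous
  and all orbits are attracted to the compact set \<open>Y\<close>, the pressure on \<open>X\<^sub>R\<close> equals the pressure \<open>\<lambda>(V)\<close> on \<open>Y\<close>.
  The Donsker--Varadhan formula follows from two substitutions: \<open>V = log (f/Pf)\<close> has the eigenfunction
  \<open>Pf\<close> with eigenvalue \<open>1\<close>; conversely for \<open>l > \<lambda>(V)\<close> a truncated resolvent
  \<open>u = \<Sum> exp(-l k) (T V)\<^sup>k 1\<close> satisfies \<open>T V u \<le> exp l u\<close>, so \<open>f = exp(V) u\<close> nearly attains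
  \<open>\<langle>V,\<sigma>\<rangle> - \<lambda>(V)\<close>.  The upper bound is the exponential Chebyshev inequality on a finite cover of the
  compact set \<open>P(Y)\<close>, and the lower bound is Kifer's tilting argument, which uses the upper bound for
  the tilted laws and uniqueness of the equilibrium state.

  For small potentials, coupling and irreducibility make a power of \<open>P\<close> a strict contraction of
  the oscillation seminorm of a bounded modulus \<open>\<theta>(x,y)\<close>.  As \<open>\<theta>(x,y) \<ge> min(1, sqrt(d(x,y)))\<close>, a Lipschitz
  function of small oscillation is small in this seminorm, so \<open>T V\<close> is a small perturbation of \<open>P\<close> and has
  a positive eigenfunction \<open>h\<close> and a spectral gap.  Equilibrium states are the stationary measures of the
  Doob transform \<open>g \<mapsto> T V (h g) / (\<mu> h)\<close>, and mixing makes them unique.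
\<close>

section \<open>Weak topology\<close>

text \<open>The sets X_R are in general not compact, so no extremum is taken over them and no cover
  of P(X_R) is used. Attraction that is uniform in the starting point and the noise takes the place
  of compactness: it permits comparing iterates at times when all orbits are close to
  \<open>Y\<close>, and it forces empirical measures into any neighbourhood of P(\<open>Y\<close>).
  As a consequence pressure, equilibrium states and uniform convergence are all decided by the
  restriction of the potential to \<open>Y\<close>; a Lipschitz extension from \<open>Y\<close> then
  shows that the set of equilibrium states is the same for every \<open>R\<close>.

  The coupling is close only up to an event of probability g(d), so the Lipschitz seminorm need not
  contract; the modulus \<theta> is tailored to g. The eigenfunction is the fixed point of the
  projective map f -> U f / (U f)(y0) with U the \<open>N\<close>-th iterate. Normalising at one
  point \<open>y0\<close> lets the seminorm control the sup norm, so that the perturbed operator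
  still contracts.

  A single estimate, for unnormalised tilted laws, yields (U), the existence of equilibrium states
  and the concentration behind (L).\<close>

lemma infdist_bump_tendsto_indicator:
  fixes C :: "'a::metric_space set"
  assumes "closed C" "C \<noteq> {}"
  shows "(\<lambda>n. max 0 (1 - real n * infdist x C)) \<longlonglongrightarrow> indicator C x"
proof (cases "x \<in> C")
  case True
  then show ?thesis by simp
next
  case False
  then have pos: "infdist x C > 0"
    using assms by (metis in_closed_iff_infdist_zero infdist_nonneg less_le)
  obtain N where N: "real N * infdist x C > 1"
    using reals_Archimedean3[OF pos] by auto
  have "eventually (\<lambda>n. max 0 (1 - real n * infdist x C) = 0) sequentially"
  proof (rule eventually_sequentiallyI[of N])
    fix n assume "N \<le> n"
    then have "real N * infdist x C \<le> real n * infdist x C"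
      using pos by (intro mult_right_mono) auto
    with N show "max 0 (1 - real n * infdist x C) = 0" by simp
  qed
  then show ?thesis using False by (simp add: tendsto_eventually)
qed

lemma probs_prob: "\<sigma> \<in> probs Z \<Longrightarrow> prob_space \<sigma>"
  and probs_sets: "\<sigma> \<in> probs Z \<Longrightarrow> sets \<sigma> = sets borel"
  by (auto simp: probs_def)

lemma probs_space: "\<sigma> \<in> probs Z \<Longrightarrow> space \<sigma> = UNIV"
  using sets_eq_imp_space_eq[OF probs_sets] by simp

lemma probs_AE:
  assumes "\<sigma> \<in> probs Z" "closed Z"
  shows "AE x in \<sigma>. x \<in> Z"
  using prob_space.AE_in_set_eq_1[OF probs_prob[OF assms(1)], of Z] assms
  by (auto simp: probs_def)

lemma probs_mono:
  assumes "closed Y" "closed Z" "Y \<subseteq> Z"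
  shows "probs Y \<subseteq> probs Z"
proof
  fix \<sigma> assume s: "\<sigma> \<in> probs Y"
  then interpret prob_space \<sigma> by (rule probs_prob)
  have "measure \<sigma> Y \<le> measure \<sigma> Z"
    using assms s by (intro finite_measure_mono) (auto simp: probs_sets)
  then show "\<sigma> \<in> probs Z"
    using s prob_le_1[of Z] by (auto simp: probs_def intro!: antisym)
qed

lemma Cb_measurable:
  assumes "continuous_on Z f" "closed Z"
  shows "(\<lambda>x. indicator Z x *\<^sub>R (f x::real)) \<in> borel_measurable borel"
  using borel_measurable_continuous_on_indicator[OF _ assms(1)] assms(2) by simp

lemma Cb_integrable:
  assumes "\<sigma> \<in> probs W" "continuous_on Z f" "closed Z" "bounded (f ` Z)"
  shows "set_integrable \<sigma> Z (f :: _ \<Rightarrow> real)"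
proof -
  interpret prob_space \<sigma> by (rule probs_prob[OF assms(1)])
  obtain B where B: "\<And>x. x \<in> Z \<Longrightarrow> \<bar>f x\<bar> \<le> B" using assms(4) by (auto simp: bounded_iff)
  show ?thesis unfolding set_integrable_def
  proof (rule integrable_const_bound[where B="\<bar>B\<bar>"])
    show "(\<lambda>x. indicat_real Z x *\<^sub>R f x) \<in> borel_measurable \<sigma>"
      using Cb_measurable[OF assms(2,3)] measurable_cong_sets[OF probs_sets[OF assms(1)] refl] by blast
    show "AE x in \<sigma>. norm (indicat_real Z x *\<^sub>R f x) \<le> \<bar>B\<bar>"
      using B by (intro AE_I2) (force simp: indicator_def)
  qed
qed

lemma set_integral_probs_subset:
  assumes "\<sigma> \<in> probs Y" "closed Y" "closed Z" "Y \<subseteq> Z" "continuous_on Z f"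
  shows "(LINT x:Z|\<sigma>. (f x::real)) = (LINT x:Y|\<sigma>. f x)"
  unfolding set_lebesgue_integral_def
proof (rule integral_cong_AE)
  note m = measurable_cong_sets[OF probs_sets[OF assms(1)] refl]
  show "(\<lambda>x. indicat_real Z x *\<^sub>R f x) \<in> borel_measurable \<sigma>"
    using Cb_measurable[OF assms(5,3)] m by blast
  show "(\<lambda>x. indicat_real Y x *\<^sub>R f x) \<in> borel_measurable \<sigma>"
    using Cb_measurable[OF continuous_on_subset[OF assms(5,4)] assms(2)] m by blast
  show "AE x in \<sigma>. indicat_real Z x *\<^sub>R f x = indicat_real Y x *\<^sub>R f x"
    using probs_AE[OF assms(1,2)] by eventually_elim (use assms(4) in auto)
qed

lemma set_integral_probs_diff_le:
  assumes "\<sigma> \<in> probs Y" "closed Y" "continuous_on Y f" "bounded (f ` Y)" "continuous_on Y g" "bounded (g ` Y)"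
    and "\<And>x. x \<in> Y \<Longrightarrow> \<bar>f x - g x\<bar> \<le> e"
  shows "\<bar>(LINT x:Y|\<sigma>. (f x::real)) - (LINT x:Y|\<sigma>. g x)\<bar> \<le> e"
proof -
  interpret prob_space \<sigma> by (rule probs_prob[OF assms(1)])
  have i: "set_integrable \<sigma> Y f" "set_integrable \<sigma> Y g"
    using Cb_integrable[OF assms(1)] assms by auto
  have ye: "Y \<noteq> {}" using assms(1) by (auto simp: probs_def)
  then have e: "0 \<le> e" using assms(7) by force
  have "(LINT x:Y|\<sigma>. f x) - (LINT x:Y|\<sigma>. g x) = (LINT x:Y|\<sigma>. f x - g x)"
    using i by (simp add: set_integral_diff)
  also have "norm \<dots> \<le> (LINT x|\<sigma>. norm (indicator Y x *\<^sub>R (f x - g x)))"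
    unfolding set_lebesgue_integral_def by (rule integral_norm_bound)
  also have "\<dots> \<le> (LINT x|\<sigma>. e)"
    using set_integral_diff(1)[OF i] e assms(7) unfolding set_integrable_def
    by (intro integral_mono) (auto simp: indicator_def)
  finally show ?thesis by (simp add: prob_space)
qed

lemma set_integral_probs_mono:
  assumes "\<sigma> \<in> probs Y" "closed Y" "continuous_on Y f" "bounded (f ` Y)" "continuous_on Y g" "bounded (g ` Y)"
    and "\<And>x. x \<in> Y \<Longrightarrow> f x \<le> g x"
  shows "(LINT x:Y|\<sigma>. (f x::real)) \<le> (LINT x:Y|\<sigma>. g x)"
  using Cb_integrable[OF assms(1)] assms by (intro set_integral_mono) auto

lemma set_integral_probs_const:
  assumes "\<sigma> \<in> probs Y"
  shows "(LINT x:Y|\<sigma>. (c::real)) = c"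
  using assms probs_space[OF assms] by (simp add: set_lebesgue_integral_def probs_def)

lemma set_integral_probs_cong:
  "(\<And>x. x \<in> Y \<Longrightarrow> f x = g x) \<Longrightarrow> (LINT x:Y|\<sigma>. (f x::real)) = (LINT x:Y|\<sigma>. g x)"
  unfolding set_lebesgue_integral_def by (intro Bochner_Integration.integral_cong) (auto simp: indicator_def)

text \<open>Closed sets form an intersection-stable generator of the Borel sets, and the indicator
  of a closed set is a pointwise limit of \<open>n\<close>-Lipschitz bumps. Only Lipschitz test
  functions are demanded because those have a finite \<theta>-seminorm in the uniqueness
  proof.\<close>

lemma probs_eqI:
  fixes Y :: "'a::{metric_space, second_countable_topology} set"
  assumes s: "\<sigma> \<in> probs Y" "\<tau> \<in> probs Y" and Y: "closed Y"
    and eq: "\<And>f :: 'a \<Rightarrow> real. \<lbrakk>bounded (range f); \<exists>L. L-lipschitz_on UNIV f\<rbrakk> \<Longrightarrow> (LINT x:Y|\<sigma>. f x) = (LINT x:Y|\<tau>. f x)"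
  shows "\<sigma> = \<tau>"
proof -
  have full: "(LINT x:Y|\<sigma>. f x) = integral\<^sup>L \<sigma> f" if "\<sigma> \<in> probs Y" "continuous_on UNIV f" for \<sigma> and f :: "'a \<Rightarrow> real"
    using set_integral_probs_subset[OF that(1) Y _ _ that(2)] by (simp add: set_lebesgue_integral_def)
  have cl: "emeasure \<sigma> C = emeasure \<tau> C" if C: "closed C" for C
  proof (cases "C = {}")
    case False
    define f where "f n x = max 0 (1 - real n * infdist x C)" for n x
    have lip: "(real n)-lipschitz_on UNIV (f n)" for n
    proof (rule lipschitz_onI)
      fix x y
      have d: "\<bar>infdist x C - infdist y C\<bar> \<le> dist x y"
        using infdist_triangle_abs by blast
      have "\<bar>f n x - f n y\<bar> \<le> \<bar>real n * infdist x C - real n * infdist y C\<bar>"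
        unfolding f_def by linarith
      also have "\<dots> = real n * \<bar>infdist x C - infdist y C\<bar>"
        by (metis abs_mult abs_of_nat right_diff_distrib')
      also have "\<dots> \<le> real n * dist x y" using d by (intro mult_left_mono) auto
      finally show "dist (f n x) (f n y) \<le> real n * dist x y" by (simp add: dist_real_def)
    qed auto
    have b: "0 \<le> f n x" "f n x \<le> 1" for n x using infdist_nonneg[of x C] by (auto simp: f_def)
    have bd: "bounded (range (f n))" for n
      using b by (intro boundedI[where B=1]) (auto simp: abs_le_iff intro: order_trans[of _ 0])
    have lim: "(\<lambda>n. integral\<^sup>L \<sigma> (f n)) \<longlonglongrightarrow> measure \<sigma> C" if sg: "\<sigma> \<in> probs Y" for \<sigma>
    proof -
      interpret prob_space \<sigma> by (rule probs_prob[OF sg])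
      have "(\<lambda>n. integral\<^sup>L \<sigma> (f n)) \<longlonglongrightarrow> integral\<^sup>L \<sigma> (indicator C)"
      proof (rule integral_dominated_convergence[where w="\<lambda>_. 1"])
        show "indicat_real C \<in> borel_measurable \<sigma>"
          using C probs_sets[OF sg] by (intro borel_measurable_indicator) auto
        show "f n \<in> borel_measurable \<sigma>" for n
          using lipschitz_on_continuous_on[OF lip[of n]] measurable_cong_sets[OF probs_sets[OF sg] refl] 
            borel_measurable_continuous_onI by blast
        show "AE x in \<sigma>. (\<lambda>i. f i x) \<longlonglongrightarrow> indicat_real C x"
          unfolding f_def using infdist_bump_tendsto_indicator[OF C False] by simp
      qed (use b in \<open>auto simp: abs_le_iff intro: order_trans[of _ 0]\<close>)
      then show ?thesis using probs_space[OF sg] by simp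
    qed
    have "integral\<^sup>L \<sigma> (f n) = integral\<^sup>L \<tau> (f n)" for n
      using eq[OF bd] lip full[OF s(1)] full[OF s(2)] lipschitz_on_continuous_on[OF lip[of n]] by metis
    then have "measure \<sigma> C = measure \<tau> C"
      using lim[OF s(1)] lim[OF s(2)] LIMSEQ_unique by simp
    then show ?thesis using s by (simp add: probs_prob finite_measure.emeasure_eq_measure prob_space.finite_measure)
  qed auto
  show ?thesis
  proof (rule measure_eqI_generator_eq[where E="Collect closed" and \<Omega>=UNIV and A="\<lambda>_. UNIV"])
    show "Int_stable (Collect closed)" by (auto simp: Int_stable_def)
    show "sets \<sigma> = sigma_sets UNIV (Collect closed)" "sets \<tau> = sigma_sets UNIV (Collect closed)"
      using s by (auto simp: probs_sets borel_eq_closed)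
    show "emeasure \<sigma> UNIV \<noteq> \<infinity>" 
      using s by (metis probs_prob infinity_ennreal_def prob_space.finite_measure finite_measure.emeasure_finite)
  qed (auto simp: cl)
qed

text \<open>Induction on the generation of the open set: convergence of all integrals places the
  family eventually in any weakly open set, without a metric on the space of measures.\<close>

lemma openin_weak_topology_eventually:
  assumes "openin (weak_topology Z) U" "\<mu> \<in> U"
    and "\<And>f. f \<in> Cb Z \<Longrightarrow> ((\<lambda>j. LINT x:Z|\<nu> j. f x) \<longlongrightarrow> (LINT x:Z|\<mu>. f x)) F"
    and ev: "eventually (\<lambda>j. \<nu> j \<in> probs Z) F"
  shows "eventually (\<lambda>j. \<nu> j \<in> U) F"
  using openin_topology_generated_by[OF assms(1)[unfolded weak_topology_def]] assms(2)
proof (induction rule: generate_topology_on.induct)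
  case (Int a b)
  then show ?case by (auto intro: eventually_conj)
next
  case (UN K)
  then obtain k where k: "k \<in> K" "\<mu> \<in> k" by auto
  with UN have "eventually (\<lambda>j. \<nu> j \<in> k) F" by auto
  then show ?case by (rule eventually_mono) (use k in auto)
next
  case (Basis s)
  then obtain f U where f: "f \<in> Cb Z" "open U" "s = {\<sigma> \<in> probs Z. (LINT x:Z|\<sigma>. f x) \<in> U}" by auto
  have "eventually (\<lambda>j. (LINT x:Z|\<nu> j. f x) \<in> U) F"
    using assms(3)[OF f(1)] Basis f by (auto intro: topological_tendstoD)
  with ev show ?case by eventually_elim (use f in auto)
qed simp

lemma openin_weak_topology_basis:
  "f \<in> Cb Z \<Longrightarrow> open U \<Longrightarrow> openin (weak_topology Z) {\<sigma> \<in> probs Z. (LINT x:Z|\<sigma>. f x) \<in> U}"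
  unfolding weak_topology_def by (rule topology_generated_by_Basis) auto

text \<open>Universal property of a topology generated by integrals: only subbasic preimages have to
  be checked.\<close>

lemma continuous_map_weak_topology:
  assumes "\<And>t. t \<in> topspace T \<Longrightarrow> k t \<in> probs Z"
    and "\<And>f. f \<in> Cb Z \<Longrightarrow> continuous_map T euclideanreal (\<lambda>t. LINT x:Z|k t. f x)"
  shows "continuous_map T (weak_topology Z) k"
  unfolding weak_topology_def
proof (rule continuous_on_generated_topo)
  fix W assume "W \<in> {{\<sigma> \<in> probs Z. (LINT x:Z|\<sigma>. f x) \<in> U} |f U. f \<in> Cb Z \<and> open U}"
  then obtain f U where f: "f \<in> Cb Z" "open U" "W = {\<sigma> \<in> probs Z. (LINT x:Z|\<sigma>. f x) \<in> U}" by auto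
  have "k -` W \<inter> topspace T = {t \<in> topspace T. (LINT x:Z|k t. f x) \<in> U}"
    using f assms(1) by auto
  then show "openin T (k -` W \<inter> topspace T)"
    using openin_continuous_map_preimage[OF assms(2)[OF f(1)]] f(2) by simp
next
  have "(\<lambda>_. 0) \<in> Cb Z" by (auto simp: Cb_def image_constant_conv)
  then have "probs Z \<in> {{\<sigma> \<in> probs Z. (LINT x:Z|\<sigma>. f x) \<in> U} |f U. f \<in> Cb Z \<and> open U}"
    by (intro CollectI exI[of _ "\<lambda>_. 0"] exI[of _ UNIV]) auto
  then show "k ` topspace T \<subseteq> \<Union> {{\<sigma> \<in> probs Z. (LINT x:Z|\<sigma>. f x) \<in> U} |f U. f \<in> Cb Z \<and> open U}"
    using assms(1) by blast
qed

lemma continuous_map_weak_integral: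
  assumes "f \<in> Cb Z"
  shows "continuous_map (weak_topology Z) euclideanreal (\<lambda>\<sigma>. LINT x:Z|\<sigma>. f x)"
  unfolding continuous_map_def using openin_weak_topology_basis[OF assms] by auto

lemma Cb_subset: "Y \<subseteq> Z \<Longrightarrow> f \<in> Cb Z \<Longrightarrow> f \<in> Cb Y"
  by (auto simp: Cb_def intro: continuous_on_subset bounded_subset)

lemma continuous_map_weak_topology_id:
  assumes "closed Y" "closed Z" "Y \<subseteq> Z"
  shows "continuous_map (weak_topology Y) (weak_topology Z) id"
proof (rule continuous_map_weak_topology)
  fix f :: "'a \<Rightarrow> real" assume f: "f \<in> Cb Z"
  show "continuous_map (weak_topology Y) euclideanreal (\<lambda>t. LINT x:Z|id t. f x)"
  proof (rule continuous_map_eq[OF continuous_map_weak_integral[OF Cb_subset[OF assms(3) f]]])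
    fix \<sigma> assume "\<sigma> \<in> topspace (weak_topology Y)"
    then show "(LINT x:Y|\<sigma>. f x) = (LINT x:Z|id \<sigma>. f x)"
      using set_integral_probs_subset[of \<sigma> Y Z f] assms f by (auto simp: Cb_def)
  qed
qed (use probs_mono[OF assms] in auto)

section \<open>Coding a compact metric space in the unit interval\<close>

text \<open>Base-3 expansions with digits 0 and 2, as for the Cantor set: the first differing digit
  contributes 2 (1/3)^(n+1) and all later ones together at most (1/3)^(n+1), so a gap of the latter
  size survives.\<close>

lemma ternary_gap:
  fixes A :: "nat \<Rightarrow> 'a set"
  assumes "\<And>k. k < n \<Longrightarrow> (x \<in> A k \<longleftrightarrow> y \<in> A k)" "x \<in> A n" "y \<notin> A n"
  shows "(1/3) ^ Suc n \<le> (\<Sum>k. 2 * indicator (A k) x * (1/3) ^ Suc k) - (\<Sum>k. 2 * indicator (A k) y * (1/3::real) ^ Suc k)"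
proof -
  define d where "d k = 2 * (indicator (A k) x - indicator (A k) y) * (1/3::real) ^ Suc k" for k
  have gs: "summable (\<lambda>k. 2 * (1/3::real) ^ Suc k)" by (simp add: summable_geometric)
  have s: "summable (\<lambda>k. 2 * indicator (A k) w * (1/3::real) ^ Suc k)" for w
    by (rule summable_comparison_test'[OF gs, of 0]) (auto simp: indicator_def)
  have sd: "summable d" unfolding d_def using summable_diff[OF s[of x] s[of y]] by (simp add: algebra_simps)
  have "(\<Sum>k. 2 * indicator (A k) x * (1/3) ^ Suc k) - (\<Sum>k. 2 * indicator (A k) y * (1/3::real) ^ Suc k) = suminf d"
    unfolding d_def by (subst suminf_diff[OF s s]) (simp add: algebra_simps)
  also have "\<dots> = (\<Sum>k. d (k + Suc n)) + (\<Sum>k<Suc n. d k)"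
    by (rule suminf_split_initial_segment[OF sd])
  also have "(\<Sum>k<Suc n. d k) = d n"
    using assms(1) by (simp add: d_def indicator_def)
  also have "d n = 2 * (1/3) ^ Suc n" using assms by (simp add: d_def)
  finally have 1: "(\<Sum>k. 2 * indicator (A k) x * (1/3) ^ Suc k) - (\<Sum>k. 2 * indicator (A k) y * (1/3::real) ^ Suc k)
     = (\<Sum>k. d (k + Suc n)) + 2 * (1/3) ^ Suc n" .
  have gsum: "(\<lambda>k. - (2 * (1/3) ^ Suc (k + Suc n))) sums (- ((1/3::real) ^ Suc n))"
  proof -
    have "(\<lambda>k. (- 2 * (1/3) ^ Suc (Suc n)) * (1/3::real) ^ k) sums ((- 2 * (1/3) ^ Suc (Suc n)) * (1 / (1 - 1/3)))"
      by (intro sums_mult geometric_sums) simp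
    moreover have "(- 2 * (1/3) ^ Suc (Suc n)) * (1 / (1 - 1/3)) = - ((1/3::real) ^ Suc n)" by simp
    moreover have "(\<lambda>k. (- 2 * (1/3) ^ Suc (Suc n)) * (1/3::real) ^ k) = (\<lambda>k. - (2 * (1/3) ^ Suc (k + Suc n)))"
      by (auto simp: power_add fun_eq_iff)
    ultimately show ?thesis by simp
  qed
  have "(\<Sum>k. - (2 * (1/3::real) ^ Suc (k + Suc n))) \<le> (\<Sum>k. d (k + Suc n))"
  proof (rule suminf_le)
    show "- (2 * (1/3) ^ Suc (k + Suc n)) \<le> d (k + Suc n)" for k
      by (auto simp: d_def indicator_def)
    show "summable (\<lambda>k. d (k + Suc n))" using sd summable_iff_shift by blast
  qed (use gsum in \<open>simp add: sums_iff\<close>)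
  with 1 gsum show ?thesis by (simp add: sums_iff)
qed

text \<open>The digits of \<open>c x\<close> record which balls of a countable family contain
  \<open>x\<close>. The code is only Borel, but on \<open>Y\<close> its inverse is uniformly
  continuous, and that direction suffices to carry limits of measures back from the line.\<close>

lemma compact_borel_code:
  fixes Y :: "'a::metric_space set"
  assumes "compact Y"
  obtains c :: "'a \<Rightarrow> real" where "c \<in> borel_measurable borel" "\<And>x. 0 \<le> c x \<and> c x \<le> 1"
    "\<And>e. 0 < e \<Longrightarrow> \<exists>d>0. \<forall>x\<in>Y. \<forall>y\<in>Y. \<bar>c x - c y\<bar> < d \<longrightarrow> dist x y < e"
proof -
  have "\<forall>m::nat. \<exists>D. finite D \<and> Y \<subseteq> (\<Union>x\<in>D. ball x (1 / (Suc m)))"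
  proof
    fix m :: nat
    have "0 < 1 / real (Suc m)" by simp
    then show "\<exists>D. finite D \<and> Y \<subseteq> (\<Union>x\<in>D. ball x (1 / (Suc m)))"
      using assms unfolding compact_eq_totally_bounded by blast
  qed
  then obtain D where D: "\<And>m::nat. finite (D m)" "\<And>m. Y \<subseteq> (\<Union>x\<in>D m. ball x (1 / (Suc m)))" by metis
  \<comment> \<open>The empty set keeps \<open>B\<close> nonempty, hence enumerable by
    \<open>from_nat_into\<close>, even if \<open>Y\<close> is empty.\<close>
  define B where "B = insert {} (\<Union>m. (\<lambda>x. ball x (1 / (Suc m))) ` D m)"
  have cB: "countable B" unfolding B_def by (intro countable_insert countable_UN countable_image countable_finite D countableI_type)
  have Bne: "B \<noteq> {}" by (auto simp: B_def)
  define A where "A = from_nat_into B"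
  have rA: "range A = B" unfolding A_def using range_from_nat_into[OF Bne cB] .
  have oA: "open (A k)" for k
  proof -
    have "A k \<in> B" using rA by blast
    then show ?thesis by (auto simp: B_def)
  qed
  define c where "c x = (\<Sum>k. 2 * indicator (A k) x * (1/3::real) ^ Suc k)" for x
  have gs: "summable (\<lambda>k. 2 * (1/3::real) ^ Suc k)" by (simp add: summable_geometric)
  have s: "summable (\<lambda>k. 2 * indicator (A k) w * (1/3::real) ^ Suc k)" for w
    by (rule summable_comparison_test'[OF gs, of 0]) (auto simp: indicator_def)
  show ?thesis
  proof
    have [measurable]: "A k \<in> sets borel" for k using oA by auto
    show "c \<in> borel_measurable borel" unfolding c_def by measurable
    show "0 \<le> c x \<and> c x \<le> 1" for x
    proof
      show "0 \<le> c x" unfolding c_def by (intro suminf_nonneg s) auto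
      have "c x \<le> (\<Sum>k. 2 * (1/3::real) ^ Suc k)"
        unfolding c_def by (intro suminf_le s gs) (auto simp: indicator_def)
      also have "\<dots> = 1"
      proof -
        have "(\<lambda>k. (2/3) * (1/3::real) ^ k) sums ((2/3) * (1 / (1 - 1/3)))" by (intro sums_mult geometric_sums) simp
        then show ?thesis by (simp add: sums_iff)
      qed
      finally show "c x \<le> 1" .
    qed
    fix e :: real assume "0 < e"
    then obtain m :: nat where m: "1 / Suc m < e / 2" using nat_approx_posE[of "e/2"] by auto
    have "\<exists>k. A k = ball p (1 / Suc m)" if "p \<in> D m" for p
      using rA that unfolding B_def by (metis (no_types, lifting) UN_I UNIV_I image_iff insertI2)
    then obtain i where i: "\<And>p. p \<in> D m \<Longrightarrow> A (i p) = ball p (1 / Suc m)" by metis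
    \<comment> \<open>\<open>K\<close> exceeds the index of every ball of radius 1/(m+1) in the
      finite cover; points of \<open>Y\<close> with equal digits below \<open>K\<close> share such a
      ball and are within 2/(m+1) < e.\<close>
    define K where "K = Suc (Max (insert 0 (i ` D m)))"
    have iK: "i p < K" if "p \<in> D m" for p
      using D(1)[of m] that by (auto simp: K_def less_Suc_eq_le)
    show "\<exists>d>0. \<forall>x\<in>Y. \<forall>y\<in>Y. \<bar>c x - c y\<bar> < d \<longrightarrow> dist x y < e"
    proof (intro exI[of _ "(1/3)^K"] conjI ballI impI)
      fix x y assume x: "x \<in> Y" and y: "y \<in> Y" and xy: "\<bar>c x - c y\<bar> < (1/3)^K"
      have agree: "x \<in> A k \<longleftrightarrow> y \<in> A k" if "k < K" for k
        using that
      proof (induction k rule: less_induct)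
        case (less k)
        have le: "(1/3::real)^K \<le> (1/3)^Suc k" using less.prems by (intro power_decreasing) auto
        show ?case
        proof (rule ccontr)
          assume "\<not> ?case"
          then consider "x \<in> A k" "y \<notin> A k" | "y \<in> A k" "x \<notin> A k" by auto
          then show False
          proof cases
            case 1
            have "(1/3)^Suc k \<le> c x - c y"
              unfolding c_def by (rule ternary_gap) (use less 1 in auto)
            with xy le show False by linarith
          next
            case 2
            have "(1/3)^Suc k \<le> c y - c x"
              unfolding c_def by (rule ternary_gap) (use less 2 in auto)
            with xy le show False by linarith
          qed
        qed
      qed
      obtain p where p: "p \<in> D m" "x \<in> ball p (1 / Suc m)" using D(2) x by blast
      then have "y \<in> ball p (1 / Suc m)" using agree[OF iK] i by auto
      then have "dist x y < 1 / Suc m + 1 / Suc m" using p(2)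
        by (metis add_strict_mono dist_commute dist_triangle_less_add mem_ball)
      with m show "dist x y < e" by linarith
    qed simp
  qed
qed

section \<open>Compactness of spaces of probability measures\<close>

text \<open>Helly selection on the line: the code pushes the measures to [0,1], a subsequence
  converges weakly there, and the continuous inverse of the code pulls the limit back to
  \<open>Y\<close>.\<close>

lemma probs_seq_compact:
  fixes Y :: "'a::polish_space set"
  assumes Y: "compact Y" and mu: "\<And>n. \<mu> n \<in> probs Y"
  obtains r \<nu> where "strict_mono (r :: nat \<Rightarrow> nat)" "\<nu> \<in> probs Y"
    "\<And>f :: 'a \<Rightarrow> real. continuous_on Y f \<Longrightarrow> (\<lambda>n. LINT x:Y|\<mu> (r n). f x) \<longlonglongrightarrow> (LINT x:Y|\<nu>. f x)"
proof -
  have clY: "closed Y" using Y by (rule compact_imp_closed)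
  have Yne: "Y \<noteq> {}" using mu[of 0] by (auto simp: probs_def)
  obtain c :: "'a \<Rightarrow> real" where c: "c \<in> borel_measurable borel" "\<And>x. 0 \<le> c x \<and> c x \<le> 1"
    "\<And>e. 0 < e \<Longrightarrow> \<exists>d>0. \<forall>x\<in>Y. \<forall>y\<in>Y. \<bar>c x - c y\<bar> < d \<longrightarrow> dist x y < e"
    using compact_borel_code[OF Y] by metis
  define g where "g = inv_into Y c"
  have gY: "g t \<in> Y" if "t \<in> c ` Y" for t using that by (simp add: g_def inv_into_into)
  have cg: "c (g t) = t" if "t \<in> c ` Y" for t using that by (simp add: g_def f_inv_into_f)
  have inj: "x = y" if "x \<in> Y" "y \<in> Y" "c x = c y" for x y
  proof (rule ccontr)
    assume "x \<noteq> y"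
    then obtain d where "d > 0" "\<forall>a\<in>Y. \<forall>b\<in>Y. \<bar>c a - c b\<bar> < d \<longrightarrow> dist a b < dist x y"
      using c(3)[of "dist x y"] by auto
    with that show False by force
  qed
  have gc: "g (c x) = x" if "x \<in> Y" for x using inj gY cg that by blast
  have "uniformly_continuous_on (c ` Y) g"
    unfolding uniformly_continuous_on_def
  proof (intro allI impI)
    fix e :: real assume "0 < e"
    then obtain d where d: "d > 0" "\<forall>x\<in>Y. \<forall>y\<in>Y. \<bar>c x - c y\<bar> < d \<longrightarrow> dist x y < e" using c(3) by metis
    show "\<exists>d>0. \<forall>x\<in>c ` Y. \<forall>x'\<in>c ` Y. dist x' x < d \<longrightarrow> dist (g x') (g x) < e"
      using d gY cg by (intro exI[of _ d]) (auto simp: dist_real_def)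
  qed
  \<comment> \<open>The limit on the line may charge limit points of codes that are not codes
    themselves, so the inverse is extended to the closure of the image of \<open>Y\<close>.\<close>
  then obtain h where h: "uniformly_continuous_on (closure (c ` Y)) h" "\<And>x. x \<in> c ` Y \<Longrightarrow> g x = h x"
    by (rule uniformly_continuous_on_extension_on_closure) blast
  define K where "K = closure (c ` Y)"
  have clK: "closed K" and Kne: "K \<noteq> {}" using Yne by (auto simp: K_def)
  have conth: "continuous_on K h" using h(1) unfolding K_def by (rule uniformly_continuous_imp_continuous)
  have hc: "h (c x) = x" if "x \<in> Y" for x using h(2)[of "c x"] gc that by auto
  have hK: "h t \<in> Y" if "t \<in> K" for t
  proof -
    have "h ` closure (c ` Y) \<subseteq> closure Y"
      using conth unfolding K_def by (rule image_closure_subset) (use hc in \<open>auto intro: closure_subset[THEN subsetD]\<close>)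
    then show ?thesis using that clY by (auto simp: K_def)
  qed
  have cK: "c x \<in> K" if "x \<in> Y" for x using that closure_subset[of "c ` Y"] by (auto simp: K_def)
  define m where "m n = distr (\<mu> n) borel c" for n
  have cm: "c \<in> measurable (\<mu> n) borel" for n
  proof -
    have "measurable (\<mu> n) borel = measurable borel (borel :: real measure)"
      by (rule measurable_cong_sets) (simp_all add: probs_sets[OF mu])
    with c(1) show ?thesis by simp
  qed
  have rd: "real_distribution (m n)" for n
  proof -
    interpret prob_space "\<mu> n" by (rule probs_prob[OF mu])
    show ?thesis unfolding m_def by (rule real_distribution_distr) (rule cm)
  qed
  have "tight m"
    unfolding tight_def
  proof (intro conjI allI impI rd)
    fix e :: real assume "e > 0"
    have "measure (m n) {-1<..1} = 1" for n
    proof -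
      interpret prob_space "\<mu> n" by (rule probs_prob[OF mu])
      have *: "0 \<le> c x" "c x \<le> 1" "-1 < c x" for x using c(2)[of x] by auto
      have "c -` {-1<..1} \<inter> space (\<mu> n) = space (\<mu> n)" using * by auto
      then show ?thesis unfolding m_def using prob_space by (subst measure_distr[OF cm]) auto
    qed
    with \<open>e > 0\<close> show "\<exists>a b. a < b \<and> (\<forall>n. 1 - e < measure (m n) {a<..b})"
      by (intro exI[of _ "-1"] exI[of _ 1]) auto
  qed
  then obtain r N where r: "strict_mono (r :: nat \<Rightarrow> nat)" "real_distribution N" "weak_conv_m (m \<circ> id \<circ> r) N"
    using tight_imp_convergent_subsubsequence[of m id] by (auto simp: strict_mono_def)
  interpret N: real_distribution N by fact
  have conv: "(\<lambda>n. integral\<^sup>L (m (r n)) F) \<longlonglongrightarrow> integral\<^sup>L N F"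
    if "continuous_on UNIV F" "\<And>x. norm (F x) \<le> B" for F :: "real \<Rightarrow> real" and B
  proof -
    have "weak_conv_m (\<lambda>n. m (r n)) N" using r(3) by (simp add: o_def)
    from rd r(2) this show ?thesis
      by (rule weak_conv_imp_integral_bdd_continuous_conv[where B=B])
         (use that in \<open>auto simp: continuous_on_eq_continuous_at\<close>)
  qed
  have mint: "integral\<^sup>L (m n) F = (LINT x:Y|\<mu> n. F (c x))" if "continuous_on UNIV F" for F :: "real \<Rightarrow> real" and n
  proof -
    have F: "F \<in> borel_measurable borel" using that by (rule borel_measurable_continuous_onI)
    have "integral\<^sup>L (m n) F = (LINT x|\<mu> n. F (c x))"
      unfolding m_def by (rule integral_distr[OF cm F])
    also have "\<dots> = (LINT x:Y|\<mu> n. F (c x))"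
      unfolding set_lebesgue_integral_def
    proof (rule integral_cong_AE)
      have Fc: "(\<lambda>x. F (c x)) \<in> borel_measurable (\<mu> n)" using measurable_compose[OF cm F] .
      then show "(\<lambda>x. F (c x)) \<in> borel_measurable (\<mu> n)" .
      have "Y \<in> sets (\<mu> n)" using clY probs_sets[OF mu] by auto
      then show "(\<lambda>x. indicat_real Y x *\<^sub>R F (c x)) \<in> borel_measurable (\<mu> n)" using Fc by measurable
      show "AE x in \<mu> n. F (c x) = indicat_real Y x *\<^sub>R F (c x)"
        using probs_AE[OF mu clY] by eventually_elim auto
    qed
    finally show ?thesis .
  qed
  \<comment> \<open>The bounded continuous function min(1, distance to \<open>K\<close>) integrates
    to 0 against every pushed-forward measure, hence against the limit.\<close>
  have NK: "AE t in N. t \<in> K"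
  proof -
    define F where "F t = min 1 (infdist t K)" for t :: real
    have F: "continuous_on UNIV F" unfolding F_def by (intro continuous_intros)
    have Fb: "norm (F t) \<le> 1" for t using infdist_nonneg[of t K] by (auto simp: F_def)
    have "integral\<^sup>L (m n) F = 0" for n
    proof -
      have "(LINT x:Y|\<mu> n. F (c x)) = (LINT x:Y|\<mu> n. 0)"
        by (rule set_integral_probs_cong) (use cK in \<open>simp add: F_def\<close>)
      then show ?thesis using mint[OF F] by (simp add: set_lebesgue_integral_def)
    qed
    then have 0: "integral\<^sup>L N F = 0" using LIMSEQ_unique[OF conv[OF F Fb] tendsto_eventually[of _ 0]] by simp
    have Fm: "F \<in> borel_measurable N" using borel_measurable_continuous_onI[OF F] by simp
    have "integrable N F"
      by (rule N.integrable_const_bound[where B=1]) (use Fb Fm in auto)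
    then have "AE t in N. F t = 0"
      using 0 integral_nonneg_eq_0_iff_AE[of N F] infdist_nonneg[of _ K] by (auto simp: F_def)
    then show ?thesis
    proof eventually_elim
      case (elim t)
      then have "infdist t K = 0" by (auto simp: F_def min_def split: if_splits)
      then show ?case using in_closed_iff_infdist_zero[OF clK Kne] by simp
    qed
  qed
  obtain y0 where y0: "y0 \<in> Y" using Yne by auto
  \<comment> \<open>Outside \<open>K\<close> the value is a dummy point of \<open>Y\<close>, so that
    \<open>h'\<close> is a total Borel map into \<open>Y\<close>.\<close>
  define h' where "h' t = (if t \<in> K then h t else y0)" for t
  have h'm: "h' \<in> borel_measurable borel"
  proof -
    have "h' \<in> measurable borel borel"
      unfolding h'_def
      by (rule borel_measurable_continuous_on_if[of K h "\<lambda>_. y0"]) (use clK conth in auto)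
    then show ?thesis .
  qed
  then have h'N: "h' \<in> measurable N borel" by simp
  have h'Y: "h' t \<in> Y" for t using hK y0 by (auto simp: h'_def)
  define \<nu> where "\<nu> = distr N borel h'"
  have nuP: "\<nu> \<in> probs Y"
  proof -
    have "prob_space \<nu>" unfolding \<nu>_def by (rule N.prob_space_distr[OF h'N])
    moreover have "measure \<nu> Y = 1"
    proof -
      have "h' -` Y \<inter> space N = space N" using h'Y by auto
      then show ?thesis unfolding \<nu>_def using clY N.prob_space by (subst measure_distr[OF h'N]) auto
    qed
    ultimately show ?thesis by (auto simp: probs_def \<nu>_def)
  qed
  show ?thesis
  proof (rule that[OF r(1) nuP])
    fix f :: "'a \<Rightarrow> real" assume f: "continuous_on Y f"
    have "compact (f ` Y)" using Y f by (rule compact_continuous_image[rotated])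
    then have "bounded (f ` Y)" by (rule compact_imp_bounded)
    then obtain B where B: "\<And>y. y \<in> Y \<Longrightarrow> norm (f y) \<le> B" by (auto simp: bounded_iff)
    have B0: "0 \<le> B" using B[OF y0] norm_ge_zero[of "f y0"] by linarith
    have "continuous_on K (f \<circ> h)"
      by (rule continuous_on_compose[OF conth]) (use hK f in \<open>auto intro: continuous_on_subset\<close>)
    \<comment> \<open>\<open>f\<close> composed with the inverse code is continuous on the closed
      set \<open>K\<close>, and Tietze makes it a test function on the line. Composing back with
      \<open>c\<close> recovers \<open>f\<close> on \<open>Y\<close>, although \<open>c\<close> may
      be discontinuous.\<close>
    then obtain F where F: "continuous_on UNIV F" "\<And>t. t \<in> K \<Longrightarrow> F t = (f \<circ> h) t" "\<And>t. norm (F t) \<le> B"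
      using Tietze[of K "f \<circ> h" UNIV B] clK B0 B hK by auto
    have 1: "integral\<^sup>L (m n) F = (LINT x:Y|\<mu> n. f x)" for n
      unfolding mint[OF F(1)] by (rule set_integral_probs_cong) (use F(2) cK hc in auto)
    have "(LINT x:Y|\<nu>. f x) = (LINT x|\<nu>. indicator Y x *\<^sub>R f x)" by (simp add: set_lebesgue_integral_def)
    also have "\<dots> = (LINT t|N. indicator Y (h' t) *\<^sub>R f (h' t))"
      unfolding \<nu>_def by (rule integral_distr[OF h'N Cb_measurable[OF f clY]])
    also have "\<dots> = integral\<^sup>L N F"
    proof (rule integral_cong_AE)
      show "(\<lambda>t. indicat_real Y (h' t) *\<^sub>R f (h' t)) \<in> borel_measurable N"
        using measurable_compose[OF h'N Cb_measurable[OF f clY]] .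
      show "F \<in> borel_measurable N" using borel_measurable_continuous_onI[OF F(1)] by simp
      show "AE x in N. indicat_real Y (h' x) *\<^sub>R f (h' x) = F x"
        using NK by eventually_elim (use F(2) hK in \<open>auto simp: h'_def\<close>)
    qed
    finally show "(\<lambda>n. LINT x:Y|\<mu> (r n). f x) \<longlonglongrightarrow> (LINT x:Y|\<nu>. f x)"
      using conv[OF F(1) F(3)] 1 by simp
  qed
qed

text \<open>Rational combinations of partitions of unity subordinate to finite covers by balls of
  radius 1/(m+1) form a countable set, and uniform continuity makes them uniformly dense.\<close>

lemma compact_continuous_separable:
  fixes Y :: "'a::metric_space set"
  assumes Y: "compact Y"
  obtains F :: "nat \<Rightarrow> 'a \<Rightarrow> real" where "\<And>i. continuous_on Y (F i)"
    "\<And>f e. continuous_on Y f \<Longrightarrow> 0 < e \<Longrightarrow> \<exists>i. \<forall>y\<in>Y. \<bar>f y - F i y\<bar> < e"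
proof -
  have "\<forall>m::nat. \<exists>xs. set xs \<subseteq> Y \<and> Y \<subseteq> (\<Union>x\<in>set xs. ball x (1 / (Suc m)))"
  proof
    fix m :: nat
    have "0 < 1 / real (Suc m)" by simp
    then have "Y \<subseteq> (\<Union>x\<in>Y. ball x (1 / real (Suc m)))" by force
    then obtain D where "finite D" "D \<subseteq> Y" "Y \<subseteq> (\<Union>x\<in>D. ball x (1 / (Suc m)))"
      using compactE_image[OF Y, of Y "\<lambda>x. ball x (1 / real (Suc m))"] by (metis open_ball)
    then show "\<exists>xs. set xs \<subseteq> Y \<and> Y \<subseteq> (\<Union>x\<in>set xs. ball x (1 / (Suc m)))"
      using finite_list by metis
  qed
  then obtain xs where xs: "\<And>m::nat. set (xs m) \<subseteq> Y" "\<And>m. Y \<subseteq> (\<Union>x\<in>set (xs m). ball x (1 / (Suc m)))" by metis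
  define p where "p m i y = max 0 (1 / (Suc m) - dist (xs m ! i) y)" for m i y
  define s where "s m y = (\<Sum>i<length (xs m). p m i y)" for m y
  have p0: "0 \<le> p m i y" for m i y by (simp add: p_def)
  have spos: "0 < s m y" if y: "y \<in> Y" for m y
  proof -
    obtain x where "x \<in> set (xs m)" "dist x y < 1 / (Suc m)" using xs(2) y by fastforce
    then obtain i where i: "i < length (xs m)" "dist (xs m ! i) y < 1 / (Suc m)" by (auto simp: in_set_conv_nth)
    show ?thesis unfolding s_def
      by (rule sum_pos2[of _ i]) (use i p0 in \<open>auto simp: p_def\<close>)
  qed
  define G where "G = (\<lambda>(m, v :: rat list) y. \<Sum>i<length (xs m). of_rat (v ! i) * (p m i y / s m y))"
  have contG: "continuous_on Y (G j)" for j
    unfolding G_def split_def s_def p_def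
  proof (intro continuous_intros ballI)
    fix y assume "y \<in> Y"
    then have "s (fst j) y \<noteq> 0" using spos[of y "fst j"] by simp
    then show "(\<Sum>i<length (xs (fst j)). max 0 (1 / real (Suc (fst j)) - dist (xs (fst j) ! i) y)) \<noteq> 0"
      by (simp add: s_def p_def)
  qed
  have appr: "\<exists>j. \<forall>y\<in>Y. \<bar>f y - G j y\<bar> < e" if f: "continuous_on Y f" and e: "0 < e" for f e
  proof -
    have "uniformly_continuous_on Y f" using f Y by (rule compact_uniformly_continuous)
    then obtain d where d: "d > 0" "\<And>x y. x \<in> Y \<Longrightarrow> y \<in> Y \<Longrightarrow> dist x y < d \<Longrightarrow> \<bar>f x - f y\<bar> < e / 2"
      unfolding uniformly_continuous_on_def dist_real_def using e by (metis half_gt_zero)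
    obtain m :: nat where m: "1 / Suc m < d" using nat_approx_posE[OF d(1)] by auto
    have "\<exists>q::rat. \<bar>f x - of_rat q\<bar> < e / 2" for x
    proof -
      obtain q where "f x - e/2 < of_rat q" "of_rat q < f x + e / 2"
        using of_rat_dense[of "f x - e/2" "f x + e/2"] e by auto
      then show ?thesis by (intro exI[of _ q]) linarith
    qed
    then obtain q where q: "\<And>x. \<bar>f x - of_rat (q x :: rat)\<bar> < e / 2" by metis
    define v where "v = map q (xs m)"
    have "\<bar>f y - G (m, v) y\<bar> < e" if y: "y \<in> Y" for y
    proof -
      define w where "w i = p m i y / s m y" for i
      have w0: "0 \<le> w i" for i using p0 spos[OF y] by (simp add: w_def less_imp_le)
      have w1: "(\<Sum>i<length (xs m). w i) = 1"
        unfolding w_def using spos[OF y, of m] by (simp add: sum_divide_distrib[symmetric] s_def)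
      have "G (m, v) y = (\<Sum>i<length (xs m). of_rat (v ! i) * w i)" by (simp add: G_def w_def)
      then have "f y - G (m, v) y = (\<Sum>i<length (xs m). (f y - of_rat (v ! i)) * w i)"
        using w1 by (simp add: left_diff_distrib sum_subtractf sum_distrib_left[symmetric])
      also have "\<bar>\<dots>\<bar> \<le> (\<Sum>i<length (xs m). \<bar>(f y - of_rat (v ! i)) * w i\<bar>)" by (rule sum_abs)
      also have "\<dots> < (\<Sum>i<length (xs m). e * w i)"
      proof -
        have le: "\<bar>(f y - of_rat (v ! i)) * w i\<bar> \<le> e * w i \<and> (w i > 0 \<longrightarrow> \<bar>(f y - of_rat (v ! i)) * w i\<bar> < e * w i)"
          if i: "i < length (xs m)" for i
        proof (cases "w i > 0")
          case True
          then have "p m i y > 0" using p0[of m i y] spos[OF y, of m] by (auto simp: w_def zero_less_divide_iff)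
          then have "dist (xs m ! i) y < d" using m by (auto simp: p_def max_def split: if_splits)
          moreover have "xs m ! i \<in> Y" using xs(1) i nth_mem by blast
          ultimately have "\<bar>f (xs m ! i) - f y\<bar> < e / 2" using d(2) y by auto
          moreover have "v ! i = q (xs m ! i)" using i by (simp add: v_def)
          ultimately have "\<bar>f y - of_rat (v ! i)\<bar> < e" using q[of "xs m ! i"] by (simp only:)
          with True show ?thesis by (simp add: abs_mult less_imp_le)
        next
          case False
          then have "w i = 0" using w0[of i] by simp
          then show ?thesis by simp
        qed
        obtain i where i: "i < length (xs m)" "w i > 0"
          using w1 sum_nonpos[of "{..<length (xs m)}" w] by (metis lessThan_iff not_less zero_less_one)
        show ?thesis by (rule sum_strict_mono_ex1) (use le i in auto)
      qed
      also have "\<dots> = e" using w1 by (simp add: sum_distrib_left[symmetric])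
      finally show ?thesis .
    qed
    then show ?thesis by blast
  qed
  show ?thesis
  proof (rule that[of "\<lambda>i. G (from_nat i)"])
    show "\<exists>i. \<forall>y\<in>Y. \<bar>f y - G (from_nat i) y\<bar> < e" if "continuous_on Y f" "0 < e" for f e
      using appr[OF that] from_nat_to_nat by metis
  qed (rule contG)
qed

lemma Cb_compact: "compact Y \<Longrightarrow> f \<in> Cb Y \<longleftrightarrow> continuous_on Y f"
  by (auto simp: Cb_def intro: compact_imp_bounded compact_continuous_image)

lemma tendsto_fun_coordinatewise:
  fixes f :: "'b \<Rightarrow> 'i \<Rightarrow> 'c::topological_space"
  assumes "\<And>i. ((\<lambda>n. f n i) \<longlongrightarrow> l i) F"
  shows "(f \<longlongrightarrow> l) F"
proof -
  have "limitin (product_topology (\<lambda>i. euclidean) UNIV) f l F"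
    using assms by (simp add: limitin_componentwise)
  then show ?thesis by (simp add: euclidean_product_topology)
qed

text \<open>Integrals against the dense sequence embed P(\<open>Y\<close>) in a countable product of
  lines, which is metrizable. There sequential compactness is compactness, and the inverse of the
  embedding is weakly continuous by uniform approximation, so compactness passes to the weak
  topology.\<close>

lemma compactin_probs:
  fixes Y :: "'a::polish_space set"
  assumes Y: "compact Y"
  shows "compactin (weak_topology Y) (probs Y)"
proof (cases "probs Y = {}")
  case False
  have clY: "closed Y" using Y by (rule compact_imp_closed)
  have bd: "bounded (f ` Y)" if "continuous_on Y f" for f :: "'a \<Rightarrow> real"
    using compact_continuous_image[OF that Y] by (rule compact_imp_bounded)
  obtain F :: "nat \<Rightarrow> 'a \<Rightarrow> real" where F: "\<And>i. continuous_on Y (F i)"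
    "\<And>f e. continuous_on Y f \<Longrightarrow> 0 < e \<Longrightarrow> \<exists>i. \<forall>y\<in>Y. \<bar>f y - F i y\<bar> < e"
    using compact_continuous_separable[OF Y] by blast
  define \<Psi> where "\<Psi> \<sigma> = (\<lambda>i. LINT x:Y|\<sigma>. F i x)" for \<sigma>
  have near: "\<bar>(LINT x:Y|\<sigma>. f x) - \<Psi> \<sigma> i\<bar> \<le> e"
    if "\<sigma> \<in> probs Y" "continuous_on Y f" "\<forall>y\<in>Y. \<bar>f y - F i y\<bar> < e" for \<sigma> f i e
    unfolding \<Psi>_def using that F(1) bd clY by (intro set_integral_probs_diff_le) (auto intro: less_imp_le)
  have inj: "\<sigma> = \<tau>" if s: "\<sigma> \<in> probs Y" "\<tau> \<in> probs Y" "\<Psi> \<sigma> = \<Psi> \<tau>" for \<sigma> \<tau>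
  proof (rule probs_eqI[OF s(1,2) clY])
    fix f :: "'a \<Rightarrow> real" assume "\<exists>L. L-lipschitz_on UNIV f"
    then have f: "continuous_on Y f" using lipschitz_on_continuous_on continuous_on_subset by blast
    show "(LINT x:Y|\<sigma>. f x) = (LINT x:Y|\<tau>. f x)"
    proof (rule ccontr)
      assume "\<not> ?thesis"
      then have e: "\<bar>(LINT x:Y|\<sigma>. f x) - (LINT x:Y|\<tau>. f x)\<bar> / 3 > 0" by simp
      from F(2)[OF f this] obtain i where i: "\<forall>y\<in>Y. \<bar>f y - F i y\<bar> < \<bar>(LINT x:Y|\<sigma>. f x) - (LINT x:Y|\<tau>. f x)\<bar> / 3" by blast
      from near[OF s(1) f i] near[OF s(2) f i] s(3) e show False by (simp add: abs_if split: if_splits)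
    qed
  qed
  define I where "I = \<Psi> ` probs Y"
  define k where "k = inv_into (probs Y) \<Psi>"
  have kP: "k v \<in> probs Y" if "v \<in> I" for v using that unfolding I_def k_def by (rule inv_into_into)
  have Pk: "\<Psi> (k v) = v" if "v \<in> I" for v using that unfolding I_def k_def by (rule f_inv_into_f)
  have kim: "k ` I = probs Y"
  proof (intro equalityI subsetI)
    show "\<sigma> \<in> k ` I" if "\<sigma> \<in> probs Y" for \<sigma>
    proof -
      have "\<Psi> \<sigma> \<in> I" using that by (simp add: I_def)
      moreover from this have "k (\<Psi> \<sigma>) = \<sigma>" using inj[OF kP that] Pk by simp
      ultimately show ?thesis by force
    qed
  qed (use kP in auto)
  have "seq_compact I"
    unfolding seq_compact_def
  proof (intro allI impI)
    fix v :: "nat \<Rightarrow> nat \<Rightarrow> real" assume v: "\<forall>n. v n \<in> I"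
    then have "k (v n) \<in> probs Y" for n using kP by blast
    then obtain r \<nu> where r: "strict_mono (r :: nat \<Rightarrow> nat)" "\<nu> \<in> probs Y"
      "\<And>f :: 'a \<Rightarrow> real. continuous_on Y f \<Longrightarrow> (\<lambda>n. LINT x:Y|k (v (r n)). f x) \<longlonglongrightarrow> (LINT x:Y|\<nu>. f x)"
      using probs_seq_compact[OF Y, of "\<lambda>n. k (v n)"] by blast
    have "(\<lambda>n. v (r n)) \<longlonglongrightarrow> \<Psi> \<nu>"
    proof (rule tendsto_fun_coordinatewise)
      fix i
      have "(\<lambda>n. v (r n) i) = (\<lambda>n. LINT x:Y|k (v (r n)). F i x)"
      proof
        fix n
        have "\<Psi> (k (v (r n))) i = v (r n) i" using Pk v by simp
        then show "v (r n) i = (LINT x:Y|k (v (r n)). F i x)" by (simp add: \<Psi>_def)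
      qed
      then show "(\<lambda>n. v (r n) i) \<longlonglongrightarrow> \<Psi> \<nu> i" using r(3)[OF F(1)] by (simp add: \<Psi>_def)
    qed
    then show "\<exists>l\<in>I. \<exists>r::nat \<Rightarrow> nat. strict_mono r \<and> (v \<circ> r) \<longlonglongrightarrow> l"
      using r(1,2) by (intro bexI[of _ "\<Psi> \<nu>"] exI[of _ r]) (auto simp: I_def o_def)
  qed
  then have "compact I" by (simp add: compact_eq_seq_compact_metric)
  then have cI: "compactin (top_of_set I) I" by (simp add: compactin_subtopology)
  have "continuous_map (top_of_set I) (weak_topology Y) k"
  proof (rule continuous_map_weak_topology)
    show "k t \<in> probs Y" if "t \<in> topspace (top_of_set I)" for t using that kP by simp
    fix f :: "'a \<Rightarrow> real" assume "f \<in> Cb Y"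
    then have f: "continuous_on Y f" by (simp add: Cb_def)
    have "continuous_on I (\<lambda>v. LINT x:Y|k v. f x)"
      unfolding continuous_on_iff
    proof (intro ballI allI impI)
      fix v and e :: real assume v: "v \<in> I" and e: "0 < e"
      obtain i where i: "\<forall>y\<in>Y. \<bar>f y - F i y\<bar> < e / 3" using F(2)[OF f, of "e/3"] e by auto
      have "continuous_on I (\<lambda>v. v i)"
        using continuous_on_product_coordinates[of i] by (rule continuous_on_subset) simp
      moreover have "0 < e / 3" using e by simp
      ultimately obtain d where d: "d > 0" "\<And>v'. v' \<in> I \<Longrightarrow> dist v' v < d \<Longrightarrow> dist (v' i) (v i) < e / 3"
        using v unfolding continuous_on_iff by blast
      have "dist (LINT x:Y|k v'. f x) (LINT x:Y|k v. f x) < e" if "v' \<in> I" "dist v' v < d" for v'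
        using near[OF kP[OF v] f i] near[OF kP[OF that(1)] f i] d(2)[OF that] unfolding Pk[OF v] Pk[OF that(1)] dist_real_def by linarith
      with d(1) show "\<exists>d>0. \<forall>v'\<in>I. dist v' v < d \<longrightarrow> dist (LINT x:Y|k v'. f x) (LINT x:Y|k v. f x) < e" by blast
    qed
    then show "continuous_map (top_of_set I) euclideanreal (\<lambda>t. LINT x:Y|k t. f x)" by simp
  qed
  from image_compactin[OF cI this] show ?thesis by (simp add: kim)
qed simp

lemma compactin_probs_subset:
  fixes Y :: "'a::polish_space set"
  assumes "compact Y" "closed Z" "Y \<subseteq> Z"
  shows "compactin (weak_topology Z) (probs Y)"
  using image_compactin[OF compactin_probs[OF assms(1)] continuous_map_weak_topology_id[OF compact_imp_closed[OF assms(1)] assms(2,3)]]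
  by simp

text \<open>Being carried by \<open>Y\<close> is the vanishing of one bounded continuous functional.
  This makes P(\<open>Y\<close>) closed in P(\<open>Z\<close>), and the same functional later forces
  an infinite rate off P(\<open>Y\<close>).\<close>

lemma probs_iff_integral_zero:
  fixes Y :: "'a::metric_space set"
  assumes Y: "closed Y" "Y \<noteq> {}" and Z: "closed Z" "Y \<subseteq> Z" and s: "\<sigma> \<in> probs Z"
  shows "\<sigma> \<in> probs Y \<longleftrightarrow> (LINT x:Z|\<sigma>. min 1 (infdist x Y)) = 0"
proof
  have c: "continuous_on Z (\<lambda>x. min 1 (infdist x Y))" by (intro continuous_intros)
  {
    assume "\<sigma> \<in> probs Y"
    then have "(LINT x:Z|\<sigma>. min 1 (infdist x Y)) = (LINT x:Y|\<sigma>. min 1 (infdist x Y))"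
      by (rule set_integral_probs_subset[OF _ Y(1) Z c])
    also have "\<dots> = (LINT x:Y|\<sigma>. 0)" by (rule set_integral_probs_cong) auto
    finally show "(LINT x:Z|\<sigma>. min 1 (infdist x Y)) = 0" by (simp add: set_lebesgue_integral_def)
  }
  assume 0: "(LINT x:Z|\<sigma>. min 1 (infdist x Y)) = 0"
  interpret prob_space \<sigma> by (rule probs_prob[OF s])
  have "bounded ((\<lambda>x. min 1 (infdist x Y)) ` Z)"
    by (rule boundedI[where B=1]) (auto simp: infdist_nonneg)
  then have "AE x in \<sigma>. indicator Z x *\<^sub>R min 1 (infdist x Y) = 0"
    using 0 Cb_integrable[OF s c Z(1)] infdist_nonneg[of _ Y]
    unfolding set_lebesgue_integral_def set_integrable_def
    by (subst (asm) integral_nonneg_eq_0_iff_AE) auto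
  then have "AE x in \<sigma>. x \<in> Y" using probs_AE[OF s Z(1)]
  proof eventually_elim
    case (elim x)
    then have "infdist x Y = 0" by (auto simp: min_def split: if_splits)
    then show ?case using in_closed_iff_infdist_zero Y by blast
  qed
  then have "measure \<sigma> Y = 1" using Y(1) probs_sets[OF s] prob_eq_1[of Y] by auto
  then show "\<sigma> \<in> probs Y" using s by (auto simp: probs_def)
qed

lemma closedin_probs:
  fixes Y :: "'a::metric_space set"
  assumes "closed Y" "Y \<noteq> {}" "closed Z" "Y \<subseteq> Z"
  shows "closedin (weak_topology Z) (probs Y)"
proof -
  have "(\<lambda>x. min 1 (infdist x Y)) \<in> Cb Z"
    by (auto simp: Cb_def infdist_nonneg intro!: continuous_intros boundedI[where B=1])
  then have "openin (weak_topology Z) {\<sigma> \<in> probs Z. (LINT x:Z|\<sigma>. min 1 (infdist x Y)) \<in> - {0}}"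
    by (rule openin_weak_topology_basis) auto
  moreover have "probs Z - probs Y = {\<sigma> \<in> probs Z. (LINT x:Z|\<sigma>. min 1 (infdist x Y)) \<in> - {0}}"
    using probs_iff_integral_zero[OF assms] by auto
  ultimately show ?thesis using probs_mono[OF assms(1,3,4)] by (simp add: closedin_def)
qed

section \<open>Feynman--Kac operators\<close>

text \<open>The weight sits at the new point \<open>S x e\<close>, not at \<open>x\<close>: the
  exponents in the pressure run over x_1, ..., x_n, so the \<open>n\<close>-th iterate applied to 1
  is exactly the expectation occurring there.\<close>

definition TV :: "'e measure \<Rightarrow> ('a \<Rightarrow> 'e \<Rightarrow> 'a) \<Rightarrow> ('a \<Rightarrow> real) \<Rightarrow> ('a \<Rightarrow> real) \<Rightarrow> 'a \<Rightarrow> real" where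
  "TV \<nu> S V f x = (\<integral>e. exp (V (S x e)) * f (S x e) \<partial>\<nu>)"

section \<open>The noise on sequence space\<close>

locale rds = prob_space M for M :: "'w measure" +
  fixes \<xi> :: "nat \<Rightarrow> 'w \<Rightarrow> 'e::compact_metric_space" and S :: "'a::polish_space \<Rightarrow> 'e \<Rightarrow> 'a"
  assumes indep: "indep_vars (\<lambda>_. borel) \<xi> UNIV"
    and ident: "\<forall>n. distr M borel (\<xi> n) = distr M borel (\<xi> 0)"
    and contS: "continuous_on UNIV (\<lambda>(x, \<zeta>). S x \<zeta>)"
begin

definition noise :: "'e measure" where "noise = distr M borel (\<xi> 0)"

abbreviation "T \<equiv> TV noise S"

lemma xi_measurable [measurable]: "\<xi> n \<in> measurable M borel"
  using indep unfolding indep_vars_def2 by auto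

lemma prob_noise: "prob_space noise"
  unfolding noise_def by (rule prob_space_distr) simp

lemma sets_noise [simp, measurable_cong]: "sets noise = sets borel"
  by (simp add: noise_def)

lemma space_noise [simp]: "space noise = UNIV"
  by (simp add: noise_def)

sublocale nz: prob_space noise by (rule prob_noise)
sublocale sq: sequence_space noise by unfold_locales

lemma measure_noise_UNIV [simp]: "measure noise UNIV = 1"
  using nz.prob_space by simp

abbreviation "PS \<equiv> Pi\<^sub>M (UNIV :: nat set) (\<lambda>_. noise)"

lemma sets_PS: "sets PS = sets (borel :: (nat \<Rightarrow> 'e) measure)"
proof -
  have "sets PS = sets (Pi\<^sub>M (UNIV :: nat set) (\<lambda>_. borel :: 'e measure))"
    by (rule sets_PiM_cong) auto
  then show ?thesis by (simp add: sets_PiM_equal_borel)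
qed

lemma space_PS [simp]: "space PS = UNIV"
  using sets_eq_imp_space_eq[OF sets_PS] by simp

lemma measure_PS_UNIV [simp]: "measure PS UNIV = 1"
  using prob_space.prob_space[OF prob_space_PiM[of "UNIV :: nat set" "\<lambda>_. noise"]] prob_noise by simp

lemma xi_seq_measurable: "(\<lambda>\<omega> k. \<xi> k \<omega>) \<in> measurable M PS"
  by (rule measurable_PiM_single') (auto simp: space_PiM)

text \<open>Independence together with equal marginals says that the whole noise sequence has the
  product law, so every probability about orbits can be computed on sequence space.\<close>

lemma distr_xi: "distr M PS (\<lambda>\<omega> k. \<xi> k \<omega>) = PS"
proof -
  have "distr M (\<Pi>\<^sub>M i\<in>UNIV. borel) (\<lambda>x. \<lambda>i\<in>UNIV. \<xi> i x) = (\<Pi>\<^sub>M i\<in>UNIV. distr M borel (\<xi> i))"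
    using indep_vars_iff_distr_eq_PiM[where I=UNIV and M'="\<lambda>_. borel" and X=\<xi>] indep by auto
  also have "\<dots> = PS" unfolding noise_def using ident by (intro PiM_cong) auto
  finally have "distr M (\<Pi>\<^sub>M i\<in>UNIV. borel) (\<lambda>x i. \<xi> i x) = PS" by (simp add: restrict_def)
  moreover have "distr M (\<Pi>\<^sub>M i\<in>UNIV. borel) (\<lambda>x i. \<xi> i x) = distr M PS (\<lambda>x i. \<xi> i x)"
    by (rule distr_cong) (auto intro!: sets_PiM_cong)
  ultimately show ?thesis by simp
qed

lemma expectation_PS:
  fixes F :: "(nat \<Rightarrow> 'e) \<Rightarrow> real"
  assumes "F \<in> borel_measurable PS"
  shows "(\<integral>\<omega>. F (\<lambda>k. \<xi> k \<omega>) \<partial>M) = (\<integral>\<zeta>. F \<zeta> \<partial>PS)"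
  using integral_distr[OF xi_seq_measurable assms] by (simp add: distr_xi)

lemma continuous_orbit: "continuous_on UNIV (\<lambda>p. orbit S (fst p) (snd p) n)"
proof (induction n)
  case 0
  show ?case by (simp add: continuous_on_fst)
next
  case (Suc n)
  have c: "continuous_on UNIV (\<lambda>p::'a \<times> (nat \<Rightarrow> 'e). snd p n)"
    by (rule continuous_on_product_then_coordinatewise) (intro continuous_intros)
  have "continuous_on UNIV ((\<lambda>(x, \<zeta>). S x \<zeta>) \<circ> (\<lambda>p. (orbit S (fst p) (snd p) n, snd p n)))"
    by (intro continuous_on_compose continuous_on_Pair Suc.IH c continuous_on_subset[OF contS]) auto
  then show ?case by (simp add: o_def)
qed

lemma continuous_orbit_noise: "continuous_on UNIV (\<lambda>\<zeta>. orbit S x \<zeta> n)"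
proof -
  have "continuous_on UNIV ((\<lambda>p. orbit S (fst p) (snd p) n) \<circ> (\<lambda>\<zeta>. (x, \<zeta>)))"
    by (intro continuous_on_compose continuous_intros continuous_on_subset[OF continuous_orbit]) auto
  then show ?thesis by (simp add: o_def)
qed

lemma continuous_orbit_state: "continuous_on UNIV (\<lambda>x. orbit S x \<zeta> n)"
proof -
  have "continuous_on UNIV ((\<lambda>p. orbit S (fst p) (snd p) n) \<circ> (\<lambda>x. (x, \<zeta>)))"
    by (intro continuous_on_compose continuous_intros continuous_on_subset[OF continuous_orbit]) auto
  then show ?thesis by (simp add: o_def)
qed

lemma continuous_S_noise: "continuous_on UNIV (S x)"
proof -
  have "continuous_on UNIV ((\<lambda>(x, \<zeta>). S x \<zeta>) \<circ> (\<lambda>\<zeta>. (x, \<zeta>)))"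
    by (intro continuous_on_compose continuous_intros continuous_on_subset[OF contS]) auto
  then show ?thesis by (simp add: o_def)
qed

lemma continuous_S_state: "continuous_on UNIV (\<lambda>x. S x \<zeta>)"
proof -
  have "continuous_on UNIV ((\<lambda>(x, \<zeta>). S x \<zeta>) \<circ> (\<lambda>x. (x, \<zeta>)))"
    by (intro continuous_on_compose continuous_intros continuous_on_subset[OF contS]) auto
  then show ?thesis by (simp add: o_def)
qed

lemma continuous_measurable_PS: "continuous_on UNIV F \<Longrightarrow> (F :: _ \<Rightarrow> real) \<in> borel_measurable PS"
  using borel_measurable_continuous_onI[of F] measurable_cong_sets[OF sets_PS refl, of borel] by blast

lemma continuous_measurable_noise: "continuous_on UNIV F \<Longrightarrow> (F :: _ \<Rightarrow> real) \<in> borel_measurable noise"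
  using borel_measurable_continuous_onI[of F] measurable_cong_sets[OF sets_noise refl, of borel] by simp

lemma orbit_case_nat: "orbit S x (case_nat e \<zeta>) (Suc n) = orbit S (S x e) \<zeta> n"
  by (induction n) auto

lemma orbit_invariant: "invariant S Z \<Longrightarrow> x \<in> Z \<Longrightarrow> orbit S x \<zeta> n \<in> Z"
  by (induction n) (auto simp: invariant_def)

lemma continuous_along_orbit:
  assumes "continuous_on Z f" "invariant S Z" "x \<in> Z"
  shows "continuous_on UNIV (\<lambda>\<zeta>. f (orbit S x \<zeta> n))"
  by (rule continuous_on_compose2[OF assms(1) continuous_orbit_noise])
     (use assms orbit_invariant in auto)

lemma continuous_along_step:
  assumes "continuous_on Z f" "invariant S Z" "x \<in> Z"
  shows "continuous_on UNIV (\<lambda>e. f (S x e))"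
  by (rule continuous_on_compose2[OF assms(1) continuous_S_noise])
     (use assms in \<open>auto simp: invariant_def\<close>)

text \<open>Fubini after splitting off the first noise variable: prepending an independent copy
  leaves the product measure unchanged. Combined with \<open>orbit_case_nat\<close> this is the
  Markov property at time 1.\<close>

lemma PS_iter:
  fixes F :: "(nat \<Rightarrow> 'e) \<Rightarrow> real"
  assumes F: "F \<in> borel_measurable PS" and B: "\<And>\<zeta>. \<bar>F \<zeta>\<bar> \<le> B"
  shows "(\<integral>\<zeta>. F \<zeta> \<partial>PS) = (\<integral>e. (\<integral>\<zeta>. F (case_nat e \<zeta>) \<partial>PS) \<partial>noise)"
proof -
  interpret pp: pair_prob_space noise PS by unfold_locales
  have cm: "(\<lambda>(s, \<omega>). case_nat s \<omega>) \<in> measurable (noise \<Otimes>\<^sub>M PS) PS"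
    by measurable
  have Fm: "(\<lambda>p. F (case_nat (fst p) (snd p))) \<in> borel_measurable (noise \<Otimes>\<^sub>M PS)"
    using measurable_compose[OF cm F] by (simp add: split_def)
  have int: "integrable (noise \<Otimes>\<^sub>M PS) (\<lambda>p. F (case_nat (fst p) (snd p)))"
    by (rule pp.integrable_const_bound[where B=B]) (use B Fm in auto)
  have "(\<integral>\<zeta>. F \<zeta> \<partial>PS) = (\<integral>\<zeta>. F \<zeta> \<partial>distr (noise \<Otimes>\<^sub>M PS) PS (\<lambda>(s, \<omega>). case_nat s \<omega>))"
    by (simp add: sq.PiM_iter)
  also have "\<dots> = (\<integral>p. F (case_nat (fst p) (snd p)) \<partial>(noise \<Otimes>\<^sub>M PS))"
    by (subst integral_distr[OF cm F]) (simp add: split_def)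
  also have "\<dots> = (\<integral>e. (\<integral>\<zeta>. F (case_nat e \<zeta>) \<partial>PS) \<partial>noise)"
    using pp.integral_fst'[OF int] by simp
  finally show ?thesis .
qed

end

section \<open>Operators on a closed invariant set\<close>

locale rds_on = rds M \<xi> S for M :: "'w measure" and \<xi> :: "nat \<Rightarrow> 'w \<Rightarrow> 'e::compact_metric_space"
    and S :: "'a::polish_space \<Rightarrow> 'e \<Rightarrow> 'a" +
  fixes Z :: "'a set"
  assumes closedZ: "closed Z" and invZ: "invariant S Z" and Zne: "Z \<noteq> {}"
begin

lemma SZ: "x \<in> Z \<Longrightarrow> S x e \<in> Z" using invZ by (auto simp: invariant_def)
lemma OZ: "x \<in> Z \<Longrightarrow> orbit S x \<zeta> n \<in> Z" using orbit_invariant[OF invZ] .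

lemma CbE:
  assumes "f \<in> Cb Z"
  obtains B where "0 \<le> B" "\<And>x. x \<in> Z \<Longrightarrow> \<bar>f x\<bar> \<le> B"
proof -
  obtain B where B: "\<And>x. x \<in> Z \<Longrightarrow> norm (f x) \<le> B" using assms by (auto simp: Cb_def bounded_iff)
  then have "0 \<le> B" using Zne norm_ge_zero by (metis all_not_in_conv order_trans)
  with B show ?thesis using that by simp
qed

lemma CbI: "continuous_on Z f \<Longrightarrow> (\<And>x. x \<in> Z \<Longrightarrow> \<bar>f x\<bar> \<le> B) \<Longrightarrow> f \<in> Cb Z"
  by (auto simp: Cb_def bounded_iff)

lemma Cb_const: "(\<lambda>_. c) \<in> Cb Z" by (rule CbI[where B="\<bar>c\<bar>"]) auto

lemma Cb_cont: "f \<in> Cb Z \<Longrightarrow> continuous_on Z f" by (simp add: Cb_def)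

lemma Cb_add: assumes "f \<in> Cb Z" "g \<in> Cb Z" shows "(\<lambda>x. f x + g x) \<in> Cb Z"
proof -
  obtain A where A: "0 \<le> A" "\<And>x. x \<in> Z \<Longrightarrow> \<bar>f x\<bar> \<le> A" using CbE[OF assms(1)] by metis
  obtain B where B: "0 \<le> B" "\<And>x. x \<in> Z \<Longrightarrow> \<bar>g x\<bar> \<le> B" using CbE[OF assms(2)] by metis
  show ?thesis
    by (rule CbI[where B="A+B"]) (use A B assms[THEN Cb_cont] in \<open>auto intro!: continuous_intros intro: order_trans[OF abs_triangle_ineq] add_mono\<close>)
qed

lemma Cb_mult: assumes "f \<in> Cb Z" "g \<in> Cb Z" shows "(\<lambda>x. f x * g x) \<in> Cb Z"
proof -
  obtain A where A: "0 \<le> A" "\<And>x. x \<in> Z \<Longrightarrow> \<bar>f x\<bar> \<le> A" using CbE[OF assms(1)] by metis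
  obtain B where B: "0 \<le> B" "\<And>x. x \<in> Z \<Longrightarrow> \<bar>g x\<bar> \<le> B" using CbE[OF assms(2)] by metis
  show ?thesis
    by (rule CbI[where B="A*B"]) (use A B assms[THEN Cb_cont] in \<open>auto intro!: continuous_intros mult_mono simp: abs_mult\<close>)
qed

lemma Cb_exp: assumes "f \<in> Cb Z" shows "(\<lambda>x. exp (f x)) \<in> Cb Z"
proof -
  obtain A where A: "0 \<le> A" "\<And>x. x \<in> Z \<Longrightarrow> \<bar>f x\<bar> \<le> A" using CbE[OF assms(1)] by metis
  show ?thesis
    by (rule CbI[where B="exp A"]) (use A assms[THEN Cb_cont] in \<open>auto intro!: continuous_intros simp: abs_le_iff\<close>)
qed

lemma Cb_sum: "(\<And>i. i \<in> A \<Longrightarrow> f i \<in> Cb Z) \<Longrightarrow> (\<lambda>x. \<Sum>i\<in>A. f i x) \<in> Cb Z"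
proof (induction A rule: infinite_finite_induct)
  case (insert x F)
  then show ?case using Cb_add[of "f x" "\<lambda>y. \<Sum>i\<in>F. f i y"] by simp
qed (auto simp: Cb_const)

lemma Cb_cmult: "f \<in> Cb Z \<Longrightarrow> (\<lambda>x. c * f x) \<in> Cb Z"
  using Cb_mult[OF Cb_const] by blast

lemma Cb_diff: "f \<in> Cb Z \<Longrightarrow> g \<in> Cb Z \<Longrightarrow> (\<lambda>x. f x - g x) \<in> Cb Z"
  using Cb_add[of f "\<lambda>x. (-1) * g x"] Cb_cmult[of g "-1"] by simp

lemma Cb_zero: "(\<lambda>_. 0) \<in> Cb Z" and Cb_one: "(\<lambda>_. 1) \<in> Cb Z" by (rule Cb_const)+

lemma step_integrable:
  assumes "f \<in> Cb Z" "x \<in> Z"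
  shows "integrable noise (\<lambda>e. f (S x e))"
proof -
  obtain B where B: "\<And>x. x \<in> Z \<Longrightarrow> \<bar>f x\<bar> \<le> B" using CbE[OF assms(1)] by metis
  show ?thesis
    by (rule nz.integrable_const_bound[where B=B])
       (use B SZ assms continuous_measurable_noise[OF continuous_along_step[OF Cb_cont[OF assms(1)] invZ assms(2)]] in auto)
qed

lemma step_integrable2:
  "V \<in> Cb Z \<Longrightarrow> f \<in> Cb Z \<Longrightarrow> x \<in> Z \<Longrightarrow> integrable noise (\<lambda>e. exp (V (S x e)) * f (S x e))"
  using step_integrable[OF Cb_mult[OF Cb_exp]] by blast

lemma orbit_integrable:
  assumes "f \<in> Cb Z" "x \<in> Z"
  shows "integrable PS (\<lambda>\<zeta>. f (orbit S x \<zeta> n))"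
proof -
  obtain B where B: "\<And>x. x \<in> Z \<Longrightarrow> \<bar>f x\<bar> \<le> B" using CbE[OF assms(1)] by metis
  show ?thesis
    by (rule sq.integrable_const_bound[where B=B])
       (use B OZ assms continuous_measurable_PS[OF continuous_along_orbit[OF Cb_cont[OF assms(1)] invZ assms(2)]] in auto)
qed

text \<open>Feller property, by dominated convergence along sequences.\<close>

lemma T_Cb:
  assumes V: "V \<in> Cb Z" and f: "f \<in> Cb Z"
  shows "T V f \<in> Cb Z"
proof -
  define F where "F x = exp (V x) * f x" for x
  have F: "F \<in> Cb Z" unfolding F_def by (rule Cb_mult[OF Cb_exp[OF V] f])
  obtain B where B: "0 \<le> B" "\<And>x. x \<in> Z \<Longrightarrow> \<bar>F x\<bar> \<le> B" using CbE[OF F] by metis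
  have TF: "T V f = (\<lambda>x. \<integral>e. F (S x e) \<partial>noise)" by (auto simp: TV_def F_def)
  show ?thesis
  proof (rule CbI[where B=B])
    show "continuous_on Z (T V f)"
      unfolding continuous_on_sequentially TF
    proof (intro allI ballI impI, elim conjE)
      fix x a assume a: "a \<in> Z" "\<forall>n. x n \<in> Z" "x \<longlonglongrightarrow> a"
      have "(\<lambda>n. \<integral>e. F (S (x n) e) \<partial>noise) \<longlonglongrightarrow> (\<integral>e. F (S a e) \<partial>noise)"
      proof (rule integral_dominated_convergence[where w="\<lambda>_. B"])
        show "(\<lambda>e. F (S a e)) \<in> borel_measurable noise" "(\<lambda>e. F (S (x n) e)) \<in> borel_measurable noise" for n
          using a continuous_measurable_noise[OF continuous_along_step[OF Cb_cont[OF F] invZ]] by auto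
        show "AE e in noise. (\<lambda>n. F (S (x n) e)) \<longlonglongrightarrow> F (S a e)"
        proof (rule AE_I2)
          fix e
          have "(\<lambda>n. S (x n) e) \<longlonglongrightarrow> S a e"
            using continuous_S_state[of e] a(3) by (auto simp: continuous_on_eq_continuous_at isCont_def intro: isCont_tendsto_compose[of a "\<lambda>x. S x e"])
          then show "(\<lambda>n. F (S (x n) e)) \<longlonglongrightarrow> F (S a e)"
            using Cb_cont[OF F] SZ a unfolding continuous_on_sequentially o_def by auto
        qed
      qed (use B SZ a in auto)
      then show "((\<lambda>x. \<integral>e. F (S x e) \<partial>noise) \<circ> x) \<longlonglongrightarrow> (\<integral>e. F (S a e) \<partial>noise)" by (simp add: o_def)
    qed
    fix x assume x: "x \<in> Z"
    have "\<bar>\<integral>e. F (S x e) \<partial>noise\<bar> \<le> (\<integral>e. \<bar>F (S x e)\<bar> \<partial>noise)" by (rule integral_abs_bound)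
    also have "\<dots> \<le> (\<integral>e. B \<partial>noise)"
      by (rule integral_mono) (use x step_integrable[OF F x] B SZ in auto)
    finally show "\<bar>T V f x\<bar> \<le> B" by (simp add: TF nz.prob_space)
  qed
qed

lemma Tn_Cb: "V \<in> Cb Z \<Longrightarrow> f \<in> Cb Z \<Longrightarrow> (T V ^^ n) f \<in> Cb Z"
  by (induction n) (auto simp: T_Cb)

lemma T_mono:
  assumes "V \<in> Cb Z" "f \<in> Cb Z" "g \<in> Cb Z" "\<And>y. y \<in> Z \<Longrightarrow> f y \<le> g y" "x \<in> Z"
  shows "T V f x \<le> T V g x"
  unfolding TV_def using step_integrable2 assms SZ
  by (intro integral_mono) (auto intro!: mult_left_mono)

lemma T_cong:
  assumes "\<And>y. y \<in> Z \<Longrightarrow> f y = g y" "x \<in> Z"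
  shows "T V f x = T V g x"
  unfolding TV_def using assms SZ by simp

lemma Tn_cong:
  assumes "\<And>y. y \<in> Z \<Longrightarrow> f y = g y" "x \<in> Z"
  shows "(T V ^^ n) f x = (T V ^^ n) g x"
  using assms(2)
  by (induction n arbitrary: x) (auto simp: assms(1) intro: T_cong)

lemma T_congV:
  assumes "\<And>y. y \<in> Z \<Longrightarrow> V y = W y" "\<And>y. y \<in> Z \<Longrightarrow> f y = g y" "x \<in> Z"
  shows "T V f x = T W g x"
  unfolding TV_def using assms SZ by simp

text \<open>Potentials are total functions of which only the values on the invariant set count; on
  \<open>Y\<close> this makes everything built from \<open>lam\<close> insensitive to how a
  potential is extended.\<close>

lemma Tn_congV:
  assumes "\<And>y. y \<in> Z \<Longrightarrow> V y = W y" "x \<in> Z"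
  shows "(T V ^^ n) f x = (T W ^^ n) f x"
  using assms(2)
  by (induction n arbitrary: x) (auto intro: T_congV assms(1))

lemma Tn_mono:
  assumes "V \<in> Cb Z" "f \<in> Cb Z" "g \<in> Cb Z" "\<And>y. y \<in> Z \<Longrightarrow> f y \<le> g y" "x \<in> Z"
  shows "(T V ^^ n) f x \<le> (T V ^^ n) g x"
  using assms(5)
proof (induction n arbitrary: x)
  case (Suc n)
  then show ?case using T_mono[OF assms(1) Tn_Cb[OF assms(1,2)] Tn_Cb[OF assms(1,3)]] by simp
qed (use assms in simp)

lemma T_cmult: "T V (\<lambda>x. c * f x) x = c * T V f x"
  by (simp add: TV_def mult.left_commute)

lemma T_add:
  "V \<in> Cb Z \<Longrightarrow> f \<in> Cb Z \<Longrightarrow> g \<in> Cb Z \<Longrightarrow> x \<in> Z \<Longrightarrow> T V (\<lambda>x. f x + g x) x = T V f x + T V g x"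
  using step_integrable2 by (simp add: TV_def distrib_left)

lemma T_sum:
  assumes "V \<in> Cb Z" "\<And>i. i \<in> A \<Longrightarrow> f i \<in> Cb Z" "x \<in> Z"
  shows "T V (\<lambda>x. \<Sum>i\<in>A. f i x) x = (\<Sum>i\<in>A. T V (f i) x)"
  using assms(2)
proof (induction A rule: infinite_finite_induct)
  case (insert a F)
  then show ?case using T_add[OF assms(1) _ Cb_sum assms(3), of "f a" F f] by simp
qed (auto simp: TV_def)

lemma Tn_cmult: "x \<in> Z \<Longrightarrow> (T V ^^ n) (\<lambda>x. c * f x) x = c * (T V ^^ n) f x"
proof (induction n arbitrary: x)
  case (Suc n)
  have "T V ((T V ^^ n) (\<lambda>x. c * f x)) x = T V (\<lambda>x. c * (T V ^^ n) f x) x"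
    by (rule T_cong) (use Suc in auto)
  then show ?case by (simp add: T_cmult)
qed simp

lemma Tn_add:
  assumes "V \<in> Cb Z" "f \<in> Cb Z" "g \<in> Cb Z" "x \<in> Z"
  shows "(T V ^^ n) (\<lambda>x. f x + g x) x = (T V ^^ n) f x + (T V ^^ n) g x"
  using assms(4)
proof (induction n arbitrary: x)
  case (Suc n)
  have "T V ((T V ^^ n) (\<lambda>x. f x + g x)) x = T V (\<lambda>x. (T V ^^ n) f x + (T V ^^ n) g x) x"
    by (rule T_cong) (use Suc in auto)
  then show ?case using T_add[OF assms(1) Tn_Cb[OF assms(1,2)] Tn_Cb[OF assms(1,3)] Suc.prems] by simp
qed simp

lemma Tn_diff:
  assumes "V \<in> Cb Z" "f \<in> Cb Z" "g \<in> Cb Z" "x \<in> Z"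
  shows "(T V ^^ n) (\<lambda>x. f x - g x) x = (T V ^^ n) f x - (T V ^^ n) g x"
  using Tn_add[OF assms(1,2) Cb_cmult[OF assms(3), of "-1"] assms(4), of n] Tn_cmult[OF assms(4), of n V "-1" g]
  by simp

text \<open>Feynman--Kac formula, by conditioning on the first step: \<open>PS_iter\<close> isolates
  the first noise variable, and the orbit restarted at \<open>S x e\<close> falls under the
  induction hypothesis.\<close>

lemma Tn_expectation:
  assumes V: "V \<in> Cb Z" and f: "f \<in> Cb Z" and x: "x \<in> Z"
  shows "(T V ^^ n) f x = (\<integral>\<zeta>. exp (\<Sum>k=1..n. V (orbit S x \<zeta> k)) * f (orbit S x \<zeta> n) \<partial>PS)"
  using x
proof (induction n arbitrary: x)
  case 0
  show ?case using sq.prob_space by simp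
next
  case (Suc n)
  define F where "F \<zeta> = exp (\<Sum>k=1..Suc n. V (orbit S x \<zeta> k)) * f (orbit S x \<zeta> (Suc n))" for \<zeta>
  obtain A where A: "0 \<le> A" "\<And>x. x \<in> Z \<Longrightarrow> \<bar>V x\<bar> \<le> A" using CbE[OF V] by metis
  obtain B where B: "0 \<le> B" "\<And>x. x \<in> Z \<Longrightarrow> \<bar>f x\<bar> \<le> B" using CbE[OF f] by metis
  have Fc: "continuous_on UNIV F" unfolding F_def
    by (intro continuous_intros continuous_along_orbit[OF Cb_cont[OF V] invZ Suc.prems] continuous_along_orbit[OF Cb_cont[OF f] invZ Suc.prems])
  have Fb: "\<bar>F \<zeta>\<bar> \<le> exp (Suc n * A) * B" for \<zeta>
  proof -
    have "(\<Sum>k=1..Suc n. V (orbit S x \<zeta> k)) \<le> (\<Sum>k=1..Suc n. A)"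
      by (rule sum_mono) (use A(2)[OF OZ[OF Suc.prems]] in \<open>auto simp: abs_le_iff\<close>)
    then show ?thesis unfolding F_def abs_mult using B(2)[OF OZ[OF Suc.prems], of \<zeta> "Suc n"]
      by (intro mult_mono) auto
  qed
  have "(\<integral>\<zeta>. F \<zeta> \<partial>PS) = (\<integral>e. (\<integral>\<zeta>. F (case_nat e \<zeta>) \<partial>PS) \<partial>noise)"
    by (rule PS_iter[OF continuous_measurable_PS[OF Fc] Fb])
  also have "\<dots> = (\<integral>e. exp (V (S x e)) * (T V ^^ n) f (S x e) \<partial>noise)"
  proof (rule Bochner_Integration.integral_cong[OF refl])
    fix e
    have "F (case_nat e \<zeta>) = exp (V (S x e)) * (exp (\<Sum>k=1..n. V (orbit S (S x e) \<zeta> k)) * f (orbit S (S x e) \<zeta> n))" for \<zeta>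
    proof -
      have "(\<Sum>k=1..Suc n. V (orbit S x (case_nat e \<zeta>) k)) = (\<Sum>k=0..n. V (orbit S x (case_nat e \<zeta>) (Suc k)))"
        by (simp only: One_nat_def sum.shift_bounds_cl_Suc_ivl)
      also have "\<dots> = (\<Sum>k=0..n. V (orbit S (S x e) \<zeta> k))" by (simp only: orbit_case_nat)
      also have "\<dots> = V (S x e) + (\<Sum>k=1..n. V (orbit S (S x e) \<zeta> k))"
        by (simp add: sum.atLeast_Suc_atMost)
      finally show ?thesis unfolding F_def orbit_case_nat by (simp add: exp_add)
    qed
    then show "(\<integral>\<zeta>. F (case_nat e \<zeta>) \<partial>PS) = exp (V (S x e)) * (T V ^^ n) f (S x e)"
      by (simp add: Suc.IH[OF SZ[OF Suc.prems]])
  qed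
  finally show ?case by (simp add: F_def TV_def[of _ _ _ _ x])
qed

lemma FK_integrable:
  assumes V: "V \<in> Cb Z" and f: "f \<in> Cb Z" and x: "x \<in> Z"
  shows "integrable PS (\<lambda>\<zeta>. exp (\<Sum>k=1..n. V (orbit S x \<zeta> k)) * f (orbit S x \<zeta> n))"
proof -
  obtain A where A: "0 \<le> A" "\<And>x. x \<in> Z \<Longrightarrow> \<bar>V x\<bar> \<le> A" using CbE[OF V] by metis
  obtain B where B: "0 \<le> B" "\<And>x. x \<in> Z \<Longrightarrow> \<bar>f x\<bar> \<le> B" using CbE[OF f] by metis
  have c: "continuous_on UNIV (\<lambda>\<zeta>. exp (\<Sum>k=1..n. V (orbit S x \<zeta> k)) * f (orbit S x \<zeta> n))"
    by (intro continuous_intros continuous_along_orbit[OF Cb_cont[OF V] invZ x] continuous_along_orbit[OF Cb_cont[OF f] invZ x])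
  have "\<bar>exp (\<Sum>k=1..n. V (orbit S x \<zeta> k)) * f (orbit S x \<zeta> n)\<bar> \<le> exp (n * A) * B" for \<zeta>
  proof -
    have "(\<Sum>k=1..n. V (orbit S x \<zeta> k)) \<le> (\<Sum>k=1..n. A)"
      by (rule sum_mono) (use A(2)[OF OZ[OF x]] in \<open>auto simp: abs_le_iff\<close>)
    then show ?thesis unfolding abs_mult using B(2)[OF OZ[OF x], of \<zeta> n] by (intro mult_mono) auto
  qed
  then show ?thesis
    by (intro sq.integrable_const_bound[where B="exp (n * A) * B"] continuous_measurable_PS[OF c]) auto
qed

text \<open>The expectation evaluates \<open>f\<close> and \<open>g\<close> only at endpoints
  reached at time \<open>n\<close>, so the comparison is needed only there. With uniform attraction
  this turns inequalities near \<open>Y\<close> into inequalities for all starting points.\<close>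

lemma Tn_mono_orbit:
  assumes V: "V \<in> Cb Z" and f: "f \<in> Cb Z" and g: "g \<in> Cb Z" and x: "x \<in> Z"
    and le: "\<And>\<zeta>. f (orbit S x \<zeta> n) \<le> g (orbit S x \<zeta> n)"
  shows "(T V ^^ n) f x \<le> (T V ^^ n) g x"
  unfolding Tn_expectation[OF V f x] Tn_expectation[OF V g x]
  using FK_integrable[OF V f x] FK_integrable[OF V g x] le by (intro integral_mono) (auto intro!: mult_left_mono)

lemma log_mgf_eq:
  assumes V: "V \<in> Cb Z" and x: "x \<in> Z"
  shows "log_mgf M \<xi> S V n x = 1 / real n * ln ((T V ^^ n) (\<lambda>_. 1) x)"
proof -
  have c: "continuous_on UNIV (\<lambda>\<zeta>. exp (\<Sum>k=1..n. V (orbit S x \<zeta> k)))"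
    by (intro continuous_intros continuous_along_orbit[OF Cb_cont[OF V] invZ x])
  have "(\<integral>\<omega>. exp (\<Sum>k=1..n. V (orbit S x (\<lambda>k. \<xi> k \<omega>) k)) \<partial>M) = (\<integral>\<zeta>. exp (\<Sum>k=1..n. V (orbit S x \<zeta> k)) \<partial>PS)"
    using expectation_PS[OF continuous_measurable_PS[OF c]] .
  then show ?thesis unfolding log_mgf_def Tn_expectation[OF V Cb_one x] by simp
qed

lemma Tn_bounds:
  assumes V: "V \<in> Cb Z" and B: "\<And>y. y \<in> Z \<Longrightarrow> \<bar>V y\<bar> \<le> B" and x: "x \<in> Z"
  shows "exp (- B * n) \<le> (T V ^^ n) (\<lambda>_. 1) x \<and> (T V ^^ n) (\<lambda>_. 1) x \<le> exp (B * n)"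
  using x
proof (induction n arbitrary: x)
  case (Suc n)
  have c: "(T V ^^ n) (\<lambda>_. 1) \<in> Cb Z" by (rule Tn_Cb[OF V Cb_one])
  have b: "- B \<le> V (S x e)" "V (S x e) \<le> B" for e using B[OF SZ[OF Suc.prems, of e]] by (auto simp: abs_le_iff)
  note bn = Suc.IH[OF SZ[OF Suc.prems]] and i = step_integrable2[OF V c Suc.prems]
  have p: "0 \<le> (T V ^^ n) (\<lambda>_. 1) (S x e)" for e using bn[of e] exp_ge_zero order_trans by blast
  have "exp (- B) * exp (- B * n) \<le> exp (V (S x e)) * (T V ^^ n) (\<lambda>_. 1) (S x e)" for e
    using bn[of e] b[of e] by (intro mult_mono) auto
  then have "(\<integral>e. exp (- B) * exp (- B * n) \<partial>noise) \<le> T V ((T V ^^ n) (\<lambda>_. 1)) x"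
    unfolding TV_def[of _ _ _ _ x] using i by (intro integral_mono) auto
  moreover have "exp (V (S x e)) * (T V ^^ n) (\<lambda>_. 1) (S x e) \<le> exp B * exp (B * n)" for e
    using bn[of e] b[of e] p[of e] by (intro mult_mono) auto
  then have "T V ((T V ^^ n) (\<lambda>_. 1)) x \<le> (\<integral>e. exp B * exp (B * n) \<partial>noise)"
    unfolding TV_def[of _ _ _ _ x] using i by (intro integral_mono) auto
  ultimately show ?case by (simp add: nz.prob_space exp_add[symmetric] algebra_simps)
qed simp

lemma Tn_pos: "V \<in> Cb Z \<Longrightarrow> x \<in> Z \<Longrightarrow> 0 < (T V ^^ n) (\<lambda>_. 1) x"
  using Tn_bounds CbE by (metis exp_gt_zero less_le_trans)

lemma markov_op_eq:
  assumes f: "continuous_on Z f" and x: "x \<in> Z"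
  shows "markov_op M \<xi> S Z f x = T (\<lambda>_. 0) f x"
proof -
  have m: "(\<lambda>\<omega>. orbit S x (\<lambda>k. \<xi> k \<omega>) 1) = (\<lambda>\<omega>. S x (\<xi> 0 \<omega>))" by simp
  have Sm: "S x \<in> measurable borel borel" by (rule borel_measurable_continuous_onI[OF continuous_S_noise])
  have Sxm: "(\<lambda>\<omega>. S x (\<xi> 0 \<omega>)) \<in> measurable M borel" using measurable_compose[OF xi_measurable Sm] .
  have "markov_op M \<xi> S Z f x = (\<integral>\<omega>. indicator Z (S x (\<xi> 0 \<omega>)) *\<^sub>R f (S x (\<xi> 0 \<omega>)) \<partial>M)"
    unfolding markov_op_def transition_def set_lebesgue_integral_def m
    by (rule integral_distr[OF Sxm Cb_measurable[OF f closedZ]])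
  also have "\<dots> = (\<integral>\<omega>. f (S x (\<xi> 0 \<omega>)) \<partial>M)" using SZ[OF x] by simp
  also have "\<dots> = (\<integral>e. f (S x e) \<partial>noise)"
    unfolding noise_def
    by (rule integral_distr[symmetric, OF xi_measurable borel_measurable_continuous_onI[OF continuous_along_step[OF f invZ x]]])
  finally show ?thesis by (simp add: TV_def)
qed

end

section \<open>Pressure and the Donsker--Varadhan formula\<close>

lemma infdist_attained_compact:
  fixes Y :: "'a::metric_space set"
  assumes "compact Y" "Y \<noteq> {}"
  shows "\<exists>y\<in>Y. infdist x Y = dist x y"
proof -
  have "continuous_on Y (dist x)" by (intro continuous_intros)
  then obtain y where y: "y \<in> Y" "\<And>w. w \<in> Y \<Longrightarrow> dist x y \<le> dist x w"
    using continuous_attains_inf[OF assms] by blast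
  have "infdist x Y = (INF w\<in>Y. dist x w)" using assms(2) by (simp add: infdist_def)
  also have "\<dots> = dist x y" using y by (intro cInf_eq_minimum) auto
  finally show ?thesis using y by blast
qed

text \<open>A strict inequality on a compact set spreads to a uniform neighbourhood inside a
  possibly noncompact domain: the points of a counterexample sequence have nearest points in
  \<open>Y\<close> that accumulate at some \<open>l\<close>, and then the sequence accumulates at
  \<open>l\<close> as well.\<close>

lemma near_compact_less:
  fixes f :: "'a::metric_space \<Rightarrow> real"
  assumes f: "continuous_on Z f" and Y: "compact Y" "Y \<subseteq> Z" "Y \<noteq> {}" and lt: "\<And>y. y \<in> Y \<Longrightarrow> f y < a"
  shows "\<exists>d>0. \<forall>x\<in>Z. infdist x Y < d \<longrightarrow> f x < a"
proof (rule ccontr)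
  assume neg: "\<not> ?thesis"
  have "\<exists>x. x \<in> Z \<and> infdist x Y < 1 / Suc n \<and> \<not> f x < a" for n
  proof -
    have "0 < 1 / real (Suc n)" by simp
    with neg show ?thesis by blast
  qed
  then obtain x where x: "\<And>n. x n \<in> Z" "\<And>n. infdist (x n) Y < 1 / Suc n" "\<And>n. \<not> f (x n) < a" by metis
  have "\<exists>y\<in>Y. infdist (x n) Y = dist (x n) y" for n
    by (rule infdist_attained_compact[OF Y(1,3)])
  then obtain y where y: "\<And>n. y n \<in> Y" "\<And>n. infdist (x n) Y = dist (x n) (y n)" by metis
  obtain l r where l: "l \<in> Y" "strict_mono (r :: nat \<Rightarrow> nat)" "(y \<circ> r) \<longlonglongrightarrow> l"
    using Y(1) y(1) unfolding compact_def by blast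
  have "(\<lambda>n. dist (x (r n)) (y (r n))) \<longlonglongrightarrow> 0"
  proof (rule tendsto_sandwich[of "\<lambda>_. 0"])
    show "\<forall>\<^sub>F n in sequentially. dist (x (r n)) (y (r n)) \<le> 1 / Suc (r n)"
      using x(2) y(2) by (intro always_eventually allI) (metis less_imp_le)
    have "(\<lambda>n. 1 / real (Suc n)) \<longlonglongrightarrow> 0" by (rule LIMSEQ_Suc[OF lim_1_over_n])
    then show "(\<lambda>n. 1 / real (Suc (r n))) \<longlonglongrightarrow> 0"
      using LIMSEQ_subseq_LIMSEQ[OF _ l(2)] by (fastforce simp: o_def)
  qed auto
  moreover have "(\<lambda>n. dist (y (r n)) l) \<longlonglongrightarrow> 0"
    using tendsto_dist_iff[THEN iffD1, OF l(3)] by (simp add: o_def)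
  ultimately have "(\<lambda>n. dist (x (r n)) (y (r n)) + dist (y (r n)) l) \<longlonglongrightarrow> 0 + 0"
    by (rule tendsto_add)
  then have sum0: "(\<lambda>n. dist (x (r n)) (y (r n)) + dist (y (r n)) l) \<longlonglongrightarrow> 0" by simp
  have "\<forall>\<^sub>F n in sequentially. dist (x (r n)) l \<le> dist (x (r n)) (y (r n)) + dist (y (r n)) l"
    by (intro always_eventually allI dist_triangle)
  then have "(\<lambda>n. dist (x (r n)) l) \<longlonglongrightarrow> 0"
    by (rule tendsto_sandwich[OF _ _ tendsto_const sum0, rotated]) simp
  then have "(\<lambda>n. x (r n)) \<longlonglongrightarrow> l" by (rule tendsto_dist_iff[THEN iffD2])
  then have "(\<lambda>n. f (x (r n))) \<longlonglongrightarrow> f l"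
    using f[unfolded continuous_on_sequentially, rule_format, of l "\<lambda>n. x (r n)"] x(1) l(1) Y(2)
    by (auto simp: o_def)
  then have "eventually (\<lambda>n. f (x (r n)) < a) sequentially"
    using lt[OF l(1)] by (rule order_tendstoD)
  then show False using x(3) by (auto simp: eventually_sequentially)
qed

text \<open>Absorbs a constant factor, entered through its logarithm \<open>c\<close>, into an
  arbitrarily small loss of the exponential rate.\<close>

lemma exp_rate_eventually:
  fixes a b c :: real
  assumes "a < b"
  shows "\<exists>n0. \<forall>n\<ge>n0. a * real n + c \<le> b * real n"
proof -
  obtain N :: nat where "c \<le> real N * (b - a)" using reals_Archimedean3[of "b - a"] assms by (metis diff_gt_0_iff_gt less_imp_le)
  moreover have "real N * (b - a) \<le> real n * (b - a)" if "n \<ge> N" for n using that assms by (intro mult_right_mono) auto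
  ultimately have "a * real n + c \<le> b * real n" if "n \<ge> N" for n
    using that by (force simp: algebra_simps)
  then show ?thesis by blast
qed

section \<open>Growth rate on the attractor\<close>

locale rds_cpt = rds_on M \<xi> S Y for M :: "'w measure" and \<xi> :: "nat \<Rightarrow> 'w \<Rightarrow> 'e::compact_metric_space"
    and S :: "'a::polish_space \<Rightarrow> 'e \<Rightarrow> 'a" and Y +
  assumes compactY: "compact Y"
begin

definition maxT :: "('a \<Rightarrow> real) \<Rightarrow> nat \<Rightarrow> real" where
  "maxT V n = (SUP y\<in>Y. (T V ^^ n) (\<lambda>_. 1) y)"

text \<open>Growth rate of the sup norm of the iterates of 1, in the infimum form of Fekete's lemma:
  an upper bound at a single time is enough, and no limit has to be shown to exist first.\<close>

definition lam :: "('a \<Rightarrow> real) \<Rightarrow> real" where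
  "lam V = (INF n\<in>{1..}. ln (maxT V n) / real n)"

lemma Cb_iff: "f \<in> Cb Y \<longleftrightarrow> continuous_on Y f"
  by (rule Cb_compact[OF compactY])

lemma maxT_attained:
  assumes "V \<in> Cb Y"
  obtains y where "y \<in> Y" "maxT V n = (T V ^^ n) (\<lambda>_. 1) y" "\<And>x. x \<in> Y \<Longrightarrow> (T V ^^ n) (\<lambda>_. 1) x \<le> maxT V n"
proof -
  have "continuous_on Y ((T V ^^ n) (\<lambda>_. 1))" using Tn_Cb[OF assms Cb_one] by (rule Cb_cont)
  then obtain y where y: "y \<in> Y" "\<And>x. x \<in> Y \<Longrightarrow> (T V ^^ n) (\<lambda>_. 1) x \<le> (T V ^^ n) (\<lambda>_. 1) y"
    using continuous_attains_sup[OF compactY Zne] by blast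
  then have "maxT V n = (T V ^^ n) (\<lambda>_. 1) y" unfolding maxT_def by (intro cSup_eq_maximum) auto
  with y show ?thesis using that by simp
qed

lemma maxT_upper: "V \<in> Cb Y \<Longrightarrow> y \<in> Y \<Longrightarrow> (T V ^^ n) (\<lambda>_. 1) y \<le> maxT V n"
  by (rule maxT_attained[of V n]) auto

lemma maxT_pos: "V \<in> Cb Y \<Longrightarrow> 0 < maxT V n"
  by (rule maxT_attained[of V n]) (auto simp: Tn_pos)

lemma lam_bdd:
  assumes V: "V \<in> Cb Y"
  shows "bdd_below ((\<lambda>n. ln (maxT V n) / real n) ` {1..})"
proof -
  obtain B where B: "0 \<le> B" "\<And>x. x \<in> Y \<Longrightarrow> \<bar>V x\<bar> \<le> B" using CbE[OF V] by metis
  have "- B \<le> ln (maxT V n) / real n" if "n \<ge> 1" for n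
  proof -
    obtain y where "y \<in> Y" "maxT V n = (T V ^^ n) (\<lambda>_. 1) y" using maxT_attained[OF V] by metis
    then have "exp (- B * n) \<le> maxT V n" using Tn_bounds[OF V B(2)] by simp
    then have "- B * n \<le> ln (maxT V n)" using maxT_pos[OF V] by (simp add: ln_ge_iff)
    then show ?thesis using that by (simp add: field_simps)
  qed
  then show ?thesis by (intro bdd_belowI2) auto
qed

lemma lam_le: "V \<in> Cb Y \<Longrightarrow> n \<ge> 1 \<Longrightarrow> lam V \<le> ln (maxT V n) / real n"
  unfolding lam_def by (rule cINF_lower[OF lam_bdd]) auto

lemma lam_less:
  assumes V: "V \<in> Cb Y" and c: "lam V < c"
  obtains n where "n \<ge> 1" "maxT V n < exp (c * real n)"
proof -
  obtain n where n: "n \<ge> 1" "ln (maxT V n) / real n < c"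
    using c cINF_less_iff[OF _ lam_bdd[OF V], of c] unfolding lam_def by auto
  then have "ln (maxT V n) < c * real n" by (simp add: field_simps)
  then have "maxT V n < exp (c * real n)" using maxT_pos[OF V] by (metis exp_less_mono exp_ln)
  with n show ?thesis using that by blast
qed

lemma pos_bounds:
  assumes "continuous_on Y u" "\<And>y. y \<in> Y \<Longrightarrow> 0 < (u y::real)"
  obtains m K where "0 < m" "\<And>y. y \<in> Y \<Longrightarrow> m \<le> u y" "\<And>y. y \<in> Y \<Longrightarrow> u y \<le> K"
proof -
  obtain a where a: "a \<in> Y" "\<And>y. y \<in> Y \<Longrightarrow> u a \<le> u y" using continuous_attains_inf[OF compactY Zne assms(1)] by blast
  obtain b where b: "b \<in> Y" "\<And>y. y \<in> Y \<Longrightarrow> u y \<le> u b" using continuous_attains_sup[OF compactY Zne assms(1)] by blast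
  show ?thesis by (rule that[of "u a" "u b"]) (use a b assms in auto)
qed

lemma Tn_super:
  assumes V: "V \<in> Cb Y" and u: "u \<in> Cb Y" and le: "\<And>y. y \<in> Y \<Longrightarrow> T V u y \<le> exp l * u y" and y: "y \<in> Y"
  shows "(T V ^^ n) u y \<le> exp (l * real n) * u y"
  using y
proof (induction n arbitrary: y)
  case (Suc n)
  have "T V ((T V ^^ n) u) y \<le> T V (\<lambda>x. exp (l * real n) * u x) y"
    by (rule T_mono[OF V Tn_Cb[OF V u] Cb_cmult[OF u] _ Suc.prems]) (rule Suc.IH)
  also have "\<dots> = exp (l * real n) * T V u y" by (rule T_cmult)
  also have "\<dots> \<le> exp (l * real n) * (exp l * u y)" using le[OF Suc.prems] by (intro mult_left_mono) auto
  also have "\<dots> = exp (l * real (Suc n)) * u y" by (simp add: algebra_simps exp_add)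
  finally show ?case by simp
qed simp

text \<open>On the compact set \<open>Y\<close> a positive supersolution dominates a multiple of 1,
  and its own iterates grow at most like exp(l n).\<close>

lemma lam_le_super:
  assumes V: "V \<in> Cb Y" and u: "continuous_on Y u" "\<And>y. y \<in> Y \<Longrightarrow> 0 < u y"
    and le: "\<And>y. y \<in> Y \<Longrightarrow> T V u y \<le> exp l * u y"
  shows "lam V \<le> l"
proof (rule field_le_epsilon)
  fix e :: real assume e: "0 < e"
  obtain m K where m: "0 < m" "\<And>y. y \<in> Y \<Longrightarrow> m \<le> u y" "\<And>y. y \<in> Y \<Longrightarrow> u y \<le> K" using pos_bounds[OF u] by metis
  have uC: "u \<in> Cb Y" using u Cb_iff by simp
  obtain y0 where "y0 \<in> Y" using Zne by auto
  then have K: "0 < K" using m by (meson less_le_trans)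
  have bnd: "maxT V n \<le> K / m * exp (l * real n)" for n
  proof -
    obtain y where y: "y \<in> Y" "maxT V n = (T V ^^ n) (\<lambda>_. 1) y" using maxT_attained[OF V] by metis
    have "(T V ^^ n) (\<lambda>_. 1) y \<le> (T V ^^ n) (\<lambda>x. (1/m) * u x) y"
      by (rule Tn_mono[OF V Cb_one Cb_cmult[OF uC] _ y(1)]) (use m in \<open>auto simp: field_simps\<close>)
    also have "\<dots> = (1/m) * (T V ^^ n) u y" by (rule Tn_cmult[OF y(1)])
    also have "\<dots> \<le> (1/m) * (exp (l * real n) * u y)" using Tn_super[OF V uC le y(1)] m by (intro mult_left_mono) auto
    also have "\<dots> \<le> (1/m) * (exp (l * real n) * K)" using m y by (intro mult_left_mono) auto
    finally show ?thesis using y by (simp add: field_simps)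
  qed
  obtain n :: nat where n: "n \<ge> 1" "l * real n + ln (K / m) \<le> (l + e) * real n"
    using exp_rate_eventually[of l "l+e" "ln (K/m)"] e by (metis less_add_same_cancel1 linorder_linear)
  have "ln (maxT V n) \<le> ln (K / m * exp (l * real n))" using bnd maxT_pos[OF V] K m by simp
  also have "\<dots> = ln (K / m) + ln (exp (l * real n))" using K m by (intro ln_mult_pos) auto
  also have "\<dots> \<le> (l + e) * n" using n by simp
  finally have "ln (maxT V n) / n \<le> l + e" using n by (simp add: pos_divide_le_eq)
  then show "lam V \<le> l + e" using lam_le[OF V n(1)] by simp
qed

lemma lam_super_exists:
  assumes V: "V \<in> Cb Y" and l: "lam V < l"
  obtains u where "continuous_on Y u" "\<And>y. y \<in> Y \<Longrightarrow> 0 < u y" "\<And>y. y \<in> Y \<Longrightarrow> T V u y \<le> exp l * u y"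
proof -
  obtain n where n: "n \<ge> 1" "maxT V n < exp (l * real n)" using lam_less[OF V l] by metis
  define t where "t k = (\<lambda>y. exp (- l * real k) * (T V ^^ k) (\<lambda>_. 1) y)" for k
  have tC: "t k \<in> Cb Y" for k unfolding t_def by (rule Cb_cmult[OF Tn_Cb[OF V Cb_one]])
  have t0: "0 < t k y" if "y \<in> Y" for k y unfolding t_def using Tn_pos[OF V that] by simp
  have Tt: "T V (t k) y = exp l * t (Suc k) y" for k y
    unfolding t_def T_cmult by (simp add: algebra_simps exp_add[symmetric] mult.assoc[symmetric])
  define u where "u y = (\<Sum>k<n. t k y)" for y
  show ?thesis
  proof
    have uC: "u \<in> Cb Y" unfolding u_def by (rule Cb_sum[OF tC])
    then show "continuous_on Y u" by (rule Cb_cont)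
    show "0 < u y" if "y \<in> Y" for y
      unfolding u_def using n t0[OF that] by (intro sum_pos2[of _ 0]) (auto intro: less_imp_le)
    fix y assume y: "y \<in> Y"
    have "T V u y = (\<Sum>k<n. exp l * t (Suc k) y)"
      unfolding u_def T_sum[OF V tC y] Tt ..
    also have "\<dots> = exp l * (\<Sum>k<n. t (Suc k) y)" by (simp add: sum_distrib_left)
    \<comment> \<open>The shift trades the term \<open>t 0\<close>, which is 1, for
      \<open>t n\<close>; the time \<open>n\<close> was chosen with T^n 1 < exp(l n), so
      \<open>t n\<close> is at most 1.\<close>
    also have "(\<Sum>k<n. t (Suc k) y) = u y + t n y - t 0 y"
      unfolding u_def using sum.lessThan_Suc_shift[of "\<lambda>k. t k y" n] by simp
    also have "\<dots> \<le> u y"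
    proof -
      have "t n y \<le> exp (- l * real n) * maxT V n" unfolding t_def using maxT_upper[OF V y] by (intro mult_left_mono) auto
      also have "\<dots> \<le> exp (- l * real n) * exp (l * real n)" using n by (intro mult_left_mono) auto
      also have "\<dots> = t 0 y" by (simp add: t_def exp_add[symmetric])
      finally show ?thesis by simp
    qed
    finally show "T V u y \<le> exp l * u y" by simp
  qed
qed

end

section \<open>Transfer from the attractor to an attracted set\<close>

locale attracted = rds M \<xi> S + Yl: rds_cpt M \<xi> S Y + Zl: rds_on M \<xi> S Z
  for M :: "'w measure" and \<xi> :: "nat \<Rightarrow> 'w \<Rightarrow> 'e::compact_metric_space"
    and S :: "'a::polish_space \<Rightarrow> 'e \<Rightarrow> 'a" and Y Z +
  assumes YZ: "Y \<subseteq> Z"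
    and attract: "\<And>e. e > 0 \<Longrightarrow> \<exists>n0. \<forall>n\<ge>n0. \<forall>x\<in>Z. \<forall>\<zeta>. infdist (orbit S x \<zeta> n) Y < e"
begin

abbreviation "lam \<equiv> Yl.lam"

lemma CbY: "V \<in> Cb Z \<Longrightarrow> V \<in> Cb Y"
  by (rule Cb_subset[OF YZ])

lemma extend_Cb:
  assumes "continuous_on Y (f :: 'a \<Rightarrow> real)"
  obtains g where "\<And>W. g \<in> Cb W" "\<And>y. y \<in> Y \<Longrightarrow> g y = f y"
proof -
  obtain B where B: "0 \<le> B" "\<And>x. x \<in> Y \<Longrightarrow> \<bar>f x\<bar> \<le> B" using Yl.CbE assms Yl.Cb_iff by metis
  have "closedin (top_of_set UNIV) Y" using Yl.closedZ by simp
  then obtain g where g: "continuous_on UNIV g" "\<And>x. x \<in> Y \<Longrightarrow> g x = f x" "\<And>x. norm (g x) \<le> B"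
    using Tietze[OF assms _ B(1), of UNIV] B(2) by auto
  have "g \<in> Cb W" for W using g continuous_on_subset[OF g(1)] by (auto simp: Cb_def bounded_iff)
  with g show ?thesis using that by blast
qed

text \<open>After \<open>n0\<close> steps the orbit is near \<open>Y\<close>, where the
  \<open>m\<close>-th iterate of 1 is below exp(c' m). Each further block of \<open>m\<close> steps
  therefore costs at most that factor, uniformly on \<open>Z\<close>.\<close>

lemma iterate_bound:
  assumes V: "V \<in> Cb Z" and m: "m \<ge> 1" and lt: "\<And>y. y \<in> Y \<Longrightarrow> (T V ^^ m) (\<lambda>_. 1) y < exp (c' * m)" and c: "c' < c"
  shows "\<exists>n0. \<forall>n\<ge>n0. \<forall>x\<in>Z. (T V ^^ n) (\<lambda>_. 1) x \<le> exp (c * n)"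
proof -
  obtain B where B: "0 \<le> B" "\<And>x. x \<in> Z \<Longrightarrow> \<bar>V x\<bar> \<le> B" using Zl.CbE[OF V] by metis
  define u where "u = (T V ^^ m) (\<lambda>_. 1)"
  have uC: "u \<in> Cb Z" unfolding u_def by (rule Zl.Tn_Cb[OF V Zl.Cb_one])
  obtain d where d: "d > 0" "\<And>x. x \<in> Z \<Longrightarrow> infdist x Y < d \<Longrightarrow> u x < exp (c' * m)"
    using near_compact_less[OF Zl.Cb_cont[OF uC] Yl.compactY YZ Yl.Zne] lt unfolding u_def by metis
  obtain n0 where n0: "\<And>n x \<zeta>. n \<ge> n0 \<Longrightarrow> x \<in> Z \<Longrightarrow> infdist (orbit S x \<zeta> n) Y < d" using attract[OF d(1)] by blast
  have step: "(T V ^^ (m + j)) (\<lambda>_. 1) x \<le> exp (c' * m) * (T V ^^ j) (\<lambda>_. 1) x" if j: "j \<ge> n0" and x: "x \<in> Z" for j x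
  proof -
    have "(T V ^^ (m + j)) (\<lambda>_. 1) x = (T V ^^ j) u x" by (simp add: funpow_add add.commute[of m j] u_def)
    also have "\<dots> \<le> (T V ^^ j) (\<lambda>x. exp (c' * m) * 1) x"
      by (rule Zl.Tn_mono_orbit[OF V uC Zl.Cb_const x]) (use d(2) Zl.OZ[OF x] n0[OF j x] in \<open>auto intro: less_imp_le\<close>)
    also have "\<dots> = exp (c' * m) * (T V ^^ j) (\<lambda>_. 1) x" by (rule Zl.Tn_cmult[OF x])
    finally show ?thesis .
  qed
  have steps: "(T V ^^ (m * k + j)) (\<lambda>_. 1) x \<le> exp (c' * real (m * k)) * (T V ^^ j) (\<lambda>_. 1) x" if j: "j \<ge> n0" and x: "x \<in> Z" for j k x
  proof (induction k)
    case (Suc k)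
    have e: "exp (c' * real (m * Suc k)) = exp (c' * m) * exp (c' * real (m * k))"
      by (simp add: exp_add[symmetric] algebra_simps)
    have "(T V ^^ (m * Suc k + j)) (\<lambda>_. 1) x \<le> exp (c' * m) * (T V ^^ (m * k + j)) (\<lambda>_. 1) x"
      using step[of "m * k + j" x] j x by (simp add: add.assoc)
    also have "\<dots> \<le> exp (c' * m) * (exp (c' * real (m * k)) * (T V ^^ j) (\<lambda>_. 1) x)" using Suc by (intro mult_left_mono) auto
    finally show ?case unfolding e mult.assoc .
  qed simp
  \<comment> \<open>The remainder \<open>j\<close> is at most n0 + m, so the crude factors exp(B j)
    and exp(- c' j) cost only a constant.\<close>
  define C where "C = (\<bar>c'\<bar> + B) * (n0 + m)"
  have all: "(T V ^^ n) (\<lambda>_. 1) x \<le> exp (c' * n + C)" if n: "n \<ge> n0" and x: "x \<in> Z" for n x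
  proof -
    define k where "k = (n - n0) div m"
    define j where "j = n0 + (n - n0) mod m"
    have nj: "n = m * k + j" using n by (simp add: k_def j_def)
    have jm: "j \<le> n0 + m" "n0 \<le> j" using m by (auto simp: j_def intro: less_imp_le)
    have "(T V ^^ n) (\<lambda>_. 1) x \<le> exp (c' * real (m * k)) * (T V ^^ j) (\<lambda>_. 1) x" unfolding nj by (rule steps[OF jm(2) x])
    also have "\<dots> \<le> exp (c' * real (m * k)) * exp (B * j)" using Zl.Tn_bounds[OF V B(2) x] by (intro mult_left_mono) auto
    also have "\<dots> = exp (c' * n + (B * j - c' * j))" by (simp add: exp_add[symmetric] nj algebra_simps)
    also have "\<dots> \<le> exp (c' * n + C)"
    proof -
      have "B * j - c' * j = (B - c') * j" by (simp add: algebra_simps)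
      also have "\<dots> \<le> (\<bar>c'\<bar> + B) * j" by (intro mult_right_mono) auto
      also have "\<dots> \<le> C" unfolding C_def using jm B by (intro mult_left_mono) auto
      finally show ?thesis by simp
    qed
    finally show ?thesis .
  qed
  obtain n1 where n1: "\<And>n. n \<ge> n1 \<Longrightarrow> c' * real n + C \<le> c * n" using exp_rate_eventually[OF c] by blast
  show ?thesis
  proof (intro exI[of _ "max n0 n1"] allI impI ballI)
    fix n x assume "max n0 n1 \<le> n" "x \<in> Z"
    then have "(T V ^^ n) (\<lambda>_. 1) x \<le> exp (c' * n + C)" "c' * real n + C \<le> c * n" using all n1 by auto
    then show "(T V ^^ n) (\<lambda>_. 1) x \<le> exp (c * n)" by (meson exp_le_cancel_iff order_trans)
  qed
qed

text \<open>The same block argument from below; the neighbourhood of \<open>Y\<close> comes from the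
  strict inequality for \<open>- u\<close>.\<close>

lemma iterate_lower:
  assumes V: "V \<in> Cb Z" and m: "m \<ge> 1" and lt: "\<And>y. y \<in> Y \<Longrightarrow> exp (c' * m) < (T V ^^ m) (\<lambda>_. 1) y" and c: "c < c'"
  shows "\<exists>n0. \<forall>n\<ge>n0. \<forall>x\<in>Z. exp (c * n) \<le> (T V ^^ n) (\<lambda>_. 1) x"
proof -
  obtain B where B: "0 \<le> B" "\<And>x. x \<in> Z \<Longrightarrow> \<bar>V x\<bar> \<le> B" using Zl.CbE[OF V] by metis
  define u where "u = (T V ^^ m) (\<lambda>_. 1)"
  have uC: "u \<in> Cb Z" unfolding u_def by (rule Zl.Tn_Cb[OF V Zl.Cb_one])
  have "continuous_on Z (\<lambda>x. - u x)" using Zl.Cb_cont[OF uC] by (intro continuous_intros)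
  then obtain d where d: "d > 0" "\<And>x. x \<in> Z \<Longrightarrow> infdist x Y < d \<Longrightarrow> - u x < - exp (c' * m)"
    using near_compact_less[OF _ Yl.compactY YZ Yl.Zne, of "\<lambda>x. - u x" "- exp (c' * m)"] lt unfolding u_def by auto
  obtain n0 where n0: "\<And>n x \<zeta>. n \<ge> n0 \<Longrightarrow> x \<in> Z \<Longrightarrow> infdist (orbit S x \<zeta> n) Y < d" using attract[OF d(1)] by blast
  have step: "exp (c' * m) * (T V ^^ j) (\<lambda>_. 1) x \<le> (T V ^^ (m + j)) (\<lambda>_. 1) x" if j: "j \<ge> n0" and x: "x \<in> Z" for j x
  proof -
    have "exp (c' * m) * (T V ^^ j) (\<lambda>_. 1) x = (T V ^^ j) (\<lambda>x. exp (c' * m) * 1) x" by (rule Zl.Tn_cmult[OF x, symmetric])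
    also have "\<dots> \<le> (T V ^^ j) u x"
      by (rule Zl.Tn_mono_orbit[OF V Zl.Cb_const uC x]) (use d(2) Zl.OZ[OF x] n0[OF j x] in \<open>auto intro: less_imp_le\<close>)
    also have "\<dots> = (T V ^^ (m + j)) (\<lambda>_. 1) x" by (simp add: funpow_add add.commute[of m j] u_def)
    finally show ?thesis .
  qed
  have steps: "exp (c' * real (m * k)) * (T V ^^ j) (\<lambda>_. 1) x \<le> (T V ^^ (m * k + j)) (\<lambda>_. 1) x" if j: "j \<ge> n0" and x: "x \<in> Z" for j k x
  proof (induction k)
    case (Suc k)
    have e: "exp (c' * real (m * Suc k)) = exp (c' * m) * exp (c' * real (m * k))"
      by (simp add: exp_add[symmetric] algebra_simps)
    have "exp (c' * m) * (exp (c' * real (m * k)) * (T V ^^ j) (\<lambda>_. 1) x) \<le> exp (c' * m) * (T V ^^ (m * k + j)) (\<lambda>_. 1) x" using Suc by (intro mult_left_mono) auto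
    also have "\<dots> \<le> (T V ^^ (m * Suc k + j)) (\<lambda>_. 1) x"
      using step[of "m * k + j" x] j x by (simp add: add.assoc)
    finally show ?case unfolding e mult.assoc .
  qed simp
  define C where "C = (\<bar>c'\<bar> + B) * (n0 + m)"
  have all: "exp (c' * n - C) \<le> (T V ^^ n) (\<lambda>_. 1) x" if n: "n \<ge> n0" and x: "x \<in> Z" for n x
  proof -
    define k where "k = (n - n0) div m"
    define j where "j = n0 + (n - n0) mod m"
    have nj: "n = m * k + j" using n by (simp add: k_def j_def)
    have jm: "j \<le> n0 + m" "n0 \<le> j" using m by (auto simp: j_def intro: less_imp_le)
    have "exp (c' * n - C) \<le> exp (c' * n - (B * j + c' * j))"
    proof -
      have "B * j + c' * j = (B + c') * j" by (simp add: algebra_simps)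
      also have "\<dots> \<le> (\<bar>c'\<bar> + B) * j" by (intro mult_right_mono) auto
      also have "\<dots> \<le> C" unfolding C_def using jm B by (intro mult_left_mono) auto
      finally show ?thesis by simp
    qed
    also have "\<dots> = exp (c' * real (m * k)) * exp (- B * j)" by (simp add: exp_add[symmetric] nj algebra_simps)
    also have "\<dots> \<le> exp (c' * real (m * k)) * (T V ^^ j) (\<lambda>_. 1) x" using Zl.Tn_bounds[OF V B(2) x] by (intro mult_left_mono) auto
    also have "\<dots> \<le> (T V ^^ n) (\<lambda>_. 1) x" unfolding nj by (rule steps[OF jm(2) x])
    finally show ?thesis .
  qed
  obtain n1 where n1: "\<And>n. n \<ge> n1 \<Longrightarrow> c * real n + C \<le> c' * n" using exp_rate_eventually[OF c] by blast
  show ?thesis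
  proof (intro exI[of _ "max n0 n1"] allI impI ballI)
    fix n x assume "max n0 n1 \<le> n" "x \<in> Z"
    then have "exp (c' * n - C) \<le> (T V ^^ n) (\<lambda>_. 1) x" "c * real n + C \<le> c' * n" using all n1 by auto
    then have "exp (c' * n - C) \<le> (T V ^^ n) (\<lambda>_. 1) x" "c * real n \<le> c' * n - C" by auto
    then show "exp (c * n) \<le> (T V ^^ n) (\<lambda>_. 1) x" by (meson exp_le_cancel_iff order_trans)
  qed
qed

lemma lam_upper:
  assumes V: "V \<in> Cb Z" and c: "lam V < c"
  shows "\<exists>n0. \<forall>n\<ge>n0. \<forall>x\<in>Z. (T V ^^ n) (\<lambda>_. 1) x \<le> exp (c * n)"
proof -
  obtain c' where c': "lam V < c'" "c' < c" using dense[OF c] by auto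
  obtain m where m: "m \<ge> 1" "Yl.maxT V m < exp (c' * real m)" using Yl.lam_less[OF CbY[OF V] c'(1)] by metis
  show ?thesis by (rule iterate_bound[OF V m(1) _ c'(2)]) (use m Yl.maxT_upper[OF CbY[OF V]] le_less_trans in blast)
qed

text \<open>The lower estimate needs no dynamics: at each time a maximising point of
  \<open>Y\<close> has a normalised logarithm at least the infimum \<open>lam\<close>.\<close>

lemma pressure_eq:
  assumes V: "V \<in> Cb Z"
  shows "limsup (\<lambda>n. SUP x\<in>Z. ereal (log_mgf M \<xi> S V n x)) = ereal (lam V)"
proof (rule antisym)
  show "limsup (\<lambda>n. SUP x\<in>Z. ereal (log_mgf M \<xi> S V n x)) \<le> ereal (lam V)"
  proof (rule ereal_le_epsilon2)
    fix e :: real assume e: "0 < e"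
    obtain n0 where n0: "\<And>n x. n \<ge> n0 \<Longrightarrow> x \<in> Z \<Longrightarrow> (T V ^^ n) (\<lambda>_. 1) x \<le> exp ((lam V + e) * n)"
      using lam_upper[OF V, of "lam V + e"] e by auto
    have "eventually (\<lambda>n. (SUP x\<in>Z. ereal (log_mgf M \<xi> S V n x)) \<le> ereal (lam V + e)) sequentially"
    proof (rule eventually_sequentiallyI[of "max 1 n0"], rule SUP_least)
      fix n x assume n: "max 1 n0 \<le> n" and x: "x \<in> Z"
      have "ln ((T V ^^ n) (\<lambda>_. 1) x) \<le> (lam V + e) * n"
        using n0[of n x] n x Zl.Tn_pos[OF V x] by (metis ln_exp ln_le_cancel_iff exp_gt_zero max.bounded_iff)
      then have "log_mgf M \<xi> S V n x \<le> lam V + e"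
        unfolding Zl.log_mgf_eq[OF V x] using n by (simp add: field_simps)
      then show "ereal (log_mgf M \<xi> S V n x) \<le> ereal (lam V + e)" by simp
    qed
    then show "limsup (\<lambda>n. SUP x\<in>Z. ereal (log_mgf M \<xi> S V n x)) \<le> ereal (lam V) + ereal e"
      using Limsup_bounded by fastforce
  qed
  have "eventually (\<lambda>n. ereal (lam V) \<le> (SUP x\<in>Z. ereal (log_mgf M \<xi> S V n x))) sequentially"
  proof (rule eventually_sequentiallyI[of 1])
    fix n :: nat assume n: "1 \<le> n"
    obtain y where y: "y \<in> Y" "Yl.maxT V n = (T V ^^ n) (\<lambda>_. 1) y" using Yl.maxT_attained[OF CbY[OF V]] by metis
    have "lam V \<le> log_mgf M \<xi> S V n y"
      using Yl.lam_le[OF CbY[OF V] n] unfolding Yl.log_mgf_eq[OF CbY[OF V] y(1)] y(2) by simp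
    then show "ereal (lam V) \<le> (SUP x\<in>Z. ereal (log_mgf M \<xi> S V n x))"
      using y YZ by (intro SUP_upper2[of y]) auto
  qed
  then have "ereal (lam V) \<le> liminf (\<lambda>n. SUP x\<in>Z. ereal (log_mgf M \<xi> S V n x))"
    by (rule Liminf_bounded)
  also have "\<dots> \<le> limsup (\<lambda>n. SUP x\<in>Z. ereal (log_mgf M \<xi> S V n x))" by (rule Liminf_le_Limsup) simp
  finally show "ereal (lam V) \<le> limsup (\<lambda>n. SUP x\<in>Z. ereal (log_mgf M \<xi> S V n x))" .
qed

section \<open>Legendre transform and the variational formula\<close>

definition leg :: "'a measure \<Rightarrow> ereal" where
  "leg \<sigma> = (SUP V\<in>Cb Z. ereal (LINT x:Z|\<sigma>. V x) - ereal (lam V))"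

lemma Cpos_ratio:
  assumes f: "f \<in> Cpos Y"
  shows "T (\<lambda>_. 0) f \<in> Cb Y" "\<And>y. y \<in> Y \<Longrightarrow> 0 < T (\<lambda>_. 0) f y"
    "continuous_on Y (\<lambda>y. ln (markov_op M \<xi> S Y f y / f y))"
    "\<And>y. y \<in> Y \<Longrightarrow> ln (markov_op M \<xi> S Y f y / f y) = ln (T (\<lambda>_. 0) f y) - ln (f y)"
proof -
  have fc: "continuous_on Y f" "\<And>y. y \<in> Y \<Longrightarrow> 0 < f y" using f by (auto simp: Cpos_def)
  then have fC: "f \<in> Cb Y" using Yl.Cb_iff by simp
  show PC: "T (\<lambda>_. 0) f \<in> Cb Y" by (rule Yl.T_Cb[OF Yl.Cb_zero fC])
  obtain m K where m: "0 < m" "\<And>y. y \<in> Y \<Longrightarrow> m \<le> f y" using Yl.pos_bounds[OF fc] by metis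
  show pos: "0 < T (\<lambda>_. 0) f y" if "y \<in> Y" for y
  proof -
    have "T (\<lambda>_. 0) (\<lambda>_. m) y \<le> T (\<lambda>_. 0) f y"
      by (rule Yl.T_mono[OF Yl.Cb_zero Yl.Cb_const fC m(2) that])
    moreover have "T (\<lambda>_. 0) (\<lambda>_. m) y = m" by (simp add: TV_def)
    ultimately show ?thesis using m by simp
  qed
  show eq: "ln (markov_op M \<xi> S Y f y / f y) = ln (T (\<lambda>_. 0) f y) - ln (f y)" if "y \<in> Y" for y
    using pos[OF that] fc(2)[OF that] Yl.markov_op_eq[OF fc(1) that] by (simp add: ln_div)
  have "continuous_on Y (\<lambda>y. ln (T (\<lambda>_. 0) f y) - ln (f y))"
    using pos fc Yl.Cb_cont[OF PC] by (intro continuous_intros) force+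
  then show "continuous_on Y (\<lambda>y. ln (markov_op M \<xi> S Y f y / f y))"
    by (rule continuous_on_cong[THEN iffD1, rotated -1]) (use eq in auto)
qed

lemma rate_ge:
  assumes s: "\<sigma> \<in> probs Y" and V: "V \<in> Cb Z"
  shows "ereal (LINT x:Z|\<sigma>. V x) - ereal (lam V) \<le> rate M \<xi> S Y \<sigma>"
proof -
  have VY: "V \<in> Cb Y" by (rule CbY[OF V])
  have "ereal ((LINT x:Z|\<sigma>. V x) - l) \<le> rate M \<xi> S Y \<sigma>" if l: "lam V < l" for l
  proof -
    obtain u where u: "continuous_on Y u" "\<And>y. y \<in> Y \<Longrightarrow> 0 < u y" "\<And>y. y \<in> Y \<Longrightarrow> T V u y \<le> exp l * u y"
      using Yl.lam_super_exists[OF VY l] by metis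
    define f where "f y = exp (V y) * u y" for y
    have f: "f \<in> Cpos Y" unfolding f_def Cpos_def using u Yl.Cb_cont[OF VY] by (auto intro!: continuous_intros)
    have PT: "T (\<lambda>_. 0) f y = T V u y" for y by (simp add: TV_def f_def)
    define h where "h = (\<lambda>y. ln (markov_op M \<xi> S Y f y / f y))"
    have hle: "h y \<le> l - V y" if y: "y \<in> Y" for y
    proof -
      have "ln (T V u y) \<le> ln (exp l * u y)" using u(3)[OF y] Cpos_ratio(2)[OF f y] u(2)[OF y] PT by simp
      then show ?thesis unfolding h_def Cpos_ratio(4)[OF f y] PT using u(2)[OF y] by (simp add: f_def ln_mult_pos)
    qed
    have hc: "continuous_on Y h" unfolding h_def by (rule Cpos_ratio(3)[OF f])
    have lVc: "(\<lambda>y. l - V y) \<in> Cb Y" by (rule Yl.Cb_diff[OF Yl.Cb_const VY])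
    have "(LINT y:Y|\<sigma>. h y) \<le> (LINT y:Y|\<sigma>. l - V y)"
      using hc hle Yl.Cb_iff[of h] lVc
      by (intro set_integral_probs_mono[OF s Yl.closedZ]) (auto simp: Cb_def)
    also have "\<dots> = l - (LINT y:Y|\<sigma>. V y)"
      using Cb_integrable[OF s _ Yl.closedZ] VY Yl.Cb_const
      by (subst set_integral_diff) (auto simp: Cb_def set_integral_probs_const[OF s])
    also have "(LINT y:Y|\<sigma>. V y) = (LINT x:Z|\<sigma>. V x)"
      by (rule set_integral_probs_subset[symmetric, OF s Yl.closedZ Zl.closedZ YZ Zl.Cb_cont[OF V]])
    finally have "(LINT y:Y|\<sigma>. h y) \<le> l - (LINT x:Z|\<sigma>. V x)" .
    then have "(INF f\<in>Cpos Y. ereal (LINT x:Y|\<sigma>. ln (markov_op M \<xi> S Y f x / f x))) \<le> ereal (l - (LINT x:Z|\<sigma>. V x))"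
      by (intro INF_lower2[OF f]) (simp add: h_def)
    then have "- ereal (l - (LINT x:Z|\<sigma>. V x)) \<le> - (INF f\<in>Cpos Y. ereal (LINT x:Y|\<sigma>. ln (markov_op M \<xi> S Y f x / f x)))"
      by (simp only: ereal_minus_le_minus)
    then show ?thesis using s by (simp add: rate_def)
  qed
  then have "ereal ((LINT x:Z|\<sigma>. V x) - (lam V + e)) \<le> rate M \<xi> S Y \<sigma>" if "e > 0" for e using that by simp
  then have "ereal (LINT x:Z|\<sigma>. V x) - ereal (lam V) \<le> rate M \<xi> S Y \<sigma> + ereal e" if "e > 0" for e
    using that by (cases "rate M \<xi> S Y \<sigma>") (force simp: algebra_simps)+
  then show ?thesis by (rule ereal_le_epsilon2)
qed

lemma leg_ge_ratio:
  assumes s: "\<sigma> \<in> probs Y" and f: "f \<in> Cpos Y"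
  shows "- leg \<sigma> \<le> ereal (LINT x:Y|\<sigma>. ln (markov_op M \<xi> S Y f x / f x))"
proof -
  define h where "h = (\<lambda>y. ln (markov_op M \<xi> S Y f y / f y))"
  have hc: "continuous_on Y (\<lambda>y. - h y)" unfolding h_def by (rule continuous_on_minus[OF Cpos_ratio(3)[OF f]])
  \<comment> \<open>log (f / Pf) is given only on \<open>Y\<close>; its Tietze extension is an
    admissible potential on \<open>Z\<close>, and its \<open>lam\<close> is still determined on
    \<open>Y\<close>.\<close>
  obtain V where V: "\<And>W. V \<in> Cb W" "\<And>y. y \<in> Y \<Longrightarrow> V y = - h y" using extend_Cb[OF hc] by metis
  define u where "u = T (\<lambda>_. 0) f"
  have f0: "\<And>y. y \<in> Y \<Longrightarrow> 0 < f y" using f by (auto simp: Cpos_def)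
  have uC: "u \<in> Cb Y" and u0: "\<And>y. y \<in> Y \<Longrightarrow> 0 < u y" unfolding u_def using Cpos_ratio(1,2)[OF f] by auto
  have ex: "exp (V y) * u y = f y" if y: "y \<in> Y" for y
    using V(2)[OF y] f0[OF y] u0[OF y] Cpos_ratio(4)[OF f y]
    by (simp add: h_def u_def[symmetric] exp_diff)
  have "lam V \<le> 0"
  proof (rule Yl.lam_le_super[OF V(1) Yl.Cb_cont[OF uC] u0])
    fix y assume y: "y \<in> Y"
    have "T V u y = u y"
      unfolding TV_def u_def[unfolded TV_def] using ex Yl.SZ[OF y] by (simp add: u_def TV_def)
    then show "T V u y \<le> exp 0 * u y" by simp
  qed
  then have "ereal (LINT x:Z|\<sigma>. V x) \<le> ereal (LINT x:Z|\<sigma>. V x) - ereal (lam V)" by simp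
  also have "\<dots> \<le> leg \<sigma>" unfolding leg_def by (rule SUP_upper[OF V(1)])
  also have "(LINT x:Z|\<sigma>. V x) = (LINT x:Y|\<sigma>. V x)"
    using V(1)[of Z] by (intro set_integral_probs_subset[OF s Yl.closedZ Zl.closedZ YZ]) (auto simp: Cb_def)
  also have "\<dots> = (LINT x:Y|\<sigma>. - h x)" by (rule set_integral_probs_cong[OF V(2)])
  also have "\<dots> = - (LINT x:Y|\<sigma>. h x)" by (simp add: set_lebesgue_integral_def)
  finally have "- ereal (LINT x:Y|\<sigma>. h x) \<le> leg \<sigma>" by simp
  then have "- leg \<sigma> \<le> - (- ereal (LINT x:Y|\<sigma>. h x))" by (simp only: ereal_minus_le_minus)
  then show ?thesis unfolding h_def by simp
qed

text \<open>Multiples of the truncated distance to \<open>Y\<close> vanish on \<open>Y\<close>, so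
  \<open>lam\<close> of them stays nonpositive, while their integral against a measure charging the
  complement is arbitrarily large.\<close>

lemma leg_outside:
  assumes s: "\<sigma> \<in> probs Z" "\<sigma> \<notin> probs Y"
  shows "leg \<sigma> = \<infinity>"
proof -
  define f where "f x = min 1 (infdist x Y)" for x
  have f01: "0 \<le> f x" "f x \<le> 1" for x using infdist_nonneg[of x Y] by (auto simp: f_def)
  have fc: "continuous_on A f" for A unfolding f_def by (intro continuous_intros)
  have fC: "f \<in> Cb Z" by (rule Zl.CbI[OF fc, of 1]) (use f01 in auto)
  have "(LINT x:Z|\<sigma>. f x) \<noteq> 0"
    unfolding f_def using probs_iff_integral_zero[OF Yl.closedZ Yl.Zne Zl.closedZ YZ s(1)] s(2) by simp
  moreover have "0 \<le> (LINT x:Z|\<sigma>. f x)" unfolding set_lebesgue_integral_def using f01 by (intro Bochner_Integration.integral_nonneg) auto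
  ultimately have I: "0 < (LINT x:Z|\<sigma>. f x)" by simp
  have "ereal B \<le> leg \<sigma>" for B
  proof -
    define c where "c = \<bar>B\<bar> / (LINT x:Z|\<sigma>. f x)"
    have cC: "(\<lambda>x. c * f x) \<in> Cb Z" by (rule Zl.Cb_cmult[OF fC])
    have "lam (\<lambda>x. c * f x) \<le> 0"
    proof (rule Yl.lam_le_super[OF CbY[OF cC], of "\<lambda>_. 1"])
      fix y assume y: "y \<in> Y"
      show "T (\<lambda>x. c * f x) (\<lambda>_. 1) y \<le> exp 0 * 1" using Yl.SZ[OF y] by (simp add: TV_def f_def)
    qed auto
    moreover have "B \<le> (LINT x:Z|\<sigma>. c * f x)" using I by (simp add: c_def)
    ultimately have "ereal B \<le> ereal (LINT x:Z|\<sigma>. c * f x) - ereal (lam (\<lambda>x. c * f x))" by simp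
    also have "\<dots> \<le> leg \<sigma>" unfolding leg_def by (rule SUP_upper[OF cC])
    finally show ?thesis .
  qed
  then show ?thesis by (rule ereal_top)
qed

theorem leg_rate:
  assumes s: "\<sigma> \<in> probs Z"
  shows "rate M \<xi> S Y \<sigma> = leg \<sigma>"
proof (cases "\<sigma> \<in> probs Y")
  case True
  show ?thesis
  proof (rule antisym)
    have "- leg \<sigma> \<le> (INF f\<in>Cpos Y. ereal (LINT x:Y|\<sigma>. ln (markov_op M \<xi> S Y f x / f x)))"
      by (rule INF_greatest) (rule leg_ge_ratio[OF True])
    then show "rate M \<xi> S Y \<sigma> \<le> leg \<sigma>" using True by (simp add: rate_def ereal_uminus_le_reorder)
    show "leg \<sigma> \<le> rate M \<xi> S Y \<sigma>" unfolding leg_def by (rule SUP_least) (rule rate_ge[OF True])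
  qed
qed (use leg_outside[OF s] in \<open>simp add: rate_def\<close>)

lemma leg_nonneg: "\<sigma> \<in> probs Z \<Longrightarrow> 0 \<le> leg \<sigma>"
proof -
  assume s: "\<sigma> \<in> probs Z"
  have "lam (\<lambda>_. 0) \<le> 0"
    by (rule Yl.lam_le_super[OF Yl.Cb_zero, of "\<lambda>_. 1"]) (auto simp: TV_def)
  then have "0 \<le> ereal (LINT x:Z|\<sigma>. 0) - ereal (lam (\<lambda>_. 0))" by (simp add: set_lebesgue_integral_def)
  also have "\<dots> \<le> leg \<sigma>" unfolding leg_def by (rule SUP_upper[OF Zl.Cb_zero])
  finally show ?thesis .
qed

end

section \<open>Spectral gap for small potentials\<close>

lemma exp_diff_le_three:
  fixes a b :: real
  assumes "a \<le> 1" "b \<le> 1"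
  shows "\<bar>exp a - exp b\<bar> \<le> 3 * \<bar>a - b\<bar>"
proof -
  have *: "exp u - exp v \<le> 3 * (u - v)" if "v \<le> u" "u \<le> 1" for u v :: real
  proof -
    have e3: "exp u \<le> 3" using that exp_le by (meson exp_le_cancel_iff order_trans)
    have "exp u - exp v = exp u * (1 - exp (v - u))" by (simp add: exp_diff algebra_simps)
    also have "\<dots> \<le> exp u * (u - v)"
    proof (rule mult_left_mono)
      show "1 - exp (v - u) \<le> u - v" using exp_ge_add_one_self[of "v - u"] by linarith
    qed simp
    also have "\<dots> \<le> 3 * (u - v)" using that e3 by (intro mult_right_mono) auto
    finally show ?thesis .
  qed
  show ?thesis
  proof (cases "a \<le> b")
    case True
    then show ?thesis using *[of a b] assms by auto
  next
    case False
    then show ?thesis using *[of b a] assms by auto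
  qed
qed

section \<open>The seminorm of the modulus\<close>

text \<open>The outcome of coupling and irreducibility, separated from its origin. \<theta> is not
  assumed to be a metric. Single steps are only nonexpansive; the strict factor \<rho> is available
  after \<open>N\<close> steps.\<close>

locale contraction = rds_cpt M \<xi> S Y for M :: "'w measure" and \<xi> :: "nat \<Rightarrow> 'w \<Rightarrow> 'e::compact_metric_space"
    and S :: "'a::polish_space \<Rightarrow> 'e \<Rightarrow> 'a" and Y +
  fixes \<theta> :: "'a \<Rightarrow> 'a \<Rightarrow> real" and \<rho> :: real and N :: nat
  assumes th0: "0 \<le> \<theta> x y" and th1: "\<theta> x y \<le> 1"
    and th_small: "0 < e \<Longrightarrow> \<exists>d>0. \<forall>x\<in>Y. \<forall>y\<in>Y. dist x y < d \<longrightarrow> \<theta> x y \<le> e"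
    and th_sqrt: "min 1 (sqrt (dist x y)) \<le> \<theta> x y"
    and rho: "0 \<le> \<rho>" "\<rho> < 1" and N1: "N \<ge> 1"
    and nonexp: "\<lbrakk>0 \<le> c; \<forall>x\<in>Y. \<forall>y\<in>Y. \<bar>f x - f y\<bar> \<le> c * \<theta> x y; continuous_on Y f\<rbrakk> \<Longrightarrow>
      \<forall>x\<in>Y. \<forall>y\<in>Y. \<bar>TV noise S (\<lambda>_. 0) f x - TV noise S (\<lambda>_. 0) f y\<bar> \<le> c * \<theta> x y"
    and contr: "\<lbrakk>0 \<le> c; \<forall>x\<in>Y. \<forall>y\<in>Y. \<bar>f x - f y\<bar> \<le> c * \<theta> x y; continuous_on Y f\<rbrakk> \<Longrightarrow>
      \<forall>x\<in>Y. \<forall>y\<in>Y. \<bar>(TV noise S (\<lambda>_. 0) ^^ N) f x - (TV noise S (\<lambda>_. 0) ^^ N) f y\<bar> \<le> \<rho> * c * \<theta> x y"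
begin

abbreviation "P \<equiv> T (\<lambda>_. 0)"

text \<open>\<open>c\<close> is any upper bound of the \<theta>-seminorm rather than its value, so
  that estimates compose without suprema. \<open>Kn\<close> below bounds the seminorm and the sup
  norm by the same constant.\<close>

definition Nle :: "real \<Rightarrow> ('a \<Rightarrow> real) \<Rightarrow> bool" where
  "Nle c f \<longleftrightarrow> 0 \<le> c \<and> (\<forall>x\<in>Y. \<forall>y\<in>Y. \<bar>f x - f y\<bar> \<le> c * \<theta> x y)"

definition Kn :: "real \<Rightarrow> ('a \<Rightarrow> real) \<Rightarrow> bool" where
  "Kn b f \<longleftrightarrow> Nle b f \<and> (\<forall>x\<in>Y. \<bar>f x\<bar> \<le> b)"

lemma NleD: "Nle c f \<Longrightarrow> x \<in> Y \<Longrightarrow> y \<in> Y \<Longrightarrow> \<bar>f x - f y\<bar> \<le> c * \<theta> x y" by (simp add: Nle_def)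
lemma Nle0: "Nle c f \<Longrightarrow> 0 \<le> c" by (simp add: Nle_def)
lemma KnN: "Kn b f \<Longrightarrow> Nle b f" by (simp add: Kn_def)
lemma KnD: "Kn b f \<Longrightarrow> x \<in> Y \<Longrightarrow> \<bar>f x\<bar> \<le> b" by (simp add: Kn_def)
lemma Kn0: "Kn b f \<Longrightarrow> 0 \<le> b" by (simp add: Kn_def Nle_def)

lemma Nle_osc: assumes "Nle c f" "x \<in> Y" "y \<in> Y" shows "\<bar>f x - f y\<bar> \<le> c"
proof -
  have "\<bar>f x - f y\<bar> \<le> c * \<theta> x y" using NleD[OF assms] .
  also have "\<dots> \<le> c * 1" using th1 Nle0[OF assms(1)] by (intro mult_left_mono)
  finally show ?thesis by simp
qed

lemma Nle_Cb: assumes "Nle c f" shows "f \<in> Cb Y"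
  unfolding Cb_iff continuous_on_iff
proof (intro ballI allI impI)
  fix x and e :: real assume x: "x \<in> Y" and e: "0 < e"
  have c: "0 \<le> c" using Nle0[OF assms] .
  then have "0 < e / (2 * (c + 1))" using e by simp
  then obtain d where d: "d > 0" "\<And>x y. x \<in> Y \<Longrightarrow> y \<in> Y \<Longrightarrow> dist x y < d \<Longrightarrow> \<theta> x y \<le> e / (2 * (c + 1))"
    using th_small by metis
  have "dist (f y) (f x) < e" if y: "y \<in> Y" "dist y x < d" for y
  proof -
    have "\<bar>f y - f x\<bar> \<le> c * \<theta> y x" using NleD[OF assms y(1) x] .
    also have "\<dots> \<le> c * (e / (2 * (c + 1)))" using d(2)[OF y(1) x y(2)] c by (intro mult_left_mono)
    also have "\<dots> < e" using e c by (simp add: field_simps add_nonneg_pos)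
    finally show ?thesis by (simp add: dist_real_def)
  qed
  with d(1) show "\<exists>d>0. \<forall>y\<in>Y. dist y x < d \<longrightarrow> dist (f y) (f x) < e" by blast
qed

lemma Nle_mono: assumes "Nle c f" "c \<le> c'" shows "Nle c' f"
proof -
  have "\<bar>f x - f y\<bar> \<le> c' * \<theta> x y" if "x \<in> Y" "y \<in> Y" for x y
    using NleD[OF assms(1) that] mult_right_mono[OF assms(2) th0] by (rule order_trans)
  then show ?thesis using Nle0[OF assms(1)] assms(2) by (simp add: Nle_def)
qed

lemma Nle_cong: "(\<And>x. x \<in> Y \<Longrightarrow> f x = g x) \<Longrightarrow> Nle c f = Nle c g" by (simp add: Nle_def)
lemma Kn_cong: "(\<And>x. x \<in> Y \<Longrightarrow> f x = g x) \<Longrightarrow> Kn c f = Kn c g" by (simp add: Kn_def Nle_def)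

lemma Nle_add: assumes "Nle c f" "Nle d g" shows "Nle (c + d) (\<lambda>x. f x + g x)"
proof -
  have "\<bar>f x + g x - (f y + g y)\<bar> \<le> (c + d) * \<theta> x y" if "x \<in> Y" "y \<in> Y" for x y
    using NleD[OF assms(1) that] NleD[OF assms(2) that] unfolding distrib_right by linarith
  then show ?thesis using Nle0[OF assms(1)] Nle0[OF assms(2)] by (simp add: Nle_def)
qed

lemma Nle_cmult: assumes "Nle c f" shows "Nle (\<bar>t\<bar> * c) (\<lambda>x. t * f x)"
proof -
  have "\<bar>t * f x - t * f y\<bar> \<le> \<bar>t\<bar> * c * \<theta> x y" if "x \<in> Y" "y \<in> Y" for x y
    using mult_left_mono[OF NleD[OF assms that], of "\<bar>t\<bar>"] by (simp add: abs_mult[symmetric] right_diff_distrib mult.assoc)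
  then show ?thesis using Nle0[OF assms(1)] by (simp add: Nle_def)
qed

lemma Nle_diff: assumes "Nle c f" "Nle d g" shows "Nle (c + d) (\<lambda>x. f x - g x)"
  using Nle_add[OF assms(1) Nle_cmult[OF assms(2), of "-1"]] by simp

lemma Nle_const: "Nle 0 (\<lambda>_. t)" by (simp add: Nle_def)

lemma Kn_add: assumes "Kn c f" "Kn d g" shows "Kn (c + d) (\<lambda>x. f x + g x)"
  unfolding Kn_def
proof (intro conjI ballI)
  show "Nle (c + d) (\<lambda>x. f x + g x)" using Nle_add assms KnN by blast
  show "\<bar>f x + g x\<bar> \<le> c + d" if "x \<in> Y" for x using KnD[OF assms(1) that] KnD[OF assms(2) that] by linarith
qed

text \<open>The product rule for the seminorm produces two terms, hence the factor 2.\<close>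

lemma Kn_mult: assumes f: "Kn b f" and g: "Kn d g" shows "Kn (2 * b * d) (\<lambda>x. f x * g x)"
  unfolding Kn_def Nle_def
proof (intro conjI ballI)
  have bd: "0 \<le> b" "0 \<le> d" using Kn0 f g by auto
  then show "0 \<le> 2 * b * d" by simp
  fix x assume x: "x \<in> Y"
  have "\<bar>f x * g x\<bar> \<le> b * d" unfolding abs_mult using KnD[OF f x] KnD[OF g x] by (intro mult_mono) auto
  also have "\<dots> \<le> 2 * b * d" using bd by simp
  finally show "\<bar>f x * g x\<bar> \<le> 2 * b * d" .
  fix y assume y: "y \<in> Y"
  have "f x * g x - f y * g y = f x * (g x - g y) + (f x - f y) * g y" by (simp add: algebra_simps)
  also have "\<bar>\<dots>\<bar> \<le> \<bar>f x\<bar> * \<bar>g x - g y\<bar> + \<bar>f x - f y\<bar> * \<bar>g y\<bar>" by (metis abs_mult abs_triangle_ineq)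
  also have "\<dots> \<le> b * (d * \<theta> x y) + (b * \<theta> x y) * d"
    using KnD[OF f x] KnD[OF g y] NleD[OF KnN[OF g] x y] NleD[OF KnN[OF f] x y] bd th0
    by (intro add_mono mult_mono) auto
  finally show "\<bar>f x * g x - f y * g y\<bar> \<le> 2 * b * d * \<theta> x y" by (simp add: algebra_simps)
qed

lemma P_Nle: assumes "Nle c f" shows "Nle c (P f)"
  using nonexp[of c f] assms Nle_Cb[OF assms] unfolding Cb_iff Nle_def by auto

lemma PN_Nle: assumes "Nle c f" shows "Nle (\<rho> * c) ((P ^^ N) f)"
  using contr[of c f] assms Nle_Cb[OF assms] rho unfolding Cb_iff Nle_def by auto

lemma Pn_sup:
  assumes "f \<in> Cb Y" "\<And>x. x \<in> Y \<Longrightarrow> \<bar>f x\<bar> \<le> b" "x \<in> Y"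
  shows "\<bar>(P ^^ n) f x\<bar> \<le> b"
proof -
  have c: "(P ^^ n) (\<lambda>_. t) x = t" if "x \<in> Y" for t x
    using that
  proof (induction n arbitrary: x)
    case (Suc n)
    have "P ((P ^^ n) (\<lambda>_. t)) x = P (\<lambda>_. t) x" by (rule T_cong) (use Suc in auto)
    then show ?case by (simp add: TV_def[of _ _ _ "\<lambda>_. t"])
  qed simp
  have "(P ^^ n) f x \<le> (P ^^ n) (\<lambda>_. b) x"
    by (rule Tn_mono[OF Cb_zero assms(1) Cb_const _ assms(3)]) (use assms(2) in \<open>auto simp: abs_le_iff\<close>)
  moreover have "(P ^^ n) (\<lambda>_. - b) x \<le> (P ^^ n) f x"
    by (rule Tn_mono[OF Cb_zero Cb_const assms(1) _ assms(3)]) (use assms(2) in \<open>force simp: abs_le_iff\<close>)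
  ultimately show ?thesis using c[OF assms(3)] by (simp add: abs_le_iff)
qed

lemma Pn_one: "x \<in> Y \<Longrightarrow> (P ^^ n) (\<lambda>_. 1) x = 1"
proof (induction n arbitrary: x)
  case (Suc n)
  have "P ((P ^^ n) (\<lambda>_. 1)) x = P (\<lambda>_. 1) x" by (rule T_cong) (use Suc in auto)
  then show ?case by (simp add: TV_def[of _ _ _ "\<lambda>_. 1"])
qed simp

lemma Kn_P:
  assumes f: "Kn b f"
  shows "Kn b (P f)"
  unfolding Kn_def
proof (intro conjI ballI)
  show "Nle b (P f)" by (rule P_Nle[OF KnN[OF f]])
  show "\<bar>P f x\<bar> \<le> b" if "x \<in> Y" for x
    using Pn_sup[OF Nle_Cb[OF KnN[OF f]] KnD[OF f] that, of 1] by simp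
qed

lemma Kn_expm1:
  assumes "Kn \<eta> V" "\<eta> \<le> 1"
  shows "Kn (3 * \<eta>) (\<lambda>x. exp (V x) - 1)"
  unfolding Kn_def Nle_def
proof (intro conjI ballI)
  have e0: "0 \<le> \<eta>" using Kn0[OF assms(1)] .
  then show "0 \<le> 3 * \<eta>" by simp
  fix x assume x: "x \<in> Y"
  have V1: "V x \<le> 1" if "x \<in> Y" for x using KnD[OF assms(1) that] assms(2) by (auto simp: abs_le_iff)
  show "\<bar>exp (V x) - 1\<bar> \<le> 3 * \<eta>" using exp_diff_le_three[of "V x" 0] V1[OF x] KnD[OF assms(1) x] by simp
  fix y assume y: "y \<in> Y"
  show "\<bar>exp (V x) - 1 - (exp (V y) - 1)\<bar> \<le> 3 * \<eta> * \<theta> x y"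
    using exp_diff_le_three[of "V x" "V y"] V1[OF x] V1[OF y] NleD[OF KnN[OF assms(1)] x y] by simp
qed

text \<open>T V f - P f = P ((exp V - 1) f). The constant 6 is the 3 from the bound on exp V - 1
  times the 2 of the product rule.\<close>

lemma T_perturb:
  assumes V: "Kn \<eta> V" "\<eta> \<le> 1" and f: "Kn b f"
  shows "Kn (6 * \<eta> * b) (\<lambda>x. T V f x - P f x)"
proof -
  have "Kn (2 * (3 * \<eta>) * b) (P (\<lambda>x. (exp (V x) - 1) * f x))"
    by (rule Kn_P[OF Kn_mult[OF Kn_expm1[OF V] f]])
  moreover have "P (\<lambda>x. (exp (V x) - 1) * f x) x = T V f x - P f x" if x: "x \<in> Y" for x
  proof -
    have fC: "f \<in> Cb Y" and VC: "V \<in> Cb Y" using Nle_Cb KnN f V(1) by auto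
    have "P (\<lambda>x. (exp (V x) - 1) * f x) x = (\<integral>e. exp (V (S x e)) * f (S x e) - f (S x e) \<partial>noise)"
      by (simp add: TV_def algebra_simps)
    also have "\<dots> = T V f x - P f x"
      using step_integrable2[OF VC fC x] step_integrable[OF fC x] by (subst Bochner_Integration.integral_diff) (auto simp: TV_def)
    finally show ?thesis .
  qed
  ultimately show ?thesis by (subst Kn_cong[symmetric, of "P (\<lambda>x. (exp (V x) - 1) * f x)"]) (auto simp: mult.assoc)
qed

text \<open>With T for T V, T^(k+1) f - P^(k+1) f = (T - P) T^k f + P (T^k f - P^k f), and P does
  not increase \<open>Kn\<close>. Both bounds are carried along because the first one feeds the
  error term of the second.\<close>

lemma Tn_perturb:
  assumes V: "Kn \<eta> V" "\<eta> \<le> 1" and f: "Kn b f"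
  shows "Kn ((1 + 6 * \<eta>) ^ k * b) ((T V ^^ k) f) \<and> Kn (((1 + 6 * \<eta>) ^ k - 1) * b) (\<lambda>x. (T V ^^ k) f x - (P ^^ k) f x)"
proof (induction k)
  case 0
  show ?case using f Kn0[OF f] by (auto simp: Kn_def Nle_def)
next
  case (Suc k)
  define q where "q = (1 + 6 * \<eta>) ^ k"
  have IH1: "Kn (q * b) ((T V ^^ k) f)" and IH2: "Kn ((q - 1) * b) (\<lambda>x. (T V ^^ k) f x - (P ^^ k) f x)"
    using Suc by (auto simp: q_def)
  have fC: "f \<in> Cb Y" and VC: "V \<in> Cb Y" using Nle_Cb KnN f V(1) by auto
  have d: "Kn (6 * \<eta> * (q * b)) (\<lambda>x. T V ((T V ^^ k) f) x - P ((T V ^^ k) f) x)"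
    by (rule T_perturb[OF V IH1])
  have "Kn (6 * \<eta> * (q * b) + q * b) (\<lambda>x. (T V ((T V ^^ k) f) x - P ((T V ^^ k) f) x) + P ((T V ^^ k) f) x)"
    by (rule Kn_add[OF d Kn_P[OF IH1]])
  moreover have "Kn (6 * \<eta> * (q * b) + (q - 1) * b) (\<lambda>x. (T V ((T V ^^ k) f) x - P ((T V ^^ k) f) x) + P (\<lambda>x. (T V ^^ k) f x - (P ^^ k) f x) x)"
    by (rule Kn_add[OF d Kn_P[OF IH2]])
  moreover have "P (\<lambda>x. (T V ^^ k) f x - (P ^^ k) f x) x = P ((T V ^^ k) f) x - P ((P ^^ k) f) x" if "x \<in> Y" for x
    using Tn_diff[OF Cb_zero Tn_Cb[OF VC fC] Tn_Cb[OF Cb_zero fC] that, of 1 k k] by simp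
  ultimately have "Kn (6 * \<eta> * (q * b) + q * b) (T V ((T V ^^ k) f))"
    "Kn (6 * \<eta> * (q * b) + (q - 1) * b) (\<lambda>x. T V ((T V ^^ k) f) x - P ((P ^^ k) f) x)"
    by (simp_all add: Kn_cong[of "\<lambda>x. T V ((T V ^^ k) f) x - P ((T V ^^ k) f) x + P (\<lambda>x. (T V ^^ k) f x - (P ^^ k) f x) x"
        "\<lambda>x. T V ((T V ^^ k) f) x - P ((P ^^ k) f) x"])
  moreover have "6 * \<eta> * (q * b) + q * b = (1 + 6 * \<eta>) ^ Suc k * b"
    "6 * \<eta> * (q * b) + (q - 1) * b = ((1 + 6 * \<eta>) ^ Suc k - 1) * b"
    by (simp_all add: q_def algebra_simps)
  ultimately show ?case by (simp only: funpow.simps o_apply)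
qed

text \<open>Dominated convergence; pointwise convergence is all that is established for the
  approximations of the eigenfunction.\<close>

lemma Tn_lim:
  assumes V: "V \<in> Cb Y" and f: "\<And>n. f n \<in> Cb Y" and g: "g \<in> Cb Y"
    and b: "\<And>n x. x \<in> Y \<Longrightarrow> \<bar>f n x\<bar> \<le> b" and lim: "\<And>x. x \<in> Y \<Longrightarrow> (\<lambda>n. f n x) \<longlonglongrightarrow> g x" and x: "x \<in> Y"
  shows "(\<lambda>n. (T V ^^ k) (f n) x) \<longlonglongrightarrow> (T V ^^ k) g x"
  unfolding Tn_expectation[OF V f x] Tn_expectation[OF V g x]
proof (rule integral_dominated_convergence[where w="\<lambda>\<zeta>. exp (\<Sum>j=1..k. V (orbit S x \<zeta> j)) * b"])
  show "integrable PS (\<lambda>\<zeta>. exp (\<Sum>j=1..k. V (orbit S x \<zeta> j)) * b)"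
    using FK_integrable[OF V Cb_const x] .
  show "(\<lambda>\<zeta>. exp (\<Sum>j=1..k. V (orbit S x \<zeta> j)) * g (orbit S x \<zeta> k)) \<in> borel_measurable PS"
    using FK_integrable[OF V g x] by (rule borel_measurable_integrable)
  show "(\<lambda>\<zeta>. exp (\<Sum>j=1..k. V (orbit S x \<zeta> j)) * f n (orbit S x \<zeta> k)) \<in> borel_measurable PS" for n
    using FK_integrable[OF V f x] by (rule borel_measurable_integrable)
  show "AE \<zeta> in PS. (\<lambda>n. exp (\<Sum>j=1..k. V (orbit S x \<zeta> j)) * f n (orbit S x \<zeta> k)) \<longlonglongrightarrow> exp (\<Sum>j=1..k. V (orbit S x \<zeta> j)) * g (orbit S x \<zeta> k)"
    by (intro AE_I2 tendsto_mult tendsto_const lim OZ[OF x])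
  show "AE \<zeta> in PS. norm (exp (\<Sum>j=1..k. V (orbit S x \<zeta> j)) * f n (orbit S x \<zeta> k)) \<le> exp (\<Sum>j=1..k. V (orbit S x \<zeta> j)) * b" for n
    by (intro AE_I2) (auto simp: abs_mult intro!: mult_left_mono b OZ[OF x])
qed

end

section \<open>Eigenfunction and mixing of the perturbed operator\<close>

locale perturbed = contraction M \<xi> S Y \<theta> \<rho> N for M :: "'w measure" and \<xi> :: "nat \<Rightarrow> 'w \<Rightarrow> 'e::compact_metric_space"
    and S :: "'a::polish_space \<Rightarrow> 'e \<Rightarrow> 'a" and Y \<theta> \<rho> N +
  fixes V :: "'a \<Rightarrow> real" and \<eta> :: real and y0 :: 'a
  assumes VK: "Kn \<eta> V" "\<eta> \<le> 1" and eta: "(1 + 6 * \<eta>) ^ N - 1 \<le> (1 - \<rho>)\<^sup>2 / 64" and y0: "y0 \<in> Y"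
begin

text \<open>\<epsilon> is the size of \<open>U\<close> minus the \<open>N\<close>-th power of
  \<open>P\<close>; \<open>a\<close> is the seminorm radius of the slice f(y0) = 1 preserved by the
  projective map; \<beta> bounds (U f)(y0) from below on that slice; \<kappa> is the seminorm factor
  before normalisation. The smallness assumed of \<eta> says \<epsilon> \<le> a^2.\<close>

definition "\<epsilon> = (1 + 6 * \<eta>) ^ N - 1"
definition "a = (1 - \<rho>) / 8"
definition "\<beta> = 1 - a - \<epsilon> * (1 + a)"
definition "\<kappa> = \<rho> + \<epsilon> + a * (1 + \<epsilon>)"
abbreviation "U \<equiv> T V ^^ N"

lemma VC: "V \<in> Cb Y" using Nle_Cb KnN VK by blast

text \<open>Everything follows from \<rho> = 1 - 8 a and \<epsilon> \<le> a^2 \<le> a / 8: the error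
  terms are small multiples of \<open>a\<close>, while the gap 1 - \<rho> leaves room for 8
  a.\<close>

lemma perturbation_constants: "0 \<le> \<epsilon>" "0 < a" "a \<le> 1/8" "\<epsilon> \<le> 1/64" "0 < \<beta>" "0 \<le> \<kappa>" "\<kappa> < \<beta>" "\<rho> * a + \<epsilon> * (1 + a) \<le> a * \<beta>"
proof -
  have e: "0 \<le> \<eta>" using Kn0[OF VK(1)] .
  then show e0: "0 \<le> \<epsilon>" by (simp add: \<epsilon>_def one_le_power)
  show a0: "0 < a" "a \<le> 1/8" using rho by (auto simp: a_def)
  have r: "\<rho> = 1 - 8 * a" by (simp add: a_def field_simps)
  have ea: "\<epsilon> \<le> a\<^sup>2" using eta by (simp add: \<epsilon>_def a_def power_divide)
  have a2: "a\<^sup>2 \<le> a / 8" using a0 by (simp add: power2_eq_square)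
  then show e1: "\<epsilon> \<le> 1/64" using ea a0 by linarith
  have eps: "\<epsilon> \<le> a / 8" using ea a2 by simp
  have ea1: "\<epsilon> * a \<le> a / 64" using e1 a0 by (simp add: mult.commute)
  have ea2: "0 \<le> \<epsilon> * a" using e0 a0 by simp
  have be: "\<beta> = 1 - a - \<epsilon> - \<epsilon> * a" and ka: "\<kappa> = \<rho> + \<epsilon> + a + \<epsilon> * a"
    unfolding \<beta>_def \<kappa>_def by (simp_all add: algebra_simps)
  show b: "0 < \<beta>" unfolding be using a0 eps ea1 by linarith
  show "0 \<le> \<kappa>" unfolding ka using rho e0 a0 ea2 by linarith
  show "\<kappa> < \<beta>" unfolding ka be using r a0 eps ea1 by linarith
  have a3: "\<epsilon> * a * a \<le> a * a / 64" using mult_right_mono[OF ea1, of a] a0 by simp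
  have "\<rho> * a + \<epsilon> * (1 + a) \<le> (1 - 8 * a) * a + a\<^sup>2 * (1 + a)"
    using arg_cong[OF r, of "\<lambda>t. t * a"] mult_right_mono[OF ea, of "1 + a"] a0 by (intro add_mono) auto
  also have "\<dots> \<le> (1 - 8 * a) * a + a\<^sup>2 * 2" using a0 by (intro add_left_mono mult_left_mono) auto
  also have "\<dots> \<le> a * \<beta>"
  proof -
    have "a * \<epsilon> \<le> a * (a / 8)" using a0 eps by (intro mult_left_mono) auto
    moreover have "a * \<beta> = a - a * a - a * \<epsilon> - \<epsilon> * a * a" unfolding be by (simp add: algebra_simps)
    moreover have "(1 - 8 * a) * a + a\<^sup>2 * 2 = a - 6 * (a * a)" by (simp add: algebra_simps power2_eq_square)
    moreover have "0 \<le> a * a" by simp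
    ultimately show ?thesis using a3 by linarith
  qed
  finally show "\<rho> * a + \<epsilon> * (1 + a) \<le> a * \<beta>" .
qed

text \<open>A Doeblin--Fortet inequality: the seminorm contracts by \<rho> up to a small multiple of
  the full norm.\<close>

lemma U_Nle:
  assumes c: "Nle c f" and b: "Kn b f"
  shows "Nle (\<rho> * c + \<epsilon> * b) (U f)"
proof -
  have 1: "Kn (\<epsilon> * b) (\<lambda>x. U f x - (P ^^ N) f x)" using Tn_perturb[OF VK b, of N] by (simp add: \<epsilon>_def)
  have "Nle (\<rho> * c + \<epsilon> * b) (\<lambda>x. (P ^^ N) f x + (U f x - (P ^^ N) f x))"
    by (rule Nle_add[OF PN_Nle[OF c] KnN[OF 1]])
  then show ?thesis by simp
qed

lemma normalized_Kn:
  assumes "f y0 = 1" "Nle c f"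
  shows "Kn (1 + c) f"
  unfolding Kn_def
proof (intro conjI ballI)
  show "Nle (1 + c) f" using Nle_mono[OF assms(2)] by simp
  show "\<bar>f x\<bar> \<le> 1 + c" if "x \<in> Y" for x using Nle_osc[OF assms(2) that y0] assms(1) by linarith
qed

lemma vanishing_Kn:
  assumes "w y0 = 0" "Nle c w"
  shows "Kn c w"
  unfolding Kn_def
proof (intro conjI ballI)
  show "\<bar>w x\<bar> \<le> c" if "x \<in> Y" for x using Nle_osc[OF assms(2) that y0] assms(1) by simp
qed (rule assms(2))

text \<open>On the slice, f and hence its image under the \<open>N\<close>-th power of
  \<open>P\<close> are within \<open>a\<close> of 1 at \<open>y0\<close>, and \<open>U\<close>
  deviates from that power by at most \<epsilon> (1 + a); this is where \<beta> comes from.\<close>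

lemma U_normalized:
  assumes f: "f y0 = 1" "Nle a f"
  shows "\<beta> \<le> U f y0" "Nle (\<rho> * a + \<epsilon> * (1 + a)) (U f)"
proof -
  have K: "Kn (1 + a) f" by (rule normalized_Kn[OF f])
  have fC: "f \<in> Cb Y" using Nle_Cb[OF f(2)] .
  show "Nle (\<rho> * a + \<epsilon> * (1 + a)) (U f)" by (rule U_Nle[OF f(2) K])
  have 1: "\<bar>U f y0 - (P ^^ N) f y0\<bar> \<le> \<epsilon> * (1 + a)" using KnD[OF conjunct2[OF Tn_perturb[OF VK K, of N]] y0] by (simp add: \<epsilon>_def)
  have "\<bar>(P ^^ N) (\<lambda>x. f x - 1) y0\<bar> \<le> a"
    by (rule Pn_sup[OF Cb_diff[OF fC Cb_one] _ y0]) (use Nle_osc[OF f(2) _ y0] f(1) in auto)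
  then have "\<bar>(P ^^ N) f y0 - 1\<bar> \<le> a" using Tn_diff[OF Cb_zero fC Cb_one y0, of N] Pn_one[OF y0] by simp
  with 1 show "\<beta> \<le> U f y0" unfolding \<beta>_def by linarith
qed

text \<open>A function vanishing at \<open>y0\<close> has sup norm at most its seminorm, so the
  extra term of \<open>U_Nle\<close> is absorbed and a true contraction remains.\<close>

lemma U_vanishing:
  assumes w: "w y0 = 0" "Nle c w"
  shows "Nle ((\<rho> + \<epsilon>) * c) (U w)" "\<bar>U w y0\<bar> \<le> (1 + \<epsilon>) * c"
proof -
  have K: "Kn c w" by (rule vanishing_Kn[OF w])
  show "Nle ((\<rho> + \<epsilon>) * c) (U w)" using U_Nle[OF w(2) K] by (simp add: algebra_simps)
  show "\<bar>U w y0\<bar> \<le> (1 + \<epsilon>) * c" using KnD[OF conjunct1[OF Tn_perturb[OF VK K, of N]] y0] by (simp add: \<epsilon>_def)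
qed

text \<open>Projective action of \<open>U\<close> on the slice f(y0) = 1; its fixed points are
  eigenfunctions of \<open>U\<close>.\<close>

definition \<Phi> :: "('a \<Rightarrow> real) \<Rightarrow> 'a \<Rightarrow> real" where "\<Phi> f = (\<lambda>x. U f x / U f y0)"

lemma Phi_props:
  assumes f: "f y0 = 1" "Nle a f"
  shows "\<Phi> f y0 = 1" "Nle a (\<Phi> f)"
proof -
  have b: "0 < U f y0" "\<beta> \<le> U f y0" using U_normalized[OF f] perturbation_constants by auto
  then show "\<Phi> f y0 = 1" by (simp add: \<Phi>_def)
  have "Nle (\<bar>1 / U f y0\<bar> * (\<rho> * a + \<epsilon> * (1 + a))) (\<lambda>x. (1 / U f y0) * U f x)"
    by (rule Nle_cmult[OF U_normalized(2)[OF f]])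
  moreover have "\<bar>1 / U f y0\<bar> * (\<rho> * a + \<epsilon> * (1 + a)) \<le> a"
  proof -
    have "\<rho> * a + \<epsilon> * (1 + a) \<le> a * U f y0" using perturbation_constants(8) mult_left_mono[OF b(2), of a] perturbation_constants(2) by linarith
    then show ?thesis using b by (simp add: field_simps)
  qed
  moreover have "\<Phi> f = (\<lambda>x. (1 / U f y0) * U f x)" by (simp add: \<Phi>_def)
  ultimately show "Nle a (\<Phi> f)" by (simp only:) (rule Nle_mono)
qed

text \<open>(U f)(y0) (\<Phi> f - \<Phi> g) = U (f - g) - (U (f - g))(y0) \<Phi> g. Since f - g
  vanishes at \<open>y0\<close>, the first term has factor \<rho> + \<epsilon> and the second (1 +
  \<epsilon>) a; they add up to \<kappa>, and the division is by at least \<beta>.\<close>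

lemma Phi_contr:
  assumes f: "f y0 = 1" "Nle a f" and g: "g y0 = 1" "Nle a g" and c: "Nle c (\<lambda>x. f x - g x)"
  shows "Nle (\<kappa> / \<beta> * c) (\<lambda>x. \<Phi> f x - \<Phi> g x)"
proof -
  have fC: "f \<in> Cb Y" "g \<in> Cb Y" using Nle_Cb f g by auto
  have bf: "0 < U f y0" "\<beta> \<le> U f y0" using U_normalized[OF f] perturbation_constants by auto
  have bg: "0 < U g y0" using U_normalized[OF g] perturbation_constants by auto
  have w: "f y0 - g y0 = 0" using f g by simp
  have Ud: "U (\<lambda>x. f x - g x) x = U f x - U g x" if "x \<in> Y" for x by (rule Tn_diff[OF VC fC that])
  have 1: "Nle ((\<rho> + \<epsilon>) * c) (\<lambda>x. U f x - U g x)"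
    using U_vanishing(1)[OF w c] Nle_cong[of "U (\<lambda>x. f x - g x)" "\<lambda>x. U f x - U g x"] Ud by simp
  have 2: "\<bar>U f y0 - U g y0\<bar> \<le> (1 + \<epsilon>) * c" using U_vanishing(2)[OF w c] Ud[OF y0] by simp
  have c0: "0 \<le> c" using Nle0[OF c] .
  have "Nle (\<bar>U f y0 - U g y0\<bar> * a) (\<lambda>x. (U f y0 - U g y0) * \<Phi> g x)"
    by (rule Nle_cmult[OF Phi_props(2)[OF g]])
  then have "Nle ((1 + \<epsilon>) * c * a) (\<lambda>x. (U f y0 - U g y0) * \<Phi> g x)"
    by (rule Nle_mono) (use 2 perturbation_constants in \<open>auto intro: mult_right_mono\<close>)
  then have "Nle ((\<rho> + \<epsilon>) * c + (1 + \<epsilon>) * c * a) (\<lambda>x. (U f x - U g x) - (U f y0 - U g y0) * \<Phi> g x)"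
    by (rule Nle_diff[OF 1])
  then have "Nle (\<kappa> * c) (\<lambda>x. (U f x - U g x) - (U f y0 - U g y0) * \<Phi> g x)" by (simp add: \<kappa>_def algebra_simps)
  then have "Nle (\<bar>1 / U f y0\<bar> * (\<kappa> * c)) (\<lambda>x. (1 / U f y0) * ((U f x - U g x) - (U f y0 - U g y0) * \<Phi> g x))"
    by (rule Nle_cmult)
  moreover have "(1 / U f y0) * ((U f x - U g x) - (U f y0 - U g y0) * \<Phi> g x) = \<Phi> f x - \<Phi> g x" for x
    using bf bg by (simp add: \<Phi>_def field_simps)
  ultimately have "Nle (\<bar>1 / U f y0\<bar> * (\<kappa> * c)) (\<lambda>x. \<Phi> f x - \<Phi> g x)" by simp
  moreover have "\<bar>1 / U f y0\<bar> * (\<kappa> * c) \<le> \<kappa> / \<beta> * c"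
  proof -
    have "1 / U f y0 \<le> 1 / \<beta>" using bf perturbation_constants by (simp add: frac_le)
    then have "1 / U f y0 * (\<kappa> * c) \<le> 1 / \<beta> * (\<kappa> * c)" using perturbation_constants c0 by (intro mult_right_mono) auto
    then show ?thesis using bf by simp
  qed
  ultimately show ?thesis by (rule Nle_mono)
qed

text \<open>The contraction principle for \<Phi> started at 1, without completeness of a function
  space: the increments are summable at every point, and the bound \<open>Nle a\<close> survives
  pointwise limits.\<close>

lemma eigenfunction_N:
  obtains h where "h y0 = 1" "Nle a h" "\<And>x. x \<in> Y \<Longrightarrow> U h x = U h y0 * h x"
proof -
  define F where "F n = (\<Phi> ^^ n) (\<lambda>_. 1)" for n
  have F: "F n y0 = 1 \<and> Nle a (F n)" for n
  proof (induction n)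
    case 0
    show ?case using Nle_mono[OF Nle_const] perturbation_constants by (simp add: F_def)
  next
    case (Suc n)
    then show ?case using Phi_props[of "F n"] by (simp add: F_def)
  qed
  define q where "q = \<kappa> / \<beta>"
  have q: "0 \<le> q" "q < 1" using perturbation_constants by (auto simp: q_def)
  have D: "Nle (q ^ n * (2 * a)) (\<lambda>x. F (Suc n) x - F n x)" for n
  proof (induction n)
    case 0
    show ?case using Nle_diff[of a "F 1" a "F 0"] F by simp
  next
    case (Suc n)
    have "Nle (\<kappa> / \<beta> * (q ^ n * (2 * a))) (\<lambda>x. \<Phi> (F (Suc n)) x - \<Phi> (F n) x)"
      by (rule Phi_contr) (use F Suc in auto)
    then show ?case by (simp add: F_def q_def algebra_simps)
  qed
  have "convergent (\<lambda>n. F n x)" if x: "x \<in> Y" for x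
  proof -
    have "\<bar>F (Suc n) x - F n x\<bar> \<le> q ^ n * (2 * a)" for n
      using Nle_osc[OF D[of n] x y0] F by simp
    moreover have "summable (\<lambda>n. q ^ n * (2 * a))" using q by (intro summable_mult2 summable_geometric) auto
    ultimately have "summable (\<lambda>n. F (Suc n) x - F n x)"
      by (intro summable_comparison_test[of "\<lambda>n. F (Suc n) x - F n x" "\<lambda>n. q ^ n * (2 * a)"]) auto
    then have "convergent (\<lambda>n. \<Sum>k<n. F (Suc k) x - F k x)" by (simp add: summable_iff_convergent)
    then have "convergent (\<lambda>n. F n x - F 0 x)" by (simp add: sum_lessThan_telescope[of "\<lambda>k. F k x"])
    then have "convergent (\<lambda>n. (F n x - F 0 x) + F 0 x)" by (intro convergent_add convergent_const)
    then show ?thesis by simp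
  qed
  then obtain h where h: "\<And>x. x \<in> Y \<Longrightarrow> (\<lambda>n. F n x) \<longlonglongrightarrow> h x" unfolding convergent_def by metis
  have h1: "h y0 = 1" using LIMSEQ_unique[OF h[OF y0]] F by simp
  have ha: "Nle a h"
    unfolding Nle_def
  proof (intro conjI ballI)
    fix x y assume xy: "x \<in> Y" "y \<in> Y"
    have "(\<lambda>n. \<bar>F n x - F n y\<bar>) \<longlonglongrightarrow> \<bar>h x - h y\<bar>" using xy by (intro tendsto_intros h)
    then show "\<bar>h x - h y\<bar> \<le> a * \<theta> x y"
      by (rule LIMSEQ_le_const2) (use F NleD xy in blast)
  qed (use perturbation_constants in simp)
  have FC: "F n \<in> Cb Y" for n using F Nle_Cb by blast
  have Fb: "\<bar>F n x\<bar> \<le> 1 + a" if "x \<in> Y" for n x using KnD[OF normalized_Kn that] F by blast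
  have UF: "(\<lambda>n. U (F n) x) \<longlonglongrightarrow> U h x" if "x \<in> Y" for x
    by (rule Tn_lim[OF VC FC Nle_Cb[OF ha] Fb h that])
  have "U h x = U h y0 * h x" if x: "x \<in> Y" for x
  proof -
    have "U (F n) x = U (F n) y0 * F (Suc n) x" for n
    proof -
      have "0 < U (F n) y0" using U_normalized(1)[of "F n"] F perturbation_constants by force
      then show ?thesis by (simp add: F_def \<Phi>_def)
    qed
    moreover have "(\<lambda>n. U (F n) y0 * F (Suc n) x) \<longlonglongrightarrow> U h y0 * h x"
      by (intro tendsto_mult UF[OF y0] LIMSEQ_Suc[OF h[OF x]])
    ultimately show ?thesis using LIMSEQ_unique[OF UF[OF x]] by simp
  qed
  with h1 ha show ?thesis using that by blast
qed

lemma U_pow: "(T V ^^ (N * n)) f = (U ^^ n) f"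
  by (simp add: funpow_mult)

text \<open>The deviation of U^n f from the multiple of \<open>h\<close> with the same value at
  \<open>y0\<close> vanishes at \<open>y0\<close>; applying \<open>U\<close> and correcting at
  \<open>y0\<close> again multiplies its seminorm by at most \<kappa>. Since \<kappa> < \<beta>
  \<le> (U h)(y0), this is a spectral gap after normalisation.\<close>

lemma mixing_N:
  assumes h: "h y0 = 1" "Nle a h" "\<And>x. x \<in> Y \<Longrightarrow> U h x = U h y0 * h x" and f: "Nle c f"
  shows "\<exists>C. \<forall>n. \<forall>x\<in>Y. \<bar>(U ^^ n) f x - (U ^^ n) f y0 * h x\<bar> \<le> C * \<kappa> ^ n"
proof -
  define w where "w n x = (U ^^ n) f x - (U ^^ n) f y0 * h x" for n x
  define C where "C = c + \<bar>f y0\<bar> * a"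
  have hC: "h \<in> Cb Y" using Nle_Cb[OF h(2)] .
  have fC: "(U ^^ n) f \<in> Cb Y" for n using Tn_Cb[OF VC Nle_Cb[OF f], of "N * n"] by (simp add: U_pow)
  have wC: "w n \<in> Cb Y" for n unfolding w_def by (rule Cb_diff[OF fC Cb_cmult[OF hC]])
  have w0: "w n y0 = 0" for n by (simp add: w_def h)
  have "Nle (C * \<kappa> ^ n) (w n)" for n
  proof (induction n)
    case 0
    show ?case using Nle_diff[OF f Nle_cmult[OF h(2), of "f y0"]] by (simp add: w_def[abs_def] C_def)
  next
    case (Suc n)
    have dec: "(U ^^ Suc n) f x = U (w n) x + (U ^^ n) f y0 * (U h y0 * h x)" if x: "x \<in> Y" for x
    proof -
      have "U ((U ^^ n) f) x = U (\<lambda>x. w n x + (U ^^ n) f y0 * h x) x" by (rule Tn_cong[OF _ x]) (simp add: w_def)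
      also have "\<dots> = U (w n) x + U (\<lambda>x. (U ^^ n) f y0 * h x) x" by (rule Tn_add[OF VC wC Cb_cmult[OF hC] x])
      also have "U (\<lambda>x. (U ^^ n) f y0 * h x) x = (U ^^ n) f y0 * U h x" by (rule Tn_cmult[OF x])
      finally show ?thesis using h(3)[OF x] by simp
    qed
    have eq: "w (Suc n) x = U (w n) x - U (w n) y0 * h x" if x: "x \<in> Y" for x
      unfolding w_def[of "Suc n"] dec[OF x] dec[OF y0] h(1) by (simp add: algebra_simps)
    define d where "d = C * \<kappa> ^ n"
    have d: "Nle d (w n)" using Suc by (simp add: d_def)
    have "Nle ((\<rho> + \<epsilon>) * d + \<bar>U (w n) y0\<bar> * a) (\<lambda>x. U (w n) x - U (w n) y0 * h x)"
      by (rule Nle_diff[OF U_vanishing(1)[OF w0 d] Nle_cmult[OF h(2)]])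
    then have "Nle (d * \<kappa>) (\<lambda>x. U (w n) x - U (w n) y0 * h x)"
    proof (rule Nle_mono)
      have "\<bar>U (w n) y0\<bar> * a \<le> (1 + \<epsilon>) * d * a" using U_vanishing(2)[OF w0 d] perturbation_constants by (intro mult_right_mono) auto
      then show "(\<rho> + \<epsilon>) * d + \<bar>U (w n) y0\<bar> * a \<le> d * \<kappa>" by (simp add: \<kappa>_def algebra_simps)
    qed
    then show ?case by (simp add: Nle_cong[OF eq] d_def mult_ac)
  qed
  then have "\<bar>w n x\<bar> \<le> C * \<kappa> ^ n" if "x \<in> Y" for n x using KnD[OF vanishing_Kn that] w0 by blast
  then show ?thesis unfolding w_def by blast
qed

text \<open>Averaging the eigenfunction of the \<open>N\<close>-th iterate along \<open>N\<close> steps gives an eigenfunction of \<open>T V\<close>,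
  which by mixing is a multiple of the original one.\<close>

lemma eigenfunction:
  obtains h \<mu> where "0 < \<mu>" "h \<in> Cb Y" "\<And>x. x \<in> Y \<Longrightarrow> 0 < h x" "\<exists>b. Kn b h" "\<And>x. x \<in> Y \<Longrightarrow> T V h x = \<mu> * h x"
    "\<And>c f. Nle c f \<Longrightarrow> \<exists>t. \<forall>e>0. \<exists>n0. \<forall>n\<ge>n0. \<forall>x\<in>Y. \<bar>(T V ^^ (N * n)) f x / \<mu> ^ (N * n) - t n * h x\<bar> \<le> e"
proof -
  obtain h where h: "h y0 = 1" "Nle a h" "\<And>x. x \<in> Y \<Longrightarrow> U h x = U h y0 * h x" using eigenfunction_N by blast
  define l where "l = U h y0"
  have lb: "\<beta> \<le> l" unfolding l_def by (rule U_normalized(1)[OF h(1,2)])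
  have l0: "0 < l" using lb perturbation_constants by simp
  have kl: "\<kappa> < l" using lb perturbation_constants by simp
  have hC: "h \<in> Cb Y" using Nle_Cb[OF h(2)] .
  have hpos: "0 < h x" if "x \<in> Y" for x using Nle_osc[OF h(2) that y0] h(1) perturbation_constants by linarith
  define \<mu> where "\<mu> = exp (ln l / N)"
  have mu0: "0 < \<mu>" by (simp add: \<mu>_def)
  have muN: "\<mu> ^ N = l" unfolding \<mu>_def using N1 l0 by (simp flip: exp_of_nat_mult)
  have mix: "\<exists>C. \<forall>n. \<forall>x\<in>Y. \<bar>(U ^^ n) f x / l ^ n - (U ^^ n) f y0 / l ^ n * h x\<bar> \<le> C * (\<kappa> / l) ^ n" if f: "Nle c f" for c f
  proof -
    obtain C where C: "\<And>n x. x \<in> Y \<Longrightarrow> \<bar>(U ^^ n) f x - (U ^^ n) f y0 * h x\<bar> \<le> C * \<kappa> ^ n" using mixing_N[OF h f] by blast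
    have "\<bar>(U ^^ n) f x / l ^ n - (U ^^ n) f y0 / l ^ n * h x\<bar> \<le> C * (\<kappa> / l) ^ n" if x: "x \<in> Y" for n x
    proof -
      have "(U ^^ n) f x / l ^ n - (U ^^ n) f y0 / l ^ n * h x = ((U ^^ n) f x - (U ^^ n) f y0 * h x) / l ^ n"
        by (simp add: diff_divide_distrib)
      also have "\<bar>\<dots>\<bar> = \<bar>(U ^^ n) f x - (U ^^ n) f y0 * h x\<bar> / l ^ n" using l0 by simp
      also have "\<dots> \<le> C * \<kappa> ^ n / l ^ n" using C[OF x, of n] l0 by (intro divide_right_mono) auto
      finally show ?thesis by (simp add: power_divide)
    qed
    then show ?thesis by blast
  qed
  have kl1: "0 \<le> \<kappa> / l" "\<kappa> / l < 1" using perturbation_constants kl l0 by auto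
  have geo: "(\<lambda>n. C * (\<kappa> / l) ^ n) \<longlonglongrightarrow> 0" for C
    using tendsto_mult_right_zero[OF LIMSEQ_power_zero[of "\<kappa> / l"]] kl1 by simp
  define h' where "h' x = (\<Sum>j<N. (1 / \<mu>) ^ j * (T V ^^ j) h x)" for x
  have TC: "(T V ^^ j) h \<in> Cb Y" for j by (rule Tn_Cb[OF VC hC])
  have h'C: "h' \<in> Cb Y" unfolding h'_def by (rule Cb_sum[OF Cb_cmult[OF TC]])
  have Th': "T V h' x = \<mu> * h' x" if x: "x \<in> Y" for x
  proof -
    define s where "s j = (1 / \<mu>) ^ j * (T V ^^ j) h x" for j
    have "T V h' x = (\<Sum>j<N. T V (\<lambda>x. (1 / \<mu>) ^ j * (T V ^^ j) h x) x)"
      unfolding h'_def by (rule T_sum[OF VC Cb_cmult[OF TC] x])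
    also have "\<dots> = (\<Sum>j<N. \<mu> * s (Suc j))"
    proof (intro sum.cong refl)
      fix j
      have "T V (\<lambda>x. (1 / \<mu>) ^ j * (T V ^^ j) h x) x = (1 / \<mu>) ^ j * T V ((T V ^^ j) h) x" by (rule T_cmult)
      also have "\<dots> = \<mu> * s (Suc j)" using mu0 by (simp add: s_def)
      finally show "T V (\<lambda>x. (1 / \<mu>) ^ j * (T V ^^ j) h x) x = \<mu> * s (Suc j)" .
    qed
    also have "\<dots> = \<mu> * (\<Sum>j<N. s (Suc j))" by (simp add: sum_distrib_left)
    also have "(\<Sum>j<N. s (Suc j)) = (\<Sum>j<N. s j) + s N - s 0"
      using sum.lessThan_Suc_shift[of s N] by simp
    \<comment> \<open>The telescoping sum closes because \<open>h\<close> is an eigenfunction of the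
      \<open>N\<close>-th iterate with eigenvalue \<mu>^N.\<close>
    also have "s N = s 0" using h(3)[OF x] muN l0 by (simp add: s_def l_def power_one_over)
    finally show ?thesis by (simp add: h'_def[of x] s_def)
  qed
  have "\<exists>b. Kn b (\<lambda>x. \<Sum>j<n. (1 / \<mu>) ^ j * (T V ^^ j) h x)" for n
  proof (induction n)
    case 0
    show ?case by (rule exI[of _ 0]) (simp add: Kn_def Nle_const)
  next
    case (Suc n)
    then obtain b where b: "Kn b (\<lambda>x. \<Sum>j<n. (1 / \<mu>) ^ j * (T V ^^ j) h x)" by blast
    obtain b' where b': "Kn b' ((T V ^^ n) h)" using Tn_perturb[OF VK normalized_Kn[OF h(1,2)], of n] by blast
    have "Kn (1 * \<bar>(1 / \<mu>) ^ n\<bar>) (\<lambda>_. (1 / \<mu>) ^ n)" by (simp add: Kn_def Nle_def th0)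
    from Kn_add[OF b Kn_mult[OF this b']] show ?case by auto
  qed
  then obtain b where b: "Kn b h'" unfolding h'_def[abs_def] by blast
  have Uh': "(U ^^ n) h' x = l ^ n * h' x" if x: "x \<in> Y" for n x
  proof -
    have "(T V ^^ k) h' x = \<mu> ^ k * h' x" if x: "x \<in> Y" for k x
      using x
    proof (induction k arbitrary: x)
      case (Suc k)
      have "T V ((T V ^^ k) h') x = T V (\<lambda>x. \<mu> ^ k * h' x) x" by (rule T_cong[OF _ Suc.prems]) (rule Suc.IH)
      then show ?case using Th'[OF Suc.prems] by (simp add: T_cmult)
    qed simp
    from this[OF x, of "N * n"] show ?thesis by (simp add: U_pow power_mult muN)
  qed
  \<comment> \<open>After division by l^n the left-hand side of the mixing bound for
    \<open>h'\<close> no longer depends on n, so the decaying right-hand side forces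
    equality.\<close>
  have hh': "h' x = h' y0 * h x" if x: "x \<in> Y" for x
  proof -
    obtain C where C: "\<And>n x. x \<in> Y \<Longrightarrow> \<bar>(U ^^ n) h' x / l ^ n - (U ^^ n) h' y0 / l ^ n * h x\<bar> \<le> C * (\<kappa> / l) ^ n"
      using mix[OF KnN[OF b]] by blast
    have "\<bar>h' x - h' y0 * h x\<bar> \<le> C * (\<kappa> / l) ^ n" for n
      using C[OF x, of n] l0 by (simp add: Uh'[OF x] Uh'[OF y0])
    then have "\<bar>h' x - h' y0 * h x\<bar> \<le> 0" by (intro LIMSEQ_le_const[OF geo]) auto
    then show ?thesis by simp
  qed
  have h'0: "0 < h' y0"
    unfolding h'_def
  proof (rule sum_pos2[of _ 0])
    show "0 \<le> (1 / \<mu>) ^ j * (T V ^^ j) h y0" for j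
    proof -
      have "(T V ^^ j) (\<lambda>_. 0) y0 \<le> (T V ^^ j) h y0"
        by (rule Tn_mono[OF VC Cb_zero hC _ y0]) (use hpos in \<open>auto intro: less_imp_le\<close>)
      moreover have "(T V ^^ j) (\<lambda>x. 0 * 1) y0 = 0 * (T V ^^ j) (\<lambda>_. 1) y0" by (rule Tn_cmult[OF y0])
      ultimately show ?thesis using mu0 by simp
    qed
  qed (use N1 h(1) in auto)
  show ?thesis
  proof (rule that[OF mu0 hC hpos])
    show "\<exists>b. Kn b h" using normalized_Kn[OF h(1,2)] by blast
    fix x assume x: "x \<in> Y"
    have "h' y0 * T V h x = T V (\<lambda>x. h' y0 * h x) x" by (simp add: T_cmult)
    also have "\<dots> = T V h' x" by (rule T_cong[OF _ x]) (simp add: hh')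
    also have "\<dots> = h' y0 * (\<mu> * h x)" using Th'[OF x] hh'[OF x] by simp
    finally show "T V h x = \<mu> * h x" using h'0 by simp
  next
    fix c f assume "Nle c f"
    from mix[OF this] obtain C where C: "\<And>n x. x \<in> Y \<Longrightarrow> \<bar>(U ^^ n) f x / l ^ n - (U ^^ n) f y0 / l ^ n * h x\<bar> \<le> C * (\<kappa> / l) ^ n" by blast
    show "\<exists>t. \<forall>e>0. \<exists>n0. \<forall>n\<ge>n0. \<forall>x\<in>Y. \<bar>(T V ^^ (N * n)) f x / \<mu> ^ (N * n) - t n * h x\<bar> \<le> e"
    proof (intro exI[of _ "\<lambda>n. (U ^^ n) f y0 / l ^ n"] allI impI)
      fix e :: real assume "0 < e"
      then have "eventually (\<lambda>n. C * (\<kappa> / l) ^ n < e) sequentially" using order_tendstoD(2)[OF geo] by blast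
      then obtain n0 where "\<And>n. n \<ge> n0 \<Longrightarrow> C * (\<kappa> / l) ^ n < e" by (auto simp: eventually_sequentially)
      then have "\<bar>(T V ^^ (N * n)) f x / \<mu> ^ (N * n) - (U ^^ n) f y0 / l ^ n * h x\<bar> \<le> e" if "n \<ge> n0" "x \<in> Y" for n x
        using C[OF that(2), of n] that(1) unfolding U_pow power_mult muN by (meson less_imp_le order_trans)
      then show "\<exists>n0. \<forall>n\<ge>n0. \<forall>x\<in>Y. \<bar>(T V ^^ (N * n)) f x / \<mu> ^ (N * n) - (U ^^ n) f y0 / l ^ n * h x\<bar> \<le> e"
        by blast
    qed
  qed
qed

end

section \<open>Uniqueness of equilibrium states\<close>

context rds_cpt begin

text \<open>Orbits starting in \<open>Y\<close> stay there, so attraction is trivial and the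
  variational formula becomes available on \<open>Y\<close> alone.\<close>

lemma attracted_self: "attracted M \<xi> S Y Y"
proof unfold_locales
  fix e :: real assume "0 < e"
  then show "\<exists>n0. \<forall>n\<ge>n0. \<forall>x\<in>Y. \<forall>\<zeta>. infdist (orbit S x \<zeta> n) Y < e"
    using OZ by auto
qed (rule order_refl)

text \<open>On the compact set \<open>Y\<close> a positive eigenfunction lies between two positive
  constants, so T^n 1 is comparable with \<mu>^n.\<close>

lemma eigen_lam:
  assumes V: "V \<in> Cb Y" and h: "h \<in> Cb Y" "\<And>x. x \<in> Y \<Longrightarrow> 0 < h x" and mu: "0 < \<mu>" and eig: "\<And>x. x \<in> Y \<Longrightarrow> T V h x = \<mu> * h x"
  shows "lam V = ln \<mu>" "\<exists>c>0. \<forall>n. \<forall>y\<in>Y. c * \<mu> ^ n \<le> (T V ^^ n) (\<lambda>_. 1) y"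
proof -
  have Tnh: "(T V ^^ n) h x = \<mu> ^ n * h x" if "x \<in> Y" for n x
    using that
  proof (induction n arbitrary: x)
    case (Suc n)
    have "T V ((T V ^^ n) h) x = T V (\<lambda>x. \<mu> ^ n * h x) x" by (rule T_cong[OF _ Suc.prems]) (rule Suc.IH)
    then show ?case using eig[OF Suc.prems] by (simp add: T_cmult)
  qed simp
  obtain a where a: "a \<in> Y" "\<And>y. y \<in> Y \<Longrightarrow> h y \<le> h a" using continuous_attains_sup[OF compactY Zne Cb_cont[OF h(1)]] by blast
  obtain m K where m: "0 < m" "\<And>y. y \<in> Y \<Longrightarrow> m \<le> h y" "\<And>y. y \<in> Y \<Longrightarrow> h y \<le> K" using pos_bounds[OF Cb_cont[OF h(1)] h(2)] by metis
  have low: "\<mu> ^ n * h y \<le> h a * (T V ^^ n) (\<lambda>_. 1) y" if y: "y \<in> Y" for n y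
  proof -
    have "(T V ^^ n) h y \<le> (T V ^^ n) (\<lambda>x. h a * 1) y"
      by (rule Tn_mono[OF V h(1) _ _ y]) (use a Cb_const in auto)
    then show ?thesis using Tnh[OF y, of n] Tn_cmult[OF y, of n V "h a" "\<lambda>_. 1"] by simp
  qed
  show "lam V = ln \<mu>"
  proof (rule antisym)
    show "lam V \<le> ln \<mu>" by (rule lam_le_super[OF V Cb_cont[OF h(1)] h(2)]) (use eig mu in auto)
    show "ln \<mu> \<le> lam V"
      unfolding lam_def
    proof (rule cINF_greatest)
      fix n :: nat assume "n \<in> {1..}"
      then have n: "n \<ge> 1" by simp
      have "\<mu> ^ n * h a \<le> h a * (T V ^^ n) (\<lambda>_. 1) a" by (rule low[OF a(1)])
      then have "\<mu> ^ n \<le> (T V ^^ n) (\<lambda>_. 1) a" using h(2)[OF a(1)] by (simp add: mult.commute)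
      then have "\<mu> ^ n \<le> maxT V n" using maxT_upper[OF V a(1), of n] by simp
      then have "ln (\<mu> ^ n) \<le> ln (maxT V n)" using mu maxT_pos[OF V, of n] by simp
      then show "ln \<mu> \<le> ln (maxT V n) / real n" using n mu by (simp add: ln_realpow field_simps)
    qed auto
  qed
  have ha: "0 < h a" using h(2)[OF a(1)] .
  show "\<exists>c>0. \<forall>n. \<forall>y\<in>Y. c * \<mu> ^ n \<le> (T V ^^ n) (\<lambda>_. 1) y"
  proof (intro exI[of _ "m / h a"] conjI allI ballI)
    fix n y assume y: "y \<in> Y"
    have "\<mu> ^ n * m \<le> \<mu> ^ n * h y" using m(2)[OF y] mu by (intro mult_left_mono) auto
    also have "\<dots> \<le> h a * (T V ^^ n) (\<lambda>_. 1) y" by (rule low[OF y])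
    finally show "m / h a * \<mu> ^ n \<le> (T V ^^ n) (\<lambda>_. 1) y" using ha by (simp add: field_simps)
  qed (use m ha in simp)
qed

text \<open>A quadratic that vanishes at 0 and is nonnegative nearby has zero derivative there; the
  test value is s = - D t with \<open>t\<close> small.\<close>

lemma zero_slope:
  fixes D C r :: real
  assumes "0 < r" "0 \<le> C" "\<And>s. \<bar>s\<bar> \<le> r \<Longrightarrow> 0 \<le> s * D + C * s\<^sup>2"
  shows "D = 0"
proof (rule ccontr)
  assume D: "D \<noteq> 0"
  define t where "t = min (r / \<bar>D\<bar>) (1 / (2 * (C + 1)))"
  have t: "0 < t" using assms D by (auto simp: t_def)
  have "\<bar>- D * t\<bar> = \<bar>D\<bar> * t" using t by (simp add: abs_mult)
  also have "\<dots> \<le> \<bar>D\<bar> * (r / \<bar>D\<bar>)" by (intro mult_left_mono) (auto simp: t_def)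
  also have "\<dots> = r" using D by simp
  finally have "0 \<le> (- D * t) * D + C * (- D * t)\<^sup>2" by (rule assms(3))
  also have "\<dots> = (D\<^sup>2 * t) * (C * t - 1)" by (simp add: algebra_simps power2_eq_square)
  finally have prod: "0 \<le> (D\<^sup>2 * t) * (C * t - 1)" .
  have "0 \<le> C * t - 1"
  proof (rule ccontr)
    assume "\<not> ?thesis"
    moreover have "0 < D\<^sup>2 * t" using D t by simp
    ultimately have "(D\<^sup>2 * t) * (C * t - 1) < 0" by (intro mult_pos_neg) auto
    with prod show False by simp
  qed
  moreover have "C * t \<le> C * (1 / (2 * (C + 1)))" using assms(2) by (intro mult_left_mono) (auto simp: t_def)
  moreover have "C * (1 / (2 * (C + 1))) < 1" using assms(2) by (simp add: field_simps)
  ultimately show False by linarith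
qed

text \<open>Differentiating the variational inequality at \<open>f = exp V * h * (1 + s k)\<close> in \<open>s\<close> shows that an
  equilibrium state is invariant for the Doob transform of \<open>T V\<close>.\<close>

lemma equilibrium_invariant:
  assumes V: "V \<in> Cb Y" and h: "h \<in> Cb Y" "\<And>x. x \<in> Y \<Longrightarrow> 0 < h x" and mu: "0 < \<mu>" and eig: "\<And>x. x \<in> Y \<Longrightarrow> T V h x = \<mu> * h x"
    and s: "\<sigma> \<in> probs Y" and rate: "rate M \<xi> S Y \<sigma> \<le> ereal ((LINT x:Y|\<sigma>. V x) - lam V)" and k: "k \<in> Cb Y"
  shows "(LINT x:Y|\<sigma>. T V (\<lambda>y. h y * k y) x / (\<mu> * h x)) = (LINT x:Y|\<sigma>. k x)"
proof -
  interpret A: attracted M \<xi> S Y Y by (rule attracted_self)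
  have lam: "lam V = ln \<mu>" by (rule eigen_lam(1)[OF V h mu eig])
  obtain B where B: "0 \<le> B" "\<And>x. x \<in> Y \<Longrightarrow> \<bar>k x\<bar> \<le> B" using CbE[OF k] by metis
  define K where "K x = T V (\<lambda>y. h y * k y) x / (\<mu> * h x)" for x
  have hk: "(\<lambda>y. h y * k y) \<in> Cb Y" by (rule Cb_mult[OF h(1) k])
  have KC: "K \<in> Cb Y" unfolding Cb_iff K_def
    using Cb_cont[OF T_Cb[OF V hk]] Cb_cont[OF h(1)] h(2) mu by (intro continuous_intros) force+
  have KT: "T V (\<lambda>y. h y * k y) x = \<mu> * h x * K x" if "x \<in> Y" for x using h(2)[OF that] mu by (simp add: K_def)
  \<comment> \<open>\<open>K\<close> is an average of \<open>k\<close> under the Doob transform and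
    therefore obeys the same bound.\<close>
  have KB: "\<bar>K x\<bar> \<le> B" if x: "x \<in> Y" for x
  proof -
    have "T V (\<lambda>y. h y * k y) x \<le> T V (\<lambda>y. B * h y) x"
      by (rule T_mono[OF V hk Cb_cmult[OF h(1)] _ x]) (use B h in \<open>auto simp: abs_le_iff mult.commute intro!: mult_right_mono less_imp_le\<close>)
    moreover have "T V (\<lambda>y. (- B) * h y) x \<le> T V (\<lambda>y. h y * k y) x"
    proof (rule T_mono[OF V Cb_cmult[OF h(1)] hk _ x])
      fix y assume y: "y \<in> Y"
      have "- B \<le> k y" using B(2)[OF y] by (simp add: abs_le_iff)
      then show "- B * h y \<le> h y * k y" using mult_right_mono[of "- B" "k y" "h y"] h(2)[OF y] by (simp add: mult.commute)
    qed
    ultimately have "\<mu> * h x * K x \<le> \<mu> * h x * B" "\<mu> * h x * (- B) \<le> \<mu> * h x * K x"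
      using eig[OF x] unfolding T_cmult KT[OF x] by (simp_all add: algebra_simps)
    moreover have "0 < \<mu> * h x" using mu h(2)[OF x] by simp
    ultimately have "K x \<le> B" "- B \<le> K x" by (meson mult_le_cancel_left_pos)+
    then show ?thesis by (simp add: abs_le_iff)
  qed
  define D where "D = (LINT x:Y|\<sigma>. K x) - (LINT x:Y|\<sigma>. k x)"
  have int: "set_integrable \<sigma> Y f" if "f \<in> Cb Y" for f :: "'a \<Rightarrow> real" using that Cb_integrable[OF s _ closedZ] by (simp add: Cb_def)
  have "D = 0"
  proof (rule zero_slope)
    \<comment> \<open>This range of \<open>t\<close> keeps |t k| and |t K| at most 1/2, where 1 + t
      k is positive and ln (1 + u) \<ge> u - 2 u^2 holds; that inequality produces the constant 2
      B^2.\<close>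
    show "0 < 1 / (2 * (B + 1))" "0 \<le> 2 * B\<^sup>2" using B by auto
    fix t :: real assume t: "\<bar>t\<bar> \<le> 1 / (2 * (B + 1))"
    have small: "\<bar>t * u\<bar> \<le> 1/2 \<and> (t * u)\<^sup>2 \<le> B\<^sup>2 * t\<^sup>2" if "\<bar>u\<bar> \<le> B" for u
    proof
      have "\<bar>t * u\<bar> \<le> 1 / (2 * (B + 1)) * B" unfolding abs_mult using that t B by (intro mult_mono) auto
      also have "\<dots> \<le> 1/2" using B by (simp add: field_simps)
      finally show "\<bar>t * u\<bar> \<le> 1/2" .
      have "u\<^sup>2 \<le> B\<^sup>2" using that B by (simp add: abs_le_square_iff[symmetric])
      then show "(t * u)\<^sup>2 \<le> B\<^sup>2 * t\<^sup>2" by (simp add: power_mult_distrib mult.commute[of "B\<^sup>2"] mult_left_mono)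
    qed
    define g where "g y = 1 + t * k y" for y
    define f where "f y = exp (V y) * (h y * g y)" for y
    have g0: "0 < g y" if "y \<in> Y" for y using small[OF B(2)[OF that]] unfolding g_def by (auto simp: abs_le_iff)
    have K0: "0 < 1 + t * K y" if "y \<in> Y" for y using small[OF KB[OF that]] by (auto simp: abs_le_iff)
    have gC: "g \<in> Cb Y" unfolding g_def by (rule Cb_add[OF Cb_one Cb_cmult[OF k]])
    have fC: "f \<in> Cb Y" unfolding f_def by (rule Cb_mult[OF Cb_exp[OF V] Cb_mult[OF h(1) gC]])
    have f: "f \<in> Cpos Y" using Cb_cont[OF fC] g0 h(2) by (auto simp: Cpos_def f_def)
    have Tf: "T (\<lambda>_. 0) f x = \<mu> * h x * (1 + t * K x)" if x: "x \<in> Y" for x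
    proof -
      have "T (\<lambda>_. 0) f x = T V (\<lambda>y. h y + t * (h y * k y)) x" by (simp add: TV_def f_def g_def algebra_simps)
      also have "\<dots> = T V h x + t * T V (\<lambda>y. h y * k y) x"
        unfolding T_add[OF V h(1) Cb_cmult[OF hk] x] T_cmult ..
      finally show ?thesis unfolding eig[OF x] KT[OF x] by (simp add: algebra_simps)
    qed
    define r where "r = (\<lambda>y. ln (markov_op M \<xi> S Y f y / f y))"
    \<comment> \<open>\<open>h\<close> cancels in log (Pf / f) because Pf = \<mu> h (1 + t K). What
      remains is ln \<mu> - V and the difference of two logarithms, estimated to second order in
      \<open>t\<close>.\<close>
    have rle: "r x \<le> (ln \<mu> - V x) + (t * (K x - k x) + 2 * (B\<^sup>2 * t\<^sup>2))" if x: "x \<in> Y" for x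
    proof -
      have hx: "0 < h x" using h(2)[OF x] .
      have "r x = ln (\<mu> * h x * (1 + t * K x)) - ln (exp (V x) * (h x * g x))"
        unfolding r_def A.Cpos_ratio(4)[OF f x] Tf[OF x] by (simp add: f_def)
      also have "ln (\<mu> * h x * (1 + t * K x)) = ln \<mu> + ln (h x) + ln (1 + t * K x)" using mu hx K0[OF x] by (simp add: ln_mult_pos)
      also have "ln (exp (V x) * (h x * g x)) = V x + (ln (h x) + ln (g x))" using hx g0[OF x] by (simp add: ln_mult_pos)
      finally have "r x = ln \<mu> + ln (1 + t * K x) - V x - ln (1 + t * k x)" by (simp add: g_def)
      moreover have "ln (1 + t * K x) \<le> t * K x" using ln_le_minus_one[OF K0[OF x]] by simp
      moreover have "t * k x - 2 * (t * k x)\<^sup>2 \<le> ln (1 + t * k x)"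
        using abs_ln_one_plus_x_minus_x_bound[of "t * k x"] small[OF B(2)[OF x]] by (auto simp: abs_le_iff)
      moreover have "(t * k x)\<^sup>2 \<le> B\<^sup>2 * t\<^sup>2" using small[OF B(2)[OF x]] by simp
      ultimately show ?thesis by (simp add: right_diff_distrib)
    qed
    have rC: "r \<in> Cb Y" unfolding Cb_iff r_def by (rule A.Cpos_ratio(3)[OF f])
    have c1: "(\<lambda>x. ln \<mu> - V x) \<in> Cb Y" by (rule Cb_diff[OF Cb_const V])
    have c2: "(\<lambda>x. t * (K x - k x)) \<in> Cb Y" by (rule Cb_cmult[OF Cb_diff[OF KC k]])
    have "(LINT x:Y|\<sigma>. r x) \<le> (LINT x:Y|\<sigma>. (ln \<mu> - V x) + (t * (K x - k x) + 2 * (B\<^sup>2 * t\<^sup>2)))"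
      by (rule set_integral_mono[OF int[OF rC] int[OF Cb_add[OF c1 Cb_add[OF c2 Cb_const]]]]) (rule rle)
    also have "\<dots> = (LINT x:Y|\<sigma>. ln \<mu> - V x) + ((LINT x:Y|\<sigma>. t * (K x - k x)) + (LINT x:Y|\<sigma>. 2 * (B\<^sup>2 * t\<^sup>2)))"
      unfolding set_integral_add(2)[OF int[OF c1] int[OF Cb_add[OF c2 Cb_const]]] set_integral_add(2)[OF int[OF c2] int[OF Cb_const]] ..
    also have "(LINT x:Y|\<sigma>. ln \<mu> - V x) = ln \<mu> - (LINT x:Y|\<sigma>. V x)"
      unfolding set_integral_diff(2)[OF int[OF Cb_const] int[OF V]] set_integral_probs_const[OF s] ..
    also have "(LINT x:Y|\<sigma>. t * (K x - k x)) = t * D"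
      using set_integral_diff(2)[OF int[OF KC] int[OF k]] by (simp add: D_def)
    finally have up: "(LINT x:Y|\<sigma>. r x) \<le> ln \<mu> - (LINT x:Y|\<sigma>. V x) + (t * D + 2 * (B\<^sup>2 * t\<^sup>2))"
      by (simp add: set_integral_probs_const[OF s])
    have "(INF f\<in>Cpos Y. ereal (LINT x:Y|\<sigma>. ln (markov_op M \<xi> S Y f x / f x))) \<le> ereal (LINT x:Y|\<sigma>. r x)"
      unfolding r_def by (rule INF_lower[OF f])
    then have "- ereal (LINT x:Y|\<sigma>. r x) \<le> rate M \<xi> S Y \<sigma>"
      using s unfolding rate_def by (simp only: if_True ereal_minus_le_minus)
    also note rate
    finally have "- (LINT x:Y|\<sigma>. r x) \<le> (LINT x:Y|\<sigma>. V x) - ln \<mu>" by (simp add: lam)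
    with up show "0 \<le> t * D + 2 * B\<^sup>2 * t\<^sup>2" by simp
  qed
  then show ?thesis by (simp add: D_def K_def)
qed

lemma equilibrium_invariant_iterate:
  assumes V: "V \<in> Cb Y" and h: "h \<in> Cb Y" "\<And>x. x \<in> Y \<Longrightarrow> 0 < h x" and mu: "0 < \<mu>" and eig: "\<And>x. x \<in> Y \<Longrightarrow> T V h x = \<mu> * h x"
    and s: "\<sigma> \<in> probs Y" and rate: "rate M \<xi> S Y \<sigma> \<le> ereal ((LINT x:Y|\<sigma>. V x) - lam V)" and k: "k \<in> Cb Y"
  shows "(LINT x:Y|\<sigma>. (T V ^^ n) (\<lambda>y. h y * k y) x / (\<mu> ^ n * h x)) = (LINT x:Y|\<sigma>. k x)"
proof (induction n)
  case 0
  show ?case by (rule set_integral_probs_cong) (use h(2) in force)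
next
  case (Suc n)
  have hk: "(\<lambda>y. h y * k y) \<in> Cb Y" by (rule Cb_mult[OF h(1) k])
  define kn where "kn x = (T V ^^ n) (\<lambda>y. h y * k y) x / (\<mu> ^ n * h x)" for x
  have knC: "kn \<in> Cb Y" unfolding Cb_iff kn_def
    using Cb_cont[OF Tn_Cb[OF V hk]] Cb_cont[OF h(1)] h(2) mu by (intro continuous_intros) force+
  have "(LINT x:Y|\<sigma>. (T V ^^ Suc n) (\<lambda>y. h y * k y) x / (\<mu> ^ Suc n * h x)) = (LINT x:Y|\<sigma>. T V (\<lambda>y. h y * kn y) x / (\<mu> * h x))"
  proof (rule set_integral_probs_cong)
    fix x assume x: "x \<in> Y"
    have "T V ((T V ^^ n) (\<lambda>y. h y * k y)) x = T V (\<lambda>y. \<mu> ^ n * (h y * kn y)) x"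
      by (rule T_cong[OF _ x]) (use h(2) mu in \<open>force simp: kn_def\<close>)
    then show "(T V ^^ Suc n) (\<lambda>y. h y * k y) x / (\<mu> ^ Suc n * h x) = T V (\<lambda>y. h y * kn y) x / (\<mu> * h x)"
      using mu by (simp add: T_cmult)
  qed
  also have "\<dots> = (LINT x:Y|\<sigma>. kn x)" by (rule equilibrium_invariant[OF V h mu eig s rate knC])
  finally show ?case using Suc by (simp add: kn_def)
qed

end

context contraction begin

text \<open>The threshold comes from continuity of (1 + 6 \<eta>)^N at \<eta> = 0, and only the
  seminorm of the potential has to be small.\<close>

lemma eigen_data:
  "\<exists>\<eta>>0. \<forall>V. Nle \<eta> V \<longrightarrow> (\<exists>h \<mu>. 0 < \<mu> \<and> h \<in> Cb Y \<and> (\<forall>x\<in>Y. 0 < h x) \<and> (\<exists>b. Kn b h) \<and> (\<forall>x\<in>Y. T V h x = \<mu> * h x) \<and>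
    (\<forall>c f. Nle c f \<longrightarrow> (\<exists>t. \<forall>e>0. \<exists>n0. \<forall>n\<ge>n0. \<forall>x\<in>Y. \<bar>(T V ^^ (N * n)) f x / \<mu> ^ (N * n) - t n * h x\<bar> \<le> e)))"
proof -
  obtain y0 where y0: "y0 \<in> Y" using Zne by auto
  have "((\<lambda>\<eta>::real. (1 + 6 * \<eta>) ^ N - 1) \<longlongrightarrow> (1 + 6 * 0) ^ N - 1) (at_right 0)" by (intro tendsto_intros)
  moreover have "(0::real) < (1 - \<rho>)\<^sup>2 / 64" using rho by simp
  ultimately have "eventually (\<lambda>\<eta>::real. (1 + 6 * \<eta>) ^ N - 1 < (1 - \<rho>)\<^sup>2 / 64) (at_right 0)"
    by (intro order_tendstoD(2)[of _ "(1 + 6 * 0) ^ N - 1"]) auto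
  then obtain b where b: "0 < b" "\<And>\<eta>::real. 0 < \<eta> \<Longrightarrow> \<eta> < b \<Longrightarrow> (1 + 6 * \<eta>) ^ N - 1 < (1 - \<rho>)\<^sup>2 / 64"
    unfolding eventually_at_right_field by auto
  define \<eta> where "\<eta> = min 1 (b / 2)"
  have eta: "0 < \<eta>" "\<eta> \<le> 1" "\<eta> < b" using b(1) by (auto simp: \<eta>_def)
  have "\<exists>h \<mu>. 0 < \<mu> \<and> h \<in> Cb Y \<and> (\<forall>x\<in>Y. 0 < h x) \<and> (\<exists>b. Kn b h) \<and> (\<forall>x\<in>Y. T V h x = \<mu> * h x) \<and>
    (\<forall>c f. Nle c f \<longrightarrow> (\<exists>t. \<forall>e>0. \<exists>n0. \<forall>n\<ge>n0. \<forall>x\<in>Y. \<bar>(T V ^^ (N * n)) f x / \<mu> ^ (N * n) - t n * h x\<bar> \<le> e))"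
    if V: "Nle \<eta> V" for V
  proof -
    \<comment> \<open>Subtracting the constant V(y0) makes the sup norm bounded by the seminorm. It
      multiplies the operator by a constant, so \<open>h\<close> is unchanged and only \<mu> is
      rescaled.\<close>
    define W where "W x = V x - V y0" for x
    have W: "Kn \<eta> W" using V Nle_osc[OF V _ y0] unfolding Kn_def Nle_def W_def by auto
    interpret pt: perturbed M \<xi> S Y \<theta> \<rho> N W \<eta> y0
      using W eta b(2)[OF eta(1,3)] y0 by unfold_locales auto
    obtain h \<mu> where h: "0 < \<mu>" "h \<in> Cb Y" "\<And>x. x \<in> Y \<Longrightarrow> 0 < h x" "\<exists>b. Kn b h" "\<And>x. x \<in> Y \<Longrightarrow> T W h x = \<mu> * h x"
      "\<And>c f. Nle c f \<Longrightarrow> \<exists>t. \<forall>e>0. \<exists>n0. \<forall>n\<ge>n0. \<forall>x\<in>Y. \<bar>(T W ^^ (N * n)) f x / \<mu> ^ (N * n) - t n * h x\<bar> \<le> e"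
      by (rule pt.eigenfunction, rule that, assumption+)
    define v where "v = exp (V y0)"
    have v0: "0 < v" by (simp add: v_def)
    have TVW: "T V f x = v * T W f x" for f x
      unfolding TV_def v_def by (simp flip: integral_mult_right_zero) (simp add: W_def exp_diff)
    have TVWn: "(T V ^^ n) f x = v ^ n * (T W ^^ n) f x" if "x \<in> Y" for n f x
      using that
    proof (induction n arbitrary: x)
      case (Suc n)
      have "T V ((T V ^^ n) f) x = T V (\<lambda>x. v ^ n * (T W ^^ n) f x) x" by (rule T_cong[OF _ Suc.prems]) (rule Suc.IH)
      also have "\<dots> = v ^ n * T V ((T W ^^ n) f) x" by (rule T_cmult)
      also have "T V ((T W ^^ n) f) x = v * T W ((T W ^^ n) f) x" by (rule TVW)
      finally show ?case by simp
    qed simp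
    have "(T V ^^ n) f x / (v * \<mu>) ^ n = (T W ^^ n) f x / \<mu> ^ n" if "x \<in> Y" for n f x
      using v0 TVWn[OF that] by (simp add: power_mult_distrib)
    then show ?thesis
      using h v0 TVW by (intro exI[of _ h] exI[of _ "v * \<mu>"]) (simp add: mult.assoc)
  qed
  with eta(1) show ?thesis by blast
qed

text \<open>Interpolation: a difference bounded both by d and by L dist is at most the geometric
  mean sqrt(d L) sqrt(dist), and \<theta> dominates sqrt(dist) up to distance 1. For fixed L the
  seminorm thus tends to 0 with the oscillation d.\<close>

lemma lipschitz_Nle:
  assumes lip: "\<And>x y. x \<in> Y \<Longrightarrow> y \<in> Y \<Longrightarrow> \<bar>f x - f y\<bar> \<le> L * dist x y"
    and osc: "\<And>x y. x \<in> Y \<Longrightarrow> y \<in> Y \<Longrightarrow> \<bar>f x - f y\<bar> \<le> d"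
    and "0 \<le> L" "0 \<le> d" "d \<le> \<eta>" "sqrt (d * L) \<le> \<eta>"
  shows "Nle \<eta> f"
  unfolding Nle_def
proof (intro conjI ballI)
  show eta: "0 \<le> \<eta>" using assms by simp
  fix x y assume xy: "x \<in> Y" "y \<in> Y"
  show "\<bar>f x - f y\<bar> \<le> \<eta> * \<theta> x y"
  proof (cases "sqrt (dist x y) \<le> 1")
    case False
    then have "1 \<le> \<theta> x y" using th_sqrt[of x y] by simp
    then have "\<eta> * 1 \<le> \<eta> * \<theta> x y" using eta by (intro mult_left_mono)
    then show ?thesis using osc[OF xy] assms(5) by simp
  next
    case True
    have "\<bar>f x - f y\<bar> = sqrt (\<bar>f x - f y\<bar> * \<bar>f x - f y\<bar>)" by simp
    also have "\<dots> \<le> sqrt (d * (L * dist x y))"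
      using osc[OF xy] lip[OF xy] assms(4) by (intro real_sqrt_le_mono mult_mono) auto
    also have "\<dots> = sqrt (d * L) * sqrt (dist x y)" by (simp add: real_sqrt_mult)
    also have "\<dots> \<le> \<eta> * \<theta> x y"
      using th_sqrt[of x y] True assms(6) eta by (intro mult_mono) auto
    finally show ?thesis .
  qed
qed

lemma lipschitz_Nle_exists:
  assumes f: "L-lipschitz_on Y f"
  shows "\<exists>c. Nle c f"
proof -
  have L0: "0 \<le> L" using lipschitz_on_nonneg[OF f] .
  have "f \<in> Cb Y" unfolding Cb_iff using lipschitz_on_continuous_on[OF f] .
  then obtain B where B: "0 \<le> B" "\<And>x. x \<in> Y \<Longrightarrow> \<bar>f x\<bar> \<le> B" using CbE by metis
  have "Nle (max (2 * B) (sqrt (2 * B * L))) f"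
  proof (rule lipschitz_Nle[where L=L and d="2 * B"])
    show "\<bar>f x - f y\<bar> \<le> L * dist x y" if "x \<in> Y" "y \<in> Y" for x y
      using lipschitz_onD[OF f that] by (simp add: dist_real_def)
    show "\<bar>f x - f y\<bar> \<le> 2 * B" if "x \<in> Y" "y \<in> Y" for x y using B(2)[OF that(1)] B(2)[OF that(2)] by linarith
  qed (use B L0 in auto)
  then show ?thesis by blast
qed

text \<open>For uniqueness a Lipschitz \<open>k\<close> is integrated after many Doob steps:
  invariance leaves the integral unchanged, and mixing makes the integrand nearly equal to a
  constant \<open>t n\<close> that does not depend on the equilibrium state.\<close>

theorem small_potential:
  "\<exists>\<eta>>0. \<forall>V. Nle \<eta> V \<longrightarrow>
    (\<forall>c<lam V. \<exists>n0. \<forall>n\<ge>n0. \<forall>y\<in>Y. exp (c * real n) \<le> (T V ^^ n) (\<lambda>_. 1) y) \<and>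
    (\<forall>\<sigma>\<in>probs Y. \<forall>\<tau>\<in>probs Y. rate M \<xi> S Y \<sigma> \<le> ereal ((LINT x:Y|\<sigma>. V x) - lam V) \<longrightarrow>
       rate M \<xi> S Y \<tau> \<le> ereal ((LINT x:Y|\<tau>. V x) - lam V) \<longrightarrow> \<sigma> = \<tau>)"
proof -
  obtain \<eta> where eta: "\<eta> > 0" "\<And>V. Nle \<eta> V \<Longrightarrow> (\<exists>h \<mu>. 0 < \<mu> \<and> h \<in> Cb Y \<and> (\<forall>x\<in>Y. 0 < h x) \<and> (\<exists>b. Kn b h) \<and> (\<forall>x\<in>Y. T V h x = \<mu> * h x) \<and>
    (\<forall>c f. Nle c f \<longrightarrow> (\<exists>t. \<forall>e>0. \<exists>n0. \<forall>n\<ge>n0. \<forall>x\<in>Y. \<bar>(T V ^^ (N * n)) f x / \<mu> ^ (N * n) - t n * h x\<bar> \<le> e)))"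
    using eigen_data by blast
  show ?thesis
  proof (intro exI[of _ \<eta>] conjI eta(1) allI impI ballI)
    fix V c assume VN: "Nle \<eta> V" and c: "c < lam V"
    have V: "V \<in> Cb Y" using Nle_Cb[OF VN] .
    obtain h \<mu> where h: "0 < \<mu>" "h \<in> Cb Y" "\<And>x. x \<in> Y \<Longrightarrow> 0 < h x" "\<And>x. x \<in> Y \<Longrightarrow> T V h x = \<mu> * h x"
      using eta(2)[OF VN] by metis
    have lam: "lam V = ln \<mu>" by (rule eigen_lam(1)[OF V h(2,3,1,4)])
    obtain m where m: "m > 0" "\<And>n y. y \<in> Y \<Longrightarrow> m * \<mu> ^ n \<le> (T V ^^ n) (\<lambda>_. 1) y" using eigen_lam(2)[OF V h(2,3,1,4)] by blast
    obtain n0 where n0: "\<And>n. n \<ge> n0 \<Longrightarrow> c * real n + (- ln m) \<le> lam V * real n" using exp_rate_eventually[OF c] by blast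
    show "\<exists>n0. \<forall>n\<ge>n0. \<forall>y\<in>Y. exp (c * real n) \<le> (T V ^^ n) (\<lambda>_. 1) y"
    proof (intro exI[of _ n0] allI impI ballI)
      fix n y assume n: "n0 \<le> n" and y: "y \<in> Y"
      have "exp (c * real n) \<le> exp (ln m + real n * ln \<mu>)" using n0[OF n] by (simp add: lam mult.commute)
      also have "\<dots> = m * \<mu> ^ n" using m(1) h(1) by (simp add: exp_add exp_of_nat_mult)
      also have "\<dots> \<le> (T V ^^ n) (\<lambda>_. 1) y" by (rule m(2)[OF y])
      finally show "exp (c * real n) \<le> (T V ^^ n) (\<lambda>_. 1) y" .
    qed
  next
    fix V \<sigma> \<tau> assume VN: "Nle \<eta> V" and st: "\<sigma> \<in> probs Y" "\<tau> \<in> probs Y"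
      and rt: "rate M \<xi> S Y \<sigma> \<le> ereal ((LINT x:Y|\<sigma>. V x) - lam V)" "rate M \<xi> S Y \<tau> \<le> ereal ((LINT x:Y|\<tau>. V x) - lam V)"
    have V: "V \<in> Cb Y" using Nle_Cb[OF VN] .
    obtain h \<mu> b where h: "0 < \<mu>" "h \<in> Cb Y" "\<And>x. x \<in> Y \<Longrightarrow> 0 < h x" "\<And>x. x \<in> Y \<Longrightarrow> T V h x = \<mu> * h x" "Kn b h"
      and mix: "\<And>c f. Nle c f \<Longrightarrow> (\<exists>t. \<forall>e>0. \<exists>n0. \<forall>n\<ge>n0. \<forall>x\<in>Y. \<bar>(T V ^^ (N * n)) f x / \<mu> ^ (N * n) - t n * h x\<bar> \<le> e)"
      using eta(2)[OF VN] by metis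
    obtain m K where m: "0 < m" "\<And>y. y \<in> Y \<Longrightarrow> m \<le> h y" using pos_bounds[OF Cb_cont[OF h(2)] h(3)] by metis
    show "\<sigma> = \<tau>"
    proof (rule probs_eqI[OF st closedZ])
      fix k :: "'a \<Rightarrow> real" assume "\<exists>L. L-lipschitz_on UNIV k"
      then obtain L where "L-lipschitz_on Y k" using lipschitz_on_subset by blast
      then obtain c where kc: "Nle c k" using lipschitz_Nle_exists by blast
      have k: "k \<in> Cb Y" using Nle_Cb[OF kc] .
      obtain B where B: "0 \<le> B" "\<And>x. x \<in> Y \<Longrightarrow> \<bar>k x\<bar> \<le> B" using CbE[OF k] by metis
      have kK: "Kn (max c B) k" using Nle_mono[OF kc, of "max c B"] B unfolding Kn_def by fastforce
      obtain t where t: "\<And>e. e > 0 \<Longrightarrow> \<exists>n0. \<forall>n\<ge>n0. \<forall>x\<in>Y. \<bar>(T V ^^ (N * n)) (\<lambda>y. h y * k y) x / \<mu> ^ (N * n) - t n * h x\<bar> \<le> e"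
        using mix[OF KnN[OF Kn_mult[OF h(5) kK]]] by blast
      have near: "\<bar>(LINT x:Y|\<sigma>. k x) - (LINT x:Y|\<tau>. k x)\<bar> \<le> 2 * e" if e: "e > 0" for e
      proof -
        \<comment> \<open>The precision e m, with \<open>m\<close> a lower bound of
          \<open>h\<close>, becomes e after division by \<open>h\<close>. One \<open>n\<close>
          serves both states, so the coefficients \<open>t n\<close> need not converge.\<close>
        obtain n where n: "\<And>x. x \<in> Y \<Longrightarrow> \<bar>(T V ^^ (N * n)) (\<lambda>y. h y * k y) x / \<mu> ^ (N * n) - t n * h x\<bar> \<le> e * m"
          using t[of "e * m"] e m(1) by auto
        define w where "w x = (T V ^^ (N * n)) (\<lambda>y. h y * k y) x / (\<mu> ^ (N * n) * h x)" for x
        have wC: "w \<in> Cb Y" unfolding Cb_iff w_def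
          using Cb_cont[OF Tn_Cb[OF V Cb_mult[OF h(2) k]]] Cb_cont[OF h(2)] h(1,3) by (intro continuous_intros) force+
        have wt: "\<bar>w x - t n\<bar> \<le> e" if x: "x \<in> Y" for x
        proof -
          have hx: "0 < h x" using h(3)[OF x] .
          have "w x - t n = ((T V ^^ (N * n)) (\<lambda>y. h y * k y) x / \<mu> ^ (N * n) - t n * h x) / h x"
            using hx h(1) by (simp add: w_def field_simps)
          also have "\<bar>\<dots>\<bar> = \<bar>(T V ^^ (N * n)) (\<lambda>y. h y * k y) x / \<mu> ^ (N * n) - t n * h x\<bar> / h x" using hx by simp
          also have "\<dots> \<le> e * m / h x" using n[OF x] hx by (intro divide_right_mono) auto
          also have "\<dots> \<le> e" using m(2)[OF x] hx e by (simp add: field_simps)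
          finally show ?thesis .
        qed
        have *: "\<bar>(LINT x:Y|\<sigma>. k x) - t n\<bar> \<le> e" if "\<sigma> \<in> probs Y" "rate M \<xi> S Y \<sigma> \<le> ereal ((LINT x:Y|\<sigma>. V x) - lam V)" for \<sigma>
        proof -
          have "(LINT x:Y|\<sigma>. w x) = (LINT x:Y|\<sigma>. k x)"
            unfolding w_def by (rule equilibrium_invariant_iterate[OF V h(2,3,1,4) that k])
          moreover have "\<bar>(LINT x:Y|\<sigma>. w x) - (LINT x:Y|\<sigma>. t n)\<bar> \<le> e"
            using wC Cb_const by (intro set_integral_probs_diff_le[OF that(1) closedZ _ _ _ _ wt]) (auto simp: Cb_def)
          ultimately show ?thesis by (simp add: set_integral_probs_const[OF that(1)])
        qed
        show ?thesis using *[OF st(1) rt(1)] *[OF st(2) rt(2)] by linarith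
      qed
      show "(LINT x:Y|\<sigma>. k x) = (LINT x:Y|\<tau>. k x)"
      proof (rule ccontr)
        assume "\<not> ?thesis"
        then show False using near[of "\<bar>(LINT x:Y|\<sigma>. k x) - (LINT x:Y|\<tau>. k x)\<bar> / 3"] by simp
      qed
    qed
  qed
qed

end

section \<open>Contraction from coupling and irreducibility\<close>

text \<open>The modulus is built from \<open>G r = (\<Sum>k. b ^ k * g (q ^ k * r))\<close> with \<open>b > 1\<close>, which satisfies
  \<open>b * G (q * r) = G r - g r\<close>; this turns the coupling bound into a strict contraction, also when \<open>q = 0\<close>.  The
  square root makes every Lipschitz function of small oscillation small for the resulting seminorm.\<close>

lemma modulus_exists:
  fixes g :: "real \<Rightarrow> real" and q :: real
  assumes q: "0 \<le> q" "q < 1" and gc: "continuous_on {0..} g" and gm: "mono_on {0..} g"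
    and g0: "\<forall>r\<ge>0. 0 \<le> g r" "g 0 = 0"
    and lim: "limsup (\<lambda>k. ereal (1 / real k) * elog (g (q ^ k))) < 0"
  obtains \<phi> \<rho> where "0 \<le> \<rho>" "\<rho> < 1" "\<And>r s. 0 \<le> r \<Longrightarrow> r \<le> s \<Longrightarrow> \<phi> r \<le> \<phi> s" "\<And>r. 0 \<le> r \<Longrightarrow> sqrt r \<le> \<phi> r"
    "\<And>r. 0 \<le> r \<Longrightarrow> g r + \<phi> (q * r) \<le> \<rho> * \<phi> r" "\<And>e. 0 < e \<Longrightarrow> \<exists>d>0. \<forall>r. 0 \<le> r \<longrightarrow> r < d \<longrightarrow> \<phi> r \<le> e"
proof -
  obtain c' where c': "limsup (\<lambda>k. ereal (1 / real k) * elog (g (q ^ k))) < ereal c'" "ereal c' < 0"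
    using ereal_dense2[OF lim] by blast
  define c where "c = - c'"
  have c0: "0 < c" using c'(2) by (simp add: c_def)
  have "eventually (\<lambda>k. ereal (1 / real k) * elog (g (q ^ k)) < ereal (- c)) sequentially"
    using Limsup_lessD[OF c'(1)] by (simp add: c_def)
  then obtain k1 where k1: "\<And>k. k \<ge> k1 \<Longrightarrow> ereal (1 / real k) * elog (g (q ^ k)) < ereal (- c)"
    by (auto simp: eventually_sequentially)
  define k0 where "k0 = max 1 k1"
  have gq: "g (q ^ k) \<le> exp (- c * real k)" if k: "k \<ge> k0" for k
  proof (cases "g (q ^ k) > 0")
    case True
    have k': "k \<ge> k1" "k \<ge> 1" using k by (auto simp: k0_def)
    have "1 / real k * ln (g (q ^ k)) < - c" using k1[OF k'(1)] True by (simp add: elog_def)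
    then have "ln (g (q ^ k)) < - c * real k" using k'(2) by (simp add: field_simps)
    then have "exp (ln (g (q ^ k))) < exp (- c * real k)" by simp
    then show ?thesis using True by simp
  next
    case False
    then show ?thesis using exp_ge_zero[of "- c * real k"] by linarith
  qed
  \<comment> \<open>Half the decay rate of g(q^k): then b > 1 while b^k g(q^k) is still
    summable.\<close>
  define b where "b = exp (c / 2)"
  have b1: "1 < b" using c0 by (simp add: b_def)
  define t where "t k r = b ^ k * g (q ^ k * r)" for k :: nat and r
  have t0: "0 \<le> t k r" if "0 \<le> r" for k r using that q g0 b1 by (simp add: t_def)
  have tm: "t k r \<le> t k s" if "0 \<le> r" "r \<le> s" for k r s
    unfolding t_def using that q b1 by (intro mult_left_mono mono_onD[OF gm]) (auto intro: mult_left_mono)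
  have sm: "summable (\<lambda>k. t k r)" if r: "0 \<le> r" for r
  proof (cases "q = 0")
    case True
    have "t k r = 0" if "k \<notin> {0}" for k using that True g0 by (simp add: t_def power_0_left)
    then show ?thesis by (intro summable_finite[of "{0}"]) auto
  next
    case False
    then have "1 < 1 / q" using q by simp
    \<comment> \<open>After \<open>m\<close> scalings \<open>r\<close> falls below 1; monotonicity
      then compares g(q^k r) with g(q^(k-m)), whose decay is known.\<close>
    then obtain m where m: "r < (1 / q) ^ m" using real_arch_pow by blast
    have qm: "q ^ m * r \<le> 1" using m False q by (simp add: power_divide field_simps)
    have geo: "summable (\<lambda>k. exp (c * real m) * exp (- c / 2) ^ k)"
      using c0 by (intro summable_mult summable_geometric) auto
    show ?thesis
    proof (rule summable_comparison_test[OF _ geo], intro exI[of _ "m + k0"] allI impI)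
      fix k assume k: "m + k0 \<le> k"
      have qk: "q ^ k * r \<le> q ^ (k - m)"
      proof -
        have "q ^ k * r = q ^ (k - m) * (q ^ m * r)" using k by (simp add: power_add[symmetric] mult.assoc[symmetric])
        also have "\<dots> \<le> q ^ (k - m) * 1" using qm q by (intro mult_left_mono) auto
        finally show ?thesis by simp
      qed
      have "g (q ^ k * r) \<le> g (q ^ (k - m))" using qk q r by (intro mono_onD[OF gm]) auto
      also have "\<dots> \<le> exp (- c * real (k - m))" using k by (intro gq) auto
      finally have "t k r \<le> b ^ k * exp (- c * real (k - m))" using b1 by (simp add: t_def)
      also have "\<dots> = exp (c / 2 * real k + - c * (real k - real m))"
        using k by (simp add: b_def exp_of_nat_mult[symmetric] exp_add[symmetric] of_nat_diff mult.commute)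
      also have "\<dots> = exp (c * real m + real k * (- c / 2))" by (simp add: algebra_simps)
      also have "\<dots> = exp (c * real m) * exp (- c / 2) ^ k" by (simp only: exp_add exp_of_nat_mult)
      finally show "norm (t k r) \<le> exp (c * real m) * exp (- c / 2) ^ k" using t0[OF r] by simp
    qed
  qed
  define G where "G r = (\<Sum>k. t k r)" for r
  have G0: "0 \<le> G r" if "0 \<le> r" for r unfolding G_def by (rule suminf_nonneg[OF sm[OF that] t0[OF that]])
  have Gm: "G r \<le> G s" if "0 \<le> r" "r \<le> s" for r s
    unfolding G_def using that by (intro suminf_le tm sm) auto
  have Gq: "b * G (q * r) = G r - g r" if r: "0 \<le> r" for r
  proof -
    have "b * t k (q * r) = t (Suc k) r" for k by (simp add: t_def mult_ac)
    then have "b * G (q * r) = (\<Sum>k. t (Suc k) r)"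
      unfolding G_def using suminf_mult[OF sm[of "q * r"], of b] q r by simp
    also have "\<dots> = G r - t 0 r" unfolding G_def by (rule suminf_split_head[OF sm[OF r]])
    finally show ?thesis by (simp add: t_def)
  qed
  have Glim: "(G \<longlongrightarrow> 0) (at_right 0)"
  proof -
    have "((\<lambda>r. \<Sum>k. t k r) \<longlongrightarrow> (\<Sum>k::nat. 0)) (at_right 0)"
    \<comment> \<open>For 0 < r < 1 the terms are dominated by those at r = 1, so the limit at 0 may
      be taken term by term.\<close>
    proof (rule tannerys_theorem[where M="\<lambda>k. t k 1", THEN conjunct2, THEN conjunct2])
      fix k
      have "((\<lambda>r. g (q ^ k * r)) \<longlongrightarrow> 0) (at_right 0)"
      proof -
        have "continuous_on {0..} (\<lambda>r. g (q ^ k * r))"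
          by (rule continuous_on_compose2[OF gc]) (use q in \<open>auto intro!: continuous_intros\<close>)
        then have "((\<lambda>r. g (q ^ k * r)) \<longlongrightarrow> g (q ^ k * 0)) (at 0 within {0..})"
          unfolding continuous_on_def by (rule bspec) simp
        then have "((\<lambda>r. g (q ^ k * r)) \<longlongrightarrow> g (q ^ k * 0)) (at_right 0)"
          by (rule tendsto_within_subset) auto
        then show ?thesis using g0 by simp
      qed
      then show "((\<lambda>r. t k r) \<longlongrightarrow> 0) (at_right 0)"
        unfolding t_def using tendsto_mult_right_zero by blast
    next
      have "eventually (\<lambda>r::real. 0 < r \<and> r < 1) (at_right 0)"
        by (auto simp: eventually_at_right_field intro: exI[of _ 1])
      then have ev: "eventually (\<lambda>r::real. \<forall>k. norm (t k r) \<le> t k 1) (at_right 0)"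
        by eventually_elim (use t0 tm in \<open>auto intro: less_imp_le\<close>)
      show "eventually (\<lambda>(k, r). norm (t k r) \<le> t k 1) (at_top \<times>\<^sub>F at_right 0)"
        unfolding eventually_prod_filter case_prod_unfold fst_conv snd_conv
        by (rule exI[of _ "\<lambda>_. True"], rule exI, rule conjI, rule eventually_True, rule conjI, rule ev) auto
    qed (use sm in auto)
    then show ?thesis by (simp add: G_def[abs_def])
  qed
  \<comment> \<open>Since b G(q r) = G r - g r, the sum g r + \<phi>(q r) equals sqrt q (b sqrt r) +
    (1/b) (b G r): the term g r cancels exactly thanks to the outer factor \<open>b\<close>, and
    each part contracts by its own factor.\<close>
  define \<phi> where "\<phi> r = b * (sqrt r + G r)" for r
  define \<rho> where "\<rho> = max (sqrt q) (1 / b)"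
  show ?thesis
  proof (rule that[of \<rho> \<phi>])
    show "0 \<le> \<rho>" using q by (simp add: \<rho>_def le_max_iff_disj)
    show "\<rho> < 1" using q b1 by (simp add: \<rho>_def)
    show "\<phi> r \<le> \<phi> s" if "0 \<le> r" "r \<le> s" for r s
      unfolding \<phi>_def using Gm[OF that] that b1 by (intro mult_left_mono add_mono) auto
    show "sqrt r \<le> \<phi> r" if "0 \<le> r" for r
    proof -
      have "1 * (sqrt r + G r) \<le> \<phi> r" unfolding \<phi>_def using G0[OF that] that b1 by (intro mult_right_mono) auto
      then show ?thesis using G0[OF that] by simp
    qed
    show "g r + \<phi> (q * r) \<le> \<rho> * \<phi> r" if r: "0 \<le> r" for r
    proof -
      have "g r + \<phi> (q * r) = sqrt q * (b * sqrt r) + 1 / b * (b * G r)"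
        using Gq[OF r] b1 by (simp add: \<phi>_def real_sqrt_mult algebra_simps)
      also have "\<dots> \<le> \<rho> * (b * sqrt r) + \<rho> * (b * G r)"
        using G0[OF r] r b1 by (intro add_mono mult_right_mono) (auto simp: \<rho>_def)
      finally show ?thesis by (simp add: \<phi>_def algebra_simps)
    qed
    fix e :: real assume e: "0 < e"
    have "(\<phi> \<longlongrightarrow> b * (sqrt 0 + 0)) (at_right 0)"
      unfolding \<phi>_def by (intro tendsto_mult tendsto_const tendsto_add Glim tendsto_real_sqrt tendsto_ident_at)
    then have "(\<phi> \<longlongrightarrow> 0) (at_right 0)" by simp
    then have "eventually (\<lambda>r. \<phi> r < e) (at_right 0)" using e by (rule order_tendstoD)
    then obtain d where d: "0 < d" "\<And>r. 0 < r \<Longrightarrow> r < d \<Longrightarrow> \<phi> r < e" unfolding eventually_at_right_field by auto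
    have "t k 0 = 0" for k using g0 by (simp add: t_def)
    then have "\<phi> 0 = 0" by (simp add: \<phi>_def G_def)
    then show "\<exists>d>0. \<forall>r. 0 \<le> r \<longrightarrow> r < d \<longrightarrow> \<phi> r \<le> e"
      using d e by (intro exI[of _ d]) (force simp: le_less)
  qed
qed

context rds_cpt begin

text \<open>Both values are expectations of \<open>f\<close> over one probability space: on the bad
  event the difference is at most the oscillation, elsewhere the closeness of the two copies bounds
  it.\<close>

lemma coupled_difference:
  fixes \<Omega> :: "'c measure"
  assumes \<Omega>: "prob_space \<Omega>"
    and R: "R \<in> measurable \<Omega> (restrict_space borel Y)" "R' \<in> measurable \<Omega> (restrict_space borel Y)"
    and dR: "distr \<Omega> borel R = transition M \<xi> S 1 x" "distr \<Omega> borel R' = transition M \<xi> S 1 x'"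
    and x: "x \<in> Y" "x' \<in> Y" and f: "continuous_on Y f"
    and bad: "measure \<Omega> {\<omega> \<in> space \<Omega>. dist (R \<omega>) (R' \<omega>) > q} \<le> p"
    and c: "0 \<le> c" "\<And>u v. u \<in> Y \<Longrightarrow> v \<in> Y \<Longrightarrow> \<bar>f u - f v\<bar> \<le> c"
    and close: "\<And>u v. u \<in> Y \<Longrightarrow> v \<in> Y \<Longrightarrow> dist u v \<le> q \<Longrightarrow> \<bar>f u - f v\<bar> \<le> c * b" and b: "0 \<le> b"
  shows "\<bar>T (\<lambda>_. 0) f x - T (\<lambda>_. 0) f x'\<bar> \<le> c * (p + b)"
proof -
  interpret O: prob_space \<Omega> by (rule \<Omega>)
  have RY: "R \<omega> \<in> Y" "R' \<omega> \<in> Y" if "\<omega> \<in> space \<Omega>" for \<omega>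
    using measurable_space[OF R(1) that] measurable_space[OF R(2) that] by (auto simp: space_restrict_space)
  have Rm[measurable]: "R \<in> measurable \<Omega> borel" "R' \<in> measurable \<Omega> borel"
    using R measurable_restrict_space2_iff by blast+
  have rep: "T (\<lambda>_. 0) f x = (\<integral>\<omega>. f (R \<omega>) \<partial>\<Omega>)" "integrable \<Omega> (\<lambda>\<omega>. f (R \<omega>))"
    if "R \<in> measurable \<Omega> borel" "\<And>\<omega>. \<omega> \<in> space \<Omega> \<Longrightarrow> R \<omega> \<in> Y" "distr \<Omega> borel R = transition M \<xi> S 1 x" "x \<in> Y" for R x
  proof -
    have "T (\<lambda>_. 0) f x = markov_op M \<xi> S Y f x" by (rule markov_op_eq[symmetric, OF f that(4)])
    also have "\<dots> = (\<integral>y. indicator Y y *\<^sub>R f y \<partial>distr \<Omega> borel R)"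
      by (simp add: markov_op_def that(3) set_lebesgue_integral_def)
    also have "\<dots> = (\<integral>\<omega>. indicator Y (R \<omega>) *\<^sub>R f (R \<omega>) \<partial>\<Omega>)"
      by (rule integral_distr[OF that(1) Cb_measurable[OF f closedZ]])
    also have "\<dots> = (\<integral>\<omega>. f (R \<omega>) \<partial>\<Omega>)"
      by (rule Bochner_Integration.integral_cong) (use that(2) in auto)
    finally show "T (\<lambda>_. 0) f x = (\<integral>\<omega>. f (R \<omega>) \<partial>\<Omega>)" .
    obtain B where B: "\<And>x. x \<in> Y \<Longrightarrow> \<bar>f x\<bar> \<le> B" using CbE f Cb_iff by metis
    have "(\<lambda>\<omega>. indicator Y (R \<omega>) *\<^sub>R f (R \<omega>)) \<in> borel_measurable \<Omega>"
      using measurable_compose[OF that(1) Cb_measurable[OF f closedZ]] .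
    then have "(\<lambda>\<omega>. f (R \<omega>)) \<in> borel_measurable \<Omega>"
      by (rule measurable_cong[THEN iffD1, rotated]) (use that(2) in auto)
    then show "integrable \<Omega> (\<lambda>\<omega>. f (R \<omega>))"
      by (rule O.integrable_const_bound[where B=B, rotated]) (use B that(2) in auto)
  qed
  note r1 = rep[OF Rm(1) RY(1) dR(1) x(1)] and r2 = rep[OF Rm(2) RY(2) dR(2) x(2)]
  define A where "A = {\<omega> \<in> space \<Omega>. dist (R \<omega>) (R' \<omega>) > q}"
  have A[measurable]: "A \<in> sets \<Omega>" unfolding A_def by measurable
  have "T (\<lambda>_. 0) f x - T (\<lambda>_. 0) f x' = (\<integral>\<omega>. f (R \<omega>) - f (R' \<omega>) \<partial>\<Omega>)"
    using r1 r2 by simp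
  also have "\<bar>\<dots>\<bar> \<le> (\<integral>\<omega>. \<bar>f (R \<omega>) - f (R' \<omega>)\<bar> \<partial>\<Omega>)" by (rule integral_abs_bound)
  also have "\<dots> \<le> (\<integral>\<omega>. c * indicator A \<omega> + c * b \<partial>\<Omega>)"
  proof (rule integral_mono)
    show "integrable \<Omega> (\<lambda>\<omega>. \<bar>f (R \<omega>) - f (R' \<omega>)\<bar>)" using r1 r2 by (intro integrable_abs Bochner_Integration.integrable_diff)
    show "integrable \<Omega> (\<lambda>\<omega>. c * indicator A \<omega> + c * b)" by (auto simp: O.emeasure_finite less_top[symmetric])
    fix \<omega> assume w: "\<omega> \<in> space \<Omega>"
    show "\<bar>f (R \<omega>) - f (R' \<omega>)\<bar> \<le> c * indicator A \<omega> + c * b"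
    proof (cases "\<omega> \<in> A")
      case True
      then show ?thesis using c(2)[OF RY[OF w]] mult_nonneg_nonneg[OF c(1) b] by simp
    next
      case False
      then show ?thesis using close[OF RY[OF w]] w by (simp add: A_def)
    qed
  qed
  also have "\<dots> = c * measure \<Omega> A + c * b"
    using O.prob_space by (simp add: O.emeasure_finite less_top[symmetric])
  also have "\<dots> \<le> c * (p + b)" using bad c(1) by (simp add: A_def distrib_left mult_left_mono)
  finally show ?thesis .
qed

lemma transition_measure:
  assumes y: "y \<in> Y" and B: "B \<in> sets borel"
  shows "measure (transition M \<xi> S n y) B = (\<integral>\<zeta>. indicator B (orbit S y \<zeta> n) \<partial>PS)"
    "integrable PS (\<lambda>\<zeta>. indicat_real B (orbit S y \<zeta> n))"
proof -
  have om: "(\<lambda>\<zeta>. orbit S y \<zeta> n) \<in> measurable PS borel"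
    using borel_measurable_continuous_onI[OF continuous_orbit_noise] measurable_cong_sets[OF sets_PS refl] by blast
  then have om2: "(\<lambda>\<omega>. orbit S y (\<lambda>k. \<xi> k \<omega>) n) \<in> measurable M borel"
    using measurable_compose[OF xi_seq_measurable] by blast
  have im: "(\<lambda>\<zeta>. indicat_real B (orbit S y \<zeta> n)) \<in> borel_measurable PS"
    using measurable_compose[OF om borel_measurable_indicator[OF B]] .
  have "measure (transition M \<xi> S n y) B = (\<integral>z. indicator B z \<partial>transition M \<xi> S n y)" by (simp add: transition_def)
  also have "\<dots> = (\<integral>\<omega>. indicator B (orbit S y (\<lambda>k. \<xi> k \<omega>) n) \<partial>M)"
    unfolding transition_def by (rule integral_distr[OF om2]) (use B in measurable)
  also have "\<dots> = (\<integral>\<zeta>. indicator B (orbit S y \<zeta> n) \<partial>PS)" by (rule expectation_PS[OF im])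
  finally show "measure (transition M \<xi> S n y) B = (\<integral>\<zeta>. indicator B (orbit S y \<zeta> n) \<partial>PS)" .
  show "integrable PS (\<lambda>\<zeta>. indicat_real B (orbit S y \<zeta> n))"
    by (rule sq.integrable_const_bound[where B=1]) (use im in \<open>auto simp: indicator_def\<close>)
qed

text \<open>\<open>f\<close> has values in an interval [m, m + c] and from every starting point
  lands, with probability at least \<open>p\<close>, where it is within c/4 of f(w). Wherever f(w)
  lies, the gains \<open>s\<close> from below and \<open>t\<close> from above satisfy s + t \<ge>
  c/2, so the range of the averages shrinks by at least p c/2.\<close>

lemma minorization_difference:
  assumes x: "x \<in> Y" "x' \<in> Y" and f: "continuous_on Y f" and c: "0 \<le> c" "\<And>u v. u \<in> Y \<Longrightarrow> v \<in> Y \<Longrightarrow> \<bar>f u - f v\<bar> \<le> c"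
    and B: "B \<in> sets borel" "B \<subseteq> Y" and w: "w \<in> Y" "\<And>u. u \<in> B \<Longrightarrow> \<bar>f u - f w\<bar> \<le> c / 4"
    and p: "0 \<le> p" "\<And>y. y \<in> Y \<Longrightarrow> p \<le> measure (transition M \<xi> S n y) B"
  shows "\<bar>(T (\<lambda>_. 0) ^^ n) f x - (T (\<lambda>_. 0) ^^ n) f x'\<bar> \<le> (1 - p / 2) * c"
proof -
  obtain a where a: "a \<in> Y" "\<And>y. y \<in> Y \<Longrightarrow> f a \<le> f y" using continuous_attains_inf[OF compactY Zne f] by blast
  define m where "m = f a"
  define s where "s = max 0 (f w - c / 4 - m)"
  define t where "t = max 0 (m + c / 2 - (f w - c / 4))"
  have fC: "f \<in> Cb Y" using f Cb_iff by simp
  have rep: "(T (\<lambda>_. 0) ^^ n) f y = (\<integral>\<zeta>. f (orbit S y \<zeta> n) \<partial>PS)" if "y \<in> Y" for y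
    using Tn_expectation[OF Cb_zero fC that] by simp
  have up: "(T (\<lambda>_. 0) ^^ n) f y \<le> m + c - t * p" if y: "y \<in> Y" for y
  proof -
    have "(T (\<lambda>_. 0) ^^ n) f y \<le> (\<integral>\<zeta>. (m + c) - t * indicator B (orbit S y \<zeta> n) \<partial>PS)"
      unfolding rep[OF y]
    proof (rule integral_mono[OF orbit_integrable[OF fC y]])
      show "integrable PS (\<lambda>\<zeta>. (m + c) - t * indicat_real B (orbit S y \<zeta> n))"
        using transition_measure(2)[OF y B(1)] by auto
      fix \<zeta>
      show "f (orbit S y \<zeta> n) \<le> (m + c) - t * indicator B (orbit S y \<zeta> n)"
      proof -
        have "f (orbit S y \<zeta> n) \<le> f w + c / 4" if "orbit S y \<zeta> n \<in> B" using w(2)[OF that] by linarith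
        moreover have "f (orbit S y \<zeta> n) \<le> m + c" using c(2)[OF OZ[OF y] a(1), of \<zeta> n] unfolding m_def by linarith
        ultimately show ?thesis unfolding t_def by (cases "orbit S y \<zeta> n \<in> B") (auto simp: max_def)
      qed
    qed
    also have "\<dots> = m + c - t * measure (transition M \<xi> S n y) B"
      using transition_measure[OF y B(1)] by (simp add: Bochner_Integration.integral_diff)
    also have "\<dots> \<le> m + c - t * p" using p(2)[OF y] by (simp add: t_def mult_left_mono)
    finally show ?thesis .
  qed
  have lo: "m + s * p \<le> (T (\<lambda>_. 0) ^^ n) f y" if y: "y \<in> Y" for y
  proof -
    have "m + s * p \<le> m + s * measure (transition M \<xi> S n y) B" using p(2)[OF y] by (simp add: s_def mult_left_mono)
    also have "\<dots> = (\<integral>\<zeta>. m + s * indicator B (orbit S y \<zeta> n) \<partial>PS)"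
      using transition_measure[OF y B(1)] by (simp add: Bochner_Integration.integral_add)
    also have "\<dots> \<le> (T (\<lambda>_. 0) ^^ n) f y"
      unfolding rep[OF y]
    proof (rule integral_mono[OF _ orbit_integrable[OF fC y]])
      show "integrable PS (\<lambda>\<zeta>. m + s * indicat_real B (orbit S y \<zeta> n))"
        using transition_measure(2)[OF y B(1)] by auto
      fix \<zeta>
      show "m + s * indicator B (orbit S y \<zeta> n) \<le> f (orbit S y \<zeta> n)"
      proof -
        have "f w - c / 4 \<le> f (orbit S y \<zeta> n)" if "orbit S y \<zeta> n \<in> B" using w(2)[OF that] by linarith
        moreover have "m \<le> f (orbit S y \<zeta> n)" using a(2)[OF OZ[OF y], of \<zeta> n] unfolding m_def .
        ultimately show ?thesis unfolding s_def by (cases "orbit S y \<zeta> n \<in> B") (auto simp: max_def)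
      qed
    qed
    finally show ?thesis .
  qed
  have "f w - c / 4 - m \<le> s" "m + c / 2 - (f w - c / 4) \<le> t" by (simp_all add: s_def t_def)
  then have "c / 2 \<le> s + t" by linarith
  then have "c / 2 * p \<le> (s + t) * p" using p(1) by (rule mult_right_mono)
  then show ?thesis using up[OF x(1)] up[OF x(2)] lo[OF x(1)] lo[OF x(2)]
    by (simp add: abs_le_iff algebra_simps)
qed

text \<open>Truncating \<phi> at 1 separates two regimes. Where \<phi> < 1 the coupling contracts in
  one step. Where \<phi> is at least 1, \<theta> equals 1 and only the oscillation counts, which
  irreducibility reduces after \<open>N\<close> steps.\<close>

lemma contraction_exists:
  fixes \<Omega> :: "'c measure"
  assumes I: "hyp_I M \<xi> S Y z" and C: "hyp_C M \<xi> S Y \<Omega>"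
  shows "\<exists>\<theta> \<rho> N. contraction M \<xi> S Y \<theta> \<rho> N"
proof -
  have \<Omega>: "prob_space \<Omega>" using C by (simp add: hyp_C_def)
  obtain q g R R' where q: "0 \<le> q" "q < 1" and gc: "continuous_on {0..} g" and gm: "mono_on {0..} g"
    and g0: "\<forall>r\<ge>0. 0 \<le> g r" "g 0 = 0" and lim: "limsup (\<lambda>k. ereal (1 / real k) * elog (g (q ^ k))) < 0"
    and Rm: "(\<lambda>(x, x', \<omega>). R x x' \<omega>) \<in> restrict_space borel Y \<Otimes>\<^sub>M (restrict_space borel Y \<Otimes>\<^sub>M \<Omega>) \<rightarrow>\<^sub>M restrict_space borel Y"
      "(\<lambda>(x, x', \<omega>). R' x x' \<omega>) \<in> restrict_space borel Y \<Otimes>\<^sub>M (restrict_space borel Y \<Otimes>\<^sub>M \<Omega>) \<rightarrow>\<^sub>M restrict_space borel Y"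
    and cpl: "\<forall>x\<in>Y. \<forall>x'\<in>Y. distr \<Omega> borel (R x x') = transition M \<xi> S 1 x \<and> distr \<Omega> borel (R' x x') = transition M \<xi> S 1 x' \<and>
           measure \<Omega> {\<omega> \<in> space \<Omega>. dist (R x x' \<omega>) (R' x x' \<omega>) > q * dist x x'} \<le> g (dist x x')"
    using C unfolding hyp_C_def by (elim conjE exE) (rule that; assumption)
  have sec: "(\<lambda>\<omega>. h x x' \<omega>) \<in> measurable \<Omega> (restrict_space borel Y)"
    if "(\<lambda>(x, x', \<omega>). h x x' \<omega>) \<in> restrict_space borel Y \<Otimes>\<^sub>M (restrict_space borel Y \<Otimes>\<^sub>M \<Omega>) \<rightarrow>\<^sub>M restrict_space borel Y" "x \<in> Y" "x' \<in> Y"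
    for h :: "'a \<Rightarrow> 'a \<Rightarrow> 'c \<Rightarrow> 'a" and x x'
  proof -
    have "(\<lambda>\<omega>. (x, x', \<omega>)) \<in> measurable \<Omega> (restrict_space borel Y \<Otimes>\<^sub>M (restrict_space borel Y \<Otimes>\<^sub>M \<Omega>))"
      using that(2,3) by (intro measurable_Pair measurable_const measurable_ident) (auto simp: space_restrict_space)
    from measurable_compose[OF this that(1)] show ?thesis by simp
  qed
  obtain \<phi> \<rho>1 where phi: "0 \<le> \<rho>1" "\<rho>1 < 1" "\<And>r s. 0 \<le> r \<Longrightarrow> r \<le> s \<Longrightarrow> \<phi> r \<le> \<phi> s" "\<And>r. 0 \<le> r \<Longrightarrow> sqrt r \<le> \<phi> r"
    "\<And>r. 0 \<le> r \<Longrightarrow> g r + \<phi> (q * r) \<le> \<rho>1 * \<phi> r" "\<And>e. 0 < e \<Longrightarrow> \<exists>d>0. \<forall>r. 0 \<le> r \<longrightarrow> r < d \<longrightarrow> \<phi> r \<le> e"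
    by (rule modulus_exists[OF q gc gm g0 lim], rule that, assumption+)
  define \<theta> where "\<theta> x y = min 1 (\<phi> (dist x y))" for x y :: 'a
  have phi0: "0 \<le> \<phi> r" if "0 \<le> r" for r using phi(4)[OF that] real_sqrt_ge_zero[OF that] by linarith
  have th0: "0 \<le> \<theta> x y" and th1: "\<theta> x y \<le> 1" for x y using phi0 by (auto simp: \<theta>_def)
  \<comment> \<open>Within \<epsilon> of \<open>z\<close> the modulus is at most 1/4, which supplies
    the c/4 required by the minorization.\<close>
  obtain \<epsilon> where eps: "\<epsilon> > 0" "\<And>r. 0 \<le> r \<Longrightarrow> r < \<epsilon> \<Longrightarrow> \<phi> r \<le> 1/4" using phi(6)[of "1/4"] by auto
  have zY: "z \<in> Y" using I by (simp add: hyp_I_def)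
  obtain N where N: "N \<ge> 1" "(INF y\<in>Y. measure (transition M \<xi> S N y) (Y \<inter> ball z \<epsilon>)) > 0"
    using I eps(1) unfolding hyp_I_def by blast
  define p where "p = (INF y\<in>Y. measure (transition M \<xi> S N y) (Y \<inter> ball z \<epsilon>))"
  have p0: "0 < p" using N(2) by (simp add: p_def)
  have pl: "p \<le> measure (transition M \<xi> S N y) (Y \<inter> ball z \<epsilon>)" if "y \<in> Y" for y
    unfolding p_def by (rule cINF_lower) (use that in \<open>auto intro!: bdd_belowI2[where m=0]\<close>)
  define \<rho> where "\<rho> = max \<rho>1 (1 - p / 2)"
  have step: "\<bar>T (\<lambda>_. 0) f x - T (\<lambda>_. 0) f x'\<bar> \<le> c * (if \<phi> (dist x x') < 1 then \<rho>1 * \<theta> x x' else 1)"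
    if c: "0 \<le> c" "\<forall>x\<in>Y. \<forall>y\<in>Y. \<bar>f x - f y\<bar> \<le> c * \<theta> x y" "continuous_on Y f" and x: "x \<in> Y" "x' \<in> Y" for f c x x'
  proof -
    have cb: "\<bar>f u - f v\<bar> \<le> c" if "u \<in> Y" "v \<in> Y" for u v
      using c(2) that mult_left_mono[OF th1[of u v] c(1)] by fastforce
    show ?thesis
    proof (cases "\<phi> (dist x x') < 1")
      case True
      have "\<bar>T (\<lambda>_. 0) f x - T (\<lambda>_. 0) f x'\<bar> \<le> c * (g (dist x x') + \<phi> (q * dist x x'))"
      proof (rule coupled_difference[OF \<Omega> sec[OF Rm(1) x] sec[OF Rm(2) x] _ _ x c(3) _ c(1) cb])
        fix u v assume uv: "u \<in> Y" "v \<in> Y" "dist u v \<le> q * dist x x'"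
        have "\<theta> u v \<le> \<phi> (q * dist x x')" using phi(3)[OF _ uv(3)] by (simp add: \<theta>_def min_le_iff_disj)
        then have "c * \<theta> u v \<le> c * \<phi> (q * dist x x')" using c(1) by (rule mult_left_mono)
        then show "\<bar>f u - f v\<bar> \<le> c * \<phi> (q * dist x x')" using c(2) uv by (meson order_trans)
      qed (use cpl x phi0 q in auto)
      also have "\<dots> \<le> c * (\<rho>1 * \<phi> (dist x x'))" using phi(5)[of "dist x x'"] c(1) by (intro mult_left_mono) auto
      finally show ?thesis using True by (simp add: \<theta>_def)
    next
      case False
      \<comment> \<open>The degenerate instance with empty target and p = 0: one step does not
        increase the oscillation.\<close>
      have "\<bar>T (\<lambda>_. 0) f x - T (\<lambda>_. 0) f x'\<bar> \<le> (1 - 0 / 2) * c"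
        using minorization_difference[OF x c(3) c(1) cb, of "{}" z 0 1] zY by simp
      then show ?thesis using False by simp
    qed
  qed
  have nonexp: "\<forall>x\<in>Y. \<forall>y\<in>Y. \<bar>T (\<lambda>_. 0) f x - T (\<lambda>_. 0) f y\<bar> \<le> c * \<theta> x y"
    if c: "0 \<le> c" "\<forall>x\<in>Y. \<forall>y\<in>Y. \<bar>f x - f y\<bar> \<le> c * \<theta> x y" "continuous_on Y f" for f c
  proof (intro ballI)
    fix x y assume xy: "x \<in> Y" "y \<in> Y"
    have "(if \<phi> (dist x y) < 1 then \<rho>1 * \<theta> x y else 1) \<le> \<theta> x y"
      using mult_right_mono[OF less_imp_le[OF phi(2)] th0[of x y]] by (auto simp: \<theta>_def)
    then have "c * (if \<phi> (dist x y) < 1 then \<rho>1 * \<theta> x y else 1) \<le> c * \<theta> x y" using c(1) by (rule mult_left_mono)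
    with step[OF c xy] show "\<bar>T (\<lambda>_. 0) f x - T (\<lambda>_. 0) f y\<bar> \<le> c * \<theta> x y" by (rule order_trans)
  qed
  have iter: "continuous_on Y ((T (\<lambda>_. 0) ^^ n) f) \<and> (\<forall>x\<in>Y. \<forall>y\<in>Y. \<bar>(T (\<lambda>_. 0) ^^ n) f x - (T (\<lambda>_. 0) ^^ n) f y\<bar> \<le> c * \<theta> x y)"
    if c: "0 \<le> c" "\<forall>x\<in>Y. \<forall>y\<in>Y. \<bar>f x - f y\<bar> \<le> c * \<theta> x y" "continuous_on Y f" for f c n
  proof (induction n)
    case (Suc n)
    then show ?case using nonexp[OF c(1), of "(T (\<lambda>_. 0) ^^ n) f"] T_Cb[OF Cb_zero, of "(T (\<lambda>_. 0) ^^ n) f"] Cb_iff by simp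
  qed (use c in simp)
  have "contraction M \<xi> S Y \<theta> \<rho> N"
  proof unfold_locales
    show "0 \<le> \<theta> x y" "\<theta> x y \<le> 1" for x y using th0 th1 by auto
    show "0 \<le> \<rho>" using phi(1) by (simp add: \<rho>_def le_max_iff_disj)
    show "\<rho> < 1" using phi(2) p0 by (simp add: \<rho>_def)
    show "min 1 (sqrt (dist x y)) \<le> \<theta> x y" for x y using phi(4)[of "dist x y"] by (simp add: \<theta>_def min_le_iff_disj)
    show "\<exists>d>0. \<forall>x\<in>Y. \<forall>y\<in>Y. dist x y < d \<longrightarrow> \<theta> x y \<le> e" if e0: "0 < e" for e
    proof -
      obtain d where "d > 0" "\<forall>r. 0 \<le> r \<longrightarrow> r < d \<longrightarrow> \<phi> r \<le> e" using phi(6)[OF e0] by blast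
      then show ?thesis by (intro exI[of _ d]) (simp add: \<theta>_def min_le_iff_disj)
    qed
    fix c and f :: "'a \<Rightarrow> real" assume c: "0 \<le> c" "\<forall>x\<in>Y. \<forall>y\<in>Y. \<bar>f x - f y\<bar> \<le> c * \<theta> x y" "continuous_on Y f"
    show "\<forall>x\<in>Y. \<forall>y\<in>Y. \<bar>T (\<lambda>_. 0) f x - T (\<lambda>_. 0) f y\<bar> \<le> c * \<theta> x y" by (rule nonexp[OF c])
    show "\<forall>x\<in>Y. \<forall>y\<in>Y. \<bar>(T (\<lambda>_. 0) ^^ N) f x - (T (\<lambda>_. 0) ^^ N) f y\<bar> \<le> \<rho> * c * \<theta> x y"
    proof (intro ballI)
      fix x y assume xy: "x \<in> Y" "y \<in> Y"
      show "\<bar>(T (\<lambda>_. 0) ^^ N) f x - (T (\<lambda>_. 0) ^^ N) f y\<bar> \<le> \<rho> * c * \<theta> x y"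
      proof (cases "\<phi> (dist x y) < 1")
        case True
        obtain n where n: "N = Suc n" using N(1) by (cases N) auto
        \<comment> \<open>The last coupled step contracts; the other \<open>n\<close> only have to
          be nonexpansive.\<close>
        have "\<bar>T (\<lambda>_. 0) ((T (\<lambda>_. 0) ^^ n) f) x - T (\<lambda>_. 0) ((T (\<lambda>_. 0) ^^ n) f) y\<bar> \<le> c * (\<rho>1 * \<theta> x y)"
          using step[OF c(1) _ _ xy, of "(T (\<lambda>_. 0) ^^ n) f"] iter[OF c, of n] True by simp
        also have "\<dots> \<le> c * (\<rho> * \<theta> x y)" using c(1) th0 by (intro mult_left_mono mult_right_mono) (auto simp: \<rho>_def)
        finally show ?thesis by (simp add: n mult_ac)
      next
        case False
        then have th: "\<theta> x y = 1" by (simp add: \<theta>_def)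
        have "\<bar>(T (\<lambda>_. 0) ^^ N) f x - (T (\<lambda>_. 0) ^^ N) f y\<bar> \<le> (1 - p / 2) * c"
        proof (rule minorization_difference[OF xy c(3) c(1) _ _ _ zY _ _ pl])
          show "\<bar>f u - f v\<bar> \<le> c" if "u \<in> Y" "v \<in> Y" for u v
            using c(2) that mult_left_mono[OF th1[of u v] c(1)] by fastforce
          show "Y \<inter> ball z \<epsilon> \<in> sets borel" using closedZ by auto
          show "\<bar>f u - f z\<bar> \<le> c / 4" if u: "u \<in> Y \<inter> ball z \<epsilon>" for u
          proof -
            have "\<theta> u z \<le> 1/4" using eps(2)[of "dist u z"] u by (simp add: \<theta>_def min_le_iff_disj dist_commute)
            then have "c * \<theta> u z \<le> c * (1/4)" using c(1) by (rule mult_left_mono)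
            moreover have "\<bar>f u - f z\<bar> \<le> c * \<theta> u z" using c(2) u zY by auto
            ultimately show ?thesis by simp
          qed
        qed (use p0 in auto)
        also have "\<dots> \<le> \<rho> * c" using c(1) by (intro mult_right_mono) (auto simp: \<rho>_def)
        finally show ?thesis by (simp add: th)
      qed
    qed
  qed (rule N(1))
  then show ?thesis by blast
qed

end

section \<open>Large deviation bounds\<close>

lemma measurable_uniform_count_measure: "X \<in> measurable (uniform_count_measure A) borel"
  by (rule measurableI) (auto simp: sets_uniform_count_measure space_uniform_count_measure)

text \<open>Seen as the law of \<open>X\<close> under a uniformly chosen index, the empirical
  measure inherits integrals as averages; n = 0 would divide by 0.\<close>

lemma empirical_distr:
  assumes "n \<ge> 1"
  shows "empirical X n = distr (uniform_count_measure {1..n}) borel X"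
proof (rule measure_eqI)
  have Xm: "X \<in> measurable (uniform_count_measure {1..n}) borel"
    by (rule measurable_uniform_count_measure)
  fix A assume "A \<in> sets (empirical X n)"
  then have A: "A \<in> sets borel" by simp
  have "emeasure (distr (uniform_count_measure {1..n}) borel X) A = emeasure (uniform_count_measure {1..n}) {k \<in> {1..n}. X k \<in> A}"
    using A by (subst emeasure_distr[OF Xm]) (auto simp: space_uniform_count_measure intro!: arg_cong2[where f=emeasure])
  also have "\<dots> = ennreal (card {k \<in> {1..n}. X k \<in> A} / n)"
    by (subst emeasure_uniform_count_measure) auto
  also have "\<dots> = of_nat (card {k \<in> {1..n}. X k \<in> A}) / of_nat n"
    using assms by (simp add: divide_ennreal[symmetric] ennreal_of_nat_eq_real_of_nat)
  also have "of_nat (card {k \<in> {1..n}. X k \<in> A}) = (\<Sum>k=1..n. indicator A (X k) :: ennreal)"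
    by (simp add: indicator_def sum.If_cases Int_def)
  finally show "emeasure (empirical X n) A = emeasure (distr (uniform_count_measure {1..n}) borel X) A"
    using A by (simp add: emeasure_empirical)
qed simp

lemma empirical_integral:
  assumes n: "n \<ge> 1" and X: "\<And>k. X k \<in> Z" and f: "continuous_on Z f" and Z: "closed Z"
  shows "(LINT x:Z|empirical X n. (f x::real)) = (\<Sum>k=1..n. f (X k)) / n"
proof -
  have Xm: "X \<in> measurable (uniform_count_measure {1..n}) borel"
    by (rule measurable_uniform_count_measure)
  have "(LINT x:Z|empirical X n. f x) = (\<integral>k. indicator Z (X k) *\<^sub>R f (X k) \<partial>uniform_count_measure {1..n})"
    unfolding set_lebesgue_integral_def empirical_distr[OF n] by (rule integral_distr[OF Xm Cb_measurable[OF f Z]])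
  also have "\<dots> = (\<Sum>k=1..n. indicator Z (X k) *\<^sub>R f (X k)) / n"
    by (subst integral_uniform_count_measure) auto
  finally show ?thesis using X by simp
qed

lemma empirical_probs:
  assumes n: "n \<ge> 1" and X: "\<And>k. X k \<in> Z" and Z: "closed Z"
  shows "empirical X n \<in> probs Z"
proof -
  have Xm: "X \<in> measurable (uniform_count_measure {1..n}) borel"
    by (rule measurable_uniform_count_measure)
  interpret u: prob_space "uniform_count_measure {1..n}" by (rule prob_space_uniform_count_measure) (use n in auto)
  have "prob_space (empirical X n)" unfolding empirical_distr[OF n] by (rule u.prob_space_distr[OF Xm])
  moreover have "measure (empirical X n) Z = 1"
  proof -
    have "X -` Z \<inter> space (uniform_count_measure {1..n}) = space (uniform_count_measure {1..n})" using X by auto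
    then show ?thesis unfolding empirical_distr[OF n] using Z u.prob_space by (subst measure_distr[OF Xm]) auto
  qed
  ultimately show ?thesis by (simp add: probs_def)
qed

text \<open>The neighbourhood lemma applied on the product of \<open>Z\<close> with itself to |f x -
  f y|, around the diagonal of \<open>Y\<close>; it substitutes for uniform continuity on the
  possibly noncompact \<open>Z\<close>.\<close>

lemma near_compact_oscillation:
  fixes f :: "'a::metric_space \<Rightarrow> real"
  assumes f: "continuous_on Z f" and Y: "compact Y" "Y \<subseteq> Z" "Y \<noteq> {}" and e: "0 < e"
  shows "\<exists>d>0. \<forall>x\<in>Z. \<forall>y\<in>Y. dist x y < d \<longrightarrow> \<bar>f x - f y\<bar> < e"
proof -
  define D where "D = (\<lambda>y. (y, y)) ` Y"
  have "continuous_on (Z \<times> Z) (\<lambda>p. \<bar>f (fst p) - f (snd p)\<bar>)"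
    by (intro continuous_intros continuous_on_compose2[OF f]) auto
  moreover have "compact D" unfolding D_def by (intro compact_continuous_image continuous_intros Y(1))
  moreover have "D \<subseteq> Z \<times> Z" "D \<noteq> {}" using Y by (auto simp: D_def)
  moreover have "\<bar>f (fst p) - f (snd p)\<bar> < e" if "p \<in> D" for p using that e by (auto simp: D_def)
  ultimately obtain d where d: "d > 0" "\<And>p. p \<in> Z \<times> Z \<Longrightarrow> infdist p D < d \<Longrightarrow> \<bar>f (fst p) - f (snd p)\<bar> < e"
    using near_compact_less[of "Z \<times> Z" "\<lambda>p. \<bar>f (fst p) - f (snd p)\<bar>" D e] by blast
  have "\<bar>f x - f y\<bar> < e" if "x \<in> Z" "y \<in> Y" "dist x y < d" for x y
  proof -
    have "infdist (x, y) D \<le> dist (x, y) (y, y)" by (rule infdist_le) (use that in \<open>auto simp: D_def\<close>)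
    also have "\<dots> = dist x y" by (simp add: dist_Pair_Pair)
    finally show ?thesis using d(2)[of "(x, y)"] that Y by auto
  qed
  with d(1) show ?thesis by blast
qed

lemma real_ereal_bound:
  fixes L m :: ereal
  assumes "\<And>a::real. ereal a < m \<Longrightarrow> L \<le> ereal (- a)"
  shows "L \<le> - m"
proof (rule ccontr)
  assume "\<not> ?thesis"
  then have "- m < L" by simp
  then obtain z where z: "- m < ereal z" "ereal z < L" using ereal_dense2 by blast
  have "ereal (- z) < m" using z(1) ereal_uminus_less_reorder[of m "ereal z"] by simp
  from assms[OF this] z(2) show False by simp
qed

section \<open>Empirical measures along orbits\<close>

context attracted begin

definition emp :: "'a \<Rightarrow> nat \<Rightarrow> (nat \<Rightarrow> 'e) \<Rightarrow> 'a measure" where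
  "emp x n \<zeta> = empirical (orbit S x \<zeta>) n"

lemma emp_probs: "n \<ge> 1 \<Longrightarrow> x \<in> Z \<Longrightarrow> emp x n \<zeta> \<in> probs Z"
  unfolding emp_def by (rule empirical_probs) (auto simp: Zl.OZ Zl.closedZ)

lemma emp_integral:
  "n \<ge> 1 \<Longrightarrow> x \<in> Z \<Longrightarrow> f \<in> Cb Z \<Longrightarrow> (LINT y:Z|emp x n \<zeta>. f y) = (\<Sum>k=1..n. f (orbit S x \<zeta> k)) / n"
  unfolding emp_def by (rule empirical_integral) (auto simp: Zl.OZ Zl.closedZ Zl.Cb_cont)

text \<open>Source of the measurability of all events below: preimages of weakly open sets are open
  in sequence space, so no sigma-algebra on the space of measures has to be chosen.\<close>

lemma emp_continuous:
  assumes n: "n \<ge> 1" and x: "x \<in> Z"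
  shows "continuous_map euclidean (weak_topology Z) (emp x n)"
proof (rule continuous_map_weak_topology)
  fix f :: "'a \<Rightarrow> real" assume f: "f \<in> Cb Z"
  have "continuous_on UNIV (\<lambda>\<zeta>. (\<Sum>k=1..n. f (orbit S x \<zeta> k)) / n)"
    using n by (intro continuous_intros continuous_along_orbit[OF Zl.Cb_cont[OF f] Zl.invZ x]) auto
  then show "continuous_map euclidean euclideanreal (\<lambda>\<zeta>. LINT y:Z|emp x n \<zeta>. f y)"
    by (simp add: emp_integral[OF n x f])
qed (use emp_probs n x in auto)

lemma emp_open: assumes "n \<ge> 1" "x \<in> Z" "openin (weak_topology Z) G" shows "open {\<zeta>. emp x n \<zeta> \<in> G}"
  using openin_continuous_map_preimage[OF emp_continuous[OF assms(1,2)] assms(3)] by simp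

lemma emp_sets_open: assumes "n \<ge> 1" "x \<in> Z" "openin (weak_topology Z) G" shows "{\<zeta>. emp x n \<zeta> \<in> G} \<in> sets PS"
  using emp_open[OF assms] by (simp add: sets_PS)

lemma emp_sets_closed: assumes "n \<ge> 1" "x \<in> Z" "closedin (weak_topology Z) F" shows "{\<zeta>. emp x n \<zeta> \<in> F} \<in> sets PS"
proof -
  have "openin (weak_topology Z) (probs Z - F)" using assms(3) by (simp add: closedin_def)
  from sets.compl_sets[OF emp_sets_open[OF assms(1,2) this]]
  have "- {\<zeta>. emp x n \<zeta> \<in> probs Z - F} \<in> sets PS"
    by (simp only: space_PS Compl_eq_Diff_UNIV)
  moreover have "- {\<zeta>. emp x n \<zeta> \<in> probs Z - F} = {\<zeta>. emp x n \<zeta> \<in> F}" using emp_probs[OF assms(1,2)] by auto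
  ultimately show ?thesis by simp
qed

lemma prob_L_eq:
  assumes "{\<zeta>. emp x n \<zeta> \<in> F} \<in> sets PS"
  shows "prob_L M \<xi> S x n F = measure PS {\<zeta>. emp x n \<zeta> \<in> F}"
proof -
  have "measure PS {\<zeta>. emp x n \<zeta> \<in> F} = measure (distr M PS (\<lambda>\<omega> k. \<xi> k \<omega>)) {\<zeta>. emp x n \<zeta> \<in> F}" by (simp add: distr_xi)
  also have "\<dots> = measure M ((\<lambda>\<omega> k. \<xi> k \<omega>) -` {\<zeta>. emp x n \<zeta> \<in> F} \<inter> space M)"
    by (rule measure_distr[OF xi_seq_measurable assms])
  also have "(\<lambda>\<omega> k. \<xi> k \<omega>) -` {\<zeta>. emp x n \<zeta> \<in> F} \<inter> space M = {\<omega> \<in> space M. empirical (orbit S x (\<lambda>k. \<xi> k \<omega>)) n \<in> F}"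
    by (auto simp: emp_def)
  finally show ?thesis by (simp add: prob_L_def)
qed

text \<open>Projecting the orbit to \<open>Y\<close> changes the empirical measures negligibly, and the projected ones
  live in the compact space \<open>probs Y\<close>.\<close>

lemma emp_eventually_in:
  assumes U: "openin (weak_topology Z) U" "probs Y \<subseteq> U"
  shows "\<exists>n0. \<forall>n\<ge>n0. \<forall>x\<in>Z. \<forall>\<zeta>. emp x n \<zeta> \<in> U"
proof (rule ccontr)
  assume "\<not> ?thesis"
  then have "\<forall>j. \<exists>n x \<zeta>. n \<ge> Suc j \<and> x \<in> Z \<and> emp x n \<zeta> \<notin> U" by blast
  then obtain n x \<zeta> where nx: "\<And>j. n j \<ge> Suc j" "\<And>j. x j \<in> Z" "\<And>j. emp (x j) (n j) (\<zeta> j) \<notin> U" by metis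
  have n1: "n j \<ge> 1" for j using nx(1)[of j] by simp
  \<comment> \<open>An arbitrary choice of nearest points is harmless: an empirical measure sees
    only finitely many of them, so \<pi> need not be measurable.\<close>
  have "\<forall>u. \<exists>y\<in>Y. infdist u Y = dist u y" using infdist_attained_compact[OF Yl.compactY Yl.Zne] by blast
  then obtain \<pi> where pi: "\<And>u. \<pi> u \<in> Y" "\<And>u. infdist u Y = dist u (\<pi> u)" by metis
  define \<mu> where "\<mu> j = emp (x j) (n j) (\<zeta> j)" for j
  define \<nu> where "\<nu> j = empirical (\<lambda>k. \<pi> (orbit S (x j) (\<zeta> j) k)) (n j)" for j
  have nuP: "\<nu> j \<in> probs Y" for j unfolding \<nu>_def by (rule empirical_probs[OF n1]) (use pi Yl.closedZ in auto)
  obtain r \<nu>0 where r: "strict_mono (r :: nat \<Rightarrow> nat)" "\<nu>0 \<in> probs Y"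
    "\<And>f :: 'a \<Rightarrow> real. continuous_on Y f \<Longrightarrow> (\<lambda>j. LINT x:Y|\<nu> (r j). f x) \<longlonglongrightarrow> (LINT x:Y|\<nu>0. f x)"
    by (rule probs_seq_compact[OF Yl.compactY nuP], rule that, assumption+)
  have "eventually (\<lambda>j. \<mu> (r j) \<in> U) sequentially"
  proof (rule openin_weak_topology_eventually[OF U(1)])
    show "\<nu>0 \<in> U" using r(2) U(2) by blast
    show "eventually (\<lambda>j. \<mu> (r j) \<in> probs Z) sequentially" unfolding \<mu>_def using emp_probs[OF n1 nx(2)] by simp
    fix f assume f: "f \<in> Cb Z"
    obtain B where B: "0 \<le> B" "\<And>x. x \<in> Z \<Longrightarrow> \<bar>f x\<bar> \<le> B" using Zl.CbE[OF f] by metis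
    have fY: "continuous_on Y f" using Zl.Cb_cont[OF f] YZ by (rule continuous_on_subset)
    \<comment> \<open>From time \<open>k1\<close> on, the integrand changes by at most e/2 under
      projection; the earlier terms contribute at most 2 B k1 in total, negligible after division by
      \<open>n j\<close>.\<close>
    have diff: "(\<lambda>j. (LINT x:Z|\<mu> j. f x) - (LINT x:Y|\<nu> j. f x)) \<longlonglongrightarrow> 0"
    proof (rule LIMSEQ_I)
      fix e :: real assume e: "0 < e"
      obtain d where d: "d > 0" "\<And>x y. x \<in> Z \<Longrightarrow> y \<in> Y \<Longrightarrow> dist x y < d \<Longrightarrow> \<bar>f x - f y\<bar> < e / 2"
        using near_compact_oscillation[OF Zl.Cb_cont[OF f] Yl.compactY YZ Yl.Zne, of "e/2"] e by auto
      obtain k1 where k1: "\<And>k x \<zeta>. k \<ge> k1 \<Longrightarrow> x \<in> Z \<Longrightarrow> infdist (orbit S x \<zeta> k) Y < d" using attract[OF d(1)] by blast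
      obtain n2 :: nat where n2: "2 * B * k1 < real n2 * (e / 2)" using reals_Archimedean3[of "e/2"] e by fastforce
      have "norm ((LINT x:Z|\<mu> j. f x) - (LINT x:Y|\<nu> j. f x) - 0) < e" if j: "j \<ge> n2" for j
      proof -
        define o' where "o' k = orbit S (x j) (\<zeta> j) k" for k
        have oZ: "o' k \<in> Z" for k unfolding o'_def by (rule Zl.OZ[OF nx(2)])
        have t: "\<bar>f (o' k) - f (\<pi> (o' k))\<bar> \<le> e / 2 + (if k < k1 then 2 * B else 0)" for k
        proof (cases "k < k1")
          case True
          have "\<bar>f (o' k)\<bar> \<le> B" "\<bar>f (\<pi> (o' k))\<bar> \<le> B" using B(2) oZ pi(1) YZ by auto
          then show ?thesis using True e by simp
        next
          case False
          have "dist (o' k) (\<pi> (o' k)) < d" using k1[OF _ nx(2)] False pi(2) unfolding o'_def by (metis not_less)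
          then show ?thesis using d(2)[OF oZ pi(1)] False by (simp add: less_imp_le)
        qed
        have "(LINT x:Z|\<mu> j. f x) - (LINT x:Y|\<nu> j. f x) = (\<Sum>k=1..n j. f (o' k)) / n j - (\<Sum>k=1..n j. f (\<pi> (o' k))) / n j"
          unfolding \<mu>_def emp_integral[OF n1 nx(2) f] \<nu>_def
          using empirical_integral[OF n1 _ fY Yl.closedZ, of "\<lambda>k. \<pi> (orbit S (x j) (\<zeta> j) k)" j] pi by (simp add: o'_def)
        also have "\<dots> = (\<Sum>k=1..n j. f (o' k) - f (\<pi> (o' k))) / n j" by (simp add: sum_subtractf diff_divide_distrib)
        also have "\<bar>\<dots>\<bar> \<le> (\<Sum>k=1..n j. \<bar>f (o' k) - f (\<pi> (o' k))\<bar>) / n j" by (simp add: divide_right_mono)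
        also have "\<dots> \<le> (\<Sum>k=1..n j. e / 2 + (if k < k1 then 2 * B else 0)) / n j"
          by (intro divide_right_mono sum_mono t) auto
        also have "(\<Sum>k=1..n j. e / 2 + (if k < k1 then 2 * B else 0)) = n j * (e / 2) + (\<Sum>k=1..n j. if k < k1 then 2 * B else 0)"
          by (simp add: sum.distrib)
        also have "(\<Sum>k=1..n j. if k < k1 then 2 * B else 0) \<le> (\<Sum>k<k1. 2 * B)"
          unfolding sum.inter_filter[symmetric, OF finite_atLeastAtMost] by (rule sum_mono2) (use B in auto)
        also have "(\<Sum>k<k1. 2 * B) = 2 * B * k1" by simp
        also have "(n j * (e / 2) + 2 * B * k1) / n j < e"
        proof -
          have "real n2 * (e / 2) \<le> real (n j) * (e / 2)" using j nx(1)[of j] e by (intro mult_right_mono) auto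
          then have "n j * (e / 2) + 2 * B * k1 < n j * e" using n2 by (simp add: field_simps)
          then show ?thesis using n1[of j] by (simp add: field_simps)
        qed
        finally show ?thesis by (simp add: divide_right_mono)
      qed
      then show "\<exists>no. \<forall>n\<ge>no. norm ((LINT x:Z|\<mu> n. f x) - (LINT x:Y|\<nu> n. f x) - 0) < e" by blast
    qed
    have "(\<lambda>j. ((LINT x:Z|\<mu> (r j). f x) - (LINT x:Y|\<nu> (r j). f x)) + (LINT x:Y|\<nu> (r j). f x)) \<longlonglongrightarrow> 0 + (LINT x:Y|\<nu>0. f x)"
      using LIMSEQ_subseq_LIMSEQ[OF diff r(1)] r(3)[OF fY] by (intro tendsto_add) (auto simp: o_def)
    moreover have "(LINT x:Y|\<nu>0. f x) = (LINT x:Z|\<nu>0. f x)"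
      by (rule set_integral_probs_subset[symmetric, OF r(2) Yl.closedZ Zl.closedZ YZ Zl.Cb_cont[OF f]])
    ultimately show "(\<lambda>j. LINT x:Z|\<mu> (r j). f x) \<longlonglongrightarrow> (LINT x:Z|\<nu>0. f x)" by simp
  qed
  then show False using nx(3) by (auto simp: \<mu>_def eventually_sequentially)
qed

section \<open>Upper bound for tilted laws\<close>

text \<open>Left unnormalised on purpose: V = 0 gives the probability of \<open>F\<close>, and the
  whole space P(\<open>Z\<close>) gives T^n 1.\<close>

definition tilt :: "('a \<Rightarrow> real) \<Rightarrow> nat \<Rightarrow> 'a \<Rightarrow> 'a measure set \<Rightarrow> real" where
  "tilt V n x F = (\<integral>\<zeta>. indicator {\<zeta>. emp x n \<zeta> \<in> F} \<zeta> * exp (\<Sum>k=1..n. V (orbit S x \<zeta> k)) \<partial>PS)"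

lemma exp_sum_integrable:
  assumes V: "V \<in> Cb Z" and x: "x \<in> Z"
  shows "integrable PS (\<lambda>\<zeta>. exp (\<Sum>k=1..n. V (orbit S x \<zeta> k)))"
    "(\<integral>\<zeta>. exp (\<Sum>k=1..n. V (orbit S x \<zeta> k)) \<partial>PS) = (T V ^^ n) (\<lambda>_. 1) x"
  using Zl.FK_integrable[OF V Zl.Cb_one x, of n] Zl.Tn_expectation[OF V Zl.Cb_one x, of n] by simp_all

lemma tilt_integrable:
  assumes V: "V \<in> Cb Z" and x: "x \<in> Z" and F: "{\<zeta>. emp x n \<zeta> \<in> F} \<in> sets PS"
  shows "integrable PS (\<lambda>\<zeta>. indicator {\<zeta>. emp x n \<zeta> \<in> F} \<zeta> * exp (\<Sum>k=1..n. V (orbit S x \<zeta> k)))"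
  using integrable_mult_indicator[OF F exp_sum_integrable(1)[OF V x, of n]] by simp

text \<open>Where the integral of W - V exceeds lam W + c, the weight exp(sum V) is below exp(sum W)
  exp(- (lam W + c) n), whose expectation is controlled by \<open>lam W\<close>. The strict surplus
  b > a is exploited when equilibrium states and the lower bound are derived.\<close>

theorem tilted_upper_bound:
  assumes V: "V \<in> Cb Z" and F: "closedin (weak_topology Z) F"
    and a: "\<And>\<sigma>. \<sigma> \<in> F \<Longrightarrow> \<sigma> \<in> probs Y \<Longrightarrow> ereal a < leg \<sigma> - ereal (LINT x:Z|\<sigma>. V x)"
  shows "\<exists>b>a. \<exists>n0. \<forall>n\<ge>n0. \<forall>x\<in>Z. tilt V n x F \<le> exp (- b * n)"
proof -
  define K where "K = F \<inter> probs Y"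
  have compK: "compactin (weak_topology Z) K"
    unfolding K_def by (rule closed_Int_compactin[OF F compactin_probs_subset[OF Yl.compactY Zl.closedZ YZ]])
  have "\<exists>W c. W \<in> Cb Z \<and> a < c \<and> c < (LINT x:Z|\<sigma>. W x) - lam W - (LINT x:Z|\<sigma>. V x)" if s: "\<sigma> \<in> K" for \<sigma>
  proof -
    have "ereal (a + (LINT x:Z|\<sigma>. V x)) < leg \<sigma>"
      using a[of \<sigma>] s by (cases "leg \<sigma>") (auto simp: K_def)
    then obtain W where W: "W \<in> Cb Z" "ereal (a + (LINT x:Z|\<sigma>. V x)) < ereal (LINT x:Z|\<sigma>. W x) - ereal (lam W)"
      unfolding leg_def less_SUP_iff by blast
    then have "a < (LINT x:Z|\<sigma>. W x) - lam W - (LINT x:Z|\<sigma>. V x)" by simp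
    then show ?thesis using W(1) dense by blast
  qed
  then obtain W c where W: "\<And>\<sigma>. \<sigma> \<in> K \<Longrightarrow> W \<sigma> \<in> Cb Z" and ca: "\<And>\<sigma>. \<sigma> \<in> K \<Longrightarrow> a < c \<sigma>"
    and cW: "\<And>\<sigma>. \<sigma> \<in> K \<Longrightarrow> c \<sigma> < (LINT x:Z|\<sigma>. W \<sigma> x) - lam (W \<sigma>) - (LINT x:Z|\<sigma>. V x)" by metis
  define U where "U \<sigma> = {\<tau> \<in> probs Z. (LINT x:Z|\<tau>. W \<sigma> x - V x) \<in> {lam (W \<sigma>) + c \<sigma> <..}}" for \<sigma>
  have WV: "(\<lambda>x. W \<sigma> x - V x) \<in> Cb Z" if "\<sigma> \<in> K" for \<sigma> by (rule Zl.Cb_diff[OF W[OF that] V])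
  have Uo: "openin (weak_topology Z) (U \<sigma>)" if "\<sigma> \<in> K" for \<sigma>
    unfolding U_def by (rule openin_weak_topology_basis[OF WV[OF that]]) auto
  have KZ: "K \<subseteq> probs Z" using probs_mono[OF Yl.closedZ Zl.closedZ YZ] by (auto simp: K_def)
  have Ui: "\<sigma> \<in> U \<sigma>" if s: "\<sigma> \<in> K" for \<sigma>
  proof -
    have sZ: "\<sigma> \<in> probs Z" using KZ s by blast
    have "(LINT x:Z|\<sigma>. W \<sigma> x - V x) = (LINT x:Z|\<sigma>. W \<sigma> x) - (LINT x:Z|\<sigma>. V x)"
      using W[OF s] V by (intro set_integral_diff Cb_integrable[OF sZ _ Zl.closedZ]) (auto simp: Cb_def)
    then show ?thesis using cW[OF s] sZ by (simp add: U_def)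
  qed
  obtain \<D> where D: "finite \<D>" "\<D> \<subseteq> K" "K \<subseteq> \<Union> (U ` \<D>)"
  proof -
    have "K \<subseteq> \<Union> (U ` K)" using Ui by blast
    then obtain \<F> where "finite \<F>" "\<F> \<subseteq> U ` K" "K \<subseteq> \<Union> \<F>"
      using compK Uo unfolding compactin_def by (metis (no_types, lifting) imageE)
    then show ?thesis using that finite_subset_image by metis
  qed
  \<comment> \<open>The element a + 1 keeps the minimum meaningful when the cover is empty.\<close>
  define b0 where "b0 = Min (insert (a + 1) (c ` \<D>))"
  have b0: "a < b0" unfolding b0_def using D ca by (subst Min_gr_iff) auto
  have b0c: "b0 \<le> c \<sigma>" if "\<sigma> \<in> \<D>" for \<sigma> unfolding b0_def using D that by (intro Min_le) auto
  \<comment> \<open>Of the surplus b0 - a one \<open>e\<close> pays for bounding T^n 1 by exp((lam +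
    e) n), another for the number of covering sets, and b0 - 2 e still exceeds a.\<close>
  define e where "e = (b0 - a) / 4"
  have e0: "0 < e" using b0 by (simp add: e_def)
  \<comment> \<open>Adding the complement of \<open>F\<close> turns the cover into an open
    neighbourhood of all of P(\<open>Y\<close>), into which the empirical measures are eventually
    forced.\<close>
  have "openin (weak_topology Z) (\<Union> (U ` \<D>) \<union> (probs Z - F))"
    using Uo D(2) F by (intro openin_Un openin_Union) (auto simp: closedin_def)
  moreover have "probs Y \<subseteq> \<Union> (U ` \<D>) \<union> (probs Z - F)"
    using D(3) probs_mono[OF Yl.closedZ Zl.closedZ YZ] by (auto simp: K_def)
  ultimately have "\<exists>n1. \<forall>n\<ge>n1. \<forall>x\<in>Z. \<forall>\<zeta>. emp x n \<zeta> \<in> \<Union> (U ` \<D>) \<union> (probs Z - F)"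
    by (rule emp_eventually_in)
  then obtain n1 where n1: "\<And>n x \<zeta>. n \<ge> n1 \<Longrightarrow> x \<in> Z \<Longrightarrow> emp x n \<zeta> \<in> \<Union> (U ` \<D>) \<union> (probs Z - F)"
    by blast
  have "\<forall>\<sigma>\<in>\<D>. \<exists>n0. \<forall>n\<ge>n0. \<forall>x\<in>Z. (T (W \<sigma>) ^^ n) (\<lambda>_. 1) x \<le> exp ((lam (W \<sigma>) + e) * n)"
    using lam_upper[OF W] D(2) e0 by (meson less_add_same_cancel1 subsetD)
  then have "\<forall>\<sigma>\<in>\<D>. eventually (\<lambda>n. \<forall>x\<in>Z. (T (W \<sigma>) ^^ n) (\<lambda>_. 1) x \<le> exp ((lam (W \<sigma>) + e) * n)) sequentially"
    by (simp add: eventually_sequentially)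
  then have "eventually (\<lambda>n. \<forall>\<sigma>\<in>\<D>. \<forall>x\<in>Z. (T (W \<sigma>) ^^ n) (\<lambda>_. 1) x \<le> exp ((lam (W \<sigma>) + e) * n)) sequentially"
    by (rule eventually_ball_finite[OF D(1)])
  then obtain n2 where n2: "\<And>n \<sigma> x. n \<ge> n2 \<Longrightarrow> \<sigma> \<in> \<D> \<Longrightarrow> x \<in> Z \<Longrightarrow> (T (W \<sigma>) ^^ n) (\<lambda>_. 1) x \<le> exp ((lam (W \<sigma>) + e) * n)"
    by (auto simp: eventually_sequentially)
  define b where "b = b0 - 2 * e"
  have ab: "a < b" using b0 by (simp add: b_def e_def field_simps)
  define C where "C = real (card \<D>) + 1"
  have "- b0 + e < - b" using e0 by (simp add: b_def)
  then obtain n3 where n3: "\<And>n. n \<ge> n3 \<Longrightarrow> (- b0 + e) * real n + ln C \<le> - b * n"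
    using exp_rate_eventually by blast
  have "tilt V n x F \<le> exp (- b * n)" if n: "n \<ge> max (max 1 n1) (max n2 n3)" and x: "x \<in> Z" for n x
  proof -
    have nn: "n \<ge> 1" "n \<ge> n1" "n \<ge> n2" "n \<ge> n3" using n by auto
    have Fs: "{\<zeta>. emp x n \<zeta> \<in> F} \<in> sets PS" by (rule emp_sets_closed[OF nn(1) x F])
    have i: "integrable PS (\<lambda>\<zeta>. exp (\<Sum>k=1..n. W \<sigma> (orbit S x \<zeta> k)) * exp (- (lam (W \<sigma>) + c \<sigma>) * n))" if "\<sigma> \<in> \<D>" for \<sigma>
      using exp_sum_integrable(1)[OF W x, of \<sigma> n] that D(2) by auto
    have "tilt V n x F \<le> (\<integral>\<zeta>. (\<Sum>\<sigma>\<in>\<D>. exp (\<Sum>k=1..n. W \<sigma> (orbit S x \<zeta> k)) * exp (- (lam (W \<sigma>) + c \<sigma>) * n)) \<partial>PS)"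
      unfolding tilt_def
    proof (rule integral_mono[OF tilt_integrable[OF V x Fs] Bochner_Integration.integrable_sum[OF i]])
      fix \<zeta>
      show "indicator {\<zeta>. emp x n \<zeta> \<in> F} \<zeta> * exp (\<Sum>k=1..n. V (orbit S x \<zeta> k)) \<le> (\<Sum>\<sigma>\<in>\<D>. exp (\<Sum>k=1..n. W \<sigma> (orbit S x \<zeta> k)) * exp (- (lam (W \<sigma>) + c \<sigma>) * n))"
      proof (cases "emp x n \<zeta> \<in> F")
        case True
        then obtain \<sigma> where s: "\<sigma> \<in> \<D>" "emp x n \<zeta> \<in> U \<sigma>" using n1[OF nn(2) x, of \<zeta>] by auto
        have sK: "\<sigma> \<in> K" using s D by blast
        have "lam (W \<sigma>) + c \<sigma> < (\<Sum>k=1..n. W \<sigma> (orbit S x \<zeta> k) - V (orbit S x \<zeta> k)) / n"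
          using s(2) unfolding U_def emp_integral[OF nn(1) x WV[OF sK], symmetric] by simp
        then have "(lam (W \<sigma>) + c \<sigma>) * n < (\<Sum>k=1..n. W \<sigma> (orbit S x \<zeta> k)) - (\<Sum>k=1..n. V (orbit S x \<zeta> k))"
          using nn(1) by (simp add: sum_subtractf field_simps)
        then have "exp (\<Sum>k=1..n. V (orbit S x \<zeta> k)) \<le> exp ((\<Sum>k=1..n. W \<sigma> (orbit S x \<zeta> k)) + (- (lam (W \<sigma>) + c \<sigma>) * n))" by (simp add: algebra_simps)
        also have "\<dots> = exp (\<Sum>k=1..n. W \<sigma> (orbit S x \<zeta> k)) * exp (- (lam (W \<sigma>) + c \<sigma>) * n)" by (rule exp_add)
        also have "\<dots> \<le> (\<Sum>\<sigma>\<in>\<D>. exp (\<Sum>k=1..n. W \<sigma> (orbit S x \<zeta> k)) * exp (- (lam (W \<sigma>) + c \<sigma>) * n))"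
          using s(1) D(1) by (intro member_le_sum) auto
        finally show ?thesis using True by simp
      qed (auto intro: sum_nonneg)
    qed
    also have "\<dots> = (\<Sum>\<sigma>\<in>\<D>. (T (W \<sigma>) ^^ n) (\<lambda>_. 1) x * exp (- (lam (W \<sigma>) + c \<sigma>) * n))"
      using i exp_sum_integrable(2)[OF W x] D(2) by (subst Bochner_Integration.integral_sum) (auto intro!: sum.cong)
    also have "\<dots> \<le> (\<Sum>\<sigma>\<in>\<D>. exp ((- b0 + e) * n))"
    proof (rule sum_mono)
      fix \<sigma> assume s: "\<sigma> \<in> \<D>"
      have "(T (W \<sigma>) ^^ n) (\<lambda>_. 1) x * exp (- (lam (W \<sigma>) + c \<sigma>) * n) \<le> exp ((lam (W \<sigma>) + e) * n) * exp (- (lam (W \<sigma>) + c \<sigma>) * n)"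
        using n2[OF nn(3) s x] by (intro mult_right_mono) auto
      also have "\<dots> = exp ((e - c \<sigma>) * n)" by (simp add: exp_add[symmetric] algebra_simps)
      also have "\<dots> \<le> exp ((- b0 + e) * n)" using b0c[OF s] by (simp add: mult_right_mono)
      finally show "(T (W \<sigma>) ^^ n) (\<lambda>_. 1) x * exp (- (lam (W \<sigma>) + c \<sigma>) * n) \<le> exp ((- b0 + e) * n)" .
    qed
    also have "\<dots> \<le> C * exp ((- b0 + e) * n)" by (simp add: C_def)
    also have "\<dots> = exp ((- b0 + e) * n + ln C)" by (simp add: exp_add C_def add_pos_nonneg)
    also have "\<dots> \<le> exp (- b * n)" using n3[OF nn(4)] by simp
    finally show ?thesis .
  qed
  with ab show ?thesis by blast
qed

lemma tilt_zero:
  assumes "{\<zeta>. emp x n \<zeta> \<in> F} \<in> sets PS"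
  shows "tilt (\<lambda>_. 0) n x F = prob_L M \<xi> S x n F"
  using prob_L_eq[OF assms] by (simp add: tilt_def)

theorem upper_bound:
  assumes F: "closedin (weak_topology Z) F"
  shows "limsup (\<lambda>n. SUP x\<in>Z. ereal (1 / real n) * elog (prob_L M \<xi> S x n F)) \<le> - (INF \<sigma>\<in>F. rate M \<xi> S Y \<sigma>)"
proof (rule real_ereal_bound)
  fix a :: real assume a: "ereal a < (INF \<sigma>\<in>F. rate M \<xi> S Y \<sigma>)"
  have FZ: "F \<subseteq> probs Z" using closedin_subset[OF F] by simp
  have "ereal a < leg \<sigma> - ereal (LINT x:Z|\<sigma>. 0)" if "\<sigma> \<in> F" "\<sigma> \<in> probs Y" for \<sigma>
  proof -
    have "ereal a < rate M \<xi> S Y \<sigma>" using a INF_lower[OF that(1)] by (rule less_le_trans)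
    moreover have "\<sigma> \<in> probs Z" using that FZ by blast
    ultimately show ?thesis by (simp add: leg_rate set_lebesgue_integral_def zero_ereal_def[symmetric])
  qed
  from tilted_upper_bound[OF Zl.Cb_zero F this] obtain b n0 where b: "a < b" and
    n0: "\<And>n x. n \<ge> n0 \<Longrightarrow> x \<in> Z \<Longrightarrow> tilt (\<lambda>_. 0) n x F \<le> exp (- b * n)" by blast
  have "eventually (\<lambda>n. (SUP x\<in>Z. ereal (1 / real n) * elog (prob_L M \<xi> S x n F)) \<le> ereal (- a)) sequentially"
  proof (rule eventually_sequentiallyI[of "max 1 n0"], rule SUP_least)
    fix n x assume n: "max 1 n0 \<le> n" and x: "x \<in> Z"
    have n1: "n \<ge> 1" using n by simp
    have p: "prob_L M \<xi> S x n F \<le> exp (- b * n)"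
      using n0[of n x] n x tilt_zero[OF emp_sets_closed[OF n1 x F]] by simp
    show "ereal (1 / real n) * elog (prob_L M \<xi> S x n F) \<le> ereal (- a)"
    proof (cases "prob_L M \<xi> S x n F > 0")
      case True
      have "ln (prob_L M \<xi> S x n F) \<le> - b * n" using p True by (metis ln_exp ln_le_cancel_iff exp_gt_zero)
      also have "\<dots> \<le> - a * n" using b by (intro mult_right_mono) auto
      finally show ?thesis using True n1 by (simp add: elog_def field_simps)
    qed (use n1 in \<open>simp add: elog_def\<close>)
  qed
  then show "limsup (\<lambda>n. SUP x\<in>Z. ereal (1 / real n) * elog (prob_L M \<xi> S x n F)) \<le> ereal (- a)"
    by (rule Limsup_bounded)
qed

text \<open>Otherwise the tilted bound on the whole space gives T^n 1 \<le> exp(- b n) with - b <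
  lam V, contradicting the infimum that defines \<open>lam\<close>.\<close>

lemma equilibrium_exists:
  assumes V: "V \<in> Cb Z"
  shows "\<exists>\<sigma>\<in>probs Y. leg \<sigma> \<le> ereal ((LINT x:Z|\<sigma>. V x) - lam V)"
proof (rule ccontr)
  assume neg: "\<not> ?thesis"
  have "ereal (- lam V) < leg \<sigma> - ereal (LINT x:Z|\<sigma>. V x)" if "\<sigma> \<in> probs Y" for \<sigma>
  proof -
    have "ereal ((LINT x:Z|\<sigma>. V x) - lam V) < leg \<sigma>" using neg that by auto
    then show ?thesis by (cases "leg \<sigma>") auto
  qed
  moreover have "closedin (weak_topology Z) (probs Z)" using closedin_topspace[of "weak_topology Z"] by simp
  ultimately obtain b n0 where b: "- lam V < b" and n0: "\<And>n x. n \<ge> n0 \<Longrightarrow> x \<in> Z \<Longrightarrow> tilt V n x (probs Z) \<le> exp (- b * n)"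
    using tilted_upper_bound[OF V, of "probs Z" "- lam V"] by blast
  define n where "n = max 1 n0"
  obtain y where y: "y \<in> Y" "Yl.maxT V n = (T V ^^ n) (\<lambda>_. 1) y" using Yl.maxT_attained[OF CbY[OF V]] by metis
  have yZ: "y \<in> Z" using y YZ by blast
  have "tilt V n y (probs Z) = (T V ^^ n) (\<lambda>_. 1) y"
    using emp_probs[of n y] yZ exp_sum_integrable(2)[OF V yZ, of n] by (simp add: tilt_def n_def)
  then have "Yl.maxT V n \<le> exp (- b * n)" using n0[OF _ yZ, of n] y by (simp add: n_def)
  then have "ln (Yl.maxT V n) \<le> - b * n" using Yl.maxT_pos[OF CbY[OF V]] by (metis ln_exp ln_le_cancel_iff exp_gt_zero)
  then have "ln (Yl.maxT V n) / n \<le> - b" by (simp add: n_def field_simps)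
  then show False using Yl.lam_le[OF CbY[OF V], of n] b by (simp add: n_def)
qed

section \<open>Uniform growth from below and the lower bound\<close>

text \<open>The lower half of the uniform convergence required in \<open>VR\<close>; the upper half
  holds for every potential by \<open>lam_upper\<close>.\<close>

definition low :: "('a \<Rightarrow> real) \<Rightarrow> 'a set \<Rightarrow> bool" where
  "low V X \<longleftrightarrow> (\<forall>c<lam V. \<exists>n0. \<forall>n\<ge>n0. \<forall>x\<in>X. exp (c * real n) \<le> (T V ^^ n) (\<lambda>_. 1) x)"

text \<open>One large time on \<open>Y\<close> gives a strict inequality there, and
  \<open>iterate_lower\<close> spreads it to \<open>Z\<close>; two intermediate rates supply the
  strictness.\<close>

lemma low_iff:
  assumes V: "V \<in> Cb Z"
  shows "low V Z \<longleftrightarrow> low V Y"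
proof
  show "low V Z \<Longrightarrow> low V Y" unfolding low_def using YZ by blast
  assume l: "low V Y"
  show "low V Z"
    unfolding low_def
  proof (intro allI impI)
    fix c assume c: "c < lam V"
    obtain c1 where c1: "c < c1" "c1 < lam V" using dense[OF c] by auto
    obtain c2 where c2: "c1 < c2" "c2 < lam V" using dense[OF c1(2)] by auto
    obtain n0 where n0: "\<And>n y. n \<ge> n0 \<Longrightarrow> y \<in> Y \<Longrightarrow> exp (c2 * real n) \<le> (T V ^^ n) (\<lambda>_. 1) y"
      using l c2(2) unfolding low_def by blast
    show "\<exists>n0. \<forall>n\<ge>n0. \<forall>x\<in>Z. exp (c * real n) \<le> (T V ^^ n) (\<lambda>_. 1) x"
    proof (rule iterate_lower[OF V _ _ c1(1), of "max 1 n0"])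
      fix y assume y: "y \<in> Y"
      have "exp (c1 * real (max 1 n0)) < exp (c2 * real (max 1 n0))"
        unfolding exp_less_cancel_iff using c2(1) by (intro mult_strict_right_mono) auto
      also have "\<dots> \<le> (T V ^^ (max 1 n0)) (\<lambda>_. 1) y" by (rule n0[OF _ y]) simp
      finally show "exp (c1 * real (max 1 n0)) < (T V ^^ (max 1 n0)) (\<lambda>_. 1) y" .
    qed simp
  qed
qed

lemma uniform_limit_log_mgf_iff:
  assumes V: "V \<in> Cb Z"
  shows "uniform_limit Z (log_mgf M \<xi> S V) (\<lambda>_. lam V) sequentially \<longleftrightarrow> low V Z"
proof
  assume u: "uniform_limit Z (log_mgf M \<xi> S V) (\<lambda>_. lam V) sequentially"
  show "low V Z"
    unfolding low_def
  proof (intro allI impI)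
    fix c assume c: "c < lam V"
    then obtain n0 where n0: "\<And>n x. n \<ge> n0 \<Longrightarrow> x \<in> Z \<Longrightarrow> dist (log_mgf M \<xi> S V n x) (lam V) < lam V - c"
      using uniform_limitD[OF u, of "lam V - c"] by (auto simp: eventually_sequentially)
    show "\<exists>n0. \<forall>n\<ge>n0. \<forall>x\<in>Z. exp (c * real n) \<le> (T V ^^ n) (\<lambda>_. 1) x"
    proof (intro exI[of _ "max 1 n0"] allI impI ballI)
      fix n x assume n: "max 1 n0 \<le> n" and x: "x \<in> Z"
      have "c < 1 / real n * ln ((T V ^^ n) (\<lambda>_. 1) x)"
        using n0[of n x] n x unfolding Zl.log_mgf_eq[OF V x] dist_real_def by auto
      then have "c * n < ln ((T V ^^ n) (\<lambda>_. 1) x)" using n by (simp add: field_simps)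
      then have "exp (c * n) < exp (ln ((T V ^^ n) (\<lambda>_. 1) x))" by simp
      then show "exp (c * real n) \<le> (T V ^^ n) (\<lambda>_. 1) x" using Zl.Tn_pos[OF V x, of n] by simp
    qed
  qed
next
  assume l: "low V Z"
  show "uniform_limit Z (log_mgf M \<xi> S V) (\<lambda>_. lam V) sequentially"
  proof (rule uniform_limitI)
    fix e :: real assume e: "0 < e"
    obtain n1 where n1: "\<And>n x. n \<ge> n1 \<Longrightarrow> x \<in> Z \<Longrightarrow> exp ((lam V - e/2) * n) \<le> (T V ^^ n) (\<lambda>_. 1) x"
      using l e unfolding low_def by (metis diff_less_eq less_add_same_cancel1 half_gt_zero)
    obtain n2 where n2: "\<And>n x. n \<ge> n2 \<Longrightarrow> x \<in> Z \<Longrightarrow> (T V ^^ n) (\<lambda>_. 1) x \<le> exp ((lam V + e/2) * n)"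
      using lam_upper[OF V, of "lam V + e/2"] e by auto
    show "eventually (\<lambda>n. \<forall>x\<in>Z. dist (log_mgf M \<xi> S V n x) (lam V) < e) sequentially"
    proof (rule eventually_sequentiallyI[of "max 1 (max n1 n2)"], intro ballI)
      fix n x assume n: "max 1 (max n1 n2) \<le> n" and x: "x \<in> Z"
      have p: "0 < (T V ^^ n) (\<lambda>_. 1) x" by (rule Zl.Tn_pos[OF V x])
      have "(lam V - e/2) * n \<le> ln ((T V ^^ n) (\<lambda>_. 1) x)" using n1[of n x] n x p by (simp add: ln_ge_iff)
      moreover have "ln ((T V ^^ n) (\<lambda>_. 1) x) \<le> (lam V + e/2) * n"
        using n2[of n x] n x p by (metis ln_exp ln_le_cancel_iff exp_gt_zero max.bounded_iff)
      ultimately have "lam V - e/2 \<le> log_mgf M \<xi> S V n x" "log_mgf M \<xi> S V n x \<le> lam V + e/2"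
        unfolding Zl.log_mgf_eq[OF V x] using n by (simp_all add: field_simps)
      then show "dist (log_mgf M \<xi> S V n x) (lam V) < e" using e unfolding dist_real_def by linarith
    qed
  qed
qed

text \<open>Kifer's lower bound: under the law tilted by \<open>V\<close> the empirical measure concentrates at the
  unique equilibrium state.\<close>

theorem lower_bound_at:
  assumes V: "V \<in> Cb Z" and l: "low V Z" and s: "\<sigma> \<in> probs Y"
    and uniq: "\<And>\<tau>. \<tau> \<in> probs Y \<Longrightarrow> leg \<tau> \<le> ereal ((LINT x:Z|\<tau>. V x) - lam V) \<Longrightarrow> \<tau> = \<sigma>"
    and G: "openin (weak_topology Z) G" "\<sigma> \<in> G" and e: "0 < e"
  shows "\<exists>n0. \<forall>n\<ge>n0. \<forall>x\<in>Z. exp (- ((LINT x:Z|\<sigma>. V x) - lam V + e) * n) \<le> prob_L M \<xi> S x n G"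
proof -
  define v where "v = (LINT x:Z|\<sigma>. V x)"
  have sZ: "\<sigma> \<in> probs Z" using s probs_mono[OF Yl.closedZ Zl.closedZ YZ] by blast
  \<comment> \<open>On \<open>H\<close> the tilting weight is at most exp((v + e/4) n), so tilted
    mass of \<open>H\<close> converts back into probability.\<close>
  define H where "H = G \<inter> {\<tau> \<in> probs Z. (LINT x:Z|\<tau>. V x) \<in> {..< v + e/4}}"
  have Ho: "openin (weak_topology Z) H"
    unfolding H_def by (intro openin_Int G(1) openin_weak_topology_basis[OF V]) auto
  have sH: "\<sigma> \<in> H" using G(2) sZ e by (simp add: H_def v_def)
  have F: "closedin (weak_topology Z) (probs Z - H)" using Ho by (metis closedin_diff closedin_topspace topspace_weak_topology)
  have "ereal (- lam V) < leg \<tau> - ereal (LINT x:Z|\<tau>. V x)" if t: "\<tau> \<in> probs Z - H" "\<tau> \<in> probs Y" for \<tau>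
  proof -
    have "\<tau> \<noteq> \<sigma>" using t sH by auto
    then have "\<not> leg \<tau> \<le> ereal ((LINT x:Z|\<tau>. V x) - lam V)" using uniq t(2) by blast
    then show ?thesis by (cases "leg \<tau>") auto
  qed
  from tilted_upper_bound[OF V F this] obtain b n1 where b: "- lam V < b"
    and n1: "\<And>n x. n \<ge> n1 \<Longrightarrow> x \<in> Z \<Longrightarrow> tilt V n x (probs Z - H) \<le> exp (- b * n)" by blast
  \<comment> \<open>Small against both the admissible error and the exponential gap b + lam V, so
    that the complement of \<open>H\<close> carries at most half of the tilted mass.\<close>
  define d where "d = min (e/4) ((b + lam V) / 2)"
  have d: "0 < d" "d \<le> e/4" "- b < lam V - d" using b e by (auto simp: d_def min_def field_simps)
  have "lam V - d < lam V" using d by simp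
  then obtain n2 where n2: "\<And>n x. n \<ge> n2 \<Longrightarrow> x \<in> Z \<Longrightarrow> exp ((lam V - d) * real n) \<le> (T V ^^ n) (\<lambda>_. 1) x"
    using l unfolding low_def by blast
  obtain n3 where n3: "\<And>n. n \<ge> n3 \<Longrightarrow> - b * real n + ln 2 \<le> (lam V - d) * n" using exp_rate_eventually[OF d(3)] by blast
  have "- (v - lam V + e) < - (v + e/4) + (lam V - d)" using d e by simp
  then obtain n4 where n4: "\<And>n. n \<ge> n4 \<Longrightarrow> - (v - lam V + e) * real n + ln 2 \<le> (- (v + e/4) + (lam V - d)) * n"
    using exp_rate_eventually by blast
  have "exp (- (v - lam V + e) * n) \<le> prob_L M \<xi> S x n G" if n: "n \<ge> max (max 1 n1) (max n2 (max n3 n4))" and x: "x \<in> Z" for n x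
  proof -
    have nn: "n \<ge> 1" "n \<ge> n1" "n \<ge> n2" "n \<ge> n3" "n \<ge> n4" using n by auto
    have Hs: "{\<zeta>. emp x n \<zeta> \<in> H} \<in> sets PS" by (rule emp_sets_open[OF nn(1) x Ho])
    have Fs: "{\<zeta>. emp x n \<zeta> \<in> probs Z - H} \<in> sets PS" by (rule emp_sets_closed[OF nn(1) x F])
    have Gs: "{\<zeta>. emp x n \<zeta> \<in> G} \<in> sets PS" by (rule emp_sets_open[OF nn(1) x G(1)])
    have split: "(T V ^^ n) (\<lambda>_. 1) x = tilt V n x H + tilt V n x (probs Z - H)"
      unfolding tilt_def exp_sum_integrable(2)[OF V x, symmetric]
      by (subst Bochner_Integration.integral_add[OF tilt_integrable[OF V x Hs] tilt_integrable[OF V x Fs], symmetric])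
         (use emp_probs[OF nn(1) x] in \<open>auto intro!: Bochner_Integration.integral_cong simp: indicator_def\<close>)
    have half: "exp ((lam V - d) * n) / 2 \<ge> exp (- b * n)"
    proof -
      have "exp (- b * n + ln 2) \<le> exp ((lam V - d) * n)" using n3[OF nn(4)] by simp
      then show ?thesis by (simp only: exp_add) simp
    qed
    have 1: "exp ((lam V - d) * n) / 2 \<le> tilt V n x H"
      using n2[OF nn(3) x] n1[OF nn(2) x] split half by linarith
    have "tilt V n x H \<le> (\<integral>\<zeta>. indicator {\<zeta>. emp x n \<zeta> \<in> G} \<zeta> * exp ((v + e/4) * n) \<partial>PS)"
      unfolding tilt_def
    proof (rule integral_mono[OF tilt_integrable[OF V x Hs]])
      show "integrable PS (\<lambda>\<zeta>. indicator {\<zeta>. emp x n \<zeta> \<in> G} \<zeta> * exp ((v + e/4) * n))"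
        using Gs by (intro integrable_mult_left integrable_real_indicator) (auto simp: sq.emeasure_finite less_top[symmetric])
      fix \<zeta>
      show "indicator {\<zeta>. emp x n \<zeta> \<in> H} \<zeta> * exp (\<Sum>k=1..n. V (orbit S x \<zeta> k)) \<le> indicator {\<zeta>. emp x n \<zeta> \<in> G} \<zeta> * exp ((v + e/4) * n)"
      proof (cases "emp x n \<zeta> \<in> H")
        case True
        then have "(\<Sum>k=1..n. V (orbit S x \<zeta> k)) / n < v + e/4"
          using emp_integral[OF nn(1) x V, of \<zeta>] by (simp add: H_def)
        then have "(\<Sum>k=1..n. V (orbit S x \<zeta> k)) \<le> (v + e/4) * n" using nn(1) by (simp add: field_simps)
        then show ?thesis using True by (simp add: H_def)
      qed simp
    qed
    also have "\<dots> = prob_L M \<xi> S x n G * exp ((v + e/4) * n)" using prob_L_eq[OF Gs] by simp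
    finally have "exp ((lam V - d) * n) / 2 \<le> prob_L M \<xi> S x n G * exp ((v + e/4) * n)" using 1 by simp
    then have "exp ((lam V - d) * n) / 2 * exp (- (v + e/4) * n) \<le> prob_L M \<xi> S x n G * exp ((v + e/4) * n) * exp (- (v + e/4) * n)"
      by (intro mult_right_mono) auto
    also have "\<dots> = prob_L M \<xi> S x n G"
      using exp_minus_inverse[of "(v + e/4) * n"] by (simp only: mult.assoc mult_minus_left mult_1_right)
    also have "exp ((lam V - d) * n) / 2 * exp (- (v + e/4) * n) = exp ((- (v + e/4) + (lam V - d)) * n) / 2"
      by (simp add: exp_add[symmetric] algebra_simps)
    finally have 2: "exp ((- (v + e/4) + (lam V - d)) * n) / 2 \<le> prob_L M \<xi> S x n G" .
    have "exp (- (v - lam V + e) * n + ln 2) \<le> exp ((- (v + e/4) + (lam V - d)) * n)" using n4[OF nn(5)] by simp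
    then have "exp (- (v - lam V + e) * n) \<le> exp ((- (v + e/4) + (lam V - d)) * n) / 2" by (simp only: exp_add) simp
    with 2 show ?thesis by linarith
  qed
  then show ?thesis unfolding v_def by blast
qed

end

section \<open>The large deviation principle\<close>

text \<open>McShane's extension, truncated to keep the bound.\<close>

lemma lipschitz_extension:
  fixes f :: "'a::metric_space \<Rightarrow> real"
  assumes f: "L-lipschitz_on Y f" and b: "\<And>y. y \<in> Y \<Longrightarrow> \<bar>f y\<bar> \<le> B" and ne: "Y \<noteq> {}"
  obtains g where "L-lipschitz_on UNIV g" "\<And>x. \<bar>g x\<bar> \<le> B" "\<And>y. y \<in> Y \<Longrightarrow> g y = f y"
proof -
  have L0: "0 \<le> L" using lipschitz_on_nonneg[OF f] .
  have B0: "0 \<le> B" using b ne by force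
  define F where "F x = (INF y\<in>Y. f y + L * dist x y)" for x
  have bdd: "bdd_below ((\<lambda>y. f y + L * dist x y) ` Y)" for x
  proof (rule bdd_belowI2[where m="- B"])
    fix y assume y: "y \<in> Y"
    have "- B \<le> f y" using b[OF y] by (simp add: abs_le_iff)
    moreover have "0 \<le> L * dist x y" using L0 by simp
    ultimately show "- B \<le> f y + L * dist x y" by linarith
  qed
  have Fle: "F x \<le> F x' + L * dist x x'" for x x'
  proof -
    have "F x - L * dist x x' \<le> F x'"
      unfolding F_def[of x']
    proof (rule cINF_greatest[OF ne])
      fix y assume y: "y \<in> Y"
      have "F x \<le> f y + L * dist x y" unfolding F_def by (rule cINF_lower[OF bdd y])
      also have "L * dist x y \<le> L * (dist x x' + dist x' y)" using L0 by (intro mult_left_mono dist_triangle)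
      finally show "F x - L * dist x x' \<le> f y + L * dist x' y" by (simp add: distrib_left)
    qed
    then show ?thesis by simp
  qed
  have FY: "F y = f y" if y: "y \<in> Y" for y
  proof (rule antisym)
    show "F y \<le> f y" unfolding F_def using cINF_lower[OF bdd y, of y] by simp
    show "f y \<le> F y"
      unfolding F_def
    proof (rule cINF_greatest[OF ne])
      fix w assume "w \<in> Y"
      then show "f y \<le> f w + L * dist y w" using lipschitz_onD[OF f y, of w] by (simp add: dist_real_def abs_le_iff)
    qed
  qed
  define g where "g x = max (- B) (min B (F x))" for x
  show ?thesis
  proof
    show "L-lipschitz_on UNIV g"
    proof (rule lipschitz_onI[OF _ L0])
      fix x x'
      have "\<bar>g x - g x'\<bar> \<le> \<bar>F x - F x'\<bar>" unfolding g_def by linarith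
      also have "\<dots> \<le> L * dist x x'" using Fle[of x x'] Fle[of x' x] by (simp add: abs_le_iff dist_commute)
      finally show "dist (g x) (g x') \<le> L * dist x x'" by (simp add: dist_real_def)
    qed
    show "\<bar>g x\<bar> \<le> B" for x using B0 by (auto simp: g_def)
    show "g y = f y" if "y \<in> Y" for y using FY[OF that] b[OF that] by (auto simp: g_def abs_le_iff)
  qed
qed

lemma Lb_Cb: "f \<in> Lb Z \<Longrightarrow> f \<in> Cb Z"
  by (auto simp: Lb_def Cb_def lipschitz_on_continuous_on)

lemma Lb_subset: "Y \<subseteq> Z \<Longrightarrow> f \<in> Lb Z \<Longrightarrow> f \<in> Lb Y"
  unfolding Lb_def using lipschitz_on_subset bounded_subset[OF _ image_mono] by blast

lemma uminus_INF_le: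
  fixes f :: "'i \<Rightarrow> ereal"
  assumes "\<And>i. i \<in> A \<Longrightarrow> - f i \<le> L"
  shows "- (INF i\<in>A. f i) \<le> L"
proof -
  have "- L \<le> (INF i\<in>A. f i)"
    by (rule INF_greatest) (use assms ereal_uminus_le_reorder in blast)
  then show ?thesis using ereal_uminus_le_reorder by blast
qed

section \<open>Independence of the radius\<close>

context attracted begin

text \<open>Equilibrium states in terms of \<open>Y\<close> alone; the inequality suffices because
  the reverse one is automatic. \<open>Z\<close> does not occur, which is the source of the
  independence of \<open>R\<close>.\<close>

definition eqst :: "('a \<Rightarrow> real) \<Rightarrow> 'a measure \<Rightarrow> bool" where
  "eqst V \<sigma> \<longleftrightarrow> \<sigma> \<in> probs Y \<and> rate M \<xi> S Y \<sigma> \<le> ereal ((LINT x:Y|\<sigma>. V x) - lam V)"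

lemma probsYZ: "\<sigma> \<in> probs Y \<Longrightarrow> \<sigma> \<in> probs Z"
  using probs_mono[OF Yl.closedZ Zl.closedZ YZ] by blast

lemma integralYZ: "\<sigma> \<in> probs Y \<Longrightarrow> V \<in> Cb Z \<Longrightarrow> (LINT x:Y|\<sigma>. V x) = (LINT x:Z|\<sigma>. V x)"
  by (rule set_integral_probs_subset[symmetric, OF _ Yl.closedZ Zl.closedZ YZ Zl.Cb_cont])

lemma leg_ge: "V \<in> Cb Z \<Longrightarrow> ereal ((LINT x:Z|\<sigma>. V x) - lam V) \<le> leg \<sigma>"
  unfolding leg_def by (rule SUP_upper2[of V]) auto

lemma eqst_iff:
  assumes V: "V \<in> Cb Z"
  shows "eqst V \<sigma> \<longleftrightarrow> \<sigma> \<in> probs Z \<and> ereal (lam V) = ereal (LINT x:Z|\<sigma>. V x) - leg \<sigma>"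
proof
  assume e: "eqst V \<sigma>"
  then have s: "\<sigma> \<in> probs Y" by (simp add: eqst_def)
  then have "leg \<sigma> = ereal ((LINT x:Z|\<sigma>. V x) - lam V)"
    using e leg_ge[OF V, of \<sigma>] leg_rate[OF probsYZ[OF s]] integralYZ[OF s V] by (simp add: eqst_def)
  then show "\<sigma> \<in> probs Z \<and> ereal (lam V) = ereal (LINT x:Z|\<sigma>. V x) - leg \<sigma>" using probsYZ[OF s] by simp
next
  assume e: "\<sigma> \<in> probs Z \<and> ereal (lam V) = ereal (LINT x:Z|\<sigma>. V x) - leg \<sigma>"
  then have l: "leg \<sigma> = ereal ((LINT x:Z|\<sigma>. V x) - lam V)" by (cases "leg \<sigma>") auto
  then have s: "\<sigma> \<in> probs Y" using leg_outside[of \<sigma>] e by (metis PInfty_neq_ereal(2))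
  then show "eqst V \<sigma>" using l e leg_rate[of \<sigma>] integralYZ[OF s V] by (simp add: eqst_def)
qed

lemma eqst_leg:
  assumes "V \<in> Cb Z" "eqst V \<sigma>"
  shows "\<sigma> \<in> probs Y" "leg \<sigma> = ereal ((LINT x:Z|\<sigma>. V x) - lam V)"
proof -
  show "\<sigma> \<in> probs Y" using assms by (simp add: eqst_def)
  show "leg \<sigma> = ereal ((LINT x:Z|\<sigma>. V x) - lam V)"
    using eqst_iff[OF assms(1)] assms(2) by (cases "leg \<sigma>") auto
qed

lemma eqst_of_leg:
  assumes "V \<in> Cb Z" "\<sigma> \<in> probs Y" "leg \<sigma> \<le> ereal ((LINT x:Z|\<sigma>. V x) - lam V)"
  shows "eqst V \<sigma>"
  using assms leg_rate[OF probsYZ[OF assms(2)]] integralYZ[OF assms(2,1)] by (simp add: eqst_def)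

lemma eqst_exists: "V \<in> Cb Z \<Longrightarrow> \<exists>\<sigma>. eqst V \<sigma>"
  using equilibrium_exists eqst_of_leg by blast

lemma lam_cong:
  assumes "\<And>y. y \<in> Y \<Longrightarrow> V y = W y"
  shows "lam V = lam W"
proof -
  have "Yl.maxT V = Yl.maxT W"
    unfolding Yl.maxT_def using Yl.Tn_congV[OF assms] by (intro ext SUP_cong) auto
  then show ?thesis by (simp add: Yl.lam_def)
qed

lemma low_cong:
  assumes "\<And>y. y \<in> Y \<Longrightarrow> V y = W y"
  shows "low V Y = low W Y"
  unfolding low_def using lam_cong[OF assms] Yl.Tn_congV[OF assms] by simp

lemma eqst_cong:
  assumes "\<And>y. y \<in> Y \<Longrightarrow> V y = W y"
  shows "eqst V = eqst W"
  unfolding eqst_def using lam_cong[of V W, OF assms] set_integral_probs_cong[of Y V W, OF assms] by (intro ext) simp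

text \<open>The common value of all W_R: the potential, its growth and its states are considered on
  \<open>Y\<close> only.\<close>

definition Wcore :: "'a measure set" where
  "Wcore = {\<sigma>. \<exists>V\<in>Lb Y. low V Y \<and> (\<exists>!\<tau>. eqst V \<tau>) \<and> eqst V \<sigma>}"

text \<open>Lower growth and equilibrium states see only the values on \<open>Y\<close>, so a
  bounded Lipschitz extension of the potential has the same ones.\<close>

lemma Wcore_extend:
  assumes "\<sigma> \<in> Wcore"
  obtains V where "V \<in> Lb Z" "low V Y" "\<exists>!\<tau>. eqst V \<tau>" "eqst V \<sigma>"
proof -
  obtain W where W: "W \<in> Lb Y" "low W Y" "\<exists>!\<tau>. eqst W \<tau>" "eqst W \<sigma>" using assms by (auto simp: Wcore_def)
  obtain L where L: "L-lipschitz_on Y W" using W(1) by (auto simp: Lb_def)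
  obtain B where B: "\<And>y. y \<in> Y \<Longrightarrow> \<bar>W y\<bar> \<le> B" using Yl.CbE[OF Lb_Cb[OF W(1)]] by metis
  obtain V where V: "L-lipschitz_on UNIV V" "\<And>x. \<bar>V x\<bar> \<le> B" "\<And>y. y \<in> Y \<Longrightarrow> V y = W y"
    using lipschitz_extension[OF L B Yl.Zne] by metis
  have "V \<in> Lb Z" using V(2) lipschitz_on_subset[OF V(1), of Z] by (auto simp: Lb_def bounded_iff)
  moreover have "low V Y" using low_cong[of V W, OF V(3)] W(2) by simp
  moreover have "eqst V = eqst W" by (rule eqst_cong[OF V(3)])
  ultimately show ?thesis using W(3,4) by (intro that[of V]) simp_all
qed

lemma lower_bound:
  assumes G: "openin (weak_topology Z) G"
  shows "- (INF \<sigma>\<in>G \<inter> Wcore. rate M \<xi> S Y \<sigma>) \<le> liminf (\<lambda>n. INF x\<in>Z. ereal (1 / real n) * elog (prob_L M \<xi> S x n G))"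
proof (rule uminus_INF_le)
  fix \<sigma> assume s: "\<sigma> \<in> G \<inter> Wcore"
  then obtain V where V: "V \<in> Lb Z" "low V Y" "\<exists>!\<tau>. eqst V \<tau>" "eqst V \<sigma>" using Wcore_extend by blast
  have VC: "V \<in> Cb Z" by (rule Lb_Cb[OF V(1)])
  define I where "I = (LINT x:Z|\<sigma>. V x) - lam V"
  have rI: "rate M \<xi> S Y \<sigma> = ereal I"
    using eqst_leg[OF VC V(4)] leg_rate[OF probsYZ] by (simp add: I_def)
  have "ereal (- I - e) \<le> liminf (\<lambda>n. INF x\<in>Z. ereal (1 / real n) * elog (prob_L M \<xi> S x n G))" if e: "0 < e" for e
  proof (rule Liminf_bounded)
    have "\<exists>n0. \<forall>n\<ge>n0. \<forall>x\<in>Z. exp (- ((LINT x:Z|\<sigma>. V x) - lam V + e) * n) \<le> prob_L M \<xi> S x n G"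
    proof (rule lower_bound_at[OF VC _ eqst_leg(1)[OF VC V(4)] _ G _ e])
      show "low V Z" using low_iff[OF VC] V(2) by simp
      show "\<tau> = \<sigma>" if "\<tau> \<in> probs Y" "leg \<tau> \<le> ereal ((LINT x:Z|\<tau>. V x) - lam V)" for \<tau>
        using eqst_of_leg[OF VC that] V(3,4) by blast
      show "\<sigma> \<in> G" using s by simp
    qed
    then obtain n0 where n0: "\<And>n x. n \<ge> n0 \<Longrightarrow> x \<in> Z \<Longrightarrow> exp (- (I + e) * n) \<le> prob_L M \<xi> S x n G"
      unfolding I_def by blast
    show "\<forall>\<^sub>F n in sequentially. ereal (- I - e) \<le> (INF x\<in>Z. ereal (1 / real n) * elog (prob_L M \<xi> S x n G))"
    proof (rule eventually_sequentiallyI[of "max 1 n0"], rule INF_greatest)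
      fix n x assume n: "max 1 n0 \<le> n" and x: "x \<in> Z"
      have p: "exp (- (I + e) * n) \<le> prob_L M \<xi> S x n G" using n0 n x by simp
      then have p0: "0 < prob_L M \<xi> S x n G" using exp_gt_zero less_le_trans by blast
      then have "- (I + e) * n \<le> ln (prob_L M \<xi> S x n G)" using p by (simp only: ln_ge_iff)
      then show "ereal (- I - e) \<le> ereal (1 / real n) * elog (prob_L M \<xi> S x n G)"
        using p0 n by (simp add: elog_def field_simps)
    qed
  qed
  then have "ereal (- I) \<le> liminf (\<lambda>n. INF x\<in>Z. ereal (1 / real n) * elog (prob_L M \<xi> S x n G)) + ereal e" if "0 < e" for e
    using that by (cases "liminf (\<lambda>n. INF x\<in>Z. ereal (1 / real n) * elog (prob_L M \<xi> S x n G))") (force simp: algebra_simps)+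
  then have "ereal (- I) \<le> liminf (\<lambda>n. INF x\<in>Z. ereal (1 / real n) * elog (prob_L M \<xi> S x n G))"
    by (rule ereal_le_epsilon2)
  then show "- rate M \<xi> S Y \<sigma> \<le> liminf (\<lambda>n. INF x\<in>Z. ereal (1 / real n) * elog (prob_L M \<xi> S x n G))"
    by (simp add: rI)
qed

lemma Wcore_probs: "\<sigma> \<in> Wcore \<Longrightarrow> \<sigma> \<in> probs Y"
  by (auto simp: Wcore_def eqst_def)

context
  fixes R assumes Z: "Z = XR S Y R"
begin

lemma pressure_XR: "V \<in> Cb Z \<Longrightarrow> pressure M \<xi> S Y R V = ereal (lam V)"
  unfolding pressure_def Z[symmetric] by (rule pressure_eq)

lemma legendre_XR: "legendre M \<xi> S Y R \<sigma> = leg \<sigma>"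
  unfolding legendre_def leg_def Z[symmetric] by (intro SUP_cong refl) (simp add: pressure_XR)

lemma equilibrium_state_XR: "V \<in> Cb Z \<Longrightarrow> equilibrium_state M \<xi> S Y R V \<sigma> \<longleftrightarrow> eqst V \<sigma>"
  unfolding equilibrium_state_def legendre_XR Z[symmetric] by (simp add: pressure_XR eqst_iff)

text \<open>The limit in \<open>VR\<close> can only be \<open>lam V\<close>, and uniform convergence
  to it reduces to growth from below on \<open>Y\<close>.\<close>

lemma VR_iff: "V \<in> VR M \<xi> S Y R \<longleftrightarrow> V \<in> Lb Z \<and> low V Y \<and> (\<exists>!\<sigma>. eqst V \<sigma>)"
proof (cases "V \<in> Lb Z")
  case True
  then have V: "V \<in> Cb Z" by (rule Lb_Cb)
  have "equilibrium_state M \<xi> S Y R V = eqst V" by (intro ext equilibrium_state_XR[OF V])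
  then show ?thesis
    unfolding VR_def Z[symmetric]
    using True low_iff[OF V] uniform_limit_log_mgf_iff[OF V] by (simp add: pressure_XR[OF V])
qed (simp add: VR_def Z)

text \<open>Restriction of potentials to \<open>Y\<close> in one direction, Lipschitz extension from
  \<open>Y\<close> in the other.\<close>

lemma WR_eq: "WR M \<xi> S Y R = Wcore"
proof (intro equalityI subsetI)
  have THE: "(THE \<sigma>. equilibrium_state M \<xi> S Y R V \<sigma>) = \<sigma>" if "V \<in> VR M \<xi> S Y R" "eqst V \<sigma>" for V \<sigma>
    using that unfolding VR_iff by (intro the_equality) (auto simp: equilibrium_state_XR[OF Lb_Cb])
  fix \<sigma>
  {
    assume "\<sigma> \<in> WR M \<xi> S Y R"
    then obtain V where V: "V \<in> VR M \<xi> S Y R" "\<sigma> = (THE \<sigma>. equilibrium_state M \<xi> S Y R V \<sigma>)" by (auto simp: WR_def)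
    then obtain \<tau> where "eqst V \<tau>" unfolding VR_iff by blast
    then have "eqst V \<sigma>" using THE[OF V(1)] V(2) by metis
    then show "\<sigma> \<in> Wcore" using V(1) Lb_subset[OF YZ] unfolding VR_iff Wcore_def by blast
  }
  assume "\<sigma> \<in> Wcore"
  then obtain V where V: "V \<in> Lb Z" "low V Y" "\<exists>!\<tau>. eqst V \<tau>" "eqst V \<sigma>" using Wcore_extend by blast
  then have "V \<in> VR M \<xi> S Y R" using VR_iff by blast
  then show "\<sigma> \<in> WR M \<xi> S Y R" using THE[OF _ V(4)] unfolding WR_def by (metis image_eqI)
qed

end

end

context rds_cpt begin

text \<open>On P(\<open>Y\<close>) the rate is a supremum of weakly continuous functionals, off the
  closed set P(\<open>Y\<close>) it is infinite; sublevel sets are therefore closed subsets of a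
  compact set.\<close>

lemma good_rate: "good_rate_function (weak_topology UNIV) (rate M \<xi> S Y)"
proof -
  interpret A: attracted M \<xi> S Y Y by (rule attracted_self)
  have cl: "closedin (weak_topology UNIV) (probs Y)" using closedin_probs[OF closedZ Zne, of UNIV] by simp
  have op: "openin (weak_topology UNIV) {\<sigma> \<in> probs UNIV. a < rate M \<xi> S Y \<sigma>}" for a
  proof (subst openin_subopen, intro ballI)
    fix \<sigma> assume "\<sigma> \<in> {\<sigma> \<in> probs UNIV. a < rate M \<xi> S Y \<sigma>}"
    then have s: "\<sigma> \<in> probs UNIV" "a < rate M \<xi> S Y \<sigma>" by auto
    show "\<exists>U. openin (weak_topology UNIV) U \<and> \<sigma> \<in> U \<and> U \<subseteq> {\<sigma> \<in> probs UNIV. a < rate M \<xi> S Y \<sigma>}"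
    proof (cases "\<sigma> \<in> probs Y")
      case False
      have "openin (weak_topology UNIV) (probs UNIV - probs Y)" using cl by (simp add: closedin_def)
      moreover have "a < \<infinity>" using s(2) by (cases a) auto
      then have "probs UNIV - probs Y \<subseteq> {\<sigma> \<in> probs UNIV. a < rate M \<xi> S Y \<sigma>}" by (auto simp: rate_def)
      ultimately show ?thesis using s False by blast
    next
      case True
      then have "a < A.leg \<sigma>" using s(2) A.leg_rate by simp
      then obtain V where V: "V \<in> Cb Y" "a < ereal (LINT x:Y|\<sigma>. V x) - ereal (lam V)"
        unfolding A.leg_def less_SUP_iff by blast
      \<comment> \<open>The test potential is extended to the whole space so that it defines a
        weakly open set there; at points of this set off P(\<open>Y\<close>) the bound is
        trivial.\<close>
      obtain g where g: "\<And>W. g \<in> Cb W" "\<And>y. y \<in> Y \<Longrightarrow> g y = V y" using A.extend_Cb[OF Cb_cont[OF V(1)]] by metis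
      have int: "(LINT x:UNIV|\<tau>. g x) = (LINT x:Y|\<tau>. V x)" if t: "\<tau> \<in> probs Y" for \<tau>
      proof -
        have "(LINT x:UNIV|\<tau>. g x) = (LINT x:Y|\<tau>. g x)"
          using g(1)[of UNIV] by (intro set_integral_probs_subset[OF t closedZ]) (auto simp: Cb_def)
        also have "\<dots> = (LINT x:Y|\<tau>. V x)" by (rule set_integral_probs_cong[OF g(2)])
        finally show ?thesis .
      qed
      obtain b where b: "a < ereal b" "ereal b < ereal ((LINT x:Y|\<sigma>. V x) - lam V)"
        using ereal_dense2[OF V(2)] by auto
      define U where "U = {\<tau> \<in> probs UNIV. (LINT x:UNIV|\<tau>. g x) \<in> {b + lam V <..}}"
      have "openin (weak_topology UNIV) U" unfolding U_def by (rule openin_weak_topology_basis[OF g(1)]) simp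
      moreover have "\<sigma> \<in> U" using s(1) int[OF True] b by (simp add: U_def)
      moreover have "a < rate M \<xi> S Y \<tau>" if t: "\<tau> \<in> U" for \<tau>
      proof (cases "\<tau> \<in> probs Y")
        case True
        have "a < ereal b" by (rule b)
        also have "ereal b \<le> ereal (LINT x:Y|\<tau>. V x) - ereal (lam V)" using t int[OF True] by (simp add: U_def)
        also have "\<dots> \<le> rate M \<xi> S Y \<tau>" by (rule A.rate_ge[OF True V(1)])
        finally show ?thesis .
      next
        case False
        have "a < \<infinity>" using b(1) by (cases a) auto
        then show ?thesis using False by (simp add: rate_def)
      qed
      ultimately show ?thesis using U_def by blast
    qed
  qed
  have nn: "0 \<le> rate M \<xi> S Y \<sigma>" for \<sigma>
  proof (cases "\<sigma> \<in> probs Y")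
    case True
    then show ?thesis using A.leg_rate A.leg_nonneg by simp
  qed (simp add: rate_def)
  have "compactin (weak_topology UNIV) {\<sigma> \<in> probs UNIV. rate M \<xi> S Y \<sigma> \<le> ereal a}" for a
  proof (rule closed_compactin)
    show "compactin (weak_topology UNIV) (probs Y)" by (rule compactin_probs_subset[OF compactY]) auto
    show "{\<sigma> \<in> probs UNIV. rate M \<xi> S Y \<sigma> \<le> ereal a} \<subseteq> probs Y" by (auto simp: rate_def split: if_splits)
    have "{\<sigma> \<in> probs UNIV. rate M \<xi> S Y \<sigma> \<le> ereal a} = topspace (weak_topology UNIV) - {\<sigma> \<in> probs UNIV. ereal a < rate M \<xi> S Y \<sigma>}" by auto
    then show "closedin (weak_topology UNIV) {\<sigma> \<in> probs UNIV. rate M \<xi> S Y \<sigma> \<le> ereal a}"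
      using closedin_diff[OF closedin_topspace op[of "ereal a"]] by (simp only:)
  qed
  then show ?thesis using op nn by (simp add: good_rate_function_def rate_function_def)
qed

end

text \<open>On the set of points reached from the neighbourhood of \<open>Y\<close> the bound of
  (AC) at the original starting point controls all later times. Continuity in the state carries
  invariance and the bound over to the closure.\<close>

lemma attracted_XR:
  fixes S :: "'a::polish_space \<Rightarrow> 'e::compact_metric_space \<Rightarrow> 'a"
  assumes "rds M \<xi> S" and AC: "hyp_AC S Y" and ne: "Y \<noteq> {}" and R: "R > 0"
  shows "attracted M \<xi> S Y (XR S Y R)"
proof -
  interpret rds M \<xi> S by fact
  define B where "B = (\<Union>y\<in>Y. ball y R)"
  define A where "A = (\<Union>n. {orbit S x \<zeta> n |x \<zeta>. x \<in> B})"
  have XA: "XR S Y R = closure A" by (simp add: XR_def attainable_def A_def B_def)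
  have cY: "compact Y" and iY: "invariant S Y" using AC by (auto simp: hyp_AC_def)
  obtain V \<kappa> where V: "\<forall>X. bounded X \<longrightarrow> bounded (V ` X)" and k: "(0::real) < \<kappa>"
    and at: "\<forall>x \<zeta> n. infdist (orbit S x \<zeta> n) Y \<le> V x * exp (- \<kappa> * real n)"
    using AC unfolding hyp_AC_def by blast
  have BA: "B \<subseteq> A"
  proof
    fix x assume "x \<in> B"
    then have "orbit S x (\<lambda>_. undefined) 0 \<in> A" unfolding A_def by blast
    then show "x \<in> A" by simp
  qed
  have YX: "Y \<subseteq> XR S Y R" using BA closure_subset[of A] R unfolding XA B_def by fastforce
  have invA: "S x e \<in> A" if x: "x \<in> A" for x e
  proof -
    obtain n y \<zeta> where y: "y \<in> B" "x = orbit S y \<zeta> n" using x by (auto simp: A_def)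
    \<comment> \<open>The noise that led to \<open>x\<close> is changed at position \<open>n\<close>
      only, so the orbit up to time \<open>n\<close> is kept and the next step uses
      \<open>e\<close>.\<close>
    have same: "orbit S y (\<zeta>(n := e)) k = orbit S y \<zeta> k" if "k \<le> n" for k using that by (induction k) auto
    have "S x e = orbit S y (\<zeta>(n := e)) (Suc n)" using y(2) same[of n] by simp
    then show ?thesis using y(1) unfolding A_def by blast
  qed
  have invX: "invariant S (XR S Y R)"
    unfolding invariant_def XA
  proof (intro ballI allI)
    fix x e assume x: "x \<in> closure A"
    have "(\<lambda>x. S x e) ` closure A \<subseteq> closure A"
      by (rule image_closure_subset)
        (use continuous_S_state[of e] invA closure_subset in \<open>auto intro: continuous_on_subset\<close>)
    then show "S x e \<in> closure A" using x by blast
  qed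
  have "bounded B"
  proof -
    obtain y0 c where c: "\<And>y. y \<in> Y \<Longrightarrow> dist y0 y \<le> c" using compact_imp_bounded[OF cY] unfolding bounded_def by blast
    have "dist y0 x \<le> c + R" if "x \<in> B" for x
    proof -
      obtain y where "y \<in> Y" "dist y x < R" using \<open>x \<in> B\<close> by (auto simp: B_def)
      then show ?thesis using c[of y] dist_triangle[of y0 x y] by linarith
    qed
    then show ?thesis unfolding bounded_def by blast
  qed
  then have "bounded (V ` B)" using V by blast
  then obtain C where "\<And>x. x \<in> B \<Longrightarrow> \<bar>V x\<bar> \<le> C" by (auto simp: bounded_iff)
  then have C: "\<And>x. x \<in> B \<Longrightarrow> V x \<le> C" by (auto simp: abs_le_iff)
  \<comment> \<open>Concatenating two noise sequences realises a restarted orbit as one longer orbit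
    from \<open>y\<close>.\<close>
  have shift: "orbit S (orbit S y \<zeta> m) \<zeta>' n = orbit S y (\<lambda>k. if k < m then \<zeta> k else \<zeta>' (k - m)) (m + n)" for y \<zeta> \<zeta>' m n
  proof -
    have same: "orbit S y (\<lambda>k. if k < m then \<zeta> k else \<zeta>' (k - m)) j = orbit S y \<zeta> j" if "j \<le> m" for j
      using that by (induction j) auto
    show ?thesis by (induction n) (auto simp: same)
  qed
  have C0: "0 \<le> C"
  proof -
    obtain y where y: "y \<in> Y" using ne by auto
    then have "y \<in> B" using R by (auto simp: B_def intro!: bexI[of _ y])
    moreover have "0 \<le> V y" using at[rule_format, of y "\<lambda>_. undefined" 0] infdist_nonneg[of y Y] by simp
    ultimately show ?thesis using C by force
  qed
  have bA: "infdist (orbit S x \<zeta> n) Y \<le> C * exp (- \<kappa> * real n)" if x: "x \<in> A" for x \<zeta> n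
  proof -
    obtain m y \<zeta>0 where y: "y \<in> B" "x = orbit S y \<zeta>0 m" using x by (auto simp: A_def)
    have "infdist (orbit S x \<zeta> n) Y \<le> V y * exp (- \<kappa> * real (m + n))"
      unfolding y(2) shift using at by blast
    also have "\<dots> \<le> C * exp (- \<kappa> * real (m + n))" using C[OF y(1)] by (intro mult_right_mono) auto
    \<comment> \<open>Forgetting the first \<open>m\<close> steps makes the bound uniform in the
      time at which \<open>x\<close> was reached.\<close>
    also have "\<dots> \<le> C * exp (- \<kappa> * real n)" using C0 k by (intro mult_left_mono) auto
    finally show ?thesis .
  qed
  have bX: "infdist (orbit S x \<zeta> n) Y \<le> C * exp (- \<kappa> * real n)" if x: "x \<in> XR S Y R" for x \<zeta> n
  proof -
    have "continuous_on (closure A) (\<lambda>x. infdist (orbit S x \<zeta> n) Y)"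
      by (intro continuous_intros continuous_on_subset[OF continuous_orbit_state]) auto
    then show ?thesis
      by (rule continuous_le_on_closure) (use x bA in \<open>auto simp: XA\<close>)
  qed
  show ?thesis
  proof unfold_locales
    show "closed Y" using cY by (rule compact_imp_closed)
    show "invariant S Y" "Y \<noteq> {}" "compact Y" "Y \<subseteq> XR S Y R" "invariant S (XR S Y R)" by fact+
    show "closed (XR S Y R)" by (simp add: XA)
    show "XR S Y R \<noteq> {}" using YX ne by blast
    fix e :: real assume e: "0 < e"
    \<comment> \<open>C + 1 is used because \<open>C\<close> may be 0 under the logarithm, and e / 2
      because a strict inequality is wanted.\<close>
    obtain n0 where n0: "\<And>n. n \<ge> n0 \<Longrightarrow> - \<kappa> * real n + ln (C + 1) \<le> 0 * real n + ln (e / 2)"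
      using exp_rate_eventually[of "- \<kappa>" 0 "ln (C + 1) - ln (e / 2)"] k by (auto simp: algebra_simps)
    show "\<exists>n0. \<forall>n\<ge>n0. \<forall>x\<in>XR S Y R. \<forall>\<zeta>. infdist (orbit S x \<zeta> n) Y < e"
    proof (intro exI[of _ n0] allI impI ballI)
      fix n x \<zeta> assume n: "n0 \<le> n" and x: "x \<in> XR S Y R"
      have "infdist (orbit S x \<zeta> n) Y \<le> (C + 1) * exp (- \<kappa> * real n)"
        using bX[OF x, of \<zeta> n] exp_ge_zero[of "- \<kappa> * real n"] unfolding distrib_right by linarith
      also have "C + 1 = exp (ln (C + 1))" using C0 by simp
      also have "exp (ln (C + 1)) * exp (- \<kappa> * real n) = exp (- \<kappa> * real n + ln (C + 1))"
        by (simp only: exp_add mult.commute)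
      also have "\<dots> \<le> exp (ln (e / 2))" using n0[OF n] by simp
      also have "\<dots> < e" using e by simp
      finally show "infdist (orbit S x \<zeta> n) Y < e" .
    qed
  qed
qed

lemma locally_lipschitz_continuous:
  assumes "locally_lipschitz f"
  shows "continuous_on UNIV f"
proof -
  have "isCont f x" for x
  proof -
    obtain u C where u: "u > 0" "C-lipschitz_on (ball x u) f" using assms unfolding locally_lipschitz_def by blast
    have "continuous_on (ball x u) f" by (rule lipschitz_on_continuous_on[OF u(2)])
    then show ?thesis using u(1) by (simp add: continuous_on_eq_continuous_at)
  qed
  then show ?thesis by (simp add: continuous_at_imp_continuous_on)
qed

lemma prob_L_cong:
  assumes "\<And>\<omega>. empirical (orbit S x (\<lambda>k. \<xi> k \<omega>)) n \<in> F \<longleftrightarrow> empirical (orbit S x (\<lambda>k. \<xi> k \<omega>)) n \<in> F'"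
  shows "prob_L M \<xi> S x n F = prob_L M \<xi> S x n F'"
  using assms by (simp add: prob_L_def)

theorem theorem2p4:
  fixes M :: "'w measure" and \<Omega> :: "'c measure"
    and \<xi> :: "nat \<Rightarrow> 'w \<Rightarrow> 'e::compact_metric_space"
    and S :: "'a::polish_space \<Rightarrow> 'e \<Rightarrow> 'a"
    and Y :: "'a set" and z :: 'a
  assumes "prob_space M"
    and "prob_space.indep_vars M (\<lambda>_. borel) \<xi> UNIV"
    and "\<forall>n. distr M borel (\<xi> n) = distr M borel (\<xi> 0)"
    and "support (distr M borel (\<xi> 0)) = UNIV"
    and "locally_lipschitz (\<lambda>(x, \<zeta>). S x \<zeta>)"
    and "hyp_AC S Y"
    and "hyp_I M \<xi> S Y z"
    and "hyp_C M \<xi> S Y \<Omega>"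
    and "\<exists>\<zeta>. S z \<zeta> = z"
  shows
    "good_rate_function (weak_topology UNIV) (rate M \<xi> S Y) \<and>
     (\<forall>x F. closedin (weak_topology UNIV) F \<longrightarrow>
        limsup (\<lambda>n. ereal (1 / real n) * elog (prob_L M \<xi> S x n F))
          \<le> - (INF \<sigma>\<in>F. rate M \<xi> S Y \<sigma>)) \<and>
     (\<forall>x G. openin (weak_topology UNIV) G \<longrightarrow>
        liminf (\<lambda>n. ereal (1 / real n) * elog (prob_L M \<xi> S x n G))
          \<ge> - (INF \<sigma>\<in>G \<inter> Wset M \<xi> S Y. rate M \<xi> S Y \<sigma>)) \<and>
     (\<forall>R>0.
        (\<forall>\<sigma>\<in>probs (XR S Y R). rate M \<xi> S Y \<sigma> = legendre M \<xi> S Y R \<sigma>) \<and>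
        (\<forall>F. closedin (weak_topology (XR S Y R)) F \<longrightarrow>
           (\<forall>x\<in>XR S Y R.
              limsup (\<lambda>n. ereal (1 / real n) * elog (prob_L M \<xi> S x n F))
                \<le> - (INF \<sigma>\<in>F. rate M \<xi> S Y \<sigma>)) \<and>
           limsup (\<lambda>n. SUP x\<in>XR S Y R. ereal (1 / real n) * elog (prob_L M \<xi> S x n F))
             \<le> - (INF \<sigma>\<in>F. rate M \<xi> S Y \<sigma>)) \<and>
        (\<forall>G. openin (weak_topology (XR S Y R)) G \<longrightarrow>
           (\<forall>x\<in>XR S Y R.
              liminf (\<lambda>n. ereal (1 / real n) * elog (prob_L M \<xi> S x n G))
                \<ge> - (INF \<sigma>\<in>G \<inter> WR M \<xi> S Y R. rate M \<xi> S Y \<sigma>)) \<and>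
           liminf (\<lambda>n. INF x\<in>XR S Y R. ereal (1 / real n) * elog (prob_L M \<xi> S x n G))
             \<ge> - (INF \<sigma>\<in>G \<inter> WR M \<xi> S Y R. rate M \<xi> S Y \<sigma>))) \<and>
     (\<forall>L>0. \<exists>\<delta>>0. \<forall>R>0. VRL S Y R L \<delta> \<subseteq> VR M \<xi> S Y R) \<and>
     (\<forall>R>0. \<forall>R'>0. WR M \<xi> S Y R = WR M \<xi> S Y R') \<and>
     (\<forall>R>0. Wset M \<xi> S Y = WR M \<xi> S Y R)"
proof -
  have rds: "rds M \<xi> S"
    unfolding rds_def rds_axioms_def using assms(1-3) locally_lipschitz_continuous[OF assms(5)] by blast
  have zY: "z \<in> Y" using assms(7) by (simp add: hyp_I_def)
  then have ne: "Y \<noteq> {}" by blast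
  note att = attracted_XR[OF rds assms(6) ne]
  \<comment> \<open>The radius 1 is arbitrary: \<open>Wcore\<close> and \<open>lam\<close> refer to
    \<open>Y\<close> alone.\<close>
  interpret A1: attracted M \<xi> S Y "XR S Y 1" by (rule att) simp
  define W where "W = A1.Wcore"
  have WR: "WR M \<xi> S Y R = W" if "R > 0" for R
  proof -
    interpret A: attracted M \<xi> S Y "XR S Y R" by (rule att[OF that])
    show ?thesis unfolding W_def by (rule A.WR_eq[OF refl])
  qed
  have Ws: "Wset M \<xi> S Y = W" unfolding Wset_def using WR zero_less_one by (auto intro: exI[of _ "1::real"])
  have WY: "W \<subseteq> probs Y" unfolding W_def using A1.Wcore_probs by blast
  have legR: "rate M \<xi> S Y \<sigma> = legendre M \<xi> S Y R \<sigma>" if "R > 0" "\<sigma> \<in> probs (XR S Y R)" for R \<sigma>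
  proof -
    interpret A: attracted M \<xi> S Y "XR S Y R" by (rule att[OF that(1)])
    show ?thesis using A.leg_rate[OF that(2)] A.legendre_XR[OF refl] by simp
  qed
  have up: "limsup (\<lambda>n. SUP x\<in>XR S Y R. ereal (1 / real n) * elog (prob_L M \<xi> S x n F)) \<le> - (INF \<sigma>\<in>F. rate M \<xi> S Y \<sigma>)"
    if "R > 0" "closedin (weak_topology (XR S Y R)) F" for R F
  proof -
    interpret A: attracted M \<xi> S Y "XR S Y R" by (rule att[OF that(1)])
    show ?thesis by (rule A.upper_bound[OF that(2)])
  qed
  have lo: "- (INF \<sigma>\<in>G \<inter> W. rate M \<xi> S Y \<sigma>) \<le> liminf (\<lambda>n. INF x\<in>XR S Y R. ereal (1 / real n) * elog (prob_L M \<xi> S x n G))"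
    if "R > 0" "openin (weak_topology (XR S Y R)) G" for R G
  proof -
    interpret A: attracted M \<xi> S Y "XR S Y R" by (rule att[OF that(1)])
    show ?thesis unfolding W_def by (rule A.lower_bound[OF that(2)])
  qed
  have upx: "limsup (\<lambda>n. ereal (1 / real n) * elog (prob_L M \<xi> S x n F)) \<le> - (INF \<sigma>\<in>F. rate M \<xi> S Y \<sigma>)"
    if "R > 0" "closedin (weak_topology (XR S Y R)) F" "x \<in> XR S Y R" for R F x
  proof -
    have "limsup (\<lambda>n. ereal (1 / real n) * elog (prob_L M \<xi> S x n F)) \<le> limsup (\<lambda>n. SUP x\<in>XR S Y R. ereal (1 / real n) * elog (prob_L M \<xi> S x n F))"
      by (intro Limsup_mono always_eventually allI SUP_upper[OF that(3)])
    also note up[OF that(1,2)]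
    finally show ?thesis .
  qed
  have lox: "- (INF \<sigma>\<in>G \<inter> W. rate M \<xi> S Y \<sigma>) \<le> liminf (\<lambda>n. ereal (1 / real n) * elog (prob_L M \<xi> S x n G))"
    if "R > 0" "openin (weak_topology (XR S Y R)) G" "x \<in> XR S Y R" for R G x
  proof -
    note lo[OF that(1,2)]
    also have "liminf (\<lambda>n. INF x\<in>XR S Y R. ereal (1 / real n) * elog (prob_L M \<xi> S x n G)) \<le> liminf (\<lambda>n. ereal (1 / real n) * elog (prob_L M \<xi> S x n G))"
      by (intro Liminf_mono always_eventually allI INF_lower[OF that(3)])
    finally show ?thesis .
  qed
  have reach: "\<exists>R>0. x \<in> XR S Y R" for x
  proof -
    \<comment> \<open>Every starting point lies in some ball around \<open>z\<close>, so the global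
      bounds reduce to those on a suitable X_R.\<close>
    define R where "R = dist z x + 1"
    have "R > 0" by (simp add: R_def add_nonneg_pos)
    moreover have "x \<in> (\<Union>y\<in>Y. ball y R)" using zY by (intro UN_I[of z]) (auto simp: R_def)
    then have "orbit S x (\<lambda>_. undefined) 0 \<in> (\<Union>n. {orbit S x \<zeta> n |x \<zeta>. x \<in> (\<Union>y\<in>Y. ball y R)})"
      by blast
    then have "x \<in> XR S Y R" unfolding XR_def attainable_def using closure_subset by fastforce
    ultimately show ?thesis by blast
  qed
  \<comment> \<open>For n \<ge> 1 the empirical measure lies in P(X_R), so intersecting with it
    changes no probability; n = 0 is invisible to the limits.\<close>
  have restr: "prob_L M \<xi> S x n F = prob_L M \<xi> S x n {\<sigma> \<in> probs (XR S Y R). \<sigma> \<in> F}"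
    if "R > 0" "x \<in> XR S Y R" "n \<ge> 1" for R x n F
  proof -
    interpret A: attracted M \<xi> S Y "XR S Y R" by (rule att[OF that(1)])
    show ?thesis by (rule prob_L_cong) (use A.emp_probs[OF that(3,2)] in \<open>auto simp: A.emp_def\<close>)
  qed
  have idc: "continuous_map (weak_topology (XR S Y R)) (weak_topology UNIV) id" if "R > 0" for R
  proof -
    interpret A: attracted M \<xi> S Y "XR S Y R" by (rule att[OF that])
    show ?thesis by (rule continuous_map_weak_topology_id[OF A.Zl.closedZ]) auto
  qed
  have good: "good_rate_function (weak_topology UNIV) (rate M \<xi> S Y)" by (rule A1.Yl.good_rate)
  have upg: "limsup (\<lambda>n. ereal (1 / real n) * elog (prob_L M \<xi> S x n F)) \<le> - (INF \<sigma>\<in>F. rate M \<xi> S Y \<sigma>)"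
    if F: "closedin (weak_topology UNIV) F" for x F
  proof -
    obtain R where R: "R > 0" "x \<in> XR S Y R" using reach by blast
    define F' where "F' = {\<sigma> \<in> probs (XR S Y R). \<sigma> \<in> F}"
    have F': "closedin (weak_topology (XR S Y R)) F'"
      using closedin_continuous_map_preimage[OF idc[OF R(1)] F] by (simp add: F'_def)
    have "limsup (\<lambda>n. ereal (1 / real n) * elog (prob_L M \<xi> S x n F)) = limsup (\<lambda>n. ereal (1 / real n) * elog (prob_L M \<xi> S x n F'))"
    proof (rule Limsup_eq, rule eventually_sequentiallyI[of 1])
      fix n :: nat assume "1 \<le> n"
      then have "prob_L M \<xi> S x n F = prob_L M \<xi> S x n F'" unfolding F'_def by (rule restr[OF R])
      then show "ereal (1 / real n) * elog (prob_L M \<xi> S x n F) = ereal (1 / real n) * elog (prob_L M \<xi> S x n F')" by simp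
    qed
    also have "\<dots> \<le> - (INF \<sigma>\<in>F'. rate M \<xi> S Y \<sigma>)" by (rule upx[OF R(1) F' R(2)])
    also have "\<dots> \<le> - (INF \<sigma>\<in>F. rate M \<xi> S Y \<sigma>)"
      unfolding ereal_minus_le_minus by (rule INF_superset_mono) (auto simp: F'_def)
    finally show ?thesis .
  qed
  have log: "- (INF \<sigma>\<in>G \<inter> W. rate M \<xi> S Y \<sigma>) \<le> liminf (\<lambda>n. ereal (1 / real n) * elog (prob_L M \<xi> S x n G))"
    if G: "openin (weak_topology UNIV) G" for x G
  proof -
    obtain R where R: "R > 0" "x \<in> XR S Y R" using reach by blast
    interpret A: attracted M \<xi> S Y "XR S Y R" by (rule att[OF R(1)])
    define G' where "G' = {\<sigma> \<in> probs (XR S Y R). \<sigma> \<in> G}"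
    have G': "openin (weak_topology (XR S Y R)) G'"
      using openin_continuous_map_preimage[OF idc[OF R(1)] G] by (simp add: G'_def)
    \<comment> \<open>Equilibrium states are carried by \<open>Y\<close>, so cutting
      \<open>G\<close> down to P(X_R) loses none of them.\<close>
    have GW: "G \<inter> W = G' \<inter> W" using WY A.probsYZ by (auto simp: G'_def)
    have "- (INF \<sigma>\<in>G \<inter> W. rate M \<xi> S Y \<sigma>) \<le> liminf (\<lambda>n. ereal (1 / real n) * elog (prob_L M \<xi> S x n G'))"
      unfolding GW by (rule lox[OF R(1) G' R(2)])
    also have "\<dots> = liminf (\<lambda>n. ereal (1 / real n) * elog (prob_L M \<xi> S x n G))"
    proof (rule Liminf_eq, rule eventually_sequentiallyI[of 1])
      fix n :: nat assume "1 \<le> n"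
      then have "prob_L M \<xi> S x n G = prob_L M \<xi> S x n G'" unfolding G'_def by (rule restr[OF R])
      then show "ereal (1 / real n) * elog (prob_L M \<xi> S x n G') = ereal (1 / real n) * elog (prob_L M \<xi> S x n G)" by simp
    qed
    finally show ?thesis .
  qed
  have small: "\<exists>\<delta>>0. \<forall>R>0. VRL S Y R L \<delta> \<subseteq> VR M \<xi> S Y R" if L: "L > 0" for L
  proof -
    obtain \<theta> \<rho> N where "contraction M \<xi> S Y \<theta> \<rho> N" using A1.Yl.contraction_exists[OF assms(7,8)] by blast
    then interpret C: contraction M \<xi> S Y \<theta> \<rho> N .
    from C.small_potential obtain \<eta> where eta: "\<eta> > 0" and
      etaV: "\<forall>V. C.Nle \<eta> V \<longrightarrow>
      (\<forall>c<A1.lam V. \<exists>n0. \<forall>n\<ge>n0. \<forall>y\<in>Y. exp (c * real n) \<le> (A1.T V ^^ n) (\<lambda>_. 1) y) \<and>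
      (\<forall>\<sigma>\<in>probs Y. \<forall>\<tau>\<in>probs Y. rate M \<xi> S Y \<sigma> \<le> ereal ((LINT x:Y|\<sigma>. V x) - A1.lam V) \<longrightarrow>
       rate M \<xi> S Y \<tau> \<le> ereal ((LINT x:Y|\<tau>. V x) - A1.lam V) \<longrightarrow> \<sigma> = \<tau>)"
      by (elim exE conjE) (rule that)
    \<comment> \<open>Chosen so that the interpolation bound sqrt(\<delta> L) is at most \<eta>;
      since \<eta> is obtained on \<open>Y\<close>, the same \<delta> serves every
      \<open>R\<close>.\<close>
    define \<delta> where "\<delta> = min \<eta> (\<eta>\<^sup>2 / L)"
    have d0: "\<delta> > 0" using eta L by (simp add: \<delta>_def)
    have dL: "\<delta> * L \<le> \<eta>\<^sup>2" using L by (simp add: \<delta>_def min_mult_distrib_right)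
    have "V \<in> VR M \<xi> S Y R" if R: "R > 0" and V: "V \<in> VRL S Y R L \<delta>" for R V
    proof -
      interpret A: attracted M \<xi> S Y "XR S Y R" by (rule att[OF R])
      have VL: "V \<in> Lb (XR S Y R)" and VLip: "Lip (XR S Y R) V < L" and VOsc: "Osc (XR S Y R) V < \<delta>"
        using V by (auto simp: VRL_def)
      \<comment> \<open>\<open>Lip\<close> is an infimum; a strict bound on it yields an actual
        Lipschitz constant below \<open>L\<close>.\<close>
      obtain C where C: "C-lipschitz_on (XR S Y R) V" "C < L"
      proof -
        have "{C. C-lipschitz_on (XR S Y R) V} \<noteq> {}" using VL by (auto simp: Lb_def)
        from cInf_lessD[OF this] VLip show ?thesis using that by (auto simp: Lip_def)
      qed
      have bV: "bounded (V ` XR S Y R)" using VL by (simp add: Lb_def)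
      have osc: "V x - V y \<le> \<delta>" if "x \<in> XR S Y R" "y \<in> XR S Y R" for x y
      proof -
        have "V x \<le> (SUP x\<in>XR S Y R. V x)" using that(1) bounded_imp_bdd_above[OF bV] by (rule cSUP_upper)
        moreover have "(INF x\<in>XR S Y R. V x) \<le> V y" using bounded_imp_bdd_below[OF bV] that(2) by (rule cINF_lower)
        ultimately show ?thesis using VOsc by (simp add: Osc_def)
      qed
      have "C.Nle \<eta> V"
      proof (rule C.lipschitz_Nle[where L=L and d=\<delta>])
        fix x y assume xy: "x \<in> Y" "y \<in> Y"
        then have xy': "x \<in> XR S Y R" "y \<in> XR S Y R" using A.YZ by auto
        show "\<bar>V x - V y\<bar> \<le> \<delta>" using osc[OF xy'] osc[OF xy'(2,1)] by (simp add: abs_le_iff)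
        have "\<bar>V x - V y\<bar> \<le> C * dist x y" using lipschitz_onD[OF C(1) xy'] by (simp add: dist_real_def)
        also have "\<dots> \<le> L * dist x y" using C(2) by (intro mult_right_mono) auto
        finally show "\<bar>V x - V y\<bar> \<le> L * dist x y" .
      next
        show "sqrt (\<delta> * L) \<le> \<eta>" using dL eta by (intro real_le_lsqrt) auto
      qed (use L d0 in \<open>auto simp: \<delta>_def\<close>)
      note small = etaV[rule_format, OF this, THEN conjunct1] etaV[rule_format, OF this, THEN conjunct2]
      have lw: "A.low V Y" unfolding A.low_def using small(1) by blast
      have uq: "\<sigma> = \<tau>" if "A.eqst V \<sigma>" "A.eqst V \<tau>" for \<sigma> \<tau>
        using small(2) that unfolding A.eqst_def by blast
      have "\<exists>!\<sigma>. A.eqst V \<sigma>" using A.eqst_exists[OF Lb_Cb[OF VL]] uq by blast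
      then show ?thesis using A.VR_iff[OF refl] VL lw by blast
    qed
    then show ?thesis using d0 by blast
  qed
  show ?thesis
    using good upg log legR up upx lo lox small WR Ws by simp
qed

end
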